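(* Let $(A,\{\Delta(\lambda)\}_{\lambda\in\Lambda})$ be a split quasi-hereditary algebra over a commutative Noetherian ring $R$, with costandard modules $\nabla(\lambda)$, $\lambda\in\Lambda$. Suppose that $M\in\mathcal{F}(\tilde{\Delta})$ and $N\in\mathcal{F}(\tilde{\nabla})$. Then: (a) The functor $-\otimes_A M\colon\mathcal{F}(D\tilde{\nabla})\to R\text{-proj}$ is a well-defined exact functor. (b) The functor $DN\otimes_A-\colon\mathcal{F}(\tilde{\Delta})\to R\text{-proj}$ is a well-defined exact functor.
   Context: Let $R$ be a commutative Noetherian ring with identity. A projective Noetherian $R$-algebra is an $R$-algebra that is finitely generated and projective as an $R$-module. $A\text{-mod}$ denotes finitely generated left $A$-modules, $A\text{-proj}$ (resp. $R\text{-proj}$) the finitely generated projective ones, $\operatorname{add}_A M$ the full subcategory of direct summands of finite direct sums of copies of $M$, and $D=\operatorname{Hom}_R(-,R)\colon A\text{-mod}\to A^{op}\text{-mod}$. For a set $\theta$ of $A$-modules, $\mathcal{F}(\theta)$ is the full subcategory of $A\text{-mod}$ of modules admitting a finite filtration with successive quotients (isomorphic to modules) in $\theta$. Split quasi-hereditary: a projective Noetherian $R$-algebra $A$ with a collection $\{\Delta(\lambda)\colon\lambda\in\Lambda\}$ in $A\text{-mod}$ indexed by a finite poset $\Lambda$ is split quasi-hereditary if: (i) each $\Delta(\lambda)$ is projective over $R$; (ii) $\operatorname{Hom}_A(\Delta(\lambda),\Delta(\mu))\neq0$ implies $\lambda\le\mu$; (iii) $\operatorname{End}_A(\Delta(\lambda))\simeq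 R$; (iv) for each $\lambda$ there is $P(\lambda)\in A\text{-proj}$ and an exact sequence $0\to C(\lambda)\to P(\lambda)\to\Delta(\lambda)\to0$ such that $C(\lambda)$ has a finite filtration by modules $\Delta(\mu)\otimes_R U_\mu$ with $U_\mu\in R\text{-proj}$, $\mu>\lambda$; (v) $\operatorname{add}_A(\bigoplus_{\lambda}P(\lambda))=A\text{-proj}$. The costandard modules $\{\nabla(\lambda)\}_{\lambda\in\Lambda}$ are the $A$-modules, unique up to isomorphism, such that $(A^{op},\{D\nabla(\lambda)\}_{\lambda\in\Lambda})$ is split quasi-hereditary (same poset) and $\operatorname{Ext}_A^i(\Delta(\lambda),\nabla(\beta))$ is $R$ if $i=0$ and $\lambda=\beta$, and $0$ otherwise. Put $\tilde{\Delta}=\{\Delta(\lambda)\otimes_R U\}$, $\tilde{\nabla}=\{\nabla(\lambda)\otimes_R U\}$, $D\tilde\nabla=\{D\nabla(\lambda)\otimes_R U\}$ (a set of $A^{op}$-modules, i.e. right $A$-modules), with $\lambda\in\Lambda$, $U\in R\text{-proj}$. Exactness on such a subcategory means exactness on short exact sequences of modules with all terms in the subcategory. *)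

theory Defs
  imports "HOL-Algebra.Module" "HOL-Algebra.QuotRing" "HOL-Algebra.Ring_Divisibility" "HOL-Algebra.Generated_Groups"
    "HOL-Algebra.Free_Abelian_Groups"
begin

section \<open>Left modules over a not necessarily commutative ring\<close>

text \<open>The locale \<^locale>\<open>module\<close> of the library requires a commutative ring of scalars; the axioms
  here are the same over an arbitrary ring.  The record type is shared, so the multiplicative
  fields of a module are meaningless and never used.  Right modules are left modules over
  the opposite ring, the scalar \<open>a\<close> acting by \<open>x \<mapsto> x a\<close>.\<close>

locale lmodule = R?: ring R + M?: abelian_group M
  for R :: "('a, 'z) ring_scheme" (structure) and M :: "('a, 'x, 'w) module_scheme" (structure) +
  assumes lsmult_closed:
      "\<lbrakk>a \<in> carrier R; x \<in> carrier M\<rbrakk> \<Longrightarrow> a \<odot>\<^bsub>M\<^esub> x \<in> carrier M"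
    and lsmult_l_distr:
      "\<lbrakk>a \<in> carrier R; b \<in> carrier R; x \<in> carrier M\<rbrakk> \<Longrightarrow>
        (a \<oplus> b) \<odot>\<^bsub>M\<^esub> x = a \<odot>\<^bsub>M\<^esub> x \<oplus>\<^bsub>M\<^esub> b \<odot>\<^bsub>M\<^esub> x"
    and lsmult_r_distr:
      "\<lbrakk>a \<in> carrier R; x \<in> carrier M; y \<in> carrier M\<rbrakk> \<Longrightarrow>
        a \<odot>\<^bsub>M\<^esub> (x \<oplus>\<^bsub>M\<^esub> y) = a \<odot>\<^bsub>M\<^esub> x \<oplus>\<^bsub>M\<^esub> a \<odot>\<^bsub>M\<^esub> y"
    and lsmult_assoc:
      "\<lbrakk>a \<in> carrier R; b \<in> carrier R; x \<in> carrier M\<rbrakk> \<Longrightarrow>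
        (a \<otimes> b) \<odot>\<^bsub>M\<^esub> x = a \<odot>\<^bsub>M\<^esub> (b \<odot>\<^bsub>M\<^esub> x)"
    and lsmult_one:
      "x \<in> carrier M \<Longrightarrow> \<one> \<odot>\<^bsub>M\<^esub> x = x"

definition opp_ring :: "('a, 'z) ring_scheme \<Rightarrow> ('a, 'z) ring_scheme" where
  "opp_ring A = A\<lparr>monoid.mult := (\<lambda>x y. y \<otimes>\<^bsub>A\<^esub> x)\<rparr>"

definition regular :: "('a, 'z) ring_scheme \<Rightarrow> ('a, 'a) module" where
  "regular A = \<lparr>carrier = carrier A, monoid.mult = monoid.mult A, one = one A,
     ring.zero = ring.zero A, ring.add = ring.add A, smult = monoid.mult A\<rparr>"

text \<open>Homomorphisms are extensional, so that the zero map and the identity are unique.\<close>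

definition lhom :: "('a, 'z) ring_scheme \<Rightarrow> ('a, 'x) module \<Rightarrow> ('a, 'y) module \<Rightarrow> ('x \<Rightarrow> 'y) set" where
  "lhom A X Y = {f \<in> carrier X \<rightarrow>\<^sub>E carrier Y.
     (\<forall>x\<in>carrier X. \<forall>y\<in>carrier X. f (x \<oplus>\<^bsub>X\<^esub> y) = f x \<oplus>\<^bsub>Y\<^esub> f y) \<and>
     (\<forall>a\<in>carrier A. \<forall>x\<in>carrier X. f (a \<odot>\<^bsub>X\<^esub> x) = a \<odot>\<^bsub>Y\<^esub> f x)}"

definition zero_map :: "('a, 'x) module \<Rightarrow> ('a, 'y) module \<Rightarrow> 'x \<Rightarrow> 'y" where
  "zero_map X Y = (\<lambda>x\<in>carrier X. \<zero>\<^bsub>Y\<^esub>)"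

definition lmod_iso :: "('a, 'z) ring_scheme \<Rightarrow> ('a, 'x) module \<Rightarrow> ('a, 'y) module \<Rightarrow> bool" where
  "lmod_iso A X Y \<longleftrightarrow> (\<exists>f\<in>lhom A X Y. bij_betw f (carrier X) (carrier Y))"

definition quot_mod :: "('a, 'x) module \<Rightarrow> 'x set \<Rightarrow> ('a, 'x set) module" where
  "quot_mod X K = \<lparr>carrier = a_rcosets\<^bsub>X\<^esub> K, monoid.mult = undefined, one = undefined,
     ring.zero = K, ring.add = set_add X, smult = (\<lambda>a C. \<Union>x\<in>C. K +>\<^bsub>X\<^esub> (a \<odot>\<^bsub>X\<^esub> x))\<rparr>"

definition direct_sum :: "'i set \<Rightarrow> ('i \<Rightarrow> ('a, 'x) module) \<Rightarrow> ('a, 'i \<Rightarrow> 'x) module" where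
  "direct_sum I X = \<lparr>carrier = {f \<in> \<Pi>\<^sub>E i\<in>I. carrier (X i). finite {i\<in>I. f i \<noteq> \<zero>\<^bsub>X i\<^esub>}},
     monoid.mult = undefined, one = undefined, ring.zero = (\<lambda>i\<in>I. \<zero>\<^bsub>X i\<^esub>),
     ring.add = (\<lambda>f g. \<lambda>i\<in>I. f i \<oplus>\<^bsub>X i\<^esub> g i), smult = (\<lambda>a f. \<lambda>i\<in>I. a \<odot>\<^bsub>X i\<^esub> f i)\<rparr>"

text \<open>\<open>X\<close> is isomorphic to a direct summand of \<open>Y\<close>: here \<open>Y\<close> is the direct sum of the image
  of \<open>i\<close> and the kernel of \<open>p\<close>.\<close>

definition is_summand :: "('a, 'z) ring_scheme \<Rightarrow> ('a, 'x) module \<Rightarrow> ('a, 'y) module \<Rightarrow> bool" where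
  "is_summand A X Y \<longleftrightarrow> (\<exists>i\<in>lhom A X Y. \<exists>p\<in>lhom A Y X. \<forall>x\<in>carrier X. p (i x) = x)"

text \<open>Projective modules are the direct summands of free modules.  Since \<open>X\<close> is a quotient of the
  free module on its own underlying set, it is no restriction to take the basis inside \<open>'x\<close>.\<close>

definition projective :: "('a, 'z) ring_scheme \<Rightarrow> ('a, 'x) module \<Rightarrow> bool" where
  "projective A X \<longleftrightarrow> lmodule A X \<and> (\<exists>I :: 'x set. is_summand A X (direct_sum I (\<lambda>_. regular A)))"

definition finitely_generated :: "('a, 'z) ring_scheme \<Rightarrow> ('a, 'x) module \<Rightarrow> bool" where
  "finitely_generated A X \<longleftrightarrow> (\<exists>S \<subseteq> carrier X. finite S \<and>
     (\<forall>x\<in>carrier X. \<exists>c \<in> S \<rightarrow> carrier A. x = (\<Oplus>\<^bsub>X\<^esub>s\<in>S. c s \<odot>\<^bsub>X\<^esub> s)))"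

text \<open>The categories \<open>A-mod\<close>, \<open>A-proj\<close> and \<open>add\<^sub>A M\<close>, restricted to modules
  with elements in a type \<open>'x\<close>.  Every object of the first two has an isomorphic copy with elements in
  \<open>(nat \<Rightarrow> 'a) set\<close>, respectively in \<open>nat \<Rightarrow> 'a\<close> (as the image of an idempotent of some
  \<open>A\<^sup>n\<close>); below, \<open>nat \<Rightarrow> 'a\<close> is therefore used whenever a bound variable ranges over \<open>A-proj\<close>.\<close>

definition fg_mods :: "('a, 'z) ring_scheme \<Rightarrow> ('a, 'x) module set" where
  "fg_mods A = {X. lmodule A X \<and> finitely_generated A X}"

definition proj_mods :: "('a, 'z) ring_scheme \<Rightarrow> ('a, 'x) module set" where
  "proj_mods A = {X \<in> fg_mods A. projective A X}"

definition add_mods :: "('a, 'z) ring_scheme \<Rightarrow> ('a, 'y) module \<Rightarrow> ('a, 'x) module set" where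
  "add_mods A M = {X. lmodule A X \<and> (\<exists>n::nat. is_summand A X (direct_sum {..<n} (\<lambda>_. M)))}"

definition short_exact ::
  "('a, 'z) ring_scheme \<Rightarrow> ('a, 'x) module \<Rightarrow> ('a, 'y) module \<Rightarrow> ('a, 'w) module \<Rightarrow>
   ('x \<Rightarrow> 'y) \<Rightarrow> ('y \<Rightarrow> 'w) \<Rightarrow> bool" where
  "short_exact A X Y Z f g \<longleftrightarrow> f \<in> lhom A X Y \<and> g \<in> lhom A Y Z \<and>
     inj_on f (carrier X) \<and> f ` carrier X = a_kernel Y Z g \<and> g ` carrier Y = carrier Z"

text \<open>\<open>\<F>(\<theta>)\<close>, again among the modules with elements in \<open>'x\<close>.\<close>

definition filtered :: "('a, 'z) ring_scheme \<Rightarrow> ('a, 't) module set \<Rightarrow> ('a, 'x) module set" where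
  "filtered A \<theta> = {X \<in> fg_mods A. \<exists>n::nat. \<exists>F. F 0 = {\<zero>\<^bsub>X\<^esub>} \<and> F n = carrier X \<and>
     (\<forall>i\<le>n. submodule (F i) A X) \<and>
     (\<forall>i<n. F i \<subseteq> F (Suc i) \<and>
        (\<exists>T\<in>\<theta>. lmod_iso A (quot_mod (X\<lparr>carrier := F (Suc i)\<rparr>) (F i)) T))}"


section \<open>Functors between full subcategories of module categories\<close>

text \<open>\<open>Fo\<close> and \<open>Fm\<close> are the actions on objects and on morphisms (with given source and target).\<close>

definition is_functor ::
  "('a, 'z) ring_scheme \<Rightarrow> ('a, 'x) module set \<Rightarrow> ('b, 'v) ring_scheme \<Rightarrow> ('b, 'y) module set \<Rightarrow>
   (('a, 'x) module \<Rightarrow> ('b, 'y) module) \<Rightarrow>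
   (('a, 'x) module \<Rightarrow> ('a, 'x) module \<Rightarrow> ('x \<Rightarrow> 'x) \<Rightarrow> 'y \<Rightarrow> 'y) \<Rightarrow> bool" where
  "is_functor A \<C> B \<D> Fo Fm \<longleftrightarrow>
     (\<forall>X\<in>\<C>. Fo X \<in> \<D>) \<and>
     (\<forall>X\<in>\<C>. \<forall>Y\<in>\<C>. \<forall>f\<in>lhom A X Y. Fm X Y f \<in> lhom B (Fo X) (Fo Y)) \<and>
     (\<forall>X\<in>\<C>. Fm X X (\<lambda>x\<in>carrier X. x) = (\<lambda>y\<in>carrier (Fo X). y)) \<and>
     (\<forall>X\<in>\<C>. \<forall>Y\<in>\<C>. \<forall>Z\<in>\<C>. \<forall>f\<in>lhom A X Y. \<forall>g\<in>lhom A Y Z.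
        Fm X Z (compose (carrier X) g f) = compose (carrier (Fo X)) (Fm Y Z g) (Fm X Y f))"

definition is_exact_functor ::
  "('a, 'z) ring_scheme \<Rightarrow> ('a, 'x) module set \<Rightarrow> ('b, 'v) ring_scheme \<Rightarrow> ('b, 'y) module set \<Rightarrow>
   (('a, 'x) module \<Rightarrow> ('b, 'y) module) \<Rightarrow>
   (('a, 'x) module \<Rightarrow> ('a, 'x) module \<Rightarrow> ('x \<Rightarrow> 'x) \<Rightarrow> 'y \<Rightarrow> 'y) \<Rightarrow> bool" where
  "is_exact_functor A \<C> B \<D> Fo Fm \<longleftrightarrow> is_functor A \<C> B \<D> Fo Fm \<and>
     (\<forall>X\<in>\<C>. \<forall>Y\<in>\<C>. \<forall>Z\<in>\<C>. \<forall>f g. short_exact A X Y Z f g \<longrightarrow>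
        short_exact B (Fo X) (Fo Y) (Fo Z) (Fm X Y f) (Fm Y Z g))"


section \<open>Tensor products\<close>

text \<open>\<open>X \<otimes>\<^sub>S M\<close> for a left \<open>S\<^sup>o\<^sup>p\<close>-module \<open>X\<close> and a left \<open>S\<close>-module \<open>M\<close>, as
  the free abelian group on pairs modulo the subgroup generated by the usual relations.\<close>

definition tensor_rels :: "('s, 'z) ring_scheme \<Rightarrow> ('s, 'x) module \<Rightarrow> ('s, 'm) module \<Rightarrow>
    ('x \<times> 'm \<Rightarrow>\<^sub>0 int) set" where
  "tensor_rels S X M =
     {frag_of (x \<oplus>\<^bsub>X\<^esub> y, m) - frag_of (x, m) - frag_of (y, m) | x y m.
        x \<in> carrier X \<and> y \<in> carrier X \<and> m \<in> carrier M} \<union>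
     {frag_of (x, m \<oplus>\<^bsub>M\<^esub> n) - frag_of (x, m) - frag_of (x, n) | x m n.
        x \<in> carrier X \<and> m \<in> carrier M \<and> n \<in> carrier M} \<union>
     {frag_of (s \<odot>\<^bsub>X\<^esub> x, m) - frag_of (x, s \<odot>\<^bsub>M\<^esub> m) | s x m.
        s \<in> carrier S \<and> x \<in> carrier X \<and> m \<in> carrier M}"

abbreviation tensor_free :: "('s, 'x) module \<Rightarrow> ('s, 'm) module \<Rightarrow> ('x \<times> 'm \<Rightarrow>\<^sub>0 int) monoid" where
  "tensor_free X M \<equiv> free_Abelian_group (carrier X \<times> carrier M)"

definition tensor_sub :: "('s, 'z) ring_scheme \<Rightarrow> ('s, 'x) module \<Rightarrow> ('s, 'm) module \<Rightarrow>
    ('x \<times> 'm \<Rightarrow>\<^sub>0 int) set" where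
  "tensor_sub S X M = generate (tensor_free X M) (tensor_rels S X M)"

definition tensor_group :: "('s, 'z) ring_scheme \<Rightarrow> ('s, 'x) module \<Rightarrow> ('s, 'm) module \<Rightarrow>
    ('x \<times> 'm \<Rightarrow>\<^sub>0 int) set monoid" where
  "tensor_group S X M = tensor_free X M Mod tensor_sub S X M"

text \<open>\<open>f \<otimes> g : X \<otimes>\<^sub>S M \<rightarrow> X' \<otimes>\<^sub>S M'\<close>, the class of \<open>\<Sum> n\<^sub>i (x\<^sub>i, m\<^sub>i)\<close> being sent to the class of
  \<open>\<Sum> n\<^sub>i (f x\<^sub>i, g m\<^sub>i)\<close>.\<close>

definition tensor_map ::
  "('s, 'z) ring_scheme \<Rightarrow> ('s, 'x) module \<Rightarrow> ('s, 'm) module \<Rightarrow> ('s, 'y) module \<Rightarrow> ('s, 'n) module \<Rightarrow>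
   ('x \<Rightarrow> 'y) \<Rightarrow> ('m \<Rightarrow> 'n) \<Rightarrow> ('x \<times> 'm \<Rightarrow>\<^sub>0 int) set \<Rightarrow> ('y \<times> 'n \<Rightarrow>\<^sub>0 int) set" where
  "tensor_map S X M X' M' f g = (\<lambda>C\<in>carrier (tensor_group S X M).
     \<Union>p\<in>C. tensor_sub S X' M' #>\<^bsub>tensor_free X' M'\<^esub>
       frag_extend (\<lambda>(x, m). frag_of (f x, g m)) p)"

text \<open>If scalars \<open>b\<close> act on \<open>X\<close> by \<open>S\<^sup>o\<^sup>p\<close>-linear maps \<open>act b\<close>, they act on \<open>X \<otimes>\<^sub>S M\<close> by
  \<open>act b \<otimes> id\<close>.\<close>

definition tensor_mod ::
  "('s, 'z) ring_scheme \<Rightarrow> ('s, 'x) module \<Rightarrow> ('s, 'm) module \<Rightarrow> ('b \<Rightarrow> 'x \<Rightarrow> 'x) \<Rightarrow>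
   ('b, ('x \<times> 'm \<Rightarrow>\<^sub>0 int) set) module" where
  "tensor_mod S X M act = \<lparr>carrier = carrier (tensor_group S X M), monoid.mult = undefined, one = undefined,
     ring.zero = one (tensor_group S X M), ring.add = monoid.mult (tensor_group S X M),
     smult = (\<lambda>b. tensor_map S X M X M (act b) (\<lambda>m. m))\<rparr>"


section \<open>Algebras over a commutative ring\<close>

locale R_algebra = module R A + ring A for R (structure) and A (structure) +
  assumes smult_mult_l: "\<lbrakk>r \<in> carrier R; a \<in> carrier A; b \<in> carrier A\<rbrakk> \<Longrightarrow>
      (r \<odot>\<^bsub>A\<^esub> a) \<otimes>\<^bsub>A\<^esub> b = r \<odot>\<^bsub>A\<^esub> (a \<otimes>\<^bsub>A\<^esub> b)"
    and smult_mult_r: "\<lbrakk>r \<in> carrier R; a \<in> carrier A; b \<in> carrier A\<rbrakk> \<Longrightarrow>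
      a \<otimes>\<^bsub>A\<^esub> (r \<odot>\<^bsub>A\<^esub> b) = r \<odot>\<^bsub>A\<^esub> (a \<otimes>\<^bsub>A\<^esub> b)"

definition proj_noetherian_algebra :: "('r, 'z) ring_scheme \<Rightarrow> ('r, 'a) module \<Rightarrow> bool" where
  "proj_noetherian_algebra R A \<longleftrightarrow> R_algebra R A \<and> finitely_generated R A \<and> projective R A"

abbreviation scalar :: "('r, 'a) module \<Rightarrow> ('a, 'x) module \<Rightarrow> 'r \<Rightarrow> 'x \<Rightarrow> 'x" where
  "scalar A X r x \<equiv> (r \<odot>\<^bsub>A\<^esub> \<one>\<^bsub>A\<^esub>) \<odot>\<^bsub>X\<^esub> x"

text \<open>Restriction of scalars along \<open>R \<rightarrow> A\<close>.\<close>

definition restr :: "('r, 'a) module \<Rightarrow> ('a, 'x) module \<Rightarrow> ('r, 'x) module" where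
  "restr A X = \<lparr>carrier = carrier X, monoid.mult = monoid.mult X, one = one X,
     ring.zero = ring.zero X, ring.add = ring.add X, smult = scalar A X\<rparr>"

text \<open>\<open>Hom\<^sub>A(X, Y)\<close> with pointwise addition and a given action of scalars.\<close>

definition hom_mod ::
  "('a, 'z) ring_scheme \<Rightarrow> ('a, 'x) module \<Rightarrow> ('a, 'y) module \<Rightarrow> ('b \<Rightarrow> ('x \<Rightarrow> 'y) \<Rightarrow> 'x \<Rightarrow> 'y) \<Rightarrow>
   ('b, 'x \<Rightarrow> 'y) module" where
  "hom_mod A X Y act = \<lparr>carrier = lhom A X Y, monoid.mult = undefined, one = undefined,
     ring.zero = zero_map X Y, ring.add = (\<lambda>f g. \<lambda>x\<in>carrier X. f x \<oplus>\<^bsub>Y\<^esub> g x), smult = act\<rparr>"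

definition HomA :: "('r, 'a) module \<Rightarrow> ('a, 'x) module \<Rightarrow> ('a, 'y) module \<Rightarrow> ('r, 'x \<Rightarrow> 'y) module" where
  "HomA A X Y = hom_mod A X Y (\<lambda>r f. \<lambda>x\<in>carrier X. scalar A Y r (f x))"

definition EndA :: "('r, 'a) module \<Rightarrow> ('a, 'x) module \<Rightarrow> ('r, 'x \<Rightarrow> 'x) module" where
  "EndA A X = (HomA A X X)\<lparr>monoid.mult := compose (carrier X), one := (\<lambda>x\<in>carrier X. x)\<rparr>"

definition algebra_iso :: "('r, 'z) ring_scheme \<Rightarrow> ('r, 'a) module \<Rightarrow> ('r, 'b) module \<Rightarrow> bool" where
  "algebra_iso R A B \<longleftrightarrow> (\<exists>\<phi>. \<phi> \<in> ring_iso A B \<and> \<phi> \<in> lhom R A B)"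

text \<open>\<open>D X = Hom\<^sub>R(X, R)\<close> as a left module over \<open>A\<^sup>o\<^sup>p\<close>: \<open>(f a)(x) = f (a x)\<close>.\<close>

definition dual :: "('r, 'z) ring_scheme \<Rightarrow> ('r, 'a) module \<Rightarrow> ('a, 'x) module \<Rightarrow> ('a, 'x \<Rightarrow> 'r) module" where
  "dual R A X = hom_mod R (restr A X) (regular R) (\<lambda>a f. \<lambda>x\<in>carrier X. f (a \<odot>\<^bsub>X\<^esub> x))"

text \<open>For a left \<open>A\<close>-module \<open>V\<close> and an \<open>R\<close>-module \<open>U\<close>, the left \<open>A\<close>-module \<open>V \<otimes>\<^sub>R U\<close>.\<close>

definition tensorR :: "('r, 'z) ring_scheme \<Rightarrow> ('r, 'a) module \<Rightarrow> ('a, 'v) module \<Rightarrow> ('r, 'u) module \<Rightarrow>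
    ('a, ('v \<times> 'u \<Rightarrow>\<^sub>0 int) set) module" where
  "tensorR R A V U = tensor_mod R (restr A V) U (smult V)"

text \<open>For a right \<open>A\<close>-module \<open>X\<close> and a left \<open>A\<close>-module \<open>M\<close>, the \<open>R\<close>-module \<open>X \<otimes>\<^sub>A M\<close>.\<close>

definition tensorA :: "('r, 'a) module \<Rightarrow> ('a, 'x) module \<Rightarrow> ('a, 'm) module \<Rightarrow>
    ('r, ('x \<times> 'm \<Rightarrow>\<^sub>0 int) set) module" where
  "tensorA A X M = tensor_mod A X M (scalar A X)"


section \<open>Ext\<close>

definition proj_resolution ::
  "('a, 'z) ring_scheme \<Rightarrow> ('a, 'x) module \<Rightarrow> (nat \<Rightarrow> ('a, 'p) module) \<Rightarrow> (nat \<Rightarrow> 'p \<Rightarrow> 'p) \<Rightarrow> ('p \<Rightarrow> 'x) \<Rightarrow> bool" where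
  "proj_resolution A X P d e \<longleftrightarrow>
     (\<forall>i. P i \<in> proj_mods A) \<and> (\<forall>i. d i \<in> lhom A (P (Suc i)) (P i)) \<and> e \<in> lhom A (P 0) X \<and>
     e ` carrier (P 0) = carrier X \<and>
     d 0 ` carrier (P (Suc 0)) = a_kernel (P 0) X e \<and>
     (\<forall>i. d (Suc i) ` carrier (P (Suc (Suc i))) = a_kernel (P (Suc i)) (P i) (d i))"

text \<open>The \<open>i\<close>-th cohomology of the complex \<open>Hom\<^sub>A(P\<^sub>0, Y) \<rightarrow> Hom\<^sub>A(P\<^sub>1, Y) \<rightarrow> \<dots>\<close>.\<close>

definition hom_cohomology ::
  "('r, 'a) module \<Rightarrow> (nat \<Rightarrow> ('a, 'p) module) \<Rightarrow> (nat \<Rightarrow> 'p \<Rightarrow> 'p) \<Rightarrow> ('a, 'y) module \<Rightarrow> nat \<Rightarrow>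
   ('r, ('p \<Rightarrow> 'y) set) module" where
  "hom_cohomology A P d Y i =
     (let \<delta> = (\<lambda>j f. compose (carrier (P (Suc j))) f (d j));
          Z = {f \<in> lhom A (P i) Y. \<delta> i f = zero_map (P (Suc i)) Y};
          B = (case i of 0 \<Rightarrow> {zero_map (P 0) Y} | Suc j \<Rightarrow> \<delta> j ` lhom A (P j) Y)
      in quot_mod ((HomA A (P i) Y)\<lparr>carrier := Z\<rparr>) B)"

text \<open>\<open>Ext\<^sub>A\<^sup>i(X, Y)\<close> as an \<open>R\<close>-module, for \<open>X \<in> A-mod\<close> over a Noetherian ring \<open>A\<close>, by means of a chosen
  resolution by finitely generated projective modules; it always exists with elements in
  \<open>nat \<Rightarrow> 'a\<close>, for instance with terms \<open>A\<^sup>n\<close>.\<close>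

definition Ext :: "('r, 'a) module \<Rightarrow> ('a, 'x) module \<Rightarrow> ('a, 'y) module \<Rightarrow> nat \<Rightarrow>
    ('r, ((nat \<Rightarrow> 'a) \<Rightarrow> 'y) set) module" where
  "Ext A X Y i = (case (SOME (P, d, e). proj_resolution A X P d e) of
     (P, d, e) \<Rightarrow> hom_cohomology A P d Y i)"


section \<open>Split quasi-hereditary algebras\<close>

definition twists :: "('r, 'z) ring_scheme \<Rightarrow> ('r, 'a) module \<Rightarrow> 'l set \<Rightarrow> ('l \<Rightarrow> ('a, 'v) module) \<Rightarrow>
    ('a, ('v \<times> (nat \<Rightarrow> 'r) \<Rightarrow>\<^sub>0 int) set) module set" where
  "twists R A \<Lambda> V = {tensorR R A (V l) U | l U. l \<in> \<Lambda> \<and> U \<in> proj_mods R}"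

definition split_quasi_hereditary ::
  "('r, 'z) ring_scheme \<Rightarrow> ('r, 'a) module \<Rightarrow> 'l::order set \<Rightarrow> ('l \<Rightarrow> ('a, 'v) module) \<Rightarrow> bool" where
  "split_quasi_hereditary R A \<Lambda> \<Delta> \<longleftrightarrow>
     proj_noetherian_algebra R A \<and> finite \<Lambda> \<and>
     (\<forall>l\<in>\<Lambda>. \<Delta> l \<in> fg_mods A) \<and>
     (\<forall>l\<in>\<Lambda>. projective R (restr A (\<Delta> l))) \<and>
     (\<forall>l\<in>\<Lambda>. \<forall>m\<in>\<Lambda>. lhom A (\<Delta> l) (\<Delta> m) \<noteq> {zero_map (\<Delta> l) (\<Delta> m)} \<longrightarrow> l \<le> m) \<and>
     (\<forall>l\<in>\<Lambda>. algebra_iso R (regular R) (EndA A (\<Delta> l))) \<and>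
     (\<exists>P :: 'l \<Rightarrow> ('a, nat \<Rightarrow> 'a) module.
        (\<forall>l\<in>\<Lambda>. P l \<in> proj_mods A \<and>
           (\<exists>(C :: ('a, nat \<Rightarrow> 'a) module) f g. short_exact A C (P l) (\<Delta> l) f g \<and>
              C \<in> filtered A (twists R A {m\<in>\<Lambda>. l < m} \<Delta>))) \<and>
        (add_mods A (direct_sum \<Lambda> P) :: ('a, nat \<Rightarrow> 'a) module set) = proj_mods A)"

definition costandard ::
  "('r, 'z) ring_scheme \<Rightarrow> ('r, 'a) module \<Rightarrow> 'l::order set \<Rightarrow> ('l \<Rightarrow> ('a, 'v) module) \<Rightarrow>
   ('l \<Rightarrow> ('a, 'w) module) \<Rightarrow> bool" where
  "costandard R A \<Lambda> \<Delta> Nabla \<longleftrightarrow>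
     (\<forall>l\<in>\<Lambda>. Nabla l \<in> fg_mods A) \<and>
     split_quasi_hereditary R (opp_ring A) \<Lambda> (\<lambda>l. dual R A (Nabla l)) \<and>
     (\<forall>l\<in>\<Lambda>. \<forall>m\<in>\<Lambda>. \<forall>i.
        if i = 0 \<and> l = m then lmod_iso R (Ext A (\<Delta> l) (Nabla m) i) (regular R)
        else carrier (Ext A (\<Delta> l) (Nabla m) i) = {\<zero>\<^bsub>Ext A (\<Delta> l) (Nabla m) i\<^esub>})"

end

theory Submission
  imports Defs
begin

text \<open>
  Call a right module \<open>Y\<close> good if it is finitely generated projective over \<open>R\<close> and
  \<open>Ext\<^sup>1(\<Delta>(\<lambda>), DY) = 0\<close> for all \<open>\<lambda>\<close>.  Both functors are tensor products of good right modules \<open>Y\<close> with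
  modules \<open>M\<close> filtered by twisted standard modules, and two facts about such \<open>Y\<close> and \<open>M\<close> suffice (\<open>good_tensor\<close>): the \<open>R\<close>-module
  \<open>Y \<otimes> M\<close> is finitely generated projective, and \<open>Ext\<^sup>1(M, Hom\<^sub>R(Y, G)) = 0\<close> for every \<open>R\<close>-module \<open>G\<close>.

  These facts are proved along the exact sequences \<open>0 \<rightarrow> C(\<lambda>) \<rightarrow> P(\<lambda>) \<rightarrow> \<Delta>(\<lambda>) \<rightarrow> 0\<close>.  Suppose that
  \<open>Y \<otimes> C(\<lambda>)\<close> is projective.  By the adjunction \<open>Hom\<^sub>R(Y \<otimes> C, G) = Hom\<^sub>A(C, Hom\<^sub>R(Y, G))\<close> with \<open>G = R\<close>, goodness means
  that functionals extend from \<open>Y \<otimes> C(\<lambda>)\<close> to \<open>Y \<otimes> P(\<lambda>)\<close>; extending those of a dual basis yields a retraction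
  (\<open>tensor_split\<close>).  So \<open>Y \<otimes> \<Delta>(\<lambda>)\<close> is a summand of \<open>Y \<otimes> P(\<lambda>)\<close>, which is a summand of some \<open>Y\<^sup>n\<close>, and now
  maps with values in any \<open>G\<close> extend (\<open>tensor_standard\<close>).  Both facts pass from standard modules to filtered ones,
  since for a submodule \<open>K\<close> of \<open>Q\<close> with quotient in \<open>add \<Delta>(\<lambda>)\<close>, the second one for this quotient and
  \<open>G = Y \<otimes> K\<close> makes \<open>Y \<otimes> K \<rightarrow> Y \<otimes> Q\<close> injective (\<open>tensor_inj_right\<close>, \<open>tensor_filtered_fgp\<close>).  As \<open>C(\<lambda>)\<close> is filtered by twists of
  \<open>\<Delta>(\<mu>)\<close> with \<open>\<mu> > \<lambda>\<close>, descending induction on \<open>\<lambda>\<close> removes the hypothesis on \<open>C(\<lambda>)\<close> (\<open>tensor_C_fgp\<close>).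

  Tensor products are right exact, so exactness of the functors is a matter of injectivity.  For
  \<open>0 \<rightarrow> K \<rightarrow> Q \<rightarrow> N \<rightarrow> 0\<close> in \<open>\<F>(\<Delta>)\<close> it follows as above by extending the identity of \<open>Y \<otimes> K\<close>.  For
  \<open>0 \<rightarrow> X \<rightarrow> Y \<rightarrow> Z \<rightarrow> 0\<close> with good terms and \<open>G = X \<otimes> M\<close>, the sequence
  \<open>0 \<rightarrow> Hom\<^sub>R(Z, G) \<rightarrow> Hom\<^sub>R(Y, G) \<rightarrow> Hom\<^sub>R(X, G) \<rightarrow> 0\<close> is exact, as \<open>Z\<close> is projective over \<open>R\<close>; the map
  \<open>M \<rightarrow> Hom\<^sub>R(X, G)\<close> adjoint to the identity lifts to \<open>Hom\<^sub>R(Y, G)\<close>, as \<open>Ext\<^sup>1(M, Hom\<^sub>R(Z, G)) = 0\<close>, and the adjoint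
  of the lift is a left inverse of \<open>X \<otimes> M \<rightarrow> Y \<otimes> M\<close> (\<open>tensor_inj_left\<close>).

  It remains to see that the modules in \<open>\<F>(D\<nabla>)\<close> and the dual of \<open>N \<in> \<F>(\<nabla>)\<close> are good.  The conditions on
  \<open>Ext\<^sup>i(\<Delta>(\<lambda>), \<nabla>(\<mu>))\<close> for \<open>i = 0, 1\<close> make \<open>Hom\<^sub>A(C(\<lambda>), \<nabla>(\<mu>))\<close> and \<open>Hom\<^sub>A(P(\<lambda>), \<nabla>(\<mu>))\<close> projective over \<open>R\<close>, and
  since the \<open>P(\<lambda>)\<close> generate \<open>A\<close>, so is \<open>\<nabla>(\<mu>) = Hom\<^sub>A(A, \<nabla>(\<mu>))\<close> (\<open>fgp_if_no_standard_ext\<close>).  It is thus reflexive, so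
  \<open>D\<nabla>(\<mu>)\<close> is good; goodness passes to extensions (\<open>good_filtered\<close>), and \<open>N\<close> is treated in the same way
  (\<open>filtered_no_standard_ext\<close>, \<open>good_dual\<close>).

  Two encodings keep the homological algebra elementary.  Membership in \<open>add V\<close>, and with it projectivity, is
  expressed by the identity being a finite sum of maps that factor through \<open>V\<close> (\<open>in_add\<close>), and vanishing of
  \<open>Ext\<^sup>1\<close> by the extension of maps from the kernel of a presentation (\<open>ext1_zero\<close>).\<close>

section \<open>Linear maps\<close>

context lmodule
begin

lemmas lsmult_simps [simp] = lsmult_closed lsmult_one

lemma lsmult_l_null [simp]:
  assumes "x \<in> carrier M" shows "\<zero> \<odot>\<^bsub>M\<^esub> x = \<zero>\<^bsub>M\<^esub>"
proof -
  have "\<zero> \<odot>\<^bsub>M\<^esub> x \<oplus>\<^bsub>M\<^esub> \<zero> \<odot>\<^bsub>M\<^esub> x = \<zero> \<odot>\<^bsub>M\<^esub> x"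
    using lsmult_l_distr[of \<zero> \<zero> x] assms by simp
  then show ?thesis using assms by (metis M.add.l_cancel_one' lsmult_closed R.zero_closed)
qed

lemma lsmult_r_null [simp]:
  assumes "a \<in> carrier R" shows "a \<odot>\<^bsub>M\<^esub> \<zero>\<^bsub>M\<^esub> = \<zero>\<^bsub>M\<^esub>"
proof -
  have "a \<odot>\<^bsub>M\<^esub> \<zero>\<^bsub>M\<^esub> \<oplus>\<^bsub>M\<^esub> a \<odot>\<^bsub>M\<^esub> \<zero>\<^bsub>M\<^esub> = a \<odot>\<^bsub>M\<^esub> \<zero>\<^bsub>M\<^esub>"
    using lsmult_r_distr[of a "\<zero>\<^bsub>M\<^esub>" "\<zero>\<^bsub>M\<^esub>"] assms by simp
  then show ?thesis using assms by (metis M.add.l_cancel_one' lsmult_closed M.zero_closed)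
qed

lemma lsmult_l_minus:
  assumes "a \<in> carrier R" "x \<in> carrier M"
  shows "(\<ominus> a) \<odot>\<^bsub>M\<^esub> x = \<ominus>\<^bsub>M\<^esub> (a \<odot>\<^bsub>M\<^esub> x)"
proof -
  have "(\<ominus> a) \<odot>\<^bsub>M\<^esub> x \<oplus>\<^bsub>M\<^esub> a \<odot>\<^bsub>M\<^esub> x = \<zero>\<^bsub>M\<^esub>"
    using lsmult_l_distr[of "\<ominus> a" a x] assms by (simp add: R.l_neg)
  then show ?thesis using assms by (metis M.minus_equality lsmult_closed R.a_inv_closed)
qed

lemma lsmult_r_minus:
  assumes "a \<in> carrier R" "x \<in> carrier M"
  shows "a \<odot>\<^bsub>M\<^esub> (\<ominus>\<^bsub>M\<^esub> x) = \<ominus>\<^bsub>M\<^esub> (a \<odot>\<^bsub>M\<^esub> x)"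
proof -
  have "a \<odot>\<^bsub>M\<^esub> (\<ominus>\<^bsub>M\<^esub> x) \<oplus>\<^bsub>M\<^esub> a \<odot>\<^bsub>M\<^esub> x = \<zero>\<^bsub>M\<^esub>"
    using lsmult_r_distr[of a "\<ominus>\<^bsub>M\<^esub> x" x] assms by (simp add: M.l_neg)
  then show ?thesis using assms by (metis M.minus_equality lsmult_closed M.a_inv_closed)
qed

end

lemma lmodule_ring: "lmodule A X \<Longrightarrow> ring A"
  by (simp add: lmodule_def)

lemma lmodule_abelian_group: "lmodule A X \<Longrightarrow> abelian_group X"
  by (simp add: lmodule_def)

lemma minus_zero_imp_eq:
  assumes "abelian_group G" "x \<in> carrier G" "y \<in> carrier G" "x \<ominus>\<^bsub>G\<^esub> y = \<zero>\<^bsub>G\<^esub>"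
  shows "x = y"
proof -
  interpret abelian_group G by fact
  have "(x \<ominus>\<^bsub>G\<^esub> y) \<oplus>\<^bsub>G\<^esub> y = x" using assms(2,3) by (simp add: a_minus_def a_assoc l_neg)
  then show ?thesis using assms by simp
qed

lemma neg_zero: "abelian_group G \<Longrightarrow> \<ominus>\<^bsub>G\<^esub> \<zero>\<^bsub>G\<^esub> = \<zero>\<^bsub>G\<^esub>"
  by (simp add: abelian_group.minus_equality abelian_groupE)

text \<open>Dropping the extensionality that \<open>lhom\<close> demands lets composites and sums of linear maps be
  written as plain abstractions, and one function serve as a map between several restrictions.\<close>

definition lin :: "('a, 'z) ring_scheme \<Rightarrow> ('a, 'x) module \<Rightarrow> ('a, 'y) module \<Rightarrow> ('x \<Rightarrow> 'y) \<Rightarrow> bool" where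
  "lin A X Y f \<longleftrightarrow> (\<forall>x\<in>carrier X. f x \<in> carrier Y) \<and>
     (\<forall>x\<in>carrier X. \<forall>y\<in>carrier X. f (x \<oplus>\<^bsub>X\<^esub> y) = f x \<oplus>\<^bsub>Y\<^esub> f y) \<and>
     (\<forall>a\<in>carrier A. \<forall>x\<in>carrier X. f (a \<odot>\<^bsub>X\<^esub> x) = a \<odot>\<^bsub>Y\<^esub> f x)"

lemma linI:
  assumes "\<And>x. x \<in> carrier X \<Longrightarrow> f x \<in> carrier Y"
    "\<And>x y. x \<in> carrier X \<Longrightarrow> y \<in> carrier X \<Longrightarrow> f (x \<oplus>\<^bsub>X\<^esub> y) = f x \<oplus>\<^bsub>Y\<^esub> f y"
    "\<And>a x. a \<in> carrier A \<Longrightarrow> x \<in> carrier X \<Longrightarrow> f (a \<odot>\<^bsub>X\<^esub> x) = a \<odot>\<^bsub>Y\<^esub> f x"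
  shows "lin A X Y f"
  using assms by (simp add: lin_def)

lemma lin_closed: "lin A X Y f \<Longrightarrow> x \<in> carrier X \<Longrightarrow> f x \<in> carrier Y"
  and lin_add: "lin A X Y f \<Longrightarrow> x \<in> carrier X \<Longrightarrow> y \<in> carrier X \<Longrightarrow> f (x \<oplus>\<^bsub>X\<^esub> y) = f x \<oplus>\<^bsub>Y\<^esub> f y"
  and lin_smult: "lin A X Y f \<Longrightarrow> a \<in> carrier A \<Longrightarrow> x \<in> carrier X \<Longrightarrow> f (a \<odot>\<^bsub>X\<^esub> x) = a \<odot>\<^bsub>Y\<^esub> f x"
  by (simp_all add: lin_def)

lemma lin_zero:
  assumes "lin A X Y f" "abelian_group X" "abelian_group Y"
  shows "f \<zero>\<^bsub>X\<^esub> = \<zero>\<^bsub>Y\<^esub>"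
proof -
  interpret X: abelian_group X by fact
  interpret Y: abelian_group Y by fact
  have "f \<zero>\<^bsub>X\<^esub> \<oplus>\<^bsub>Y\<^esub> f \<zero>\<^bsub>X\<^esub> = f \<zero>\<^bsub>X\<^esub>" using lin_add[OF assms(1), of "\<zero>\<^bsub>X\<^esub>" "\<zero>\<^bsub>X\<^esub>"] by simp
  then show ?thesis using lin_closed[OF assms(1), of "\<zero>\<^bsub>X\<^esub>"] by (metis Y.add.l_cancel_one' X.zero_closed)
qed

lemma lin_neg:
  assumes "lin A X Y f" "abelian_group X" "abelian_group Y" "x \<in> carrier X"
  shows "f (\<ominus>\<^bsub>X\<^esub> x) = \<ominus>\<^bsub>Y\<^esub> f x"
proof -
  interpret X: abelian_group X by fact
  interpret Y: abelian_group Y by fact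
  have "f (\<ominus>\<^bsub>X\<^esub> x) \<oplus>\<^bsub>Y\<^esub> f x = \<zero>\<^bsub>Y\<^esub>"
    using lin_add[OF assms(1), of "\<ominus>\<^bsub>X\<^esub> x" x] lin_zero[OF assms(1-3)] assms(4) by (simp add: X.l_neg)
  then show ?thesis using lin_closed[OF assms(1)] assms(4) by (simp add: Y.minus_equality)
qed

lemma lin_diff:
  assumes "lin A X Y f" "abelian_group X" "abelian_group Y" "x \<in> carrier X" "y \<in> carrier X"
  shows "f (x \<ominus>\<^bsub>X\<^esub> y) = f x \<ominus>\<^bsub>Y\<^esub> f y"
proof -
  interpret X: abelian_group X by fact
  show ?thesis using assms lin_add[OF assms(1), of x "\<ominus>\<^bsub>X\<^esub> y"] lin_neg[OF assms(1-3)]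
    by (simp add: a_minus_def)
qed

lemma lin_comp: "lin A X Y f \<Longrightarrow> lin A Y Z g \<Longrightarrow> lin A X Z (\<lambda>x. g (f x))"
  by (simp add: lin_def)

lemma lin_id: "lin A X X (\<lambda>x. x)"
  by (simp add: lin_def)

lemma lin_cong: "lin A X Y f \<Longrightarrow> (\<And>x. x \<in> carrier X \<Longrightarrow> g x = f x) \<Longrightarrow> lmodule A X \<Longrightarrow> lin A X Y g"
  by (simp add: lin_def lmodule.lsmult_closed abelian_groupE(1)[OF lmodule_abelian_group])

lemma lin_const_zero: "lmodule A Y \<Longrightarrow> lin A X Y (\<lambda>x. \<zero>\<^bsub>Y\<^esub>)"
proof -
  assume "lmodule A Y"
  then interpret Y: lmodule A Y .
  show ?thesis by (simp add: lin_def)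
qed

lemma lin_plus:
  assumes "lin A X Y f" "lin A X Y g" "lmodule A Y"
  shows "lin A X Y (\<lambda>x. f x \<oplus>\<^bsub>Y\<^esub> g x)"
proof -
  interpret Y: lmodule A Y by fact
  show ?thesis using assms(1,2)
    by (auto simp add: lin_def Y.lsmult_r_distr Y.M.a_ac)
qed

lemma lin_minus:
  assumes "lin A X Y f" "lin A X Y g" "lmodule A Y"
  shows "lin A X Y (\<lambda>x. f x \<ominus>\<^bsub>Y\<^esub> g x)"
proof -
  interpret Y: lmodule A Y by fact
  show ?thesis using assms(1,2)
    by (auto simp add: lin_def a_minus_def Y.lsmult_r_distr Y.lsmult_r_minus Y.M.minus_add Y.M.a_ac)
qed

text \<open>The module axioms are equations, so they pass to surjective images; the quotient modules are
  instances.\<close>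

lemma lin_lmodule_image:
  assumes "lmodule A X" "lin A X Y f" "f ` carrier X = carrier Y" "\<zero>\<^bsub>Y\<^esub> = f \<zero>\<^bsub>X\<^esub>"
  shows "lmodule A Y"
proof -
  interpret X: lmodule A X by fact
  note f = lin_closed[OF assms(2)] and h = lin_add[OF assms(2)] lin_smult[OF assms(2)]
  have ex: "\<exists>x\<in>carrier X. y = f x" if "y \<in> carrier Y" for y using that assms(3) by auto
  show ?thesis
  proof (intro lmodule.intro lmodule_axioms.intro abelian_groupI)
    show "ring A" by (rule X.R.ring_axioms)
    fix x y assume "x \<in> carrier Y" "y \<in> carrier Y"
    then obtain u v where "u \<in> carrier X" "v \<in> carrier X" "x = f u" "y = f v" using ex by metis
    then show "x \<oplus>\<^bsub>Y\<^esub> y \<in> carrier Y" "x \<oplus>\<^bsub>Y\<^esub> y = y \<oplus>\<^bsub>Y\<^esub> x"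
      using h(1)[of u v] h(1)[of v u] f[of "u \<oplus>\<^bsub>X\<^esub> v"] by (simp_all add: X.M.a_comm)
  next
    show "\<zero>\<^bsub>Y\<^esub> \<in> carrier Y" using assms(4) f by simp
  next
    fix x y z assume "x \<in> carrier Y" "y \<in> carrier Y" "z \<in> carrier Y"
    then obtain u v w where "u \<in> carrier X" "v \<in> carrier X" "w \<in> carrier X" "x = f u" "y = f v" "z = f w"
      using ex by metis
    then show "x \<oplus>\<^bsub>Y\<^esub> y \<oplus>\<^bsub>Y\<^esub> z = x \<oplus>\<^bsub>Y\<^esub> (y \<oplus>\<^bsub>Y\<^esub> z)"
      using h(1)[of u v] h(1)[of v w] h(1)[of "u \<oplus>\<^bsub>X\<^esub> v" w] h(1)[of u "v \<oplus>\<^bsub>X\<^esub> w"] by (simp add: X.M.a_assoc)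
  next
    fix x assume "x \<in> carrier Y"
    then obtain u where u: "u \<in> carrier X" "x = f u" using ex by metis
    then show "\<zero>\<^bsub>Y\<^esub> \<oplus>\<^bsub>Y\<^esub> x = x" using h(1)[of "\<zero>\<^bsub>X\<^esub>" u] assms(4) by simp
    show "\<exists>y\<in>carrier Y. y \<oplus>\<^bsub>Y\<^esub> x = \<zero>\<^bsub>Y\<^esub>"
      using h(1)[of "\<ominus>\<^bsub>X\<^esub> u" u] u assms(4) f[of "\<ominus>\<^bsub>X\<^esub> u"] by (auto simp: X.M.l_neg)
    show "\<one>\<^bsub>A\<^esub> \<odot>\<^bsub>Y\<^esub> x = x" using h(2)[of "\<one>\<^bsub>A\<^esub>" u] u by simp
    fix a assume a: "a \<in> carrier A"
    then show "a \<odot>\<^bsub>Y\<^esub> x \<in> carrier Y" using h(2)[of a u] u f[of "a \<odot>\<^bsub>X\<^esub> u"] by simp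
    fix b assume b: "b \<in> carrier A"
    then show "(a \<oplus>\<^bsub>A\<^esub> b) \<odot>\<^bsub>Y\<^esub> x = a \<odot>\<^bsub>Y\<^esub> x \<oplus>\<^bsub>Y\<^esub> b \<odot>\<^bsub>Y\<^esub> x"
      using h(2)[of "a \<oplus>\<^bsub>A\<^esub> b" u] h(2)[of a u] h(2)[of b u] h(1)[of "a \<odot>\<^bsub>X\<^esub> u" "b \<odot>\<^bsub>X\<^esub> u"] u a
      by (simp add: X.lsmult_l_distr)
    show "(a \<otimes>\<^bsub>A\<^esub> b) \<odot>\<^bsub>Y\<^esub> x = a \<odot>\<^bsub>Y\<^esub> (b \<odot>\<^bsub>Y\<^esub> x)"
      using h(2)[of "a \<otimes>\<^bsub>A\<^esub> b" u] h(2)[of b u] h(2)[of a "b \<odot>\<^bsub>X\<^esub> u"] u a b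
      by (simp add: X.lsmult_assoc)
  next
    fix a x y assume a: "a \<in> carrier A" and "x \<in> carrier Y" "y \<in> carrier Y"
    then obtain u v where "u \<in> carrier X" "v \<in> carrier X" "x = f u" "y = f v" using ex by metis
    then show "a \<odot>\<^bsub>Y\<^esub> (x \<oplus>\<^bsub>Y\<^esub> y) = a \<odot>\<^bsub>Y\<^esub> x \<oplus>\<^bsub>Y\<^esub> a \<odot>\<^bsub>Y\<^esub> y"
      using h(1)[of u v] h(2)[of a u] h(2)[of a v] h(2)[of a "u \<oplus>\<^bsub>X\<^esub> v"] h(1)[of "a \<odot>\<^bsub>X\<^esub> u" "a \<odot>\<^bsub>X\<^esub> v"] a
      by (simp add: X.lsmult_r_distr)
  qed
qed

lemma lhom_iff: "f \<in> lhom A X Y \<longleftrightarrow> lin A X Y f \<and> f \<in> extensional (carrier X)"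
  by (auto simp: lhom_def lin_def PiE_def)

lemma lhom_lin: "f \<in> lhom A X Y \<Longrightarrow> lin A X Y f"
  by (simp add: lhom_iff)

lemma lin_restrict_lhom: "lmodule A X \<Longrightarrow> lin A X Y f \<Longrightarrow> restrict f (carrier X) \<in> lhom A X Y"
  by (simp add: lhom_iff lin_cong)

subsection \<open>Submodules and quotients\<close>

abbreviation ker :: "('a, 'x) module \<Rightarrow> ('a, 'y) module \<Rightarrow> ('x \<Rightarrow> 'y) \<Rightarrow> 'x set" where
  "ker X Y g \<equiv> {x \<in> carrier X. g x = \<zero>\<^bsub>Y\<^esub>}"

lemma a_kernel_eq: "a_kernel X Y g = ker X Y g"
  by (simp add: a_kernel_def kernel_def)

text \<open>Closure under negatives is implied, since \<open>- 1\<close> is a scalar.\<close>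

definition subm :: "('a, 'z) ring_scheme \<Rightarrow> ('a, 'x) module \<Rightarrow> 'x set \<Rightarrow> bool" where
  "subm A X H \<longleftrightarrow> H \<subseteq> carrier X \<and> \<zero>\<^bsub>X\<^esub> \<in> H \<and> (\<forall>x\<in>H. \<forall>y\<in>H. x \<oplus>\<^bsub>X\<^esub> y \<in> H) \<and>
     (\<forall>a\<in>carrier A. \<forall>x\<in>H. a \<odot>\<^bsub>X\<^esub> x \<in> H)"

lemma submodule_subm: "submodule H A X \<Longrightarrow> subm A X H"
  unfolding submodule_def submodule_axioms_def subgroup_def subm_def by auto

lemma subm_neg:
  assumes "lmodule A X" "subm A X H" "x \<in> H" shows "\<ominus>\<^bsub>X\<^esub> x \<in> H"
proof -
  interpret X: lmodule A X by fact
  have "(\<ominus>\<^bsub>A\<^esub> \<one>\<^bsub>A\<^esub>) \<odot>\<^bsub>X\<^esub> x \<in> H" using assms by (simp add: subm_def)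
  moreover have "x \<in> carrier X" using assms by (auto simp: subm_def)
  ultimately show ?thesis by (simp add: X.lsmult_l_minus)
qed

lemma subm_diff:
  assumes "lmodule A X" "subm A X H" "x \<in> H" "y \<in> H" shows "x \<ominus>\<^bsub>X\<^esub> y \<in> H"
  using assms subm_neg[OF assms(1,2,4)] by (simp add: subm_def a_minus_def)

lemma subm_lmodule:
  assumes "lmodule A X" "subm A X H"
  shows "lmodule A (X\<lparr>carrier := H\<rparr>)"
proof -
  interpret X: lmodule A X by fact
  have [simp]: "x \<in> H \<Longrightarrow> x \<in> carrier X" for x using assms(2) by (auto simp: subm_def)
  have ng: "x \<in> H \<Longrightarrow> \<exists>y\<in>H. y \<oplus>\<^bsub>X\<^esub> x = \<zero>\<^bsub>X\<^esub>" for x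
    using subm_neg[OF assms] X.M.l_neg by (metis \<open>\<And>x. x \<in> H \<Longrightarrow> x \<in> carrier X\<close>)
  show ?thesis
    by (intro lmodule.intro lmodule_axioms.intro abelian_groupI X.R.ring_axioms)
      (use assms(2) ng in \<open>auto simp: subm_def X.M.a_ac X.lsmult_l_distr X.lsmult_r_distr X.lsmult_assoc\<close>)
qed

lemma kernel_subm:
  assumes "lmodule A X" "lmodule A Y" "lin A X Y g"
  shows "subm A X (ker X Y g)"
proof -
  interpret X: lmodule A X by fact
  interpret Y: lmodule A Y by fact
  show ?thesis using assms lin_zero[OF assms(3) X.M.abelian_group_axioms Y.M.abelian_group_axioms]
    by (auto simp: subm_def lin_add lin_smult)
qed

lemma subm_carrier: "lmodule A X \<Longrightarrow> subm A X (carrier X)"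
proof -
  assume "lmodule A X"
  then interpret X: lmodule A X .
  show ?thesis by (simp add: subm_def)
qed

lemma lin_inclusion: "subm A X H \<Longrightarrow> lin A (X\<lparr>carrier := H\<rparr>) X (\<lambda>x. x)"
  by (simp add: lin_def subm_def subset_iff)

lemma lin_sub: "lin A X Y f \<Longrightarrow> H \<subseteq> carrier X \<Longrightarrow> lin A (X\<lparr>carrier := H\<rparr>) Y f"
  by (simp add: lin_def subset_iff)

lemma lin_into_sub: "lin A X Y f \<Longrightarrow> (\<And>x. x \<in> carrier X \<Longrightarrow> f x \<in> H) \<Longrightarrow> lin A X (Y\<lparr>carrier := H\<rparr>) f"
  by (auto simp: lin_def)

lemma lin_inv:
  assumes "lin A X Y f" "bij_betw f (carrier X) (carrier Y)" "lmodule A X"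
  shows "lin A Y X (inv_into (carrier X) f)"
proof -
  interpret X: lmodule A X by fact
  let ?g = "inv_into (carrier X) f"
  have g: "?g y \<in> carrier X" "f (?g y) = y" if "y \<in> carrier Y" for y
    using that assms(2) by (auto simp: bij_betw_def inv_into_into f_inv_into_f)
  have gf: "?g (f x) = x" if "x \<in> carrier X" for x using that assms(2) by (simp add: bij_betw_def)
  show ?thesis
  proof (rule linI)
    fix x y assume "x \<in> carrier Y" "y \<in> carrier Y"
    then show "?g (x \<oplus>\<^bsub>Y\<^esub> y) = ?g x \<oplus>\<^bsub>X\<^esub> ?g y"
      using gf[of "?g x \<oplus>\<^bsub>X\<^esub> ?g y"] lin_add[OF assms(1), of "?g x" "?g y"] g by simp
  next
    fix a y assume "a \<in> carrier A" "y \<in> carrier Y"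
    then show "?g (a \<odot>\<^bsub>Y\<^esub> y) = a \<odot>\<^bsub>X\<^esub> ?g y"
      using gf[of "a \<odot>\<^bsub>X\<^esub> ?g y"] lin_smult[OF assms(1), of a "?g y"] g by simp
  qed (rule g)
qed

lemma lin_inv_image:
  assumes f: "lin A U V f" "inj_on f (carrier U)" and U: "lmodule A U"
  shows "lin A (V\<lparr>carrier := f ` carrier U\<rparr>) U (inv_into (carrier U) f)"
proof (rule lin_inv[OF _ _ U])
  show "lin A U (V\<lparr>carrier := f ` carrier U\<rparr>) f" by (rule lin_into_sub[OF f(1)]) simp
qed (use f(2) in \<open>auto simp: bij_betw_def\<close>)

lemma subm_abelian_subgroup:
  assumes "lmodule A X" "subm A X K" shows "abelian_subgroup K X"
proof -
  interpret X: lmodule A X by fact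
  have "subgroup K (add_monoid X)"
    using assms subm_neg[OF assms] by (auto simp: subgroup_def subm_def a_inv_def)
  then show ?thesis by (simp add: abelian_subgroupI3 additive_subgroupI X.M.abelian_group_axioms)
qed

text \<open>The point is that the union defining the scalar multiple of a coset is a union of equal cosets.\<close>

lemma quot_mod_proj:
  assumes X: "lmodule A X" and K: "subm A X K"
  shows "lin A X (quot_mod X K) (\<lambda>x. K +>\<^bsub>X\<^esub> x)"
    and "(\<lambda>x. K +>\<^bsub>X\<^esub> x) ` carrier X = carrier (quot_mod X K)"
    and "x \<in> carrier X \<Longrightarrow> K +>\<^bsub>X\<^esub> x = \<zero>\<^bsub>quot_mod X K\<^esub> \<longleftrightarrow> x \<in> K"
    and "lmodule A (quot_mod X K)"
proof -
  interpret X: lmodule A X by fact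
  interpret K: abelian_subgroup K X by (rule subm_abelian_subgroup[OF assms])
  have sub: "K \<subseteq> carrier X" by (rule K.a_subset)
  have sm: "(\<Union>y\<in>K +>\<^bsub>X\<^esub> x. K +>\<^bsub>X\<^esub> a \<odot>\<^bsub>X\<^esub> y) = K +>\<^bsub>X\<^esub> (a \<odot>\<^bsub>X\<^esub> x)"
    if a: "a \<in> carrier A" and x: "x \<in> carrier X" for a x
  proof -
    have "K +>\<^bsub>X\<^esub> a \<odot>\<^bsub>X\<^esub> y = K +>\<^bsub>X\<^esub> (a \<odot>\<^bsub>X\<^esub> x)" if y: "y \<in> K +>\<^bsub>X\<^esub> x" for y
    proof -
      obtain k where k: "k \<in> K" "y = k \<oplus>\<^bsub>X\<^esub> x" using y by (auto simp: a_r_coset_def')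
      have "a \<odot>\<^bsub>X\<^esub> y = a \<odot>\<^bsub>X\<^esub> k \<oplus>\<^bsub>X\<^esub> a \<odot>\<^bsub>X\<^esub> x" using k x a sub by (auto simp: X.lsmult_r_distr)
      moreover have "a \<odot>\<^bsub>X\<^esub> k \<in> K" using K a k by (simp add: subm_def)
      ultimately have "a \<odot>\<^bsub>X\<^esub> y \<in> K +>\<^bsub>X\<^esub> (a \<odot>\<^bsub>X\<^esub> x)" by (auto simp: a_r_coset_def')
      then show ?thesis using X.M.a_repr_independence[OF _ _ K.a_subgroup, of "a \<odot>\<^bsub>X\<^esub> y" "a \<odot>\<^bsub>X\<^esub> x"] a x by simp
    qed
    then have "(\<Union>y\<in>K +>\<^bsub>X\<^esub> x. K +>\<^bsub>X\<^esub> a \<odot>\<^bsub>X\<^esub> y) = (\<Union>y\<in>K +>\<^bsub>X\<^esub> x. K +>\<^bsub>X\<^esub> (a \<odot>\<^bsub>X\<^esub> x))"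
      by (rule SUP_cong[OF refl])
    also have "\<dots> = K +>\<^bsub>X\<^esub> (a \<odot>\<^bsub>X\<^esub> x)"
      by (rule UN_constant_eq) (use x K.a_rcos_self in auto)
    finally show ?thesis .
  qed
  show 1: "lin A X (quot_mod X K) (\<lambda>x. K +>\<^bsub>X\<^esub> x)"
    by (rule linI) (simp_all add: quot_mod_def K.a_rcos_sum sm X.M.a_rcosetsI[OF sub])
  show 2: "(\<lambda>x. K +>\<^bsub>X\<^esub> x) ` carrier X = carrier (quot_mod X K)"
    by (auto simp: quot_mod_def A_RCOSETS_def')
  show "K +>\<^bsub>X\<^esub> x = \<zero>\<^bsub>quot_mod X K\<^esub> \<longleftrightarrow> x \<in> K" if "x \<in> carrier X" for x
    using that X.M.a_coset_join1[OF _ _ K.a_subgroup] X.M.a_coset_join2[OF _ K.a_subgroup]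
    by (auto simp: quot_mod_def)
  show "lmodule A (quot_mod X K)"
    by (rule lin_lmodule_image[OF X 1 2]) (simp add: quot_mod_def sub)
qed

section \<open>Maps that factor through sums of copies of a module\<close>

text \<open>The maps \<open>X \<rightarrow> Y\<close> that factor through some power \<open>V\<^sup>n\<close>, as finite sums of composites
  \<open>X \<rightarrow> V \<rightarrow> Y\<close>.  The rule \<open>cong\<close> makes the notion depend on the values on the carrier only.\<close>

inductive thru :: "('a, 'z) ring_scheme \<Rightarrow> ('a, 'x) module \<Rightarrow> ('a, 'v) module \<Rightarrow> ('a, 'y) module \<Rightarrow> ('x \<Rightarrow> 'y) \<Rightarrow> bool"
  for A X V Y where
  zero: "thru A X V Y (\<lambda>x. \<zero>\<^bsub>Y\<^esub>)"
| step: "\<lbrakk>lin A X V i; lin A V Y p; thru A X V Y h\<rbrakk> \<Longrightarrow> thru A X V Y (\<lambda>x. p (i x) \<oplus>\<^bsub>Y\<^esub> h x)"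
| cong: "\<lbrakk>thru A X V Y h; \<And>x. x \<in> carrier X \<Longrightarrow> h' x = h x\<rbrakk> \<Longrightarrow> thru A X V Y h'"

text \<open>Membership in \<open>add V\<close>: the identity of \<open>X\<close> factors through some \<open>V\<^sup>n\<close>.  With no power of \<open>V\<close> in
  the definition, closure properties of \<open>add V\<close> become inductions over the summands of the identity.  For
  \<open>V = A\<close> the maps \<open>X \<rightarrow> A\<close> and the images of \<open>1\<close> under the maps \<open>A \<rightarrow> X\<close> form a dual basis.\<close>

definition in_add :: "('a, 'z) ring_scheme \<Rightarrow> ('a, 'x) module \<Rightarrow> ('a, 'v) module \<Rightarrow> bool" where
  "in_add A X V \<longleftrightarrow> thru A X V X (\<lambda>x. x)"

lemma thru_lin:
  assumes "thru A X V Y h" "lmodule A X" "lmodule A Y"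
  shows "lin A X Y h"
  using assms(1)
proof induct
  case zero show ?case by (rule lin_const_zero[OF assms(3)])
next
  case (step i p h) show ?case by (rule lin_plus[OF lin_comp[OF step(1,2)] step(4) assms(3)])
next
  case (cong h h') show ?case by (rule lin_cong[OF cong(2)]) (simp_all add: cong(3) assms(2))
qed

lemma thru_post:
  assumes "thru A X V Y h" "lin A Y Z g" "lmodule A X" "lmodule A Y" "lmodule A Z"
  shows "thru A X V Z (\<lambda>x. g (h x))"
  using assms(1)
proof induct
  case zero
  show ?case by (rule thru.cong[OF thru.zero]) (use lin_zero[OF assms(2)] assms(4,5) in \<open>simp add: lmodule_def\<close>)
next
  case (step i p h)
  have "lin A X Y h" using step thru_lin assms by blast
  then have "\<And>x. x \<in> carrier X \<Longrightarrow> g (p (i x) \<oplus>\<^bsub>Y\<^esub> h x) = g (p (i x)) \<oplus>\<^bsub>Z\<^esub> g (h x)"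
    using step(1,2) assms(2) by (simp add: lin_def)
  then show ?case by (rule thru.cong[OF thru.step[OF step(1) lin_comp[OF step(2) assms(2)] step(4)]])
next
  case (cong h h')
  show ?case by (rule thru.cong[OF cong(2)]) (simp add: cong(3))
qed

lemma thru_pre:
  assumes "thru A X V Y h" "lin A W X f"
  shows "thru A W V Y (\<lambda>x. h (f x))"
  using assms(1)
proof induct
  case zero show ?case by (rule thru.zero)
next
  case (step i p h) show ?case by (rule thru.step[OF lin_comp[OF assms(2) step(1)] step(2,4)])
next
  case (cong h h')
  show ?case by (rule thru.cong[OF cong(2)]) (simp add: cong(3) lin_closed[OF assms(2)])
qed

lemma thru_plus:
  assumes "thru A X V Y h" "thru A X V Y k" "lmodule A X" "lmodule A Y"
  shows "thru A X V Y (\<lambda>x. h x \<oplus>\<^bsub>Y\<^esub> k x)"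
proof -
  interpret Y: lmodule A Y by fact
  note k = lin_closed[OF thru_lin[OF assms(2-4)]]
  show ?thesis using assms(1)
  proof induct
    case zero show ?case by (rule thru.cong[OF assms(2)]) (simp add: k)
  next
    case (step i p h)
    have "lin A X Y h" using step thru_lin assms by blast
    then show ?case
      by (intro thru.cong[OF thru.step[OF step(1,2,4)]]) (use step(1,2) k in \<open>simp add: lin_def Y.M.a_assoc\<close>)
  next
    case (cong h h')
    show ?case by (rule thru.cong[OF cong(2)]) (simp add: cong(3))
  qed
qed

lemma thru_single:
  assumes "lin A X V i" "lin A V Y p" "lmodule A Y"
  shows "thru A X V Y (\<lambda>x. p (i x))"
proof -
  interpret Y: lmodule A Y by fact
  show ?thesis by (rule thru.cong[OF thru.step[OF assms(1,2) thru.zero]]) (use assms(1,2) in \<open>simp add: lin_def\<close>)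
qed

text \<open>Maps factoring through sums of copies of a module form an ideal of the category, so they may
  be refined along \<open>V \<in> add W\<close>.\<close>

lemma thru_trans:
  assumes "thru A X V Y h" "in_add A V W" "lmodule A X" "lmodule A V" "lmodule A Y"
  shows "thru A X W Y h"
  using assms(1)
proof induct
  case zero show ?case by (rule thru.zero)
next
  case (step i p h)
  show ?case
    using thru_plus[OF thru_post[OF thru_pre[OF assms(2)[unfolded in_add_def] step(1)] step(2) assms(3-5)] step(4) assms(3,5)]
    by simp
next
  case (cong h h') show ?case by (rule thru.cong[OF cong(2)]) (simp add: cong(3))
qed

lemma in_add_trans:
  "in_add A X V \<Longrightarrow> in_add A V W \<Longrightarrow> lmodule A X \<Longrightarrow> lmodule A V \<Longrightarrow> in_add A X W"
  unfolding in_add_def using thru_trans[of A X V X "\<lambda>x. x" W] by (simp add: in_add_def)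

lemma in_add_retract:
  assumes "lin A X V i" "lin A V X p" "\<And>x. x \<in> carrier X \<Longrightarrow> p (i x) = x" "lmodule A X"
  shows "in_add A X V"
  unfolding in_add_def by (rule thru.cong[OF thru_single[OF assms(1,2,4)]]) (simp add: assms(3))

lemma in_add_refl: "lmodule A X \<Longrightarrow> in_add A X X"
  by (rule in_add_retract[OF lin_id lin_id refl])

lemma in_add_bij:
  assumes "lin A X Y f" "bij_betw f (carrier X) (carrier Y)" "lmodule A X"
  shows "in_add A X Y"
  by (rule in_add_retract[OF assms(1) lin_inv[OF assms]])
    (use assms in \<open>auto simp: bij_betw_def\<close>)

lemma in_add_trivial:
  assumes "carrier X = {\<zero>\<^bsub>X\<^esub>}"
  shows "in_add A X V"
  unfolding in_add_def by (rule thru.cong[OF thru.zero]) (use assms in auto)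

subsection \<open>Projective modules\<close>

lemma regular_lmodule: "ring A \<Longrightarrow> lmodule A (regular A)"
proof -
  assume "ring A"
  then interpret ring A .
  show ?thesis
    by (intro lmodule.intro lmodule_axioms.intro abelian_groupI ring_axioms)
      (use l_neg a_inv_closed in \<open>auto simp: regular_def a_ac l_distr r_distr m_assoc\<close>)
qed

lemma regular_simps [simp]:
  "carrier (regular A) = carrier A" "\<zero>\<^bsub>regular A\<^esub> = \<zero>\<^bsub>A\<^esub>" "x \<oplus>\<^bsub>regular A\<^esub> y = x \<oplus>\<^bsub>A\<^esub> y"
  "a \<odot>\<^bsub>regular A\<^esub> x = a \<otimes>\<^bsub>A\<^esub> x"
  by (simp_all add: regular_def)

lemma lin_orbit:
  assumes "lmodule A X" "x \<in> carrier X" shows "lin A (regular A) X (\<lambda>a. a \<odot>\<^bsub>X\<^esub> x)"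
proof -
  interpret X: lmodule A X by fact
  show ?thesis using assms by (auto simp: lin_def X.lsmult_l_distr X.lsmult_assoc)
qed

lemma lin_regular:
  assumes "ring A" "lin A (regular A) X p" "a \<in> carrier A"
  shows "p a = a \<odot>\<^bsub>X\<^esub> p \<one>\<^bsub>A\<^esub>"
proof -
  interpret ring A by fact
  show ?thesis using lin_smult[OF assms(2), of a "\<one>\<^bsub>A\<^esub>"] assms(3) by simp
qed

text \<open>On a summand \<open>X \<rightarrow> A \<rightarrow> M\<close> of \<open>f\<close>, a lift is determined by a preimage of the image of
  \<open>1\<close>.\<close>

lemma projective_lift:
  assumes P: "in_add A P (regular A)" "lmodule A P" and Q: "lmodule A Q" and M: "lmodule A M"
    and g: "lin A Q M g" "g ` carrier Q = carrier M" and f: "lin A P M f"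
  obtains f' where "lin A P Q f'" "\<And>x. x \<in> carrier P \<Longrightarrow> g (f' x) = f x"
proof -
  interpret P: lmodule A P by fact
  interpret Q: lmodule A Q by fact
  interpret M: lmodule A M by fact
  have "\<exists>f'. lin A P Q f' \<and> (\<forall>x\<in>carrier P. g (f' x) = f (h x))" if "thru A P (regular A) P h" for h
    using that
  proof induct
    case zero
    show ?case
      using lin_const_zero[OF Q, of P] lin_zero[OF g(1) Q.M.abelian_group_axioms M.M.abelian_group_axioms]
        lin_zero[OF f P.M.abelian_group_axioms M.M.abelian_group_axioms] by auto
  next
    case (step i p h)
    then obtain f' where f': "lin A P Q f'" "\<forall>x\<in>carrier P. g (f' x) = f (h x)" by auto
    have p1: "p \<one>\<^bsub>A\<^esub> \<in> carrier P" using lin_closed[OF step(2), of "\<one>\<^bsub>A\<^esub>"] by simp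
    then have "f (p \<one>\<^bsub>A\<^esub>) \<in> g ` carrier Q" using lin_closed[OF f] g(2) by simp
    then obtain q where q: "q \<in> carrier Q" "g q = f (p \<one>\<^bsub>A\<^esub>)" by auto
    let ?k = "\<lambda>x. i x \<odot>\<^bsub>Q\<^esub> q"
    have k: "lin A P Q ?k" by (rule lin_comp[OF step(1) lin_orbit[OF Q q(1)]])
    have "g (?k x) = f (p (i x))" if x: "x \<in> carrier P" for x
    proof -
      have ix: "i x \<in> carrier A" using lin_closed[OF step(1) x] by simp
      show ?thesis using q lin_smult[OF g(1) ix q(1)] lin_regular[OF P.R.ring_axioms step(2) ix]
          lin_smult[OF f ix p1] by simp
    qed
    moreover have "lin A P P h" using step(3) thru_lin P(2) by blast
    ultimately have "\<forall>x\<in>carrier P. g (?k x \<oplus>\<^bsub>Q\<^esub> f' x) = f (p (i x) \<oplus>\<^bsub>P\<^esub> h x)"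
      using f' k g(1) f step(1,2) by (simp add: lin_def)
    then show ?case using lin_plus[OF k f'(1) Q] by blast
  next
    case (cong h h') then show ?case by simp
  qed
  from this[OF P(1)[unfolded in_add_def]] show thesis using that by auto
qed

text \<open>A section \<open>s\<close> of \<open>g\<close> exists because \<open>D\<close> is projective, and \<open>x - s (g x)\<close> lies in the image of
  \<open>f\<close>.\<close>

lemma projective_extension_splits:
  assumes B: "lmodule A B" and C: "lmodule A C" and D: "in_add A D (regular A)" "lmodule A D"
    and f: "lin A B C f" "inj_on f (carrier B)" and g: "lin A C D g" "g ` carrier C = carrier D"
    and ex: "f ` carrier B = ker C D g"
  obtains t s where "lin A C B t" "\<And>b. b \<in> carrier B \<Longrightarrow> t (f b) = b" "lin A D C s"
    "\<And>x. x \<in> carrier C \<Longrightarrow> f (t x) \<oplus>\<^bsub>C\<^esub> s (g x) = x"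
proof -
  interpret C: lmodule A C by fact
  interpret D: lmodule A D by fact
  obtain s where s: "lin A D C s" "\<And>x. x \<in> carrier D \<Longrightarrow> g (s x) = x"
    by (rule projective_lift[OF D C D(2) g lin_id]) (rule that)
  let ?r = "\<lambda>x. x \<ominus>\<^bsub>C\<^esub> s (g x)"
  let ?t = "\<lambda>x. inv_into (carrier B) f (?r x)"
  have r0: "?r x \<in> f ` carrier B" if "x \<in> carrier C" for x
    using that s g(1) lin_diff[OF g(1) C.M.abelian_group_axioms D.M.abelian_group_axioms that, of "s (g x)"]
    unfolding ex by (simp add: lin_def) (simp add: a_minus_def D.M.r_neg)
  have "lin A C (C\<lparr>carrier := f ` carrier B\<rparr>) ?r"
    by (rule lin_into_sub[OF lin_minus[OF lin_id lin_comp[OF g(1) s(1)] C] r0])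
  then have t: "lin A C B ?t" by (rule lin_comp[OF _ lin_inv_image[OF f B]])
  have tf: "?t (f b) = b" if b: "b \<in> carrier B" for b
  proof -
    have "f b \<in> ker C D g" using ex b by blast
    then have "?r (f b) = f b"
      using lin_zero[OF s(1) D.M.abelian_group_axioms C.M.abelian_group_axioms] neg_zero[OF C.M.abelian_group_axioms]
      by (simp add: a_minus_def)
    then show ?thesis using f(2) b by simp
  qed
  have e: "f (?t x) \<oplus>\<^bsub>C\<^esub> s (g x) = x" if x: "x \<in> carrier C" for x
  proof -
    have "f (?t x) = ?r x" using r0[OF x] by (rule f_inv_into_f)
    then show ?thesis using x s(1) g(1) by (simp add: lin_def a_minus_def C.M.a_assoc C.M.l_neg)
  qed
  show thesis by (rule that[OF t tf s(1) e])
qed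

text \<open>An extension of modules in \<open>add A\<close> splits, hence lies in \<open>add A\<close> as well.\<close>

lemma in_add_regular_extension:
  assumes B: "in_add A B (regular A)" "lmodule A B" and C: "lmodule A C"
    and D: "in_add A D (regular A)" "lmodule A D"
    and f: "lin A B C f" "inj_on f (carrier B)" and g: "lin A C D g" "g ` carrier C = carrier D"
    and ex: "f ` carrier B = ker C D g"
  shows "in_add A C (regular A)"
proof -
  obtain t s where t: "lin A C B t" and s: "lin A D C s" and x: "\<And>x. x \<in> carrier C \<Longrightarrow> f (t x) \<oplus>\<^bsub>C\<^esub> s (g x) = x"
    by (rule projective_extension_splits[OF B(2) C D f g ex]) (rule that)
  have "thru A C (regular A) C (\<lambda>x. f (t x))"
    by (rule thru_trans[OF thru_single[OF t f(1) C] B(1) C B(2) C])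
  moreover have "thru A C (regular A) C (\<lambda>x. s (g x))"
    by (rule thru_trans[OF thru_single[OF g(1) s C] D(1) C D(2) C])
  ultimately have "thru A C (regular A) C (\<lambda>x. f (t x) \<oplus>\<^bsub>C\<^esub> s (g x))"
    by (rule thru_plus[OF _ _ C C])
  then show ?thesis unfolding in_add_def by (rule thru.cong) (simp add: x)
qed

section \<open>Vanishing of the first extension module\<close>

text \<open>The homomorphism theorem, for an arbitrary surjection in place of a quotient module.\<close>

lemma lin_factor:
  assumes X: "lmodule A X" and Y: "lmodule A Y" and Z: "lmodule A Z"
    and g: "lin A X Y g" "g ` carrier X = carrier Y" and f: "lin A X Z f"
    and ker: "\<And>x. x \<in> carrier X \<Longrightarrow> g x = \<zero>\<^bsub>Y\<^esub> \<Longrightarrow> f x = \<zero>\<^bsub>Z\<^esub>"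
  obtains f' where "lin A Y Z f'" "\<And>x. x \<in> carrier X \<Longrightarrow> f' (g x) = f x"
proof -
  interpret X: lmodule A X by fact
  interpret Y: lmodule A Y by fact
  interpret Z: lmodule A Z by fact
  note ag = X.M.abelian_group_axioms Y.M.abelian_group_axioms Z.M.abelian_group_axioms
  have wd: "f x = f y" if "x \<in> carrier X" "y \<in> carrier X" "g x = g y" for x y
  proof -
    have "g (x \<ominus>\<^bsub>X\<^esub> y) = \<zero>\<^bsub>Y\<^esub>"
      using lin_diff[OF g(1) ag(1,2) that(1,2)] that lin_closed[OF g(1)] by (simp add: a_minus_def Y.M.r_neg)
    then have "f x \<ominus>\<^bsub>Z\<^esub> f y = \<zero>\<^bsub>Z\<^esub>" using ker[of "x \<ominus>\<^bsub>X\<^esub> y"] lin_diff[OF f ag(1,3) that(1,2)] that by simp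
    from this show ?thesis by (rule minus_zero_imp_eq[OF ag(3), rotated 2]) (use lin_closed[OF f] that in auto)
  qed
  let ?s = "inv_into (carrier X) g"
  have s: "?s y \<in> carrier X" "g (?s y) = y" if "y \<in> carrier Y" for y
    using that g(2) by (simp_all add: inv_into_into f_inv_into_f)
  let ?f = "\<lambda>y. f (?s y)"
  have 1: "?f (g x) = f x" if "x \<in> carrier X" for x
    using wd[OF s(1) that s(2)] lin_closed[OF g(1)] that by simp
  have "lin A Y Z ?f"
  proof (rule linI)
    fix x y assume xy: "x \<in> carrier Y" "y \<in> carrier Y"
    show "?f x \<in> carrier Z" using s xy lin_closed[OF f] by simp
    show "?f (x \<oplus>\<^bsub>Y\<^esub> y) = ?f x \<oplus>\<^bsub>Z\<^esub> ?f y"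
      using 1[of "?s x \<oplus>\<^bsub>X\<^esub> ?s y"] lin_add[OF g(1), of "?s x" "?s y"] lin_add[OF f, of "?s x" "?s y"] s xy by simp
  next
    fix a y assume xy: "a \<in> carrier A" "y \<in> carrier Y"
    show "?f (a \<odot>\<^bsub>Y\<^esub> y) = a \<odot>\<^bsub>Z\<^esub> ?f y"
      using 1[of "a \<odot>\<^bsub>X\<^esub> ?s y"] lin_smult[OF g(1), of a "?s y"] lin_smult[OF f, of a "?s y"] s xy by simp
  qed
  from this 1 show thesis by (rule that)
qed

definition fgp :: "('a, 'z) ring_scheme \<Rightarrow> ('a, 'x) module \<Rightarrow> bool" where
  "fgp A P \<longleftrightarrow> lmodule A P \<and> in_add A P (regular A)"

definition extends_all :: "('a, 'z) ring_scheme \<Rightarrow> ('a, 'x) module \<Rightarrow> 'x set \<Rightarrow> ('a, 'w) module \<Rightarrow> bool" where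
  "extends_all A P K W \<longleftrightarrow> (\<forall>\<phi>. lin A (P\<lparr>carrier := K\<rparr>) W \<phi> \<longrightarrow> (\<exists>\<psi>. lin A P W \<psi> \<and> (\<forall>x\<in>K. \<psi> x = \<phi> x)))"

definition presents :: "('a, 'z) ring_scheme \<Rightarrow> ('a, 'p) module \<Rightarrow> ('p \<Rightarrow> 'm) \<Rightarrow> ('a, 'm) module \<Rightarrow> bool" where
  "presents A P g M \<longleftrightarrow> fgp A P \<and> lin A P M g \<and> g ` carrier P = carrier M"

text \<open>For \<open>0 \<rightarrow> K \<rightarrow> P \<rightarrow> M \<rightarrow> 0\<close> with \<open>P\<close> projective, \<open>Ext\<^sup>1(M, W)\<close> is the cokernel of
  \<open>Hom(P, W) \<rightarrow> Hom(K, W)\<close>.  Its vanishing is an extension property, the form in which extensions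
  are used below.  A finitely generated \<open>M\<close> has a presentation with \<open>P = A\<^sup>n\<close>, whence the type
  of the elements of \<open>P\<close>.\<close>

definition ext1_zero :: "('a, 'z) ring_scheme \<Rightarrow> ('a, 'm) module \<Rightarrow> ('a, 'w) module \<Rightarrow> bool" where
  "ext1_zero A M W \<longleftrightarrow>
     (\<exists>(P :: ('a, nat \<Rightarrow> 'a) module) g. presents A P g M \<and> extends_all A P (ker P M g) W)"

text \<open>The extension property of one projective presentation \<open>\<pi> : P \<rightarrow> M\<close> passes to every surjection
  \<open>g : Q \<rightarrow> M\<close>.  Lift \<open>\<pi>\<close> to \<open>h : P \<rightarrow> Q\<close> and extend \<open>\<phi> \<circ> h\<close> to \<open>\<psi>\<close> on \<open>P\<close>; then
  \<open>q \<mapsto> \<psi> p + \<phi> (q - h p)\<close>, for any \<open>p\<close> with \<open>\<pi> p = g q\<close>, extends \<open>\<phi>\<close>.\<close>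

lemma ext1_zero_extend:
  assumes ext: "ext1_zero A M W" and M: "lmodule A M" and W: "lmodule A W" and Q: "lmodule A Q"
    and g: "lin A Q M g" "g ` carrier Q = carrier M"
  shows "extends_all A Q (ker Q M g) W"
  unfolding extends_all_def
proof (intro allI impI)
  fix \<phi> assume \<phi>: "lin A (Q\<lparr>carrier := ker Q M g\<rparr>) W \<phi>"
  obtain P :: "('a, nat \<Rightarrow> 'a) module" and \<pi> where P: "lmodule A P" "in_add A P (regular A)"
    and \<pi>: "lin A P M \<pi>" "\<pi> ` carrier P = carrier M" and ea: "extends_all A P (ker P M \<pi>) W"
    using ext unfolding ext1_zero_def presents_def fgp_def by auto
  obtain h where h: "lin A P Q h" "\<And>x. x \<in> carrier P \<Longrightarrow> g (h x) = \<pi> x"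
    using projective_lift[OF P(2,1) Q M g \<pi>(1)] by blast
  interpret P: lmodule A P by fact
  interpret Q: lmodule A Q by fact
  interpret M: lmodule A M by fact
  interpret W: lmodule A W by fact
  note ag = P.M.abelian_group_axioms Q.M.abelian_group_axioms M.M.abelian_group_axioms W.M.abelian_group_axioms
  have "lin A (P\<lparr>carrier := ker P M \<pi>\<rparr>) (Q\<lparr>carrier := ker Q M g\<rparr>) h"
    using lin_sub[OF h(1), of "ker P M \<pi>"] h(2) by (auto simp: lin_def)
  from lin_comp[OF this \<phi>] obtain \<psi> where \<psi>: "lin A P W \<psi>" "\<And>x. x \<in> carrier P \<Longrightarrow> \<pi> x = \<zero>\<^bsub>M\<^esub> \<Longrightarrow> \<psi> x = \<phi> (h x)"
    using ea unfolding extends_all_def by force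
  have \<phi>a: "\<phi> (x \<oplus>\<^bsub>Q\<^esub> y) = \<phi> x \<oplus>\<^bsub>W\<^esub> \<phi> y" if "x \<in> ker Q M g" "y \<in> ker Q M g" for x y
    using lin_add[OF \<phi>, of x y] that by simp
  have \<phi>s: "\<phi> (a \<odot>\<^bsub>Q\<^esub> x) = a \<odot>\<^bsub>W\<^esub> \<phi> x" if "a \<in> carrier A" "x \<in> ker Q M g" for a x
    using lin_smult[OF \<phi>, of a x] that by simp
  have \<phi>c: "\<phi> x \<in> carrier W" if "x \<in> ker Q M g" for x using lin_closed[OF \<phi>, of x] that by simp
  have kg: "q \<ominus>\<^bsub>Q\<^esub> h p \<in> ker Q M g" if "p \<in> carrier P" "q \<in> carrier Q" "\<pi> p = g q" for p q
    using that lin_diff[OF g(1) ag(2,3), of q "h p"] lin_closed[OF h(1)] lin_closed[OF g(1)] h(2)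
    by (simp add: a_minus_def M.M.r_neg)
  have kh: "h k \<in> ker Q M g" if "k \<in> carrier P" "\<pi> k = \<zero>\<^bsub>M\<^esub>" for k
    using that h lin_closed[OF h(1)] by simp
  \<comment> \<open>independence of the choice of p, as \<psi> and \<phi> \<circ> h agree on differences of such p\<close>
  have wd: "\<psi> p \<oplus>\<^bsub>W\<^esub> \<phi> (q \<ominus>\<^bsub>Q\<^esub> h p) = \<psi> p' \<oplus>\<^bsub>W\<^esub> \<phi> (q \<ominus>\<^bsub>Q\<^esub> h p')"
    if p: "p \<in> carrier P" "p' \<in> carrier P" "q \<in> carrier Q" "\<pi> p = g q" "\<pi> p' = g q" for p p' q
  proof -
    let ?k = "p' \<ominus>\<^bsub>P\<^esub> p"
    have k: "?k \<in> carrier P" "\<pi> ?k = \<zero>\<^bsub>M\<^esub>"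
      using p lin_diff[OF \<pi>(1) ag(1,3), of p' p] lin_closed[OF \<pi>(1)] lin_closed[OF g(1)]
      by (simp_all add: a_minus_def M.M.r_neg)
    have "p' = p \<oplus>\<^bsub>P\<^esub> ?k" using p by (simp add: a_minus_def P.M.a_lcomm P.M.r_neg)
    then have 1: "\<psi> p' = \<psi> p \<oplus>\<^bsub>W\<^esub> \<phi> (h ?k)" using lin_add[OF \<psi>(1) p(1) k(1)] \<psi>(2)[OF k] by simp
    have "h ?k = h p' \<ominus>\<^bsub>Q\<^esub> h p" by (rule lin_diff[OF h(1) ag(1,2) p(2,1)])
    then have "h ?k \<oplus>\<^bsub>Q\<^esub> (q \<ominus>\<^bsub>Q\<^esub> h p') = q \<ominus>\<^bsub>Q\<^esub> h p"
      using p lin_closed[OF h(1)] by (simp add: a_minus_def Q.M.a_ac Q.M.r_neg2 Q.M.r_neg1 Q.M.r_neg Q.M.l_neg)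
    then have "\<phi> (q \<ominus>\<^bsub>Q\<^esub> h p) = \<phi> (h ?k) \<oplus>\<^bsub>W\<^esub> \<phi> (q \<ominus>\<^bsub>Q\<^esub> h p')"
      using \<phi>a[OF kh[OF k] kg[OF p(2,3,5)]] by simp
    then show ?thesis using 1 \<phi>c[OF kh[OF k]] \<phi>c[OF kg[OF p(2,3,5)]] lin_closed[OF \<psi>(1) p(1)]
      by (simp add: W.M.a_assoc)
  qed
  define \<sigma> where "\<sigma> q = (SOME p. p \<in> carrier P \<and> \<pi> p = g q)" for q
  have \<sigma>: "\<sigma> q \<in> carrier P" "\<pi> (\<sigma> q) = g q" if "q \<in> carrier Q" for q
  proof -
    have "g q \<in> \<pi> ` carrier P" using that lin_closed[OF g(1)] \<pi>(2) by simp
    then have "\<exists>p. p \<in> carrier P \<and> \<pi> p = g q" by auto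
    from someI_ex[OF this] show "\<sigma> q \<in> carrier P" "\<pi> (\<sigma> q) = g q" unfolding \<sigma>_def by auto
  qed
  define \<chi> where "\<chi> q = \<psi> (\<sigma> q) \<oplus>\<^bsub>W\<^esub> \<phi> (q \<ominus>\<^bsub>Q\<^esub> h (\<sigma> q))" for q
  have \<chi>: "\<chi> q = \<psi> p \<oplus>\<^bsub>W\<^esub> \<phi> (q \<ominus>\<^bsub>Q\<^esub> h p)" if "p \<in> carrier P" "q \<in> carrier Q" "\<pi> p = g q" for p q
    unfolding \<chi>_def by (rule wd) (use that \<sigma> in auto)
  have "lin A Q W \<chi>"
  proof (rule linI)
    fix x assume x: "x \<in> carrier Q"
    show "\<chi> x \<in> carrier W" unfolding \<chi>_def using \<sigma>[OF x] x lin_closed[OF \<psi>(1)] \<phi>c[OF kg] by simp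
    fix y assume y: "y \<in> carrier Q"
    let ?p = "\<sigma> x \<oplus>\<^bsub>P\<^esub> \<sigma> y"
    note xy = x y \<sigma>[OF x] \<sigma>[OF y] lin_closed[OF h(1)] lin_closed[OF \<psi>(1)]
    note k = kg[OF xy(3,1,4)] kg[OF xy(5,2,6)]
    have "(x \<ominus>\<^bsub>Q\<^esub> h (\<sigma> x)) \<oplus>\<^bsub>Q\<^esub> (y \<ominus>\<^bsub>Q\<^esub> h (\<sigma> y)) = (x \<oplus>\<^bsub>Q\<^esub> y) \<ominus>\<^bsub>Q\<^esub> h ?p"
      using xy lin_add[OF h(1), of "\<sigma> x" "\<sigma> y"] by (simp add: a_minus_def Q.M.a_ac Q.M.minus_add)
    then have "\<phi> ((x \<oplus>\<^bsub>Q\<^esub> y) \<ominus>\<^bsub>Q\<^esub> h ?p) = \<phi> (x \<ominus>\<^bsub>Q\<^esub> h (\<sigma> x)) \<oplus>\<^bsub>W\<^esub> \<phi> (y \<ominus>\<^bsub>Q\<^esub> h (\<sigma> y))"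
      using \<phi>a[OF k] by simp
    moreover have "\<chi> (x \<oplus>\<^bsub>Q\<^esub> y) = \<psi> ?p \<oplus>\<^bsub>W\<^esub> \<phi> ((x \<oplus>\<^bsub>Q\<^esub> y) \<ominus>\<^bsub>Q\<^esub> h ?p)"
      by (rule \<chi>) (use xy lin_add[OF \<pi>(1), of "\<sigma> x" "\<sigma> y"] lin_add[OF g(1) x y] in auto)
    ultimately show "\<chi> (x \<oplus>\<^bsub>Q\<^esub> y) = \<chi> x \<oplus>\<^bsub>W\<^esub> \<chi> y"
      unfolding \<chi>_def[of x] \<chi>_def[of y] using lin_add[OF \<psi>(1), of "\<sigma> x" "\<sigma> y"] xy \<phi>c[OF k(1)] \<phi>c[OF k(2)]
      by (simp add: W.M.a_ac)
  next
    fix a x assume a: "a \<in> carrier A" and x: "x \<in> carrier Q"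
    note xy = x \<sigma>[OF x] lin_closed[OF h(1)] lin_closed[OF \<psi>(1)]
    note k = kg[OF xy(2,1,3)]
    have "a \<odot>\<^bsub>Q\<^esub> (x \<ominus>\<^bsub>Q\<^esub> h (\<sigma> x)) = a \<odot>\<^bsub>Q\<^esub> x \<ominus>\<^bsub>Q\<^esub> h (a \<odot>\<^bsub>P\<^esub> \<sigma> x)"
      using xy a lin_smult[OF h(1), of a "\<sigma> x"] by (simp add: a_minus_def Q.lsmult_r_distr Q.lsmult_r_minus)
    then have "\<phi> (a \<odot>\<^bsub>Q\<^esub> x \<ominus>\<^bsub>Q\<^esub> h (a \<odot>\<^bsub>P\<^esub> \<sigma> x)) = a \<odot>\<^bsub>W\<^esub> \<phi> (x \<ominus>\<^bsub>Q\<^esub> h (\<sigma> x))"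
      using \<phi>s[OF a k] by simp
    moreover have "\<chi> (a \<odot>\<^bsub>Q\<^esub> x) = \<psi> (a \<odot>\<^bsub>P\<^esub> \<sigma> x) \<oplus>\<^bsub>W\<^esub> \<phi> (a \<odot>\<^bsub>Q\<^esub> x \<ominus>\<^bsub>Q\<^esub> h (a \<odot>\<^bsub>P\<^esub> \<sigma> x))"
      by (rule \<chi>) (use xy a lin_smult[OF \<pi>(1), of a "\<sigma> x"] lin_smult[OF g(1) a x] in auto)
    ultimately show "\<chi> (a \<odot>\<^bsub>Q\<^esub> x) = a \<odot>\<^bsub>W\<^esub> \<chi> x"
      unfolding \<chi>_def[of x] using lin_smult[OF \<psi>(1), of a "\<sigma> x"] xy a \<phi>c[OF k]
      by (simp add: W.lsmult_r_distr)
  qed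
  moreover have "\<chi> x = \<phi> x" if "x \<in> ker Q M g" for x
    using \<chi>[of "\<zero>\<^bsub>P\<^esub>" x] that lin_zero[OF \<pi>(1) ag(1,3)] lin_zero[OF h(1) ag(1,2)] lin_zero[OF \<psi>(1) ag(1,4)] \<phi>c[OF that]
    by (simp add: a_minus_def neg_zero[OF ag(2)])
  ultimately show "\<exists>\<chi>. lin A Q W \<chi> \<and> (\<forall>x\<in>ker Q M g. \<chi> x = \<phi> x)" by blast
qed

lemma extends_along_injection:
  assumes ea: "extends_all A Q (f ` carrier K) W" and K: "lmodule A K" and Q: "lmodule A Q"
    and f: "lin A K Q f" "inj_on f (carrier K)" and \<phi>: "lin A K W \<phi>"
  obtains \<psi> where "lin A Q W \<psi>" "\<And>x. x \<in> carrier K \<Longrightarrow> \<psi> (f x) = \<phi> x"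
proof -
  from lin_comp[OF lin_inv_image[OF f K] \<phi>] obtain \<psi> where \<psi>: "lin A Q W \<psi>"
    "\<forall>x\<in>f ` carrier K. \<psi> x = \<phi> (inv_into (carrier K) f x)"
    using ea unfolding extends_all_def by blast
  show thesis by (rule that[OF \<psi>(1)]) (use \<psi>(2) f(2) in simp)
qed

lemma ext1_zero_extend_injection:
  assumes "ext1_zero A M W" "lmodule A M" "lmodule A W" "lmodule A Q" "lmodule A K"
    and "lin A Q M g" "g ` carrier Q = carrier M"
    and "lin A K Q f" "inj_on f (carrier K)" "f ` carrier K = ker Q M g" and "lin A K W \<phi>"
  obtains \<psi> where "lin A Q W \<psi>" "\<And>x. x \<in> carrier K \<Longrightarrow> \<psi> (f x) = \<phi> x"
  using extends_along_injection[of A Q f K W \<phi>] ext1_zero_extend[of A M W Q g] assms by metis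

text \<open>Let \<open>g\<close> and \<open>g'\<close> present \<open>M\<close> and \<open>V\<close>.  For a map \<open>h\<close> of \<open>M\<close> that factors through a power of
  \<open>V\<close> and a lift \<open>e\<close> of \<open>h\<close> along \<open>g\<close>, the map \<open>\<phi> \<circ> e\<close> extends from the kernel of \<open>g\<close>; the case of identities
  is the claim.  In the induction a summand \<open>M \<rightarrow> V \<rightarrow> M\<close> of \<open>h\<close> is lifted to \<open>P \<rightarrow> P' \<rightarrow> P\<close>, and the difference
  of \<open>e\<close> and this lift is a lift of the rest.\<close>

lemma ext1_zero_in_add_left:
  assumes MV: "in_add A M V" and ext: "ext1_zero A V W" and M: "lmodule A M" and V: "lmodule A V" and W: "lmodule A W"
    and pres: "presents A (P :: ('a, nat \<Rightarrow> 'a) module) g M"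
  shows "ext1_zero A M W"
proof -
  obtain P' :: "('a, nat \<Rightarrow> 'a) module" and g' where P': "lmodule A P'" "in_add A P' (regular A)"
    and g': "lin A P' V g'" "g' ` carrier P' = carrier V" and ea: "extends_all A P' (ker P' V g') W"
    using ext unfolding ext1_zero_def presents_def fgp_def by auto
  have P: "lmodule A P" "in_add A P (regular A)" and g: "lin A P M g" "g ` carrier P = carrier M"
    using pres unfolding presents_def fgp_def by auto
  interpret P: lmodule A P by fact
  interpret M: lmodule A M by fact
  interpret V: lmodule A V by fact
  interpret W: lmodule A W by fact
  interpret P': lmodule A P' by fact
  note ag = P.M.abelian_group_axioms M.M.abelian_group_axioms V.M.abelian_group_axioms
  have "extends_all A P (ker P M g) W"
    unfolding extends_all_def
  proof (intro allI impI)
    fix \<phi> assume \<phi>: "lin A (P\<lparr>carrier := ker P M g\<rparr>) W \<phi>"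
    have *: "\<exists>\<psi>. lin A P W \<psi> \<and> (\<forall>x\<in>ker P M g. \<psi> x = \<phi> (e x))"
      if "thru A M V M h" "lin A P P e" "\<And>x. x \<in> carrier P \<Longrightarrow> g (e x) = h (g x)" for h e
      using that
    proof (induct arbitrary: e)
      case zero
      then have "lin A P (P\<lparr>carrier := ker P M g\<rparr>) e" by (auto simp: lin_def)
      from lin_comp[OF this \<phi>] show ?case by blast
    next
      case (step i p h)
      obtain a where a: "lin A P P' a" "\<And>x. x \<in> carrier P \<Longrightarrow> g' (a x) = i (g x)"
        using projective_lift[OF P(2,1) P'(1) V g' lin_comp[OF g(1) step(1)]] by blast
      obtain b where b: "lin A P' P b" "\<And>x. x \<in> carrier P' \<Longrightarrow> g (b x) = p (g' x)"
        using projective_lift[OF P'(2,1) P(1) M g lin_comp[OF g'(1) step(2)]] by blast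
      \<comment> \<open>a lift of the remaining sum h\<close>
      let ?e = "\<lambda>x. e x \<ominus>\<^bsub>P\<^esub> b (a x)"
      have hl: "lin A M M h" by (rule thru_lin[OF step(3) M M])
      have ba: "b (a x) \<in> carrier P" "g (b (a x)) = p (i (g x))" if "x \<in> carrier P" for x
        using that a b by (simp_all add: lin_def)
      have e: "lin A P P ?e" by (rule lin_minus[OF step(5) lin_comp[OF a(1) b(1)] P(1)])
      have ge: "g (?e x) = h (g x)" if x: "x \<in> carrier P" for x
      proof -
        have gx: "g x \<in> carrier M" using x lin_closed[OF g(1)] by simp
        have cl: "p (i (g x)) \<in> carrier M" "h (g x) \<in> carrier M"
          using gx step(1,2) hl by (simp_all add: lin_def)
        have "g (?e x) = g (e x) \<ominus>\<^bsub>M\<^esub> g (b (a x))"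
          by (rule lin_diff[OF g(1) ag(1,2) lin_closed[OF step(5) x] ba(1)[OF x]])
        also have "\<dots> = (p (i (g x)) \<oplus>\<^bsub>M\<^esub> h (g x)) \<ominus>\<^bsub>M\<^esub> p (i (g x))" using step(6)[OF x] ba[OF x] by simp
        also have "\<dots> = h (g x)" using cl by (simp add: a_minus_def M.M.a_ac M.M.r_neg M.M.r_neg1 M.M.r_neg2)
        finally show ?thesis .
      qed
      obtain \<psi>1 where \<psi>1: "lin A P W \<psi>1" "\<forall>x\<in>ker P M g. \<psi>1 x = \<phi> (?e x)" using step(4)[OF e ge] by auto
      have "lin A (P'\<lparr>carrier := ker P' V g'\<rparr>) (P\<lparr>carrier := ker P M g\<rparr>) b"
        using lin_sub[OF b(1), of "ker P' V g'"] b(2) lin_zero[OF step(2) ag(3,2)] by (auto simp: lin_def)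
      from lin_comp[OF this \<phi>] obtain \<psi>2 where \<psi>2: "lin A P' W \<psi>2" "\<forall>x\<in>ker P' V g'. \<psi>2 x = \<phi> (b x)"
        using ea unfolding extends_all_def by blast
      have "lin A P W (\<lambda>x. \<psi>1 x \<oplus>\<^bsub>W\<^esub> \<psi>2 (a x))" by (rule lin_plus[OF \<psi>1(1) lin_comp[OF a(1) \<psi>2(1)] W])
      moreover have "\<psi>1 x \<oplus>\<^bsub>W\<^esub> \<psi>2 (a x) = \<phi> (e x)" if x: "x \<in> ker P M g" for x
      proof -
        have i0: "i \<zero>\<^bsub>M\<^esub> = \<zero>\<^bsub>V\<^esub>" "p \<zero>\<^bsub>V\<^esub> = \<zero>\<^bsub>M\<^esub>" "h \<zero>\<^bsub>M\<^esub> = \<zero>\<^bsub>M\<^esub>"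
          using lin_zero[OF step(1) ag(2,3)] lin_zero[OF step(2) ag(3,2)] lin_zero[OF hl ag(2,2)] by auto
        have ax: "a x \<in> ker P' V g'" using x a i0 lin_closed[OF a(1)] by simp
        have k: "?e x \<in> ker P M g" "b (a x) \<in> ker P M g"
          using x ge[of x] ba[of x] i0 lin_closed[OF e, of x] by auto
        have "e x = ?e x \<oplus>\<^bsub>P\<^esub> b (a x)" using x ba lin_closed[OF step(5)]
          by (simp add: a_minus_def P.M.a_ac P.M.r_neg P.M.l_neg)
        then have "\<phi> (e x) = \<phi> (?e x) \<oplus>\<^bsub>W\<^esub> \<phi> (b (a x))" using lin_add[OF \<phi>, of "?e x" "b (a x)"] k by simp
        then show ?thesis using \<psi>1(2) \<psi>2(2) x ax by simp
      qed
      ultimately show ?case by blast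
    next
      case (cong h h')
      then show ?case using lin_closed[OF g(1)] by simp
    qed
    show "\<exists>\<psi>. lin A P W \<psi> \<and> (\<forall>x\<in>ker P M g. \<psi> x = \<phi> x)"
      using *[OF MV[unfolded in_add_def] lin_id] by simp
  qed
  then show ?thesis unfolding ext1_zero_def using pres by blast
qed

lemma ext1_zero_in_add_right:
  assumes WV: "in_add A W V" and ext: "ext1_zero A M V" and V: "lmodule A V" and W: "lmodule A W"
  shows "ext1_zero A M W"
proof -
  obtain P :: "('a, nat \<Rightarrow> 'a) module" and g where pres: "presents A P g M" and ea: "extends_all A P (ker P M g) V"
    using ext unfolding ext1_zero_def by auto
  interpret W: lmodule A W by fact
  have "extends_all A P (ker P M g) W"
    unfolding extends_all_def
  proof (intro allI impI)
    fix \<phi> assume \<phi>: "lin A (P\<lparr>carrier := ker P M g\<rparr>) W \<phi>"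
    have *: "\<exists>\<psi>. lin A P W \<psi> \<and> (\<forall>x\<in>ker P M g. \<psi> x = h (\<phi> x))" if "thru A W V W h" for h
      using that
    proof induct
      case zero then show ?case using lin_const_zero[OF W] by blast
    next
      case (step i p h)
      obtain \<psi>1 where \<psi>1: "lin A P W \<psi>1" "\<forall>x\<in>ker P M g. \<psi>1 x = h (\<phi> x)" using step by auto
      obtain \<psi>2 where \<psi>2: "lin A P V \<psi>2" "\<forall>x\<in>ker P M g. \<psi>2 x = i (\<phi> x)"
        using ea lin_comp[OF \<phi> step(1)] unfolding extends_all_def by blast
      show ?case using lin_plus[OF lin_comp[OF \<psi>2(1) step(2)] \<psi>1(1) W] \<psi>1(2) \<psi>2(2) by (intro exI conjI) auto
    next
      case (cong h h')
      then show ?case using lin_closed[OF \<phi>] by auto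
    qed
    show "\<exists>\<psi>. lin A P W \<psi> \<and> (\<forall>x\<in>ker P M g. \<psi> x = \<phi> x)"
      using *[OF WV[unfolded in_add_def]] .
  qed
  then show ?thesis unfolding ext1_zero_def using pres by blast
qed

text \<open>An extension problem with values in \<open>V\<close> is first solved in \<open>W\<close>; the solution is lifted to \<open>V\<close> by
  projectivity, and what is missing takes values in \<open>U\<close>.\<close>

lemma ext1_zero_extension_right:
  assumes ext: "ext1_zero A M U" "ext1_zero A M W"
    and M: "lmodule A M" and U: "lmodule A U" and V: "lmodule A V" and W: "lmodule A W"
    and f: "lin A U V f" "inj_on f (carrier U)" and g: "lin A V W g" "g ` carrier V = carrier W"
    and fg: "f ` carrier U = ker V W g"
  shows "ext1_zero A M V"
proof -
  obtain P :: "('a, nat \<Rightarrow> 'a) module" and \<pi> where pres: "presents A P \<pi> M" and ea: "extends_all A P (ker P M \<pi>) U"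
    using ext unfolding ext1_zero_def by auto
  have P: "lmodule A P" "in_add A P (regular A)" and \<pi>: "lin A P M \<pi>" "\<pi> ` carrier P = carrier M"
    using pres unfolding presents_def fgp_def by auto
  interpret U: lmodule A U by fact
  interpret V: lmodule A V by fact
  interpret W: lmodule A W by fact
  have "extends_all A P (ker P M \<pi>) V"
    unfolding extends_all_def
  proof (intro allI impI)
    fix \<phi> assume \<phi>: "lin A (P\<lparr>carrier := ker P M \<pi>\<rparr>) V \<phi>"
    let ?K = "P\<lparr>carrier := ker P M \<pi>\<rparr>"
    have "extends_all A P (ker P M \<pi>) W" by (rule ext1_zero_extend[OF ext(2) M W P(1) \<pi>])
    then obtain \<psi> where \<psi>: "lin A P W \<psi>" "\<forall>x\<in>ker P M \<pi>. \<psi> x = g (\<phi> x)"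
      using lin_comp[OF \<phi> g(1)] unfolding extends_all_def by blast
    obtain \<theta> where \<theta>: "lin A P V \<theta>" "\<And>x. x \<in> carrier P \<Longrightarrow> g (\<theta> x) = \<psi> x"
      using projective_lift[OF P(2,1) V W g \<psi>(1)] by blast
    have \<theta>K: "lin A ?K V \<theta>" by (rule lin_sub[OF \<theta>(1)]) simp
    let ?d = "\<lambda>x. \<phi> x \<ominus>\<^bsub>V\<^esub> \<theta> x"
    have cl: "\<phi> x \<in> carrier V" "\<theta> x \<in> carrier V" if "x \<in> ker P M \<pi>" for x
      using that lin_closed[OF \<phi>] lin_closed[OF \<theta>(1)] by auto
    have dK: "?d x \<in> f ` carrier U" if x: "x \<in> ker P M \<pi>" for x
      using x cl[OF x] lin_diff[OF g(1) V.M.abelian_group_axioms W.M.abelian_group_axioms cl[OF x]] \<psi>(2) \<theta>(2)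
        lin_closed[OF g(1)] unfolding fg by (simp add: a_minus_def W.M.r_neg)
    have "lin A ?K (V\<lparr>carrier := f ` carrier U\<rparr>) ?d"
      by (rule lin_into_sub[OF lin_minus[OF \<phi> \<theta>K V]]) (use dK in simp)
    then have "lin A ?K U (\<lambda>x. inv_into (carrier U) f (?d x))" by (rule lin_comp[OF _ lin_inv_image[OF f U]])
    then obtain \<eta> where \<eta>: "lin A P U \<eta>" "\<forall>x\<in>ker P M \<pi>. \<eta> x = inv_into (carrier U) f (?d x)"
      using ea unfolding extends_all_def by blast
    have "lin A P V (\<lambda>x. f (\<eta> x) \<oplus>\<^bsub>V\<^esub> \<theta> x)" by (rule lin_plus[OF lin_comp[OF \<eta>(1) f(1)] \<theta>(1) V])
    moreover have "f (\<eta> x) \<oplus>\<^bsub>V\<^esub> \<theta> x = \<phi> x" if x: "x \<in> ker P M \<pi>" for x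
      using \<eta>(2) x dK[OF x] cl[OF x] by (simp add: f_inv_into_f a_minus_def V.M.a_assoc V.M.l_neg)
    ultimately show "\<exists>\<psi>. lin A P V \<psi> \<and> (\<forall>x\<in>ker P M \<pi>. \<psi> x = \<phi> x)" by blast
  qed
  then show ?thesis unfolding ext1_zero_def using pres by blast
qed

text \<open>A presentation \<open>P \<rightarrow> M\<close> also presents \<open>N\<close>, and the kernel of \<open>P \<rightarrow> N\<close> maps onto \<open>L\<close> with
  the kernel of \<open>P \<rightarrow> M\<close>.  Maps thus extend in two steps, first by the property of \<open>L\<close>, for a surjection from a
  module that is in general not projective, and then by that of \<open>N\<close>.\<close>

lemma ext1_zero_extension_left:
  assumes ext: "ext1_zero A L W" "ext1_zero A N W"
    and L: "lmodule A L" and M: "lmodule A M" and N: "lmodule A N" and W: "lmodule A W"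
    and f: "lin A L M f" "inj_on f (carrier L)" and g: "lin A M N g" "g ` carrier M = carrier N"
    and fg: "f ` carrier L = ker M N g"
    and pres: "presents A (P :: ('a, nat \<Rightarrow> 'a) module) \<pi> M"
  shows "ext1_zero A M W"
proof -
  have P: "lmodule A P" and \<pi>: "lin A P M \<pi>" "\<pi> ` carrier P = carrier M"
    using pres unfolding presents_def fgp_def by auto
  interpret M: lmodule A M by fact
  interpret N: lmodule A N by fact
  interpret L: lmodule A L by fact
  interpret P: lmodule A P by fact
  let ?g = "\<lambda>x. g (\<pi> x)"
  have g': "lin A P N ?g" "?g ` carrier P = carrier N"
    using lin_comp[OF \<pi>(1) g(1)] g(2) \<pi>(2) by (auto simp: image_image[symmetric])
  let ?P' = "P\<lparr>carrier := ker P N ?g\<rparr>"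
  have P': "lmodule A ?P'" by (rule subm_lmodule[OF P kernel_subm[OF P N g'(1)]])
  have "lin A ?P' (M\<lparr>carrier := f ` carrier L\<rparr>) \<pi>"
    by (rule lin_into_sub[OF lin_sub[OF \<pi>(1)]]) (use lin_closed[OF \<pi>(1)] fg in auto)
  from lin_comp[OF this lin_inv_image[OF f L]] have \<pi>': "lin A ?P' L (\<lambda>x. inv_into (carrier L) f (\<pi> x))" .
  let ?\<pi>' = "\<lambda>x. inv_into (carrier L) f (\<pi> x)"
  have f\<pi>': "f (?\<pi>' x) = \<pi> x" if "x \<in> ker P N ?g" for x
    by (rule f_inv_into_f) (use that fg lin_closed[OF \<pi>(1)] in auto)
  have surj: "?\<pi>' ` carrier ?P' = carrier L"
  proof (intro equalityI subsetI)
    fix y assume "y \<in> ?\<pi>' ` carrier ?P'" then show "y \<in> carrier L" using lin_closed[OF \<pi>'] by blast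
  next
    fix y assume y: "y \<in> carrier L"
    then have fy: "f y \<in> ker M N g" using fg by blast
    then obtain x where x: "x \<in> carrier P" "f y = \<pi> x" using \<pi>(2) by (metis (mono_tags, lifting) imageE mem_Collect_eq)
    then show "y \<in> ?\<pi>' ` carrier ?P'" using fy y f(2) by (intro image_eqI[of _ _ x]) (auto simp: x(2)[symmetric])
  qed
  have z: "f \<zero>\<^bsub>L\<^esub> = \<zero>\<^bsub>M\<^esub>" "g \<zero>\<^bsub>M\<^esub> = \<zero>\<^bsub>N\<^esub>"
    using lin_zero[OF f(1) L.M.abelian_group_axioms M.M.abelian_group_axioms]
      lin_zero[OF g(1) M.M.abelian_group_axioms N.M.abelian_group_axioms] by auto
  have kk: "ker ?P' L ?\<pi>' = ker P M \<pi>"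
  proof (intro equalityI subsetI)
    fix x assume "x \<in> ker ?P' L ?\<pi>'"
    then show "x \<in> ker P M \<pi>" using f\<pi>'[of x] z by simp
  next
    fix x assume "x \<in> ker P M \<pi>"
    then show "x \<in> ker ?P' L ?\<pi>'" using z f(2) by (simp add: inv_into_f_eq)
  qed
  have "extends_all A P (ker P M \<pi>) W"
    unfolding extends_all_def
  proof (intro allI impI)
    fix \<phi> assume \<phi>: "lin A (P\<lparr>carrier := ker P M \<pi>\<rparr>) W \<phi>"
    have "extends_all A ?P' (ker ?P' L ?\<pi>') W" by (rule ext1_zero_extend[OF ext(1) L W P' \<pi>' surj])
    then obtain \<psi> where \<psi>: "lin A ?P' W \<psi>" "\<forall>x\<in>ker P M \<pi>. \<psi> x = \<phi> x"
      unfolding kk using \<phi> by (auto simp: extends_all_def)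
    have "extends_all A P (ker P N ?g) W" by (rule ext1_zero_extend[OF ext(2) N W P g'])
    then obtain \<chi> where \<chi>: "lin A P W \<chi>" "\<forall>x\<in>ker P N ?g. \<chi> x = \<psi> x"
      using \<psi> unfolding extends_all_def by blast
    have "\<forall>x\<in>ker P M \<pi>. \<chi> x = \<phi> x"
      using \<chi>(2) \<psi>(2) lin_zero[OF g(1) M.M.abelian_group_axioms N.M.abelian_group_axioms] by auto
    then show "\<exists>\<psi>. lin A P W \<psi> \<and> (\<forall>x\<in>ker P M \<pi>. \<psi> x = \<phi> x)" using \<chi>(1) by blast
  qed
  then show ?thesis unfolding ext1_zero_def using pres by blast
qed

text \<open>The obstruction against lifting \<open>\<phi>\<close> is a class in \<open>Ext\<^sup>1(M, U)\<close>: a lift \<open>\<theta>\<close> of \<open>\<phi> \<circ> \<pi>\<close> on a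
  presentation \<open>\<pi>\<close> maps the kernel of \<open>\<pi>\<close> into \<open>U\<close>, and subtracting an extension of this restriction makes
  \<open>\<theta>\<close> factor through \<open>M\<close>.\<close>

lemma ext1_zero_lift:
  assumes ext: "ext1_zero A M U" and M: "lmodule A M" and U: "lmodule A U" and V: "lmodule A V" and W: "lmodule A W"
    and f: "lin A U V f" "inj_on f (carrier U)" and g: "lin A V W g" "g ` carrier V = carrier W"
    and fg: "f ` carrier U = ker V W g" and \<phi>: "lin A M W \<phi>"
  obtains \<psi> where "lin A M V \<psi>" "\<And>x. x \<in> carrier M \<Longrightarrow> g (\<psi> x) = \<phi> x"
proof -
  obtain P :: "('a, nat \<Rightarrow> 'a) module" and \<pi> where pres: "presents A P \<pi> M" and ea: "extends_all A P (ker P M \<pi>) U"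
    using ext unfolding ext1_zero_def by auto
  have P: "lmodule A P" "in_add A P (regular A)" and \<pi>: "lin A P M \<pi>" "\<pi> ` carrier P = carrier M"
    using pres unfolding presents_def fgp_def by auto
  interpret U: lmodule A U by fact
  interpret V: lmodule A V by fact
  interpret W: lmodule A W by fact
  interpret M: lmodule A M by fact
  obtain \<theta> where \<theta>: "lin A P V \<theta>" "\<And>x. x \<in> carrier P \<Longrightarrow> g (\<theta> x) = \<phi> (\<pi> x)"
    using projective_lift[OF P(2,1) V W g lin_comp[OF \<pi>(1) \<phi>]] by blast
  let ?K = "P\<lparr>carrier := ker P M \<pi>\<rparr>"
  have \<theta>K: "\<theta> x \<in> f ` carrier U" if "x \<in> ker P M \<pi>" for x
    using that \<theta>(2) lin_closed[OF \<theta>(1)] lin_zero[OF \<phi> M.M.abelian_group_axioms W.M.abelian_group_axioms]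
    unfolding fg by simp
  have "lin A ?K (V\<lparr>carrier := f ` carrier U\<rparr>) \<theta>"
    by (rule lin_into_sub[OF lin_sub[OF \<theta>(1)]]) (use \<theta>K in auto)
  then have "lin A ?K U (\<lambda>x. inv_into (carrier U) f (\<theta> x))" by (rule lin_comp[OF _ lin_inv_image[OF f U]])
  then obtain \<eta> where \<eta>: "lin A P U \<eta>" "\<forall>x\<in>ker P M \<pi>. \<eta> x = inv_into (carrier U) f (\<theta> x)"
    using ea unfolding extends_all_def by blast
  let ?d = "\<lambda>x. \<theta> x \<ominus>\<^bsub>V\<^esub> f (\<eta> x)"
  have d: "lin A P V ?d" by (rule lin_minus[OF \<theta>(1) lin_comp[OF \<eta>(1) f(1)] V])
  have d0: "?d x = \<zero>\<^bsub>V\<^esub>" if "x \<in> carrier P" "\<pi> x = \<zero>\<^bsub>M\<^esub>" for x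
    using that \<eta>(2) \<theta>K[of x] lin_closed[OF \<theta>(1)] by (simp add: f_inv_into_f a_minus_def V.M.r_neg)
  obtain \<psi> where \<psi>: "lin A M V \<psi>" "\<And>x. x \<in> carrier P \<Longrightarrow> \<psi> (\<pi> x) = ?d x"
    using lin_factor[OF P(1) M V \<pi> d d0] by metis
  have "g (\<psi> y) = \<phi> y" if "y \<in> carrier M" for y
  proof -
    obtain x where x: "x \<in> carrier P" "y = \<pi> x" using \<open>y \<in> carrier M\<close> unfolding \<pi>(2)[symmetric] by (rule imageE)
    have cl: "\<theta> x \<in> carrier V" "f (\<eta> x) \<in> f ` carrier U" "f (\<eta> x) \<in> carrier V" "\<eta> x \<in> carrier U"
      using x \<theta>(1) \<eta>(1) f(1) by (auto simp: lin_def)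
    have "g (f (\<eta> x)) = \<zero>\<^bsub>W\<^esub>" using cl(2) unfolding fg by simp
    then show ?thesis
      using \<psi>(2) x \<theta>(2) lin_diff[OF g(1) V.M.abelian_group_axioms W.M.abelian_group_axioms cl(1,3)] lin_closed[OF \<phi>] that
      by (simp add: a_minus_def)
  qed
  then show thesis by (rule that[OF \<psi>(1)])
qed

section \<open>Finitely generated modules\<close>

text \<open>Linear combinations built term by term, in place of finite sums with a coefficient function.\<close>

inductive_set lspan :: "('a, 'z) ring_scheme \<Rightarrow> ('a, 'x) module \<Rightarrow> 'x set \<Rightarrow> 'x set" for A X S where
  zero: "\<zero>\<^bsub>X\<^esub> \<in> lspan A X S"
| step: "\<lbrakk>a \<in> carrier A; s \<in> S; x \<in> lspan A X S\<rbrakk> \<Longrightarrow> a \<odot>\<^bsub>X\<^esub> s \<oplus>\<^bsub>X\<^esub> x \<in> lspan A X S"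

lemma lspan_mono:
  assumes "S \<subseteq> T" shows "lspan A X S \<subseteq> lspan A X T"
proof
  fix x assume "x \<in> lspan A X S"
  then show "x \<in> lspan A X T" by induct (use assms in \<open>auto intro: lspan.intros\<close>)
qed

lemma lspan_least:
  assumes "subm A X H" "S \<subseteq> H" shows "lspan A X S \<subseteq> H"
proof
  fix x assume "x \<in> lspan A X S"
  then show "x \<in> H" by induct (use assms in \<open>auto simp: subm_def\<close>)
qed

lemma lspan_subm:
  assumes X: "lmodule A X" and S: "S \<subseteq> carrier X" shows "subm A X (lspan A X S)"
proof -
  interpret X: lmodule A X by fact
  have sub: "lspan A X S \<subseteq> carrier X" by (rule lspan_least[OF subm_carrier[OF X] S])
  have add: "x \<oplus>\<^bsub>X\<^esub> y \<in> lspan A X S" if "x \<in> lspan A X S" "y \<in> lspan A X S" for x y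
    using that(1)
  proof induct
    case zero show ?case using that(2) sub by auto
  next
    case (step a s x)
    have "a \<odot>\<^bsub>X\<^esub> s \<oplus>\<^bsub>X\<^esub> (x \<oplus>\<^bsub>X\<^esub> y) \<in> lspan A X S" by (rule lspan.step) (use step in auto)
    moreover have "a \<odot>\<^bsub>X\<^esub> s \<oplus>\<^bsub>X\<^esub> (x \<oplus>\<^bsub>X\<^esub> y) = a \<odot>\<^bsub>X\<^esub> s \<oplus>\<^bsub>X\<^esub> x \<oplus>\<^bsub>X\<^esub> y"
      using step sub S that(2) by (subst X.M.a_assoc) auto
    ultimately show ?case by simp
  qed
  have smult: "b \<odot>\<^bsub>X\<^esub> x \<in> lspan A X S" if b: "b \<in> carrier A" and "x \<in> lspan A X S" for b x
    using that(2)
  proof induct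
    case zero show ?case using b by (simp add: lspan.zero)
  next
    case (step a s x)
    have "(b \<otimes>\<^bsub>A\<^esub> a) \<odot>\<^bsub>X\<^esub> s \<oplus>\<^bsub>X\<^esub> b \<odot>\<^bsub>X\<^esub> x \<in> lspan A X S" by (rule lspan.step) (use step b in auto)
    moreover have "(b \<otimes>\<^bsub>A\<^esub> a) \<odot>\<^bsub>X\<^esub> s \<oplus>\<^bsub>X\<^esub> b \<odot>\<^bsub>X\<^esub> x = b \<odot>\<^bsub>X\<^esub> (a \<odot>\<^bsub>X\<^esub> s \<oplus>\<^bsub>X\<^esub> x)"
      using step sub S b by (subst X.lsmult_r_distr) (auto simp: X.lsmult_assoc)
    ultimately show ?case by simp
  qed
  show ?thesis using sub add smult lspan.zero by (auto simp: subm_def)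
qed

lemma lspan_incl:
  assumes X: "lmodule A X" and S: "S \<subseteq> carrier X" "s \<in> S" shows "s \<in> lspan A X S"
proof -
  interpret X: lmodule A X by fact
  show ?thesis using lspan.step[OF X.R.one_closed S(2) lspan.zero, of X] S by auto
qed

lemma lspan_image:
  assumes X: "lmodule A X" and Y: "lmodule A Y" and f: "lin A X Y f" and S: "S \<subseteq> carrier X"
    and x: "x \<in> lspan A X S"
  shows "f x \<in> lspan A Y (f ` S)"
  using x
proof induct
  case zero
  show ?case using lin_zero[OF f lmodule_abelian_group[OF X] lmodule_abelian_group[OF Y]] lspan.zero[of Y] by simp
next
  case (step a s x)
  have "x \<in> carrier X" "s \<in> carrier X" using lspan_least[OF subm_carrier[OF X] S] step S by auto
  moreover from this have "a \<odot>\<^bsub>X\<^esub> s \<in> carrier X" using lmodule.lsmult_closed[OF X step(1)] by simp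
  ultimately have "f (a \<odot>\<^bsub>X\<^esub> s \<oplus>\<^bsub>X\<^esub> x) = a \<odot>\<^bsub>Y\<^esub> f s \<oplus>\<^bsub>Y\<^esub> f x" using step f by (simp add: lin_def)
  then show ?case using lspan.step[OF step(1) imageI[OF step(2)] step(4)] by simp
qed

lemma lspan_insert:
  assumes X: "lmodule A X" and S: "insert s S \<subseteq> carrier X" and x: "x \<in> lspan A X (insert s S)"
  obtains r y where "r \<in> carrier A" "y \<in> lspan A X S" "x = r \<odot>\<^bsub>X\<^esub> s \<oplus>\<^bsub>X\<^esub> y"
proof -
  interpret X: lmodule A X by fact
  have sb: "subm A X (lspan A X S)" by (rule lspan_subm[OF X]) (use S in auto)
  have "\<exists>r y. r \<in> carrier A \<and> y \<in> lspan A X S \<and> x = r \<odot>\<^bsub>X\<^esub> s \<oplus>\<^bsub>X\<^esub> y"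
    using x
  proof induct
    case zero show ?case
      by (rule exI[of _ "\<zero>\<^bsub>A\<^esub>"], rule exI[of _ "\<zero>\<^bsub>X\<^esub>"]) (use S lspan.zero in simp)
  next
    case (step a t x)
    then obtain r y where ry: "r \<in> carrier A" "y \<in> lspan A X S" "x = r \<odot>\<^bsub>X\<^esub> s \<oplus>\<^bsub>X\<^esub> y" by blast
    have yc: "y \<in> carrier X" using ry sb by (auto simp: subm_def)
    show ?case
    proof (cases "t = s")
      case True
      have "a \<odot>\<^bsub>X\<^esub> t \<oplus>\<^bsub>X\<^esub> x = (a \<oplus>\<^bsub>A\<^esub> r) \<odot>\<^bsub>X\<^esub> s \<oplus>\<^bsub>X\<^esub> y"
        using True ry step S yc by (simp add: X.lsmult_l_distr X.M.a_assoc)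
      then show ?thesis using ry step by blast
    next
      case False
      then have t: "t \<in> S" "t \<in> carrier X" using step S by auto
      have "a \<odot>\<^bsub>X\<^esub> t \<oplus>\<^bsub>X\<^esub> x = r \<odot>\<^bsub>X\<^esub> s \<oplus>\<^bsub>X\<^esub> (a \<odot>\<^bsub>X\<^esub> t \<oplus>\<^bsub>X\<^esub> y)"
        using ry step S yc t by (simp add: X.M.a_ac)
      moreover have "a \<odot>\<^bsub>X\<^esub> t \<oplus>\<^bsub>X\<^esub> y \<in> lspan A X S" by (rule lspan.step) (use t step ry in auto)
      ultimately show ?thesis using ry by blast
    qed
  qed
  then show thesis using that by auto
qed

lemma fg_iff_lspan:
  assumes X: "lmodule A X"
  shows "finitely_generated A X \<longleftrightarrow> (\<exists>S. finite S \<and> S \<subseteq> carrier X \<and> carrier X \<subseteq> lspan A X S)"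
proof -
  interpret X: lmodule A X by fact
  have 1: "x \<in> lspan A X S \<longleftrightarrow> (\<exists>c\<in>S \<rightarrow> carrier A. x = (\<Oplus>\<^bsub>X\<^esub>s\<in>S. c s \<odot>\<^bsub>X\<^esub> s))"
    if "finite S" "S \<subseteq> carrier X" for S x
    using that
  proof (induct S arbitrary: x)
    case empty
    have "lspan A X {} \<subseteq> {\<zero>\<^bsub>X\<^esub>}" by (rule lspan_least) (auto simp: subm_def)
    then show ?case using lspan.zero[of X A "{}"] by auto
  next
    case (insert s S)
    show ?case
    proof
      assume "x \<in> lspan A X (insert s S)"
      then obtain r y where ry: "r \<in> carrier A" "y \<in> lspan A X S" "x = r \<odot>\<^bsub>X\<^esub> s \<oplus>\<^bsub>X\<^esub> y"
        using lspan_insert[OF X insert(4)] by metis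
      then obtain c where c: "c \<in> S \<rightarrow> carrier A" "y = (\<Oplus>\<^bsub>X\<^esub>s\<in>S. c s \<odot>\<^bsub>X\<^esub> s)" using insert by auto
      let ?c = "c(s := r)"
      have "(\<Oplus>\<^bsub>X\<^esub>t\<in>insert s S. ?c t \<odot>\<^bsub>X\<^esub> t) = ?c s \<odot>\<^bsub>X\<^esub> s \<oplus>\<^bsub>X\<^esub> (\<Oplus>\<^bsub>X\<^esub>t\<in>S. ?c t \<odot>\<^bsub>X\<^esub> t)"
        by (rule X.M.finsum_insert) (use insert c ry in \<open>auto simp: Pi_def\<close>)
      also have "(\<Oplus>\<^bsub>X\<^esub>t\<in>S. ?c t \<odot>\<^bsub>X\<^esub> t) = y" unfolding c(2)
        by (rule X.M.finsum_cong') (use insert c in \<open>auto simp: Pi_def\<close>)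
      finally show "\<exists>c\<in>insert s S \<rightarrow> carrier A. x = (\<Oplus>\<^bsub>X\<^esub>s\<in>insert s S. c s \<odot>\<^bsub>X\<^esub> s)"
        using ry c by (intro bexI[of _ ?c]) (auto simp: Pi_def)
    next
      assume "\<exists>c\<in>insert s S \<rightarrow> carrier A. x = (\<Oplus>\<^bsub>X\<^esub>s\<in>insert s S. c s \<odot>\<^bsub>X\<^esub> s)"
      then obtain c where c: "c \<in> insert s S \<rightarrow> carrier A" "x = (\<Oplus>\<^bsub>X\<^esub>s\<in>insert s S. c s \<odot>\<^bsub>X\<^esub> s)" by blast
      have "x = c s \<odot>\<^bsub>X\<^esub> s \<oplus>\<^bsub>X\<^esub> (\<Oplus>\<^bsub>X\<^esub>t\<in>S. c t \<odot>\<^bsub>X\<^esub> t)"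
        unfolding c(2) by (rule X.M.finsum_insert) (use insert c in \<open>auto simp: Pi_def\<close>)
      moreover have "(\<Oplus>\<^bsub>X\<^esub>t\<in>S. c t \<odot>\<^bsub>X\<^esub> t) \<in> lspan A X S" using insert c by auto
      then have "(\<Oplus>\<^bsub>X\<^esub>t\<in>S. c t \<odot>\<^bsub>X\<^esub> t) \<in> lspan A X (insert s S)" using lspan_mono[of S "insert s S"] by blast
      ultimately show "x \<in> lspan A X (insert s S)" using lspan.step[of "c s" A s "insert s S"] c by auto
    qed
  qed
  have 2: "carrier X \<subseteq> lspan A X S \<longleftrightarrow> (\<forall>x\<in>carrier X. \<exists>c\<in>S \<rightarrow> carrier A. x = (\<Oplus>\<^bsub>X\<^esub>s\<in>S. c s \<odot>\<^bsub>X\<^esub> s))"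
    if "finite S" "S \<subseteq> carrier X" for S
    unfolding subset_eq using 1[OF that] by simp
  show ?thesis unfolding finitely_generated_def
  proof
    assume "\<exists>S\<subseteq>carrier X. finite S \<and> (\<forall>x\<in>carrier X. \<exists>c\<in>S \<rightarrow> carrier A. x = (\<Oplus>\<^bsub>X\<^esub>s\<in>S. c s \<odot>\<^bsub>X\<^esub> s))"
    then obtain S where S: "S \<subseteq> carrier X" "finite S" "\<forall>x\<in>carrier X. \<exists>c\<in>S \<rightarrow> carrier A. x = (\<Oplus>\<^bsub>X\<^esub>s\<in>S. c s \<odot>\<^bsub>X\<^esub> s)"
      by (elim exE conjE)
    show "\<exists>S. finite S \<and> S \<subseteq> carrier X \<and> carrier X \<subseteq> lspan A X S"
      using S(3)[folded 2[OF S(2,1)]] S(1,2) by (intro exI[of _ S] conjI)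
  next
    assume "\<exists>S. finite S \<and> S \<subseteq> carrier X \<and> carrier X \<subseteq> lspan A X S"
    then obtain S where S: "finite S" "S \<subseteq> carrier X" "carrier X \<subseteq> lspan A X S"
      by (elim exE conjE)
    show "\<exists>S\<subseteq>carrier X. finite S \<and> (\<forall>x\<in>carrier X. \<exists>c\<in>S \<rightarrow> carrier A. x = (\<Oplus>\<^bsub>X\<^esub>s\<in>S. c s \<odot>\<^bsub>X\<^esub> s))"
      using S(3)[unfolded 2[OF S(1,2)]] S(1,2) by (intro exI[of _ S] conjI)
  qed
qed

lemma fg_extension:
  assumes X: "lmodule A X" and Y: "lmodule A Y" and Z: "lmodule A Z" and f: "lin A X Y f" and g: "lin A Y Z g" "g ` carrier Y = carrier Z"
    and fg: "f ` carrier X = ker Y Z g" and fgX: "finitely_generated A X" and fgZ: "finitely_generated A Z"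
  shows "finitely_generated A Y"
proof -
  interpret Y: lmodule A Y by fact
  interpret Z: lmodule A Z by fact
  obtain S where S: "finite S" "S \<subseteq> carrier X" "carrier X \<subseteq> lspan A X S" using fgX fg_iff_lspan[OF X] by auto
  obtain T where T: "finite T" "T \<subseteq> carrier Z" "carrier Z \<subseteq> lspan A Z T" using fgZ fg_iff_lspan[OF Z] by auto
  let ?t = "inv_into (carrier Y) g"
  have t: "?t z \<in> carrier Y" "g (?t z) = z" if "z \<in> carrier Z" for z
    using that unfolding g(2)[symmetric] by (simp_all add: inv_into_into f_inv_into_f)
  let ?U = "f ` S \<union> ?t ` T"
  have U: "?U \<subseteq> carrier Y" using S(2) T(2) t lin_closed[OF f] by blast
  note sU = lspan_subm[OF Y U]
  have 1: "f x \<in> lspan A Y ?U" if "x \<in> lspan A X S" for x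
    using lspan_image[OF X Y f S(2) that] lspan_mono[of "f ` S" ?U A Y] by blast
  have 2: "\<exists>y\<in>lspan A Y ?U. g y = z" if "z \<in> lspan A Z T" for z
    using that
  proof induct
    case zero show ?case using lin_zero[OF g(1) Y.M.abelian_group_axioms Z.M.abelian_group_axioms] lspan.zero[of Y] by blast
  next
    case (step a s x)
    then obtain y where y: "y \<in> lspan A Y ?U" "g y = x" by blast
    have "y \<in> carrier Y" "s \<in> carrier Z" using y sU step T(2) by (auto simp: subm_def)
    then have "g (a \<odot>\<^bsub>Y\<^esub> ?t s \<oplus>\<^bsub>Y\<^esub> y) = a \<odot>\<^bsub>Z\<^esub> s \<oplus>\<^bsub>Z\<^esub> x" using step y g(1) t[of s] by (simp add: lin_def)
    moreover have "a \<odot>\<^bsub>Y\<^esub> ?t s \<oplus>\<^bsub>Y\<^esub> y \<in> lspan A Y ?U" by (rule lspan.step) (use step y in auto)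
    ultimately show ?case by blast
  qed
  have "y \<in> lspan A Y ?U" if y: "y \<in> carrier Y" for y
  proof -
    obtain y' where y': "y' \<in> lspan A Y ?U" "g y' = g y" using 2[of "g y"] T(3) lin_closed[OF g(1) y] by auto
    have c: "y' \<in> carrier Y" using y' sU by (auto simp: subm_def)
    have "y \<ominus>\<^bsub>Y\<^esub> y' \<in> ker Y Z g" using y y' c lin_diff[OF g(1) Y.M.abelian_group_axioms Z.M.abelian_group_axioms y c] lin_closed[OF g(1) y]
      by (simp add: a_minus_def Z.M.r_neg)
    then have "y \<ominus>\<^bsub>Y\<^esub> y' \<in> f ` carrier X" using fg by simp
    then have "y \<ominus>\<^bsub>Y\<^esub> y' \<in> lspan A Y ?U" using 1 S(3) by auto
    then have "(y \<ominus>\<^bsub>Y\<^esub> y') \<oplus>\<^bsub>Y\<^esub> y' \<in> lspan A Y ?U" using sU y' by (simp add: subm_def)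
    then show ?thesis using y c by (simp add: a_minus_def Y.M.a_assoc Y.M.l_neg)
  qed
  then show ?thesis using fg_iff_lspan[OF Y] S(1) T(1) U by (metis finite_UnI finite_imageI subsetI)
qed

lemma fg_in_add:
  assumes X: "lmodule A X" and V: "lmodule A V" and XV: "in_add A X V" and fg: "finitely_generated A V"
  shows "finitely_generated A X"
proof -
  obtain S where S: "finite S" "S \<subseteq> carrier V" "carrier V \<subseteq> lspan A V S" using fg fg_iff_lspan[OF V] by auto
  have "\<exists>T. finite T \<and> T \<subseteq> carrier X \<and> h ` carrier X \<subseteq> lspan A X T" if "thru A X V X h" for h
    using that
  proof induct
    case zero
    have "(\<lambda>x. \<zero>\<^bsub>X\<^esub>) ` carrier X \<subseteq> lspan A X {}" using lspan.zero[of X A "{}"] by auto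
    then show ?case by blast
  next
    case (step i p h)
    then obtain T where T: "finite T" "T \<subseteq> carrier X" "h ` carrier X \<subseteq> lspan A X T" by blast
    let ?T = "p ` S \<union> T"
    have sub: "?T \<subseteq> carrier X" using T S lin_closed[OF step(2)] by auto
    have p: "p v \<in> lspan A X ?T" if "v \<in> lspan A V S" for v
      using lspan_image[OF V X step(2) S(2) that] lspan_mono[of "p ` S" ?T A X] by blast
    have "p (i x) \<oplus>\<^bsub>X\<^esub> h x \<in> lspan A X ?T" if x: "x \<in> carrier X" for x
    proof -
      have "i x \<in> lspan A V S" using lin_closed[OF step(1) x] S(3) by auto
      then have "p (i x) \<in> lspan A X ?T" by (rule p)
      moreover have "h x \<in> lspan A X ?T" using T(3) x lspan_mono[of T ?T A X] by auto
      ultimately show ?thesis using lspan_subm[OF X sub] by (simp add: subm_def)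
    qed
    then show ?case using sub T(1) S(1) by (intro exI[of _ ?T]) auto
  next
    case (cong h h')
    then show ?case by (metis image_cong)
  qed
  from this[OF XV[unfolded in_add_def]] show ?thesis using fg_iff_lspan[OF X] by auto
qed

lemma fg_regular: "ring A \<Longrightarrow> finitely_generated A (regular A)"
proof -
  assume A: "ring A"
  interpret A: ring A by fact
  have "x \<in> lspan A (regular A) {\<one>\<^bsub>A\<^esub>}" if "x \<in> carrier A" for x
    using lspan.step[OF that, of "\<one>\<^bsub>A\<^esub>" "{\<one>\<^bsub>A\<^esub>}" "\<zero>\<^bsub>A\<^esub>" "regular A"] lspan.zero[of "regular A" A] that by simp
  then show ?thesis using fg_iff_lspan[OF regular_lmodule[OF A]] by (intro iffD2[OF fg_iff_lspan[OF regular_lmodule[OF A]]] exI[of _ "{\<one>\<^bsub>A\<^esub>}"]) auto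
qed

lemma fgp_imp_fg: "fgp A P \<Longrightarrow> finitely_generated A P"
  unfolding fgp_def by (metis fg_in_add fg_regular lmodule_ring regular_lmodule)

subsection \<open>Direct sums\<close>

lemma direct_sum_simps:
  "carrier (direct_sum I X) = {f \<in> \<Pi>\<^sub>E i\<in>I. carrier (X i). finite {i\<in>I. f i \<noteq> \<zero>\<^bsub>X i\<^esub>}}"
  "\<zero>\<^bsub>direct_sum I X\<^esub> = (\<lambda>i\<in>I. \<zero>\<^bsub>X i\<^esub>)"
  "f \<oplus>\<^bsub>direct_sum I X\<^esub> g = (\<lambda>i\<in>I. f i \<oplus>\<^bsub>X i\<^esub> g i)"
  "a \<odot>\<^bsub>direct_sum I X\<^esub> f = (\<lambda>i\<in>I. a \<odot>\<^bsub>X i\<^esub> f i)"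
  by (simp_all add: direct_sum_def)

lemma direct_sum_lmodule:
  assumes A: "ring A" and X: "\<And>i. i \<in> I \<Longrightarrow> lmodule A (X i)"
  shows "lmodule A (direct_sum I X)"
proof -
  have ag: "abelian_group (X i)" if "i \<in> I" for i using X[OF that] by (rule lmodule_abelian_group)
  note [simp] = abelian_groupE(1)[OF ag] abelian_groupE(2)[OF ag] abelian_groupE(5)[OF ag] lmodule.lsmult_closed[OF X]
    lmodule.lsmult_one[OF X] abelian_group.a_inv_closed[OF ag] abelian_group.l_neg[OF ag] lmodule.lsmult_r_null[OF X]
  have fin_add: "finite {i\<in>I. f i \<oplus>\<^bsub>X i\<^esub> g i \<noteq> \<zero>\<^bsub>X i\<^esub>}"
    if "finite {i\<in>I. f i \<noteq> \<zero>\<^bsub>X i\<^esub>}" "finite {i\<in>I. g i \<noteq> \<zero>\<^bsub>X i\<^esub>}" for f g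
    by (rule finite_subset[OF _ finite_UnI[OF that]]) auto
  have fin_sm: "finite {i\<in>I. a \<odot>\<^bsub>X i\<^esub> f i \<noteq> \<zero>\<^bsub>X i\<^esub>}" if "finite {i\<in>I. f i \<noteq> \<zero>\<^bsub>X i\<^esub>}" "a \<in> carrier A" for a f
    by (rule finite_subset[OF _ that(1)]) (use that(2) in auto)
  have fin_neg: "finite {i\<in>I. \<ominus>\<^bsub>X i\<^esub> f i \<noteq> \<zero>\<^bsub>X i\<^esub>}" if "finite {i\<in>I. f i \<noteq> \<zero>\<^bsub>X i\<^esub>}" for f
    by (rule finite_subset[OF _ that]) (auto simp: neg_zero[OF ag])
  have cong: "{i\<in>I. restrict f I i \<noteq> \<zero>\<^bsub>X i\<^esub>} = {i\<in>I. f i \<noteq> \<zero>\<^bsub>X i\<^esub>}" for f by auto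
  show ?thesis
  proof (intro lmodule.intro lmodule_axioms.intro abelian_groupI A)
    fix x assume x: "x \<in> carrier (direct_sum I X)"
    have neg: "(\<lambda>i\<in>I. \<ominus>\<^bsub>X i\<^esub> x i) \<in> carrier (direct_sum I X)"
      unfolding direct_sum_simps mem_Collect_eq cong using x fin_neg[of x] by (auto simp: direct_sum_simps PiE_iff)
    show "\<exists>y\<in>carrier (direct_sum I X). y \<oplus>\<^bsub>direct_sum I X\<^esub> x = \<zero>\<^bsub>direct_sum I X\<^esub>"
      by (rule bexI[of _ "\<lambda>i\<in>I. \<ominus>\<^bsub>X i\<^esub> x i"])
        (use x neg in \<open>auto simp: direct_sum_simps PiE_iff intro!: restrict_ext\<close>)
    show "\<zero>\<^bsub>direct_sum I X\<^esub> \<oplus>\<^bsub>direct_sum I X\<^esub> x = x"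
      using x by (auto simp: direct_sum_simps PiE_iff fun_eq_iff extensional_def)
    show "\<one>\<^bsub>A\<^esub> \<odot>\<^bsub>direct_sum I X\<^esub> x = x"
      using x by (auto simp: direct_sum_simps PiE_iff fun_eq_iff extensional_def)
  next
    show "\<zero>\<^bsub>direct_sum I X\<^esub> \<in> carrier (direct_sum I X)" by (simp add: direct_sum_simps cong)
  next
    fix x y assume xy: "x \<in> carrier (direct_sum I X)" "y \<in> carrier (direct_sum I X)"
    then show "x \<oplus>\<^bsub>direct_sum I X\<^esub> y \<in> carrier (direct_sum I X)"
      unfolding direct_sum_simps mem_Collect_eq cong using fin_add[of x y] by (auto simp: PiE_iff)
  next
    fix a x assume xy: "a \<in> carrier A" "x \<in> carrier (direct_sum I X)"
    then show "a \<odot>\<^bsub>direct_sum I X\<^esub> x \<in> carrier (direct_sum I X)"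
      unfolding direct_sum_simps mem_Collect_eq cong using fin_sm[of x a] by (auto simp: PiE_iff)
  qed (auto simp: direct_sum_simps cong fin_add fin_sm PiE_iff intro!: restrict_ext
      abelian_groupE(3)[OF ag] abelian_groupE(4)[OF ag] lmodule.lsmult_l_distr[OF X] lmodule.lsmult_r_distr[OF X]
      lmodule.lsmult_assoc[OF X])
qed

lemma direct_sum_proj:
  assumes "i \<in> I" shows "lin A (direct_sum I X) (X i) (\<lambda>f. f i)"
  using assms by (auto simp: lin_def direct_sum_simps)

lemma direct_sum_inj:
  assumes A: "ring A" and X: "\<And>i. i \<in> I \<Longrightarrow> lmodule A (X i)" and j: "j \<in> I"
  shows "lin A (X j) (direct_sum I X) (\<lambda>x. \<lambda>i\<in>I. if i = j then x else \<zero>\<^bsub>X i\<^esub>)"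
proof -
  have ag: "abelian_group (X i)" if "i \<in> I" for i using X[OF that] by (rule lmodule_abelian_group)
  note [simp] = abelian_groupE(1)[OF ag] abelian_groupE(2)[OF ag] abelian_groupE(5)[OF ag] lmodule.lsmult_closed[OF X]
    lmodule.lsmult_r_null[OF X]
  show ?thesis
  proof (rule linI)
    fix x assume x: "x \<in> carrier (X j)"
    have "finite {i \<in> I. (\<lambda>i\<in>I. if i = j then x else \<zero>\<^bsub>X i\<^esub>) i \<noteq> \<zero>\<^bsub>X i\<^esub>}"
      by (rule finite_subset[of _ "{j}"]) auto
    then show "(\<lambda>i\<in>I. if i = j then x else \<zero>\<^bsub>X i\<^esub>) \<in> carrier (direct_sum I X)"
      using x j by (auto simp: direct_sum_simps)
  qed (use j in \<open>auto simp: direct_sum_simps intro!: restrict_ext\<close>)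
qed

lemma direct_sum_truncate_insert:
  assumes X: "\<And>i. i \<in> I \<Longrightarrow> lmodule A (X i)" and f: "f \<in> carrier (direct_sum I X)" and j: "j \<notin> J"
  shows "(\<lambda>i\<in>I. if i \<in> insert j J then f i else \<zero>\<^bsub>X i\<^esub>) =
    (\<lambda>i\<in>I. if i = j then f j else \<zero>\<^bsub>X i\<^esub>) \<oplus>\<^bsub>direct_sum I X\<^esub> (\<lambda>i\<in>I. if i \<in> J then f i else \<zero>\<^bsub>X i\<^esub>)"
proof -
  have ag: "abelian_group (X i)" if "i \<in> I" for i using X[OF that] by (rule lmodule_abelian_group)
  have "f i \<oplus>\<^bsub>X i\<^esub> \<zero>\<^bsub>X i\<^esub> = f i" "\<zero>\<^bsub>X i\<^esub> \<oplus>\<^bsub>X i\<^esub> f i = f i" "\<zero>\<^bsub>X i\<^esub> \<oplus>\<^bsub>X i\<^esub> \<zero>\<^bsub>X i\<^esub> = \<zero>\<^bsub>X i\<^esub>" if "i \<in> I" for i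
    using f that abelian_groupE(5)[OF ag[OF that]] abelian_groupE(4)[OF ag[OF that], of "f i" "\<zero>\<^bsub>X i\<^esub>"] abelian_groupE(2)[OF ag[OF that]]
    by (auto simp: direct_sum_simps PiE_iff)
  then show ?thesis using j unfolding direct_sum_simps by (intro restrict_ext) auto
qed

text \<open>Truncation to finitely many coordinates.  The index set may be infinite, so that this applies to
  the free modules in the definition of projectivity.\<close>

lemma direct_sum_truncate_thru:
  assumes A: "ring A" and X: "\<And>i. i \<in> I \<Longrightarrow> lmodule A (X i)" and V: "\<And>i. i \<in> I \<Longrightarrow> in_add A (X i) V"
    and V': "lmodule A V" and "finite J" "J \<subseteq> I"
  shows "thru A (direct_sum I X) V (direct_sum I X) (\<lambda>f. \<lambda>i\<in>I. if i \<in> J then f i else \<zero>\<^bsub>X i\<^esub>)"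
  using assms(5,6)
proof (induct J)
  case empty
  show ?case by (rule thru.cong[OF thru.zero]) (simp add: direct_sum_simps restrict_def)
next
  case (insert j J)
  have j: "j \<in> I" using insert by simp
  have D: "lmodule A (direct_sum I X)" by (rule direct_sum_lmodule[OF A X])
  have pj: "lin A (direct_sum I X) (X j) (\<lambda>f. f j)" by (rule direct_sum_proj[OF j])
  have ij: "lin A (X j) (direct_sum I X) (\<lambda>x. \<lambda>i\<in>I. if i = j then x else \<zero>\<^bsub>X i\<^esub>)"
    by (rule direct_sum_inj[OF A X j])
  have 1: "thru A (direct_sum I X) V (direct_sum I X) (\<lambda>f. \<lambda>i\<in>I. if i = j then f j else \<zero>\<^bsub>X i\<^esub>)"
    by (rule thru_trans[OF thru_single[OF pj ij D] V[OF j] D X[OF j] D])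
  have 2: "thru A (direct_sum I X) V (direct_sum I X) (\<lambda>f. \<lambda>i\<in>I. if i \<in> J then f i else \<zero>\<^bsub>X i\<^esub>)"
    by (rule insert.hyps(3)) (use insert.prems in blast)
  show ?case
    by (rule thru.cong[OF thru_plus[OF 1 2 D D]]) (rule direct_sum_truncate_insert[OF X _ insert.hyps(2)])
qed

lemma direct_sum_in_add:
  assumes A: "ring A" and X: "\<And>i. i \<in> I \<Longrightarrow> lmodule A (X i)" and V: "\<And>i. i \<in> I \<Longrightarrow> in_add A (X i) V"
    and V': "lmodule A V" and "finite I"
  shows "in_add A (direct_sum I X) V"
  unfolding in_add_def
  by (rule thru.cong[OF direct_sum_truncate_thru[OF assms(1-4), of I]])
    (use assms(5) in \<open>auto simp: direct_sum_simps PiE_iff fun_eq_iff extensional_def\<close>)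

lemma lin_combination:
  assumes X: "lmodule A X" and fin: "finite I" and x: "x \<in> I \<rightarrow> carrier X"
  shows "lin A (direct_sum I (\<lambda>_. regular A)) X (\<lambda>c. \<Oplus>\<^bsub>X\<^esub>i\<in>I. c i \<odot>\<^bsub>X\<^esub> x i)"
proof -
  interpret X: lmodule A X by fact
  have sm: "(\<Oplus>\<^bsub>X\<^esub>i\<in>J. a \<odot>\<^bsub>X\<^esub> g i) = a \<odot>\<^bsub>X\<^esub> (\<Oplus>\<^bsub>X\<^esub>i\<in>J. g i)" if "finite J" "a \<in> carrier A" "g \<in> J \<rightarrow> carrier X" for J a g
    using that by (induct J) (auto simp: Pi_def X.lsmult_r_distr)
  note cl = X.M.finsum_closed and x = funcset_mem[OF x]
  show ?thesis
  proof (rule linI)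
    fix c assume c: "c \<in> carrier (direct_sum I (\<lambda>_. regular A))"
    then have cc: "c i \<in> carrier A" if "i \<in> I" for i using that by (auto simp: direct_sum_simps)
    show "(\<Oplus>\<^bsub>X\<^esub>i\<in>I. c i \<odot>\<^bsub>X\<^esub> x i) \<in> carrier X" by (rule cl) (use cc x in auto)
    fix d assume d: "d \<in> carrier (direct_sum I (\<lambda>_. regular A))"
    then have dc: "d i \<in> carrier A" if "i \<in> I" for i using that by (auto simp: direct_sum_simps)
    have "(\<Oplus>\<^bsub>X\<^esub>i\<in>I. (c \<oplus>\<^bsub>direct_sum I (\<lambda>_. regular A)\<^esub> d) i \<odot>\<^bsub>X\<^esub> x i) = (\<Oplus>\<^bsub>X\<^esub>i\<in>I. c i \<odot>\<^bsub>X\<^esub> x i \<oplus>\<^bsub>X\<^esub> d i \<odot>\<^bsub>X\<^esub> x i)"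
      by (rule X.M.finsum_cong') (use cc dc x in \<open>auto simp: direct_sum_simps X.lsmult_l_distr Pi_def\<close>)
    also have "\<dots> = (\<Oplus>\<^bsub>X\<^esub>i\<in>I. c i \<odot>\<^bsub>X\<^esub> x i) \<oplus>\<^bsub>X\<^esub> (\<Oplus>\<^bsub>X\<^esub>i\<in>I. d i \<odot>\<^bsub>X\<^esub> x i)"
      by (rule X.M.finsum_addf) (use cc dc x in auto)
    finally show "(\<Oplus>\<^bsub>X\<^esub>i\<in>I. (c \<oplus>\<^bsub>direct_sum I (\<lambda>_. regular A)\<^esub> d) i \<odot>\<^bsub>X\<^esub> x i) = (\<Oplus>\<^bsub>X\<^esub>i\<in>I. c i \<odot>\<^bsub>X\<^esub> x i) \<oplus>\<^bsub>X\<^esub> (\<Oplus>\<^bsub>X\<^esub>i\<in>I. d i \<odot>\<^bsub>X\<^esub> x i)" .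
  next
    fix a c assume a: "a \<in> carrier A" and c: "c \<in> carrier (direct_sum I (\<lambda>_. regular A))"
    then have cc: "c i \<in> carrier A" if "i \<in> I" for i using that by (auto simp: direct_sum_simps)
    have "(\<Oplus>\<^bsub>X\<^esub>i\<in>I. (a \<odot>\<^bsub>direct_sum I (\<lambda>_. regular A)\<^esub> c) i \<odot>\<^bsub>X\<^esub> x i) = (\<Oplus>\<^bsub>X\<^esub>i\<in>I. a \<odot>\<^bsub>X\<^esub> (c i \<odot>\<^bsub>X\<^esub> x i))"
      by (rule X.M.finsum_cong') (use a cc x in \<open>auto simp: direct_sum_simps X.lsmult_assoc Pi_def\<close>)
    also have "\<dots> = a \<odot>\<^bsub>X\<^esub> (\<Oplus>\<^bsub>X\<^esub>i\<in>I. c i \<odot>\<^bsub>X\<^esub> x i)" by (rule sm) (use fin a cc x in auto)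
    finally show "(\<Oplus>\<^bsub>X\<^esub>i\<in>I. (a \<odot>\<^bsub>direct_sum I (\<lambda>_. regular A)\<^esub> c) i \<odot>\<^bsub>X\<^esub> x i) = a \<odot>\<^bsub>X\<^esub> (\<Oplus>\<^bsub>X\<^esub>i\<in>I. c i \<odot>\<^bsub>X\<^esub> x i)" .
  qed
qed

lemma fgp_free: "ring A \<Longrightarrow> finite I \<Longrightarrow> fgp A (direct_sum I (\<lambda>_. regular A))"
  unfolding fgp_def
  by (simp add: direct_sum_lmodule direct_sum_in_add regular_lmodule in_add_refl)

lemma free_cover:
  assumes X: "lmodule A X" and fg: "finitely_generated A X"
  obtains S where "finite S" "S \<subseteq> carrier X"
    "presents A (direct_sum S (\<lambda>_. regular A)) (\<lambda>c. \<Oplus>\<^bsub>X\<^esub>s\<in>S. c s \<odot>\<^bsub>X\<^esub> s) X"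
proof -
  interpret X: lmodule A X by fact
  obtain S where S: "S \<subseteq> carrier X" "finite S" and g: "\<And>x. x \<in> carrier X \<Longrightarrow> \<exists>c \<in> S \<rightarrow> carrier A. x = (\<Oplus>\<^bsub>X\<^esub>s\<in>S. c s \<odot>\<^bsub>X\<^esub> s)"
    using fg unfolding finitely_generated_def by blast
  have l: "lin A (direct_sum S (\<lambda>_. regular A)) X (\<lambda>c. \<Oplus>\<^bsub>X\<^esub>s\<in>S. c s \<odot>\<^bsub>X\<^esub> s)"
    by (rule lin_combination[OF X S(2), of "\<lambda>s. s"]) (use S(1) in auto)
  have "\<exists>c\<in>carrier (direct_sum S (\<lambda>_. regular A)). x = (\<Oplus>\<^bsub>X\<^esub>s\<in>S. c s \<odot>\<^bsub>X\<^esub> s)" if "x \<in> carrier X" for x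
  proof -
    obtain c where c: "c \<in> S \<rightarrow> carrier A" "x = (\<Oplus>\<^bsub>X\<^esub>s\<in>S. c s \<odot>\<^bsub>X\<^esub> s)" using g[OF \<open>x \<in> carrier X\<close>] by blast
    have "restrict c S \<in> carrier (direct_sum S (\<lambda>_. regular A))" using c S by (auto simp: direct_sum_simps)
    moreover have "x = (\<Oplus>\<^bsub>X\<^esub>s\<in>S. restrict c S s \<odot>\<^bsub>X\<^esub> s)" unfolding c(2)
      by (rule X.M.finsum_cong') (use c S in \<open>auto simp: Pi_def subset_iff\<close>)
    ultimately show ?thesis by blast
  qed
  then have "(\<lambda>c. \<Oplus>\<^bsub>X\<^esub>s\<in>S. c s \<odot>\<^bsub>X\<^esub> s) ` carrier (direct_sum S (\<lambda>_. regular A)) = carrier X"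
    using lin_closed[OF l] by auto
  then show thesis using that S l fgp_free[OF X.R.ring_axioms S(2)] unfolding presents_def by blast
qed

text \<open>Numbering the generators makes the covering free module one whose elements are functions on \<open>nat\<close>.\<close>

lemma fg_presents:
  assumes X: "lmodule A X" and fg: "finitely_generated A X"
  obtains P :: "('a, nat \<Rightarrow> 'a) module" and g where "presents A P g X"
proof -
  interpret X: lmodule A X by fact
  obtain S where S: "finite S" "S \<subseteq> carrier X" and pr: "presents A (direct_sum S (\<lambda>_. regular A)) (\<lambda>c. \<Oplus>\<^bsub>X\<^esub>s\<in>S. c s \<odot>\<^bsub>X\<^esub> s) X"
    by (rule free_cover[OF X fg])
  obtain b where b: "bij_betw b {..<card S} S" using ex_bij_betw_nat_finite[OF S(1)] by (auto simp: lessThan_atLeast0)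
  let ?P = "direct_sum {..<card S} (\<lambda>_. regular A) :: ('a, nat \<Rightarrow> 'a) module"
  have bS: "b i \<in> S" if "i < card S" for i using that b by (auto simp: bij_betw_def)
  have l: "lin A ?P X (\<lambda>c. \<Oplus>\<^bsub>X\<^esub>i\<in>{..<card S}. c i \<odot>\<^bsub>X\<^esub> b i)"
    by (rule lin_combination[OF X]) (use bS S(2) in auto)
  have "\<exists>c\<in>carrier ?P. x = (\<Oplus>\<^bsub>X\<^esub>i\<in>{..<card S}. c i \<odot>\<^bsub>X\<^esub> b i)" if x: "x \<in> carrier X" for x
  proof -
    have "x \<in> (\<lambda>c. \<Oplus>\<^bsub>X\<^esub>s\<in>S. c s \<odot>\<^bsub>X\<^esub> s) ` carrier (direct_sum S (\<lambda>_. regular A))"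
      using pr x unfolding presents_def by simp
    then obtain c where c: "c \<in> carrier (direct_sum S (\<lambda>_. regular A))" "x = (\<Oplus>\<^bsub>X\<^esub>s\<in>S. c s \<odot>\<^bsub>X\<^esub> s)" by blast
    have cS: "c s \<in> carrier A" if "s \<in> S" for s using that c by (auto simp: direct_sum_simps)
    let ?c = "\<lambda>i\<in>{..<card S}. c (b i)"
    have "x = (\<Oplus>\<^bsub>X\<^esub>i\<in>{..<card S}. c (b i) \<odot>\<^bsub>X\<^esub> b i)"
      using X.M.finsum_reindex[of "\<lambda>s. c s \<odot>\<^bsub>X\<^esub> s" b "{..<card S}"] b cS S(2) c(2)
      by (simp add: bij_betw_def Pi_def subset_iff)
    also have "\<dots> = (\<Oplus>\<^bsub>X\<^esub>i\<in>{..<card S}. ?c i \<odot>\<^bsub>X\<^esub> b i)"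
      by (rule X.M.finsum_cong') (use bS cS S(2) in \<open>auto simp: Pi_def subset_iff\<close>)
    finally show ?thesis using bS cS by (intro bexI[of _ ?c]) (auto simp: direct_sum_simps)
  qed
  then have "(\<lambda>c. \<Oplus>\<^bsub>X\<^esub>i\<in>{..<card S}. c i \<odot>\<^bsub>X\<^esub> b i) ` carrier ?P = carrier X"
    using lin_closed[OF l] by auto
  then show thesis using that l fgp_free[OF X.R.ring_axioms, of "{..<card S}"] unfolding presents_def by blast
qed

text \<open>A finitely generated summand of a free module of any rank lies in a finite part of it: the finitely
  many generators have only finitely many nonzero coordinates, and truncation to these does not change the
  identity.\<close>

lemma proj_mods_iff:
  fixes X :: "('a, 'x) module"
  shows "X \<in> proj_mods A \<longleftrightarrow> fgp A X"
proof
  assume "X \<in> proj_mods A"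
  then have X: "lmodule A X" and fg: "finitely_generated A X" and "projective A X"
    by (auto simp: proj_mods_def fg_mods_def)
  obtain I :: "'x set" where "is_summand A X (direct_sum I (\<lambda>_. regular A))"
    using \<open>projective A X\<close> unfolding projective_def by blast
  then obtain i p where ip: "i \<in> lhom A X (direct_sum I (\<lambda>_. regular A))"
    "p \<in> lhom A (direct_sum I (\<lambda>_. regular A)) X" "\<forall>x\<in>carrier X. p (i x) = x"
    unfolding is_summand_def by blast
  note i = lhom_lin[OF ip(1)] and p = lhom_lin[OF ip(2)] and pi = bspec[OF ip(3)]
  interpret X: lmodule A X by fact
  let ?D = "direct_sum I (\<lambda>_. regular A)"
  note reg = regular_lmodule[OF X.R.ring_axioms]
  have D: "lmodule A ?D" by (rule direct_sum_lmodule[OF X.R.ring_axioms reg])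
  interpret D: lmodule A ?D by fact
  obtain S where S: "finite S" "S \<subseteq> carrier X" "carrier X \<subseteq> lspan A X S" using fg fg_iff_lspan[OF X] by auto
  let ?J = "\<Union>s\<in>S. {j\<in>I. i s j \<noteq> \<zero>\<^bsub>A\<^esub>}"
  have iD: "i x \<in> carrier ?D" if "x \<in> carrier X" for x using lin_closed[OF i that] .
  have J: "finite ?J" "?J \<subseteq> I" using S(1,2) iD by (auto simp: direct_sum_simps subset_iff)
  \<comment> \<open>coordinates outside J vanish on the generators, hence on X\<close>
  have supp: "i x j = \<zero>\<^bsub>A\<^esub>" if "x \<in> lspan A X S" "j \<in> I" "j \<notin> ?J" for x j
    using that(1)
  proof induct
    case zero
    show ?case using lin_zero[OF i X.M.abelian_group_axioms D.M.abelian_group_axioms] that(2) by (simp add: direct_sum_simps)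
  next
    case (step a s x)
    have "x \<in> carrier X" "s \<in> carrier X" using lspan_least[OF subm_carrier[OF X] S(2)] step S(2) by auto
    then have "i (a \<odot>\<^bsub>X\<^esub> s \<oplus>\<^bsub>X\<^esub> x) = a \<odot>\<^bsub>?D\<^esub> i s \<oplus>\<^bsub>?D\<^esub> i x" using step i by (simp add: lin_def)
    moreover have "i s j = \<zero>\<^bsub>A\<^esub>" using that step by auto
    ultimately show ?case using step that by (simp add: direct_sum_simps)
  qed
  have "thru A ?D (regular A) ?D (\<lambda>f. \<lambda>j\<in>I. if j \<in> ?J then f j else \<zero>\<^bsub>A\<^esub>)"
    using direct_sum_truncate_thru[OF X.R.ring_axioms reg _ reg J, OF in_add_refl[OF reg]]
    unfolding regular_simps .
  from thru_post[OF thru_pre[OF this i] p X D X]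
  have "thru A X (regular A) X (\<lambda>x. p (\<lambda>j\<in>I. if j \<in> ?J then i x j else \<zero>\<^bsub>A\<^esub>))" .
  then have "in_add A X (regular A)" unfolding in_add_def
  proof (rule thru.cong)
    fix x assume x: "x \<in> carrier X"
    have "(\<lambda>j\<in>I. if j \<in> ?J then i x j else \<zero>\<^bsub>A\<^esub>) = i x"
    proof
      fix j show "(\<lambda>j\<in>I. if j \<in> ?J then i x j else \<zero>\<^bsub>A\<^esub>) j = i x j"
        using supp[of x j] x S(3) iD[OF x] by (auto simp: direct_sum_simps PiE_iff extensional_def)
    qed
    then have "p (\<lambda>j\<in>I. if j \<in> ?J then i x j else \<zero>\<^bsub>A\<^esub>) = p (i x)" by (rule arg_cong)
    from this pi[OF x] show "x = p (\<lambda>j\<in>I. if j \<in> ?J then i x j else \<zero>\<^bsub>A\<^esub>)" by (rule sym[OF trans])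
  qed
  then show "fgp A X" using X by (simp add: fgp_def)
next
  assume f: "fgp A X"
  then have X: "lmodule A X" "in_add A X (regular A)" by (auto simp: fgp_def)
  interpret X: lmodule A X by fact
  note fg = fgp_imp_fg[OF f]
  obtain S where S: "finite S" "S \<subseteq> carrier X" and pr: "presents A (direct_sum S (\<lambda>_. regular A)) (\<lambda>c. \<Oplus>\<^bsub>X\<^esub>s\<in>S. c s \<odot>\<^bsub>X\<^esub> s) X"
    by (rule free_cover[OF X(1) fg])
  let ?D = "direct_sum S (\<lambda>_. regular A)" and ?g = "\<lambda>c. \<Oplus>\<^bsub>X\<^esub>s\<in>S. c s \<odot>\<^bsub>X\<^esub> s"
  have D: "lmodule A ?D" and g: "lin A ?D X ?g" "?g ` carrier ?D = carrier X" using pr by (auto simp: presents_def fgp_def)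
  obtain s where s: "lin A X ?D s" "\<And>x. x \<in> carrier X \<Longrightarrow> ?g (s x) = x"
    by (rule projective_lift[OF X(2,1) D X(1) g lin_id]) (rule that)
  have "is_summand A X ?D" unfolding is_summand_def
  proof (intro bexI ballI)
    show "restrict s (carrier X) \<in> lhom A X ?D" by (rule lin_restrict_lhom[OF X(1) s(1)])
    show "restrict ?g (carrier ?D) \<in> lhom A ?D X" by (rule lin_restrict_lhom[OF D g(1)])
    fix x assume "x \<in> carrier X"
    then show "restrict ?g (carrier ?D) (restrict s (carrier X) x) = x" using s lin_closed[OF s(1)] by simp
  qed
  then show "X \<in> proj_mods A" using X fg by (auto simp: proj_mods_def fg_mods_def projective_def)
qed

section \<open>Modules over an algebra\<close>

lemma opp_ring_simps [simp]:
  "carrier (opp_ring A) = carrier A" "\<zero>\<^bsub>opp_ring A\<^esub> = \<zero>\<^bsub>A\<^esub>" "\<one>\<^bsub>opp_ring A\<^esub> = \<one>\<^bsub>A\<^esub>"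
  "x \<oplus>\<^bsub>opp_ring A\<^esub> y = x \<oplus>\<^bsub>A\<^esub> y" "x \<otimes>\<^bsub>opp_ring A\<^esub> y = y \<otimes>\<^bsub>A\<^esub> x" "opp_ring (opp_ring A) = A"
  by (simp_all add: opp_ring_def)

lemma opp_ring_smult [simp]: "r \<odot>\<^bsub>opp_ring A\<^esub> x = r \<odot>\<^bsub>A\<^esub> x"
  by (simp add: opp_ring_def)

lemma opp_ring_ring: "ring A \<Longrightarrow> ring (opp_ring A)"
proof -
  assume "ring A"
  then interpret ring A .
  show ?thesis
    by (intro ringI abelian_groupI monoidI)
      (use l_neg a_inv_closed in \<open>auto simp: a_ac l_distr r_distr m_assoc\<close>)
qed

lemma opp_R_algebra: "R_algebra R A \<Longrightarrow> R_algebra R (opp_ring A)"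
proof -
  assume "R_algebra R A"
  then interpret R_algebra R A .
  interpret A: ring A by (rule ring_axioms)
  interpret O: ring "opp_ring A" by (rule opp_ring_ring[OF ring_axioms])
  show ?thesis
    by (intro R_algebra.intro R_algebra_axioms.intro O.ring_axioms moduleI O.abelian_group_axioms)
      (auto simp: smult_l_distr smult_r_distr smult_assoc1 smult_mult_l smult_mult_r R.cring_axioms)
qed

lemma restr_simps [simp]:
  "carrier (restr A X) = carrier X" "\<zero>\<^bsub>restr A X\<^esub> = \<zero>\<^bsub>X\<^esub>" "x \<oplus>\<^bsub>restr A X\<^esub> y = x \<oplus>\<^bsub>X\<^esub> y"
  "r \<odot>\<^bsub>restr A X\<^esub> x = scalar A X r x" "restr (opp_ring A) X = restr A X"
  "restr A (X\<lparr>carrier := H\<rparr>) = (restr A X)\<lparr>carrier := H\<rparr>"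
  by (simp_all add: restr_def fun_eq_iff)

text \<open>The record type of \<open>A\<close> is fixed as in the definitions of duals and tensor products, and the locale
  can be interpreted for the opposite algebra.\<close>

locale algebra_over = R_algebra R A
  for R :: "('r, 'z) ring_scheme" (structure) and A :: "('r, 'a) module" (structure)
begin

lemma scalar_central:
  assumes "r \<in> carrier R" "a \<in> carrier A"
  shows "(r \<odot>\<^bsub>A\<^esub> \<one>\<^bsub>A\<^esub>) \<otimes>\<^bsub>A\<^esub> a = r \<odot>\<^bsub>A\<^esub> a" "a \<otimes>\<^bsub>A\<^esub> (r \<odot>\<^bsub>A\<^esub> \<one>\<^bsub>A\<^esub>) = r \<odot>\<^bsub>A\<^esub> a"
  using assms smult_mult_l[of r "\<one>\<^bsub>A\<^esub>" a] smult_mult_r[of r a "\<one>\<^bsub>A\<^esub>"] by simp_all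

lemma scalar_commute:
  assumes "lmodule A X" "r \<in> carrier R" "a \<in> carrier A" "x \<in> carrier X"
  shows "scalar A X r (a \<odot>\<^bsub>X\<^esub> x) = a \<odot>\<^bsub>X\<^esub> scalar A X r x"
proof -
  interpret X: lmodule A X by fact
  show ?thesis using assms X.lsmult_assoc[of "r \<odot>\<^bsub>A\<^esub> \<one>\<^bsub>A\<^esub>" a x] X.lsmult_assoc[of a "r \<odot>\<^bsub>A\<^esub> \<one>\<^bsub>A\<^esub>" x]
    by (simp add: scalar_central)
qed

lemma restr_lmodule:
  assumes "lmodule A X" shows "lmodule R (restr A X)"
proof -
  interpret X: lmodule A X by fact
  have ml: "(r \<otimes>\<^bsub>R\<^esub> s) \<odot>\<^bsub>A\<^esub> \<one>\<^bsub>A\<^esub> = (r \<odot>\<^bsub>A\<^esub> \<one>\<^bsub>A\<^esub>) \<otimes>\<^bsub>A\<^esub> (s \<odot>\<^bsub>A\<^esub> \<one>\<^bsub>A\<^esub>)" if "r \<in> carrier R" "s \<in> carrier R" for r s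
    using that by (simp add: scalar_central(1) smult_assoc1)
  have ng: "\<exists>y\<in>carrier X. y \<oplus>\<^bsub>X\<^esub> x = \<zero>\<^bsub>X\<^esub>" if "x \<in> carrier X" for x
    by (rule bexI[of _ "\<ominus>\<^bsub>X\<^esub> x"]) (use that in \<open>simp_all add: X.M.l_neg\<close>)
  show ?thesis
    by (intro lmodule.intro lmodule_axioms.intro abelian_groupI)
      (use ng in \<open>auto simp: R.ring_axioms X.M.a_ac smult_l_distr X.lsmult_l_distr X.lsmult_r_distr ml X.lsmult_assoc\<close>)
qed

lemma restr_lin: "lin A X Y f \<Longrightarrow> lmodule A X \<Longrightarrow> lin R (restr A X) (restr A Y) f"
  by (simp add: lin_def)

lemma thru_restr:
  assumes "thru A X V Y h" "lmodule A X" "lmodule A V"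
  shows "thru R (restr A X) (restr A V) (restr A Y) h"
  using assms(1)
proof induct
  case zero show ?case by (rule thru.cong[OF thru.zero]) simp
next
  case (step i p h)
  show ?case
    by (rule thru.cong[OF thru.step[OF restr_lin[OF step(1) assms(2)] restr_lin[OF step(2) assms(3)] step(4)]]) simp
next
  case (cong h h')
  show ?case by (rule thru.cong[OF cong(2)]) (simp add: cong(3))
qed

lemma in_add_restr: "in_add A X V \<Longrightarrow> lmodule A X \<Longrightarrow> lmodule A V \<Longrightarrow> in_add R (restr A X) (restr A V)"
  unfolding in_add_def by (rule thru_restr)

lemma subm_restr: "subm A X H \<Longrightarrow> subm R (restr A X) H"
  by (simp add: subm_def)

lemma algebra_lmodule: "lmodule R A"
  by (intro lmodule.intro lmodule_axioms.intro R.ring_axioms M.abelian_group_axioms)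
    (simp_all add: smult_l_distr smult_r_distr smult_assoc1)

lemma fg_restr:
  assumes X: "lmodule A X" and fgA: "finitely_generated R A" and fgX: "finitely_generated A X"
  shows "finitely_generated R (restr A X)"
proof -
  interpret X: lmodule A X by fact
  note rX = restr_lmodule[OF X]
  obtain S where S: "finite S" "S \<subseteq> carrier X" "carrier X \<subseteq> lspan A X S" using fgX fg_iff_lspan[OF X] by auto
  obtain T where T: "finite T" "T \<subseteq> carrier A" "carrier A \<subseteq> lspan R A T" using fgA fg_iff_lspan[OF algebra_lmodule] by auto
  let ?U = "(\<lambda>(b, s). b \<odot>\<^bsub>X\<^esub> s) ` (T \<times> S)"
  have U: "?U \<subseteq> carrier (restr A X)" using S(2) T(2) by (auto simp: subset_iff)
  have 1: "a \<odot>\<^bsub>X\<^esub> s \<in> lspan R (restr A X) ?U" if "a \<in> lspan R A T" and s: "s \<in> S" for a s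
    using that(1)
  proof induct
    case zero
    have "\<zero>\<^bsub>A\<^esub> \<odot>\<^bsub>X\<^esub> s = \<zero>\<^bsub>restr A X\<^esub>" using s S(2) by auto
    then show ?case using lspan.zero by metis
  next
    case (step r b a)
    have c: "a \<in> carrier A" "b \<in> carrier A" "s \<in> carrier X"
      using lspan_least[OF subm_carrier[OF algebra_lmodule] T(2)] step T(2) S(2) s by auto
    have "(r \<odot>\<^bsub>A\<^esub> b \<oplus>\<^bsub>A\<^esub> a) \<odot>\<^bsub>X\<^esub> s = r \<odot>\<^bsub>restr A X\<^esub> (b \<odot>\<^bsub>X\<^esub> s) \<oplus>\<^bsub>restr A X\<^esub> a \<odot>\<^bsub>X\<^esub> s"
      using step(1) c X.lsmult_assoc[of "r \<odot>\<^bsub>A\<^esub> \<one>\<^bsub>A\<^esub>" b s] by (simp add: X.lsmult_l_distr scalar_central)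
    then show ?case using lspan.step[OF step(1) _ step(4), of "b \<odot>\<^bsub>X\<^esub> s"] step(2) s by auto
  qed
  have "x \<in> lspan R (restr A X) ?U" if "x \<in> lspan A X S" for x
    using that
  proof induct
    case zero show ?case using lspan.zero[of "restr A X"] by simp
  next
    case (step a s x)
    have "a \<odot>\<^bsub>X\<^esub> s \<in> lspan R (restr A X) ?U" using 1 step T(3) by auto
    then show ?case using lspan_subm[OF rX U] step unfolding subm_def by simp
  qed
  then have "carrier (restr A X) \<subseteq> lspan R (restr A X) ?U" using S(3) by auto
  moreover have "finite ?U" using S(1) T(1) by simp
  ultimately show ?thesis using fg_iff_lspan[OF rX] U by blast
qed

end

section \<open>Noetherian base rings\<close>

lemma lspan_restrict: "lspan A (X\<lparr>carrier := H\<rparr>) S = lspan A X S"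
proof
  show "lspan A (X\<lparr>carrier := H\<rparr>) S \<subseteq> lspan A X S"
  proof
    fix x assume "x \<in> lspan A (X\<lparr>carrier := H\<rparr>) S"
    then show "x \<in> lspan A X S" by induct (auto intro: lspan.intros)
  qed
  show "lspan A X S \<subseteq> lspan A (X\<lparr>carrier := H\<rparr>) S"
  proof
    fix x assume "x \<in> lspan A X S"
    then show "x \<in> lspan A (X\<lparr>carrier := H\<rparr>) S"
    proof induct
      case zero show ?case using lspan.zero[of "X\<lparr>carrier := H\<rparr>"] by simp
    next
      case (step a s x)
      then show ?case using lspan.step[OF step(1,2,4)] by simp
    qed
  qed
qed

lemma fg_subm_iff:
  assumes X: "lmodule A X" and H: "subm A X H"
  shows "finitely_generated A (X\<lparr>carrier := H\<rparr>) \<longleftrightarrow> (\<exists>S. finite S \<and> S \<subseteq> H \<and> H \<subseteq> lspan A X S)"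
  using fg_iff_lspan[OF subm_lmodule[OF X H]] by (simp add: lspan_restrict)

text \<open>With \<open>s\<close> as the leading generator, these are the leading coefficients of the elements of \<open>H\<close>.\<close>

lemma leading_coefficient_ideal:
  assumes R: "cring R" and X: "lmodule R X" and S: "S \<subseteq> carrier X" "s \<in> carrier X" and H: "subm R X H"
  shows "ideal {r \<in> carrier R. \<exists>y\<in>lspan R X S. r \<odot>\<^bsub>X\<^esub> s \<oplus>\<^bsub>X\<^esub> y \<in> H} R" (is "ideal ?I R")
proof -
  interpret R: cring R by fact
  interpret X: lmodule R X by fact
  note L = lspan_subm[OF X S(1)]
  have Lc: "y \<in> carrier X" if "y \<in> lspan R X S" for y using that L by (auto simp: subm_def)
  have sc: "t \<otimes>\<^bsub>R\<^esub> r \<in> ?I" if r: "r \<in> ?I" and t: "t \<in> carrier R" for r t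
  proof -
    obtain y where y: "y \<in> lspan R X S" "r \<odot>\<^bsub>X\<^esub> s \<oplus>\<^bsub>X\<^esub> y \<in> H" using r by auto
    have "t \<odot>\<^bsub>X\<^esub> (r \<odot>\<^bsub>X\<^esub> s \<oplus>\<^bsub>X\<^esub> y) \<in> H" using y H t by (simp add: subm_def)
    moreover have "t \<odot>\<^bsub>X\<^esub> (r \<odot>\<^bsub>X\<^esub> s \<oplus>\<^bsub>X\<^esub> y) = (t \<otimes>\<^bsub>R\<^esub> r) \<odot>\<^bsub>X\<^esub> s \<oplus>\<^bsub>X\<^esub> t \<odot>\<^bsub>X\<^esub> y"
      using r t S(2) Lc[OF y(1)] by (simp add: X.lsmult_r_distr X.lsmult_assoc)
    moreover have "t \<odot>\<^bsub>X\<^esub> y \<in> lspan R X S" using L y t by (simp add: subm_def)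
    ultimately show ?thesis using r t by auto
  qed
  show ?thesis
  proof (rule idealI)
    show "subgroup ?I (add_monoid R)"
    proof
      show "?I \<subseteq> carrier (add_monoid R)" by auto
      have "\<zero>\<^bsub>R\<^esub> \<odot>\<^bsub>X\<^esub> s \<oplus>\<^bsub>X\<^esub> \<zero>\<^bsub>X\<^esub> \<in> H" using S(2) H by (simp add: subm_def)
      then show "\<one>\<^bsub>add_monoid R\<^esub> \<in> ?I" using lspan.zero[of X R S] by auto
      fix r assume r: "r \<in> ?I"
      have "inv\<^bsub>add_monoid R\<^esub> r = (\<ominus>\<^bsub>R\<^esub> \<one>\<^bsub>R\<^esub>) \<otimes>\<^bsub>R\<^esub> r"
        using r by (simp add: a_inv_def[symmetric] R.l_minus)
      then show "inv\<^bsub>add_monoid R\<^esub> r \<in> ?I" using sc[OF r] by simp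
      fix t assume t: "t \<in> ?I"
      obtain y where y: "y \<in> lspan R X S" "r \<odot>\<^bsub>X\<^esub> s \<oplus>\<^bsub>X\<^esub> y \<in> H" using r by auto
      obtain z where z: "z \<in> lspan R X S" "t \<odot>\<^bsub>X\<^esub> s \<oplus>\<^bsub>X\<^esub> z \<in> H" using t by auto
      have "(r \<odot>\<^bsub>X\<^esub> s \<oplus>\<^bsub>X\<^esub> y) \<oplus>\<^bsub>X\<^esub> (t \<odot>\<^bsub>X\<^esub> s \<oplus>\<^bsub>X\<^esub> z) \<in> H" using y z H by (simp add: subm_def)
      moreover have "(r \<odot>\<^bsub>X\<^esub> s \<oplus>\<^bsub>X\<^esub> y) \<oplus>\<^bsub>X\<^esub> (t \<odot>\<^bsub>X\<^esub> s \<oplus>\<^bsub>X\<^esub> z) = (r \<oplus>\<^bsub>R\<^esub> t) \<odot>\<^bsub>X\<^esub> s \<oplus>\<^bsub>X\<^esub> (y \<oplus>\<^bsub>X\<^esub> z)"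
        using r t S(2) Lc[OF y(1)] Lc[OF z(1)] by (simp add: X.lsmult_l_distr X.M.a_ac)
      moreover have "y \<oplus>\<^bsub>X\<^esub> z \<in> lspan R X S" using L y z by (simp add: subm_def)
      ultimately show "r \<otimes>\<^bsub>add_monoid R\<^esub> t \<in> ?I" using r t by auto
    qed
    fix r t assume r: "r \<in> ?I" and t: "t \<in> carrier R"
    show "t \<otimes>\<^bsub>R\<^esub> r \<in> ?I" by (rule sc[OF r t])
    then show "r \<otimes>\<^bsub>R\<^esub> t \<in> ?I" using r t by (simp add: R.m_comm)
  qed (rule R.ring_axioms)
qed

text \<open>The argument of Hilbert's basis theorem: lift generators of the ideal of leading coefficients to \<open>H\<close>,
  subtract, and treat the part of \<open>H\<close> in the span of the remaining generators by induction.\<close>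

lemma noetherian_subm_lspan:
  assumes R: "cring R" "noetherian_ring R" and X: "lmodule R X"
    and S: "finite S" "S \<subseteq> carrier X" and H: "subm R X H" "H \<subseteq> lspan R X S"
  shows "\<exists>T. finite T \<and> T \<subseteq> H \<and> H \<subseteq> lspan R X T"
  using S H
proof (induct S arbitrary: H)
  case empty
  interpret X: lmodule R X by fact
  have "lspan R X {} \<subseteq> {\<zero>\<^bsub>X\<^esub>}" by (rule lspan_least) (auto simp: subm_def)
  then show ?case using empty lspan.zero[of X R "{}"] by (intro exI[of _ "{}"]) auto
next
  case (insert s S)
  interpret R: cring R by fact
  interpret X: lmodule R X by fact
  have S: "S \<subseteq> carrier X" "s \<in> carrier X" using insert by auto
  have Hc: "H \<subseteq> carrier X" using insert by (auto simp: subm_def)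
  note L = lspan_subm[OF X S(1)]
  let ?I = "\<lambda>H. {r \<in> carrier R. \<exists>y\<in>lspan R X S. r \<odot>\<^bsub>X\<^esub> s \<oplus>\<^bsub>X\<^esub> y \<in> H}"
  obtain B where B: "B \<subseteq> carrier R" "finite B" "?I H = Idl\<^bsub>R\<^esub> B"
    using noetherian_ring.finetely_gen[OF R(2) leading_coefficient_ideal[OF R(1) X S insert(5)]] by (elim exE conjE)
  have "\<forall>b\<in>B. \<exists>k. k \<in> H \<and> (\<exists>y\<in>lspan R X S. k = b \<odot>\<^bsub>X\<^esub> s \<oplus>\<^bsub>X\<^esub> y)"
  proof
    fix b assume "b \<in> B"
    then have "b \<in> ?I H" using R.genideal_self[OF B(1)] B(3) by auto
    then show "\<exists>k. k \<in> H \<and> (\<exists>y\<in>lspan R X S. k = b \<odot>\<^bsub>X\<^esub> s \<oplus>\<^bsub>X\<^esub> y)" by auto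
  qed
  from bchoice[OF this] obtain k where "\<forall>b\<in>B. k b \<in> H \<and> (\<exists>y\<in>lspan R X S. k b = b \<odot>\<^bsub>X\<^esub> s \<oplus>\<^bsub>X\<^esub> y)" by (rule exE)
  note k = bspec[OF this, THEN conjunct1] bspec[OF this, THEN conjunct2]
  let ?T1 = "k ` B"
  have T1: "?T1 \<subseteq> H" "?T1 \<subseteq> carrier X" using k(1) Hc by auto
  note L1 = lspan_subm[OF X T1(2)]
  have L1H: "lspan R X ?T1 \<subseteq> H" by (rule lspan_least[OF insert(5) T1(1)])
  \<comment> \<open>the lifts k b realise all leading coefficients of H\<close>
  have "B \<subseteq> ?I (lspan R X ?T1)"
  proof
    fix b assume b: "b \<in> B"
    from k(2)[OF this] obtain y where "y \<in> lspan R X S" "k b = b \<odot>\<^bsub>X\<^esub> s \<oplus>\<^bsub>X\<^esub> y" by (elim bexE)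
    moreover have "k b \<in> lspan R X ?T1" by (rule lspan_incl[OF X T1(2)]) (use b in simp)
    ultimately show "b \<in> ?I (lspan R X ?T1)" using b B(1) by auto
  qed
  then have I: "?I H \<subseteq> ?I (lspan R X ?T1)"
    unfolding B(3) by (rule R.genideal_minimal[OF leading_coefficient_ideal[OF R(1) X S L1]])
  have "subm R X (H \<inter> lspan R X S)" using insert(5) L by (auto simp: subm_def)
  from insert(3)[OF S(1) this Int_lower2] obtain T2 where T2: "finite T2" "T2 \<subseteq> H \<inter> lspan R X S" "H \<inter> lspan R X S \<subseteq> lspan R X T2"
    by (elim exE conjE)
  let ?T = "?T1 \<union> T2"
  have T: "?T \<subseteq> H" using T1 T2 by auto
  note LT = lspan_subm[OF X, of ?T]
  have "h \<in> lspan R X ?T" if h: "h \<in> H" for h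
  proof -
    obtain r y where ry: "r \<in> carrier R" "y \<in> lspan R X S" "h = r \<odot>\<^bsub>X\<^esub> s \<oplus>\<^bsub>X\<^esub> y"
      by (rule lspan_insert[OF X insert(4) subsetD[OF insert(6) h]])
    then have "r \<in> ?I H" using h by auto
    then have "r \<in> ?I (lspan R X ?T1)" using I by auto
    then obtain z where z: "z \<in> lspan R X S" "r \<odot>\<^bsub>X\<^esub> s \<oplus>\<^bsub>X\<^esub> z \<in> lspan R X ?T1" by auto
    let ?g = "r \<odot>\<^bsub>X\<^esub> s \<oplus>\<^bsub>X\<^esub> z"
    have c: "y \<in> carrier X" "z \<in> carrier X" "r \<odot>\<^bsub>X\<^esub> s \<in> carrier X" using ry z L S by (auto simp: subm_def)
    have hg: "h \<ominus>\<^bsub>X\<^esub> ?g = y \<ominus>\<^bsub>X\<^esub> z"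
      using c unfolding ry(3) by (simp add: a_minus_def X.M.minus_add X.M.a_ac X.M.r_neg1 X.M.r_neg2 X.M.r_neg)
    have "h \<ominus>\<^bsub>X\<^esub> ?g \<in> H" by (rule subm_diff[OF X insert(5) h]) (use z L1H in auto)
    moreover have "y \<ominus>\<^bsub>X\<^esub> z \<in> lspan R X S" by (rule subm_diff[OF X L ry(2) z(1)])
    ultimately have "h \<ominus>\<^bsub>X\<^esub> ?g \<in> lspan R X T2" using T2(3) hg by auto
    then have 1: "h \<ominus>\<^bsub>X\<^esub> ?g \<in> lspan R X ?T" using lspan_mono[of T2 ?T R X] by auto
    have 2: "?g \<in> lspan R X ?T" using z(2) lspan_mono[of ?T1 ?T R X] by auto
    have "subm R X (lspan R X ?T)" by (rule LT) (use T Hc in auto)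
    then have "(h \<ominus>\<^bsub>X\<^esub> ?g) \<oplus>\<^bsub>X\<^esub> ?g \<in> lspan R X ?T" using 1 2 by (simp add: subm_def)
    moreover have "(h \<ominus>\<^bsub>X\<^esub> ?g) \<oplus>\<^bsub>X\<^esub> ?g = h" using h Hc c by (auto simp: a_minus_def X.M.a_assoc X.M.l_neg)
    ultimately show ?thesis by simp
  qed
  then have "H \<subseteq> lspan R X ?T" by (rule subsetI)
  moreover have "finite ?T" using B(2) T2(1) by simp
  ultimately show ?case using T by (intro exI[of _ ?T] conjI)
qed

text \<open>Over \<open>R\<close> all modules involved are finitely generated, and generators over \<open>R\<close> are generators over
  \<open>A\<close>.\<close>

lemma fg_submodule:
  assumes R: "noetherian_ring R" and A: "R_algebra R A" "finitely_generated R A"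
    and X: "lmodule A X" "finitely_generated A X" and H: "subm A X H"
  shows "finitely_generated A (X\<lparr>carrier := H\<rparr>)"
proof -
  interpret algebra_over R A by (rule algebra_over.intro[OF A(1)])
  interpret X: lmodule A X by fact
  note rX = restr_lmodule[OF X(1)]
  obtain S where S: "finite S" "S \<subseteq> carrier X" "carrier X \<subseteq> lspan R (restr A X) S"
    using fg_restr[OF X(1) A(2) X(2)] fg_iff_lspan[OF rX] by auto
  have "H \<subseteq> carrier X" using H by (auto simp: subm_def)
  then obtain T where T: "finite T" "T \<subseteq> H" "H \<subseteq> lspan R (restr A X) T"
    using noetherian_subm_lspan[OF R.cring_axioms R rX S(1) _ subm_restr[OF H]] S by auto
  have "x \<in> lspan A X T" if "x \<in> lspan R (restr A X) T" for x
    using that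
  proof induct
    case zero show ?case using lspan.zero[of X] by simp
  next
    case (step r s x)
    then show ?case using lspan.step[of "r \<odot>\<^bsub>A\<^esub> \<one>\<^bsub>A\<^esub>" A s T x X] by simp
  qed
  then show ?thesis using fg_subm_iff[OF X(1) H] T by blast
qed

text \<open>The dependent choice runs over pairs of a projective module and the submodule that the next
  differential has to cover.\<close>

lemma proj_resolution_exists:
  fixes X :: "('a, 'x) module"
  assumes R: "noetherian_ring R" and A: "R_algebra R A" "finitely_generated R A"
    and X: "lmodule A X" "finitely_generated A X"
  obtains P :: "nat \<Rightarrow> ('a, nat \<Rightarrow> 'a) module" and d e where "proj_resolution A X P d e"
proof -
  obtain P0 :: "('a, nat \<Rightarrow> 'a) module" and e where e: "presents A P0 e X" by (rule fg_presents[OF X])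
  have P0: "fgp A P0" "lmodule A P0" and el: "lin A P0 X e" "e ` carrier P0 = carrier X"
    using e by (auto simp: presents_def fgp_def)
  let ?ok = "\<lambda>(n::nat) (\<sigma> :: ('a, nat \<Rightarrow> 'a) module \<times> (nat \<Rightarrow> 'a) set). fgp A (fst \<sigma>) \<and> subm A (fst \<sigma>) (snd \<sigma>) \<and> (n = 0 \<longrightarrow> \<sigma> = (P0, ker P0 X e))"
  let ?next = "\<lambda>(n::nat) \<sigma> \<tau>. \<exists>d. d \<in> lhom A (fst \<tau>) (fst \<sigma>) \<and> d ` carrier (fst \<tau>) = snd \<sigma> \<and> snd \<tau> = ker (fst \<tau>) (fst \<sigma>) d"
  have 0: "?ok 0 (P0, ker P0 X e)" using P0 kernel_subm[OF P0(2) X(1) el(1)] by simp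
  have st: "\<exists>\<tau>. ?ok (Suc n) \<tau> \<and> ?next n \<sigma> \<tau>" if "?ok n \<sigma>" for n \<sigma>
  proof -
    obtain P K where \<sigma>: "\<sigma> = (P, K)" by fastforce
    have P: "fgp A P" "lmodule A P" and K: "subm A P K" using that \<sigma> by (auto simp: fgp_def)
    let ?K = "P\<lparr>carrier := K\<rparr>"
    have "finitely_generated A ?K" by (rule fg_submodule[OF R A P(2) fgp_imp_fg[OF P(1)] K])
    then obtain Q :: "('a, nat \<Rightarrow> 'a) module" and g where "presents A Q g ?K"
      by (rule fg_presents[OF subm_lmodule[OF P(2) K]])
    then have Q: "fgp A Q" "lmodule A Q" and g: "lin A Q ?K g" "g ` carrier Q = K" by (auto simp: presents_def fgp_def)
    have gP: "lin A Q P g" using lin_comp[OF g(1) lin_inclusion[OF K]] .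
    let ?d = "restrict g (carrier Q)"
    have d: "?d \<in> lhom A Q P" "?d ` carrier Q = K"
      using lin_restrict_lhom[OF Q(2) gP] g(2) by auto
    show ?thesis unfolding \<sigma> using Q d kernel_subm[OF Q(2) P(2) lhom_lin[OF d(1)]]
      by (intro exI[of _ "(Q, ker Q P ?d)"]) auto
  qed
  have "\<exists>\<sigma>. \<forall>n. ?ok n (\<sigma> n) \<and> ?next n (\<sigma> n) (\<sigma> (Suc n))"
    by (rule dependent_nat_choice) (rule exI[of _ "(P0, ker P0 X e)"], rule 0, rule st)
  then obtain \<sigma> where \<sigma>': "\<forall>n. ?ok n (\<sigma> n) \<and> ?next n (\<sigma> n) (\<sigma> (Suc n))" by (rule exE)
  note \<sigma> = spec[OF \<sigma>', THEN conjunct1] spec[OF \<sigma>', THEN conjunct2]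
  from choice[OF allI[OF \<sigma>(2)]] obtain d where
    d': "\<forall>n. d n \<in> lhom A (fst (\<sigma> (Suc n))) (fst (\<sigma> n)) \<and> d n ` carrier (fst (\<sigma> (Suc n))) = snd (\<sigma> n) \<and>
        snd (\<sigma> (Suc n)) = ker (fst (\<sigma> (Suc n))) (fst (\<sigma> n)) (d n)" by (rule exE)
  have d: "d n \<in> lhom A (fst (\<sigma> (Suc n))) (fst (\<sigma> n))" "d n ` carrier (fst (\<sigma> (Suc n))) = snd (\<sigma> n)"
    "snd (\<sigma> (Suc n)) = ker (fst (\<sigma> (Suc n))) (fst (\<sigma> n)) (d n)" for n
    using spec[OF d', of n] by auto
  have \<sigma>0: "\<sigma> 0 = (P0, ker P0 X e)" using \<sigma>(1)[of 0] by simp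
  have "proj_resolution A X (\<lambda>n. fst (\<sigma> n)) d (restrict e (carrier P0))"
    unfolding proj_resolution_def a_kernel_eq
  proof (intro conjI allI)
    fix n
    show "fst (\<sigma> n) \<in> proj_mods A" using \<sigma>(1)[of n] by (simp add: proj_mods_iff)
    show "d n \<in> lhom A (fst (\<sigma> (Suc n))) (fst (\<sigma> n))" by (rule d(1))
    show "d (Suc n) ` carrier (fst (\<sigma> (Suc (Suc n)))) = ker (fst (\<sigma> (Suc n))) (fst (\<sigma> n)) (d n)"
      unfolding d(2) by (rule d(3))
  next
    show "restrict e (carrier P0) \<in> lhom A (fst (\<sigma> 0)) X"
      unfolding \<sigma>0 fst_conv by (rule lin_restrict_lhom[OF P0(2) el(1)])
    show "restrict e (carrier P0) ` carrier (fst (\<sigma> 0)) = carrier X"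
      unfolding \<sigma>0 fst_conv using el(2) by simp
    show "d 0 ` carrier (fst (\<sigma> (Suc 0))) = ker (fst (\<sigma> 0)) X (restrict e (carrier P0))"
      unfolding d(2) \<sigma>0 fst_conv snd_conv by auto
  qed
  then show thesis by (rule that)
qed

section \<open>Tensor products\<close>

text \<open>The left factor is a module over the opposite ring, so the two factors share no more than being
  abelian groups on which \<open>S\<close> operates.\<close>

locale tensor_pair = X: abelian_group X + M: abelian_group M
  for S :: "('s, 'z) ring_scheme" and X :: "('s, 'x) module" and M :: "('s, 'm) module" +
  assumes smult_X: "s \<in> carrier S \<Longrightarrow> x \<in> carrier X \<Longrightarrow> s \<odot>\<^bsub>X\<^esub> x \<in> carrier X"
    and smult_M: "s \<in> carrier S \<Longrightarrow> m \<in> carrier M \<Longrightarrow> s \<odot>\<^bsub>M\<^esub> m \<in> carrier M"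
begin

abbreviation "T \<equiv> tensor_free X M"
abbreviation "K \<equiv> tensor_sub S X M"
abbreviation "cls p \<equiv> K #>\<^bsub>T\<^esub> p"

end

text \<open>The pure tensor \<open>x \<otimes> m\<close>.\<close>

definition pt :: "('s, 'z) ring_scheme \<Rightarrow> ('s, 'x) module \<Rightarrow> ('s, 'm) module \<Rightarrow> 'x \<Rightarrow> 'm \<Rightarrow> ('x \<times> 'm \<Rightarrow>\<^sub>0 int) set" where
  "pt S X M x m = tensor_sub S X M #>\<^bsub>tensor_free X M\<^esub> frag_of (x, m)"

lemma hom_closed_carrier: "h \<in> hom G H \<Longrightarrow> x \<in> carrier G \<Longrightarrow> h x \<in> carrier H"
  by (auto simp: hom_def)

lemma eq_minus_of_plus:
  assumes "abelian_group G" "a \<oplus>\<^bsub>G\<^esub> b = c" "a \<in> carrier G" "b \<in> carrier G"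
  shows "a = c \<ominus>\<^bsub>G\<^esub> b"
proof -
  interpret abelian_group G by fact
  show ?thesis using assms(3,4) unfolding assms(2)[symmetric] by (simp add: a_minus_def a_assoc r_neg)
qed

lemma keys_diff_subset: "Poly_Mapping.keys a \<subseteq> B \<Longrightarrow> Poly_Mapping.keys b \<subseteq> B \<Longrightarrow> Poly_Mapping.keys (a - b) \<subseteq> B"
  using keys_diff[of a b] by blast

lemma tensor_simps:
  "carrier (tensor_mod S X M act) = carrier (tensor_group S X M)"
  "\<zero>\<^bsub>tensor_mod S X M act\<^esub> = \<one>\<^bsub>tensor_group S X M\<^esub>"
  "u \<oplus>\<^bsub>tensor_mod S X M act\<^esub> v = u \<otimes>\<^bsub>tensor_group S X M\<^esub> v"
  "b \<odot>\<^bsub>tensor_mod S X M act\<^esub> u = tensor_map S X M X M (act b) (\<lambda>m. m) u"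
  by (simp_all add: tensor_mod_def)

lemma tensor_rels_intros:
  "\<lbrakk>x \<in> carrier X; y \<in> carrier X; m \<in> carrier M\<rbrakk> \<Longrightarrow>
    frag_of (x \<oplus>\<^bsub>X\<^esub> y, m) - frag_of (x, m) - frag_of (y, m) \<in> tensor_rels S X M"
  "\<lbrakk>x \<in> carrier X; m \<in> carrier M; n \<in> carrier M\<rbrakk> \<Longrightarrow>
    frag_of (x, m \<oplus>\<^bsub>M\<^esub> n) - frag_of (x, m) - frag_of (x, n) \<in> tensor_rels S X M"
  "\<lbrakk>s \<in> carrier S; x \<in> carrier X; m \<in> carrier M\<rbrakk> \<Longrightarrow>
    frag_of (s \<odot>\<^bsub>X\<^esub> x, m) - frag_of (x, s \<odot>\<^bsub>M\<^esub> m) \<in> tensor_rels S X M"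
  unfolding tensor_rels_def by blast+

lemma tensor_rels_cases [consumes 1]:
  assumes "r \<in> tensor_rels S X M"
  obtains (1) x y m where "x \<in> carrier X" "y \<in> carrier X" "m \<in> carrier M"
      "r = frag_of (x \<oplus>\<^bsub>X\<^esub> y, m) - frag_of (x, m) - frag_of (y, m)"
    | (2) x m n where "x \<in> carrier X" "m \<in> carrier M" "n \<in> carrier M"
      "r = frag_of (x, m \<oplus>\<^bsub>M\<^esub> n) - frag_of (x, m) - frag_of (x, n)"
    | (3) s x m where "s \<in> carrier S" "x \<in> carrier X" "m \<in> carrier M"
      "r = frag_of (s \<odot>\<^bsub>X\<^esub> x, m) - frag_of (x, s \<odot>\<^bsub>M\<^esub> m)"
  using assms unfolding tensor_rels_def by (elim UnE CollectE exE conjE) simp_all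

context tensor_pair
begin

lemma free_diff_closed: "p \<in> carrier T \<Longrightarrow> q \<in> carrier T \<Longrightarrow> p - q \<in> carrier T"
  by (simp add: keys_diff_subset)

lemma rels_subset: "tensor_rels S X M \<subseteq> carrier T"
  unfolding tensor_rels_def
  by (auto intro!: free_diff_closed simp: smult_X smult_M simp del: carrier_free_Abelian_group_iff)

lemma sub_subgroup: "subgroup K T"
  unfolding tensor_sub_def by (rule group.generate_is_subgroup[OF group_free_Abelian_group rels_subset])

lemma sub_normal: "K \<lhd> T"
  using sub_subgroup abelian_free_Abelian_group[of "carrier X \<times> carrier M"]
  by (simp add: comm_group.normal_iff_subgroup)

lemma cls_hom: "cls \<in> hom T (tensor_group S X M)"
  unfolding tensor_group_def by (rule normal.r_coset_hom_Mod[OF sub_normal])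

lemma comm_group_tensor: "comm_group (tensor_group S X M)"
  unfolding tensor_group_def by (rule comm_group.abelian_FactGroup[OF abelian_free_Abelian_group sub_subgroup])

lemma carrier_tensor: "carrier (tensor_group S X M) = cls ` carrier T"
  unfolding tensor_group_def by (rule carrier_FactGroup)

lemma cls_add: "p \<in> carrier T \<Longrightarrow> q \<in> carrier T \<Longrightarrow> cls (p + q) = cls p \<otimes>\<^bsub>tensor_group S X M\<^esub> cls q"
  using hom_mult[OF cls_hom, of p q] by simp

lemma cls_closed: "p \<in> carrier T \<Longrightarrow> cls p \<in> carrier (tensor_group S X M)"
  by (simp add: carrier_tensor del: carrier_free_Abelian_group_iff)

lemma cls_eq_one: "p \<in> K \<Longrightarrow> cls p = \<one>\<^bsub>tensor_group S X M\<^esub>"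
  unfolding tensor_group_def one_FactGroup
  using group.coset_join2[OF group_free_Abelian_group _ sub_subgroup] subgroup.subset[OF sub_subgroup] by blast

lemma cls_diff:
  assumes "p \<in> carrier T" "q \<in> carrier T"
  shows "cls (p - q) \<otimes>\<^bsub>tensor_group S X M\<^esub> cls q = cls p"
proof -
  have "p - q \<in> carrier T" using assms by (simp add: keys_diff_subset)
  from cls_add[OF this assms(2)] show ?thesis by simp
qed

lemma abelian_group_tensor: "abelian_group (tensor_mod S X M act)"
  by (rule comm_group_abelian_groupI, rule comm_groupI)
    (use comm_groupE[OF comm_group_tensor] in \<open>simp_all add: tensor_simps\<close>)

lemma pt_closed: "x \<in> carrier X \<Longrightarrow> m \<in> carrier M \<Longrightarrow> pt S X M x m \<in> carrier (tensor_mod S X M act)"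
  unfolding pt_def tensor_simps by (rule cls_closed) simp

lemma pt_eqI:
  assumes "frag_of a - frag_of b - frag_of c \<in> tensor_rels S X M"
    and "a \<in> carrier X \<times> carrier M" "b \<in> carrier X \<times> carrier M" "c \<in> carrier X \<times> carrier M"
  shows "cls (frag_of a) = cls (frag_of b) \<otimes>\<^bsub>tensor_group S X M\<^esub> cls (frag_of c)"
proof -
  interpret G: comm_group "tensor_group S X M" by (rule comm_group_tensor)
  have "frag_of a - frag_of b - frag_of c \<in> K" unfolding tensor_sub_def by (rule generate.incl[OF assms(1)])
  then have 0: "cls (frag_of a - frag_of b - frag_of c) = \<one>\<^bsub>tensor_group S X M\<^esub>" by (rule cls_eq_one)
  have fr: "frag_of a \<in> carrier T" "frag_of b \<in> carrier T" "frag_of c \<in> carrier T" using assms(2-4) by auto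
  then have d: "frag_of a - frag_of b - frag_of c \<in> carrier T" "frag_of b + frag_of c \<in> carrier T"
    using free_diff_closed[OF free_diff_closed] keys_add[of "frag_of b" "frag_of c"] by auto
  from cls_add[OF d] have "cls (frag_of a) = \<one>\<^bsub>tensor_group S X M\<^esub> \<otimes>\<^bsub>tensor_group S X M\<^esub> cls (frag_of b + frag_of c)"
    unfolding 0 by simp
  then show ?thesis using cls_add[OF fr(2,3)] cls_closed[OF fr(2)] cls_closed[OF fr(3)] by simp
qed

lemma pt_add_left:
  assumes "x \<in> carrier X" "y \<in> carrier X" "m \<in> carrier M"
  shows "pt S X M (x \<oplus>\<^bsub>X\<^esub> y) m = pt S X M x m \<oplus>\<^bsub>tensor_mod S X M act\<^esub> pt S X M y m"
  unfolding pt_def tensor_simps by (rule pt_eqI) (use assms in \<open>auto simp: tensor_rels_def\<close>)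

lemma pt_add_right:
  assumes "x \<in> carrier X" "m \<in> carrier M" "n \<in> carrier M"
  shows "pt S X M x (m \<oplus>\<^bsub>M\<^esub> n) = pt S X M x m \<oplus>\<^bsub>tensor_mod S X M act\<^esub> pt S X M x n"
  unfolding pt_def tensor_simps by (rule pt_eqI) (use assms in \<open>auto simp: tensor_rels_def\<close>)

lemma pt_balanced:
  assumes "s \<in> carrier S" "x \<in> carrier X" "m \<in> carrier M"
  shows "pt S X M (s \<odot>\<^bsub>X\<^esub> x) m = pt S X M x (s \<odot>\<^bsub>M\<^esub> m)"
proof -
  interpret G: comm_group "tensor_group S X M" by (rule comm_group_tensor)
  have "frag_of (s \<odot>\<^bsub>X\<^esub> x, m) - frag_of (x, s \<odot>\<^bsub>M\<^esub> m) \<in> tensor_rels S X M"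
    using assms by (auto simp: tensor_rels_def)
  then have "cls (frag_of (s \<odot>\<^bsub>X\<^esub> x, m) - frag_of (x, s \<odot>\<^bsub>M\<^esub> m)) = \<one>\<^bsub>tensor_group S X M\<^esub>"
    by (intro cls_eq_one) (simp add: tensor_sub_def generate.incl)
  moreover have fr: "frag_of (s \<odot>\<^bsub>X\<^esub> x, m) \<in> carrier T" "frag_of (x, s \<odot>\<^bsub>M\<^esub> m) \<in> carrier T"
    using assms smult_X smult_M by simp_all
  ultimately show ?thesis using cls_diff[OF fr] cls_closed[OF fr(2)] unfolding pt_def by simp
qed

lemma pt_zero_left:
  assumes "m \<in> carrier M" shows "pt S X M \<zero>\<^bsub>X\<^esub> m = \<zero>\<^bsub>tensor_mod S X M act\<^esub>"
proof -
  interpret G: abelian_group "tensor_mod S X M act" by (rule abelian_group_tensor)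
  have "pt S X M \<zero>\<^bsub>X\<^esub> m \<oplus>\<^bsub>tensor_mod S X M act\<^esub> pt S X M \<zero>\<^bsub>X\<^esub> m = pt S X M \<zero>\<^bsub>X\<^esub> m"
    using pt_add_left[of "\<zero>\<^bsub>X\<^esub>" "\<zero>\<^bsub>X\<^esub>" m act] assms by simp
  then show ?thesis using pt_closed[OF X.zero_closed assms, of act] by (metis G.add.l_cancel_one' G.zero_closed)
qed

lemma pt_zero_right:
  assumes "x \<in> carrier X" shows "pt S X M x \<zero>\<^bsub>M\<^esub> = \<zero>\<^bsub>tensor_mod S X M act\<^esub>"
proof -
  interpret G: abelian_group "tensor_mod S X M act" by (rule abelian_group_tensor)
  have "pt S X M x \<zero>\<^bsub>M\<^esub> \<oplus>\<^bsub>tensor_mod S X M act\<^esub> pt S X M x \<zero>\<^bsub>M\<^esub> = pt S X M x \<zero>\<^bsub>M\<^esub>"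
    using pt_add_right[of x "\<zero>\<^bsub>M\<^esub>" "\<zero>\<^bsub>M\<^esub>" act] assms by simp
  then show ?thesis using pt_closed[OF assms M.zero_closed, of act] by (metis G.add.l_cancel_one' G.zero_closed)
qed

text \<open>Differences cover sums and negatives at once, as in the induction for free abelian groups.\<close>

lemma tensor_induct:
  assumes u: "u \<in> carrier (tensor_mod S X M act)"
    and 0: "P \<zero>\<^bsub>tensor_mod S X M act\<^esub>"
    and pure: "\<And>x m. x \<in> carrier X \<Longrightarrow> m \<in> carrier M \<Longrightarrow> P (pt S X M x m)"
    and diff: "\<And>u v. u \<in> carrier (tensor_mod S X M act) \<Longrightarrow> v \<in> carrier (tensor_mod S X M act) \<Longrightarrow>
      P u \<Longrightarrow> P v \<Longrightarrow> P (u \<ominus>\<^bsub>tensor_mod S X M act\<^esub> v)"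
  shows "P u"
proof -
  interpret G: abelian_group "tensor_mod S X M act" by (rule abelian_group_tensor)
  obtain p where p: "Poly_Mapping.keys p \<subseteq> carrier X \<times> carrier M" "u = cls p"
    using u by (auto simp: tensor_simps carrier_tensor)
  have "P (cls p)"
  proof (rule free_Abelian_group_induct[OF p(1), of "\<lambda>p. P (cls p)"], goal_cases)
    case 1
    have "0 \<in> K" using subgroup.one_closed[OF sub_subgroup] by simp
    from cls_eq_one[OF this] show ?case using 0 by (simp add: tensor_simps)
  next
    case (2 p q)
    then have pq: "p \<in> carrier T" "q \<in> carrier T" "p - q \<in> carrier T" by (simp_all add: keys_diff_subset)
    note c = cls_closed[OF pq(1)] cls_closed[OF pq(2)] cls_closed[OF pq(3)]
    have "cls (p - q) \<oplus>\<^bsub>tensor_mod S X M act\<^esub> cls q = cls p" unfolding tensor_simps by (rule cls_diff[OF pq(1,2)])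
    then have "cls p \<ominus>\<^bsub>tensor_mod S X M act\<^esub> cls q = (cls (p - q) \<oplus>\<^bsub>tensor_mod S X M act\<^esub> cls q) \<ominus>\<^bsub>tensor_mod S X M act\<^esub> cls q"
      by simp
    also have "\<dots> = cls (p - q)" using c[folded tensor_simps(1)[of S X M act]] by (simp add: a_minus_def G.a_assoc G.r_neg)
    finally show ?case using diff[of "cls p" "cls q"] c 2(3,4) by (simp add: tensor_simps(1))
  next
    case (3 a)
    then show ?case using pure[of "fst a" "snd a"] by (auto simp: pt_def)
  qed
  then show ?thesis using p by simp
qed

text \<open>The universal property: the extension of a balanced map to the free abelian group kills the relations
  and hence the subgroup that they generate.\<close>

lemma tensor_lift:
  fixes G :: "('g, 'h) ring_scheme" and \<beta> :: "'x \<Rightarrow> 'm \<Rightarrow> 'g"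
  assumes G: "abelian_group G"
    and closed: "\<And>x m. x \<in> carrier X \<Longrightarrow> m \<in> carrier M \<Longrightarrow> \<beta> x m \<in> carrier G"
    and addl: "\<And>x y m. x \<in> carrier X \<Longrightarrow> y \<in> carrier X \<Longrightarrow> m \<in> carrier M \<Longrightarrow> \<beta> (x \<oplus>\<^bsub>X\<^esub> y) m = \<beta> x m \<oplus>\<^bsub>G\<^esub> \<beta> y m"
    and addr: "\<And>x m n. x \<in> carrier X \<Longrightarrow> m \<in> carrier M \<Longrightarrow> n \<in> carrier M \<Longrightarrow> \<beta> x (m \<oplus>\<^bsub>M\<^esub> n) = \<beta> x m \<oplus>\<^bsub>G\<^esub> \<beta> x n"
    and bal: "\<And>s x m. s \<in> carrier S \<Longrightarrow> x \<in> carrier X \<Longrightarrow> m \<in> carrier M \<Longrightarrow> \<beta> (s \<odot>\<^bsub>X\<^esub> x) m = \<beta> x (s \<odot>\<^bsub>M\<^esub> m)"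
  obtains h where "\<And>u. u \<in> carrier (tensor_mod S X M act) \<Longrightarrow> h u \<in> carrier G"
    "\<And>u v. u \<in> carrier (tensor_mod S X M act) \<Longrightarrow> v \<in> carrier (tensor_mod S X M act) \<Longrightarrow>
      h (u \<oplus>\<^bsub>tensor_mod S X M act\<^esub> v) = h u \<oplus>\<^bsub>G\<^esub> h v"
    "\<And>x m. x \<in> carrier X \<Longrightarrow> m \<in> carrier M \<Longrightarrow> h (pt S X M x m) = \<beta> x m"
proof -
  interpret G: abelian_group G by fact
  have im: "(\<lambda>(x, m). \<beta> x m) ` (carrier X \<times> carrier M) \<subseteq> carrier (add_monoid G)" using closed by auto
  obtain h0 where h0: "h0 \<in> hom T (add_monoid G)" "\<And>a. a \<in> carrier X \<times> carrier M \<Longrightarrow> h0 (frag_of a) = (\<lambda>(x, m). \<beta> x m) a"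
    by (rule comm_group.free_Abelian_group_universal[OF G.a_comm_group im]) (rule that)
  interpret h0: group_hom T "add_monoid G" h0
    by (intro group_hom.intro group_hom_axioms.intro h0(1) G.a_group group_free_Abelian_group)
  have h0d: "h0 (p - q) = h0 p \<oplus>\<^bsub>G\<^esub> \<ominus>\<^bsub>G\<^esub> h0 q" if "p \<in> carrier T" "q \<in> carrier T" for p q
  proof -
    have pq: "p - q \<in> carrier T" using that by (simp add: keys_diff_subset)
    have "h0 (p - q) \<oplus>\<^bsub>G\<^esub> h0 q = h0 p" using hom_mult[OF h0(1) pq that(2)] by simp
    moreover have "h0 (p - q) \<in> carrier G" "h0 q \<in> carrier G" using hom_closed_carrier[OF h0(1)] pq that(2) by auto
    ultimately show ?thesis unfolding a_minus_def[symmetric] by (rule eq_minus_of_plus[OF G])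
  qed
  have fr: "frag_of (x, m) \<in> carrier T" if "x \<in> carrier X" "m \<in> carrier M" for x m using that by simp
  have frd: "p - q \<in> carrier T" if "p \<in> carrier T" "q \<in> carrier T" for p q using that by (simp add: keys_diff_subset)
  have h0r: "h0 r = \<zero>\<^bsub>G\<^esub>" if r: "r \<in> tensor_rels S X M" for r
  proof -
    have z: "(a \<oplus>\<^bsub>G\<^esub> b) \<oplus>\<^bsub>G\<^esub> \<ominus>\<^bsub>G\<^esub> a \<oplus>\<^bsub>G\<^esub> \<ominus>\<^bsub>G\<^esub> b = \<zero>\<^bsub>G\<^esub>" if "a \<in> carrier G" "b \<in> carrier G" for a b
      using that G.r_neg[of "a \<oplus>\<^bsub>G\<^esub> b"] by (simp add: G.minus_add G.a_assoc)
    show ?thesis using r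
    proof (cases rule: tensor_rels_cases)
      case (1 x y m)
      then have "h0 r = \<beta> (x \<oplus>\<^bsub>X\<^esub> y) m \<oplus>\<^bsub>G\<^esub> \<ominus>\<^bsub>G\<^esub> \<beta> x m \<oplus>\<^bsub>G\<^esub> \<ominus>\<^bsub>G\<^esub> \<beta> y m"
        by (simp add: h0d h0(2) fr frd del: carrier_free_Abelian_group_iff)
      then show ?thesis using addl[OF 1(1-3)] z[OF closed[OF 1(1,3)] closed[OF 1(2,3)]] by simp
    next
      case (2 x m n)
      then have "h0 r = \<beta> x (m \<oplus>\<^bsub>M\<^esub> n) \<oplus>\<^bsub>G\<^esub> \<ominus>\<^bsub>G\<^esub> \<beta> x m \<oplus>\<^bsub>G\<^esub> \<ominus>\<^bsub>G\<^esub> \<beta> x n"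
        by (simp add: h0d h0(2) fr frd del: carrier_free_Abelian_group_iff)
      then show ?thesis using addr[OF 2(1-3)] z[OF closed[OF 2(1,2)] closed[OF 2(1,3)]] by simp
    next
      case (3 s x m)
      then have "h0 r = \<beta> (s \<odot>\<^bsub>X\<^esub> x) m \<oplus>\<^bsub>G\<^esub> \<ominus>\<^bsub>G\<^esub> \<beta> x (s \<odot>\<^bsub>M\<^esub> m)"
        by (simp add: h0d h0(2) fr frd smult_X smult_M del: carrier_free_Abelian_group_iff)
      then show ?thesis using bal[OF 3(1-3)] closed[OF 3(2) smult_M[OF 3(1,3)]] by (simp add: G.r_neg)
    qed
  qed
  have "tensor_rels S X M \<subseteq> kernel T (add_monoid G) h0" using h0r rels_subset by (intro subsetI) (simp add: kernel_def subset_iff del: carrier_free_Abelian_group_iff)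
  then have ker: "K \<subseteq> kernel T (add_monoid G) h0"
    unfolding tensor_sub_def by (rule group.generate_subgroup_incl[OF group_free_Abelian_group _ h0.subgroup_kernel])
  have wd: "h0 p = h0 q" if pq: "p \<in> carrier T" "q \<in> carrier T" "cls p = cls q" for p q
  proof -
    have "p \<in> cls q" using group.rcos_self[OF group_free_Abelian_group pq(1) sub_subgroup] pq(3) by simp
    then obtain k where k: "k \<in> K" "p = k + q" unfolding r_coset_def by auto
    have "k \<in> carrier T" "h0 k = \<zero>\<^bsub>G\<^esub>" using subsetD[OF ker k(1)] by (simp_all add: kernel_def)
    then show ?thesis using hom_mult[OF h0(1), of k q] hom_closed_carrier[OF h0(1) pq(2)] pq(2) k(2) by simp
  qed
  obtain h where h: "h \<in> hom (T Mod K) (add_monoid G)" "\<And>p. p \<in> carrier T \<Longrightarrow> h (cls p) = h0 p"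
    by (rule FactGroup_universal[OF h0(1) sub_normal]) (erule (2) wd, rule that)
  show thesis
  proof (rule that[of h])
    fix u v assume uv: "u \<in> carrier (tensor_mod S X M act)" "v \<in> carrier (tensor_mod S X M act)"
    show "h (u \<oplus>\<^bsub>tensor_mod S X M act\<^esub> v) = h u \<oplus>\<^bsub>G\<^esub> h v"
      using hom_mult[OF h(1), of u v] uv by (simp add: tensor_simps tensor_group_def)
  next
    fix u assume uv: "u \<in> carrier (tensor_mod S X M act)"
    show "h u \<in> carrier G" using hom_closed_carrier[OF h(1), of u] uv by (simp add: tensor_simps tensor_group_def)
  next
    fix x m assume "x \<in> carrier X" "m \<in> carrier M"
    then show "h (pt S X M x m) = \<beta> x m" unfolding pt_def using h(2)[OF fr] h0(2)[of "(x, m)"] by simp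
  qed
qed

end

lemma (in tensor_pair) tensor_ext:
  assumes G: "abelian_group G" and f: "\<And>u. u \<in> carrier (tensor_mod S X M act) \<Longrightarrow> f u \<in> carrier G"
    "\<And>u v. u \<in> carrier (tensor_mod S X M act) \<Longrightarrow> v \<in> carrier (tensor_mod S X M act) \<Longrightarrow>
      f (u \<oplus>\<^bsub>tensor_mod S X M act\<^esub> v) = f u \<oplus>\<^bsub>G\<^esub> f v"
    and g: "\<And>u. u \<in> carrier (tensor_mod S X M act) \<Longrightarrow> g u \<in> carrier G"
    "\<And>u v. u \<in> carrier (tensor_mod S X M act) \<Longrightarrow> v \<in> carrier (tensor_mod S X M act) \<Longrightarrow>
      g (u \<oplus>\<^bsub>tensor_mod S X M act\<^esub> v) = g u \<oplus>\<^bsub>G\<^esub> g v"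
    and eq: "\<And>x m. x \<in> carrier X \<Longrightarrow> m \<in> carrier M \<Longrightarrow> f (pt S X M x m) = g (pt S X M x m)"
    and u: "u \<in> carrier (tensor_mod S X M act)"
  shows "f u = g u"
proof -
  interpret G: abelian_group G by fact
  interpret T: abelian_group "tensor_mod S X M act" by (rule abelian_group_tensor)
  have z: "k \<zero>\<^bsub>tensor_mod S X M act\<^esub> = \<zero>\<^bsub>G\<^esub>"
    if "\<And>u. u \<in> carrier (tensor_mod S X M act) \<Longrightarrow> k u \<in> carrier G"
      "\<And>u v. u \<in> carrier (tensor_mod S X M act) \<Longrightarrow> v \<in> carrier (tensor_mod S X M act) \<Longrightarrow>
        k (u \<oplus>\<^bsub>tensor_mod S X M act\<^esub> v) = k u \<oplus>\<^bsub>G\<^esub> k v" for k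
    using that(2)[of "\<zero>\<^bsub>tensor_mod S X M act\<^esub>" "\<zero>\<^bsub>tensor_mod S X M act\<^esub>"] that(1)[of "\<zero>\<^bsub>tensor_mod S X M act\<^esub>"]
    by (metis G.add.l_cancel_one' T.l_zero T.zero_closed)
  have d: "k (u \<ominus>\<^bsub>tensor_mod S X M act\<^esub> v) = k u \<ominus>\<^bsub>G\<^esub> k v"
    if k: "\<And>u. u \<in> carrier (tensor_mod S X M act) \<Longrightarrow> k u \<in> carrier G"
      "\<And>u v. u \<in> carrier (tensor_mod S X M act) \<Longrightarrow> v \<in> carrier (tensor_mod S X M act) \<Longrightarrow>
        k (u \<oplus>\<^bsub>tensor_mod S X M act\<^esub> v) = k u \<oplus>\<^bsub>G\<^esub> k v"
      and uv: "u \<in> carrier (tensor_mod S X M act)" "v \<in> carrier (tensor_mod S X M act)" for k u v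
  proof -
    have "k (u \<ominus>\<^bsub>tensor_mod S X M act\<^esub> v) \<oplus>\<^bsub>G\<^esub> k v = k u"
      using k(2)[of "u \<ominus>\<^bsub>tensor_mod S X M act\<^esub> v" v] uv by (simp add: a_minus_def T.a_assoc T.l_neg)
    then show ?thesis by (rule eq_minus_of_plus[OF G _ k(1)[OF T.minus_closed[OF uv]] k(1)[OF uv(2)]])
  qed
  show ?thesis
  proof (rule tensor_induct[OF u, of "\<lambda>u. f u = g u"], goal_cases)
    case 1 show ?case using z[OF f] z[OF g] by simp
  next
    case (2 x m) then show ?case by (rule eq)
  next
    case (3 u v) then show ?case using d[OF f, of u v] d[OF g, of u v] by simp
  qed
qed

lemma tensor_pairI:
  "abelian_group X \<Longrightarrow> abelian_group M \<Longrightarrow> (\<And>s x. s \<in> carrier S \<Longrightarrow> x \<in> carrier X \<Longrightarrow> s \<odot>\<^bsub>X\<^esub> x \<in> carrier X) \<Longrightarrow>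
    (\<And>s m. s \<in> carrier S \<Longrightarrow> m \<in> carrier M \<Longrightarrow> s \<odot>\<^bsub>M\<^esub> m \<in> carrier M) \<Longrightarrow> tensor_pair S X M"
  by (simp add: tensor_pair_def tensor_pair_axioms_def)

subsection \<open>Functoriality\<close>

text \<open>Here linearity over \<open>S\<close> only refers to the given scalar multiplications, so that it applies to
  the left factor, a module over the opposite ring, as well.\<close>

lemma frag_map_closed:
  assumes f: "lin S X X' f" and g: "lin S M M' g" and q: "q \<in> carrier (tensor_free X M)"
  shows "frag_extend (\<lambda>(x, m). frag_of (f x, g m)) q \<in> carrier (tensor_free X' M')"
proof -
  have "Poly_Mapping.keys (frag_extend (\<lambda>(x, m). frag_of (f x, g m)) q) \<subseteq>
      (\<Union>a\<in>Poly_Mapping.keys q. Poly_Mapping.keys (case a of (x, m) \<Rightarrow> frag_of (f x, g m)))"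
    by (rule keys_frag_extend)
  also have "\<dots> \<subseteq> carrier X' \<times> carrier M'"
  proof (rule UN_least)
    fix a assume "a \<in> Poly_Mapping.keys q"
    then have "a \<in> carrier X \<times> carrier M" using q by auto
    then obtain x m where "a = (x, m)" "x \<in> carrier X" "m \<in> carrier M" by (rule SigmaE)
    then show "Poly_Mapping.keys (case a of (x, m) \<Rightarrow> frag_of (f x, g m)) \<subseteq> carrier X' \<times> carrier M'"
      using lin_closed[OF f] lin_closed[OF g] by (simp add: keys_frag_of)
  qed
  finally show ?thesis by simp
qed

lemma frag_map_rels:
  assumes XM: "tensor_pair S X M" and f: "lin S X X' f" and g: "lin S M M' g" and r: "r \<in> tensor_rels S X M"
  shows "frag_extend (\<lambda>(x, m). frag_of (f x, g m)) r \<in> tensor_rels S X' M'"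
proof -
  interpret P: tensor_pair S X M by fact
  note cl = lin_closed[OF f] lin_closed[OF g]
  show ?thesis using r
  proof (cases rule: tensor_rels_cases)
    case (1 x y m)
    then show ?thesis using cl tensor_rels_intros(1)[of "f x" X' "f y" "g m" M' S]
      by (simp add: frag_extend_diff lin_add[OF f])
  next
    case (2 x m n)
    then show ?thesis using cl tensor_rels_intros(2)[of "f x" X' "g m" M' "g n" S]
      by (simp add: frag_extend_diff lin_add[OF g])
  next
    case (3 s x m)
    then show ?thesis using cl tensor_rels_intros(3)[of s S "f x" X' "g m" M']
      by (simp add: frag_extend_diff lin_smult[OF f] lin_smult[OF g])
  qed
qed

text \<open>The induced map of free abelian groups sends relations to relations, so all representatives of a class
  yield the same class.\<close>

lemma tensor_map_cls:
  assumes XM: "tensor_pair S X M" and XM': "tensor_pair S X' M'" and f: "lin S X X' f" and g: "lin S M M' g"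
    and p: "p \<in> carrier (tensor_free X M)"
  shows "tensor_map S X M X' M' f g (tensor_sub S X M #>\<^bsub>tensor_free X M\<^esub> p) =
    tensor_sub S X' M' #>\<^bsub>tensor_free X' M'\<^esub> frag_extend (\<lambda>(x, m). frag_of (f x, g m)) p"
proof -
  interpret P: tensor_pair S X M by fact
  interpret P': tensor_pair S X' M' by fact
  let ?F = "frag_extend (\<lambda>(x, m). frag_of (f x, g m))"
  note Fc = frag_map_closed[OF f g]
  have FK: "?F k \<in> P'.K" if "k \<in> P.K" for k
    using that[unfolded tensor_sub_def]
  proof induct
    case one
    show ?case using subgroup.one_closed[OF P'.sub_subgroup] by simp
  next
    case (incl r)
    have "?F r \<in> tensor_rels S X' M'" by (rule frag_map_rels[OF XM f g incl])
    then show ?case unfolding tensor_sub_def by (rule generate.incl)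
  next
    case (inv r)
    have "?F r \<in> tensor_rels S X' M'" by (rule frag_map_rels[OF XM f g inv])
    then have "inv\<^bsub>P'.T\<^esub> ?F r \<in> P'.K" unfolding tensor_sub_def by (rule generate.inv)
    moreover have r: "r \<in> carrier P.T" by (rule subsetD[OF P.rels_subset inv])
    have "inv\<^bsub>P.T\<^esub> r = - r" "inv\<^bsub>P'.T\<^esub> ?F r = - ?F r" using r Fc[OF r] by simp_all
    ultimately show ?case by (simp add: frag_extend_minus)
  next
    case (eng k l)
    then show ?case using subgroup.m_closed[OF P'.sub_subgroup, of "?F k" "?F l"] by (simp add: frag_extend_add)
  qed
  have "P'.cls (?F q) = P'.cls (?F p)" if q: "q \<in> P.cls p" for q
  proof -
    obtain k where k: "k \<in> P.K" "q = k + p" using q unfolding r_coset_def by auto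
    have kc: "?F k \<in> carrier P'.T" by (rule subsetD[OF subgroup.subset[OF P'.sub_subgroup] FK[OF k(1)]])
    interpret G: comm_group "tensor_group S X' M'" by (rule P'.comm_group_tensor)
    have "P'.cls (?F q) = P'.cls (?F k) \<otimes>\<^bsub>tensor_group S X' M'\<^esub> P'.cls (?F p)"
      unfolding k(2) frag_extend_add by (rule P'.cls_add[OF kc Fc[OF p]])
    then show ?thesis using P'.cls_eq_one[OF FK[OF k(1)]] P'.cls_closed[OF Fc[OF p]] by simp
  qed
  then have "(\<Union>q\<in>P.cls p. P'.cls (?F q)) = (\<Union>q\<in>P.cls p. P'.cls (?F p))" by (rule SUP_cong[OF refl])
  also have "\<dots> = P'.cls (?F p)"
    by (rule UN_constant_eq) (use group.rcos_self[OF group_free_Abelian_group p P.sub_subgroup] in auto)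
  finally show ?thesis using P.cls_closed[OF p] by (simp add: tensor_map_def)
qed

lemma tensor_map_props:
  assumes XM: "tensor_pair S X M" and XM': "tensor_pair S X' M'" and f: "lin S X X' f" and g: "lin S M M' g"
  shows tensor_map_closed: "u \<in> carrier (tensor_mod S X M act) \<Longrightarrow> tensor_map S X M X' M' f g u \<in> carrier (tensor_mod S X' M' act')"
    and tensor_map_add: "u \<in> carrier (tensor_mod S X M act) \<Longrightarrow> v \<in> carrier (tensor_mod S X M act) \<Longrightarrow>
      tensor_map S X M X' M' f g (u \<oplus>\<^bsub>tensor_mod S X M act\<^esub> v) =
      tensor_map S X M X' M' f g u \<oplus>\<^bsub>tensor_mod S X' M' act'\<^esub> tensor_map S X M X' M' f g v"
    and tensor_map_pt: "x \<in> carrier X \<Longrightarrow> m \<in> carrier M \<Longrightarrow> tensor_map S X M X' M' f g (pt S X M x m) = pt S X' M' (f x) (g m)"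
proof -
  interpret P: tensor_pair S X M by fact
  interpret P': tensor_pair S X' M' by fact
  let ?F = "frag_extend (\<lambda>(x, m). frag_of (f x, g m))"
  note cls = tensor_map_cls[OF assms]
  note Fc = frag_map_closed[OF f g]
  show "tensor_map S X M X' M' f g u \<in> carrier (tensor_mod S X' M' act')" if u: "u \<in> carrier (tensor_mod S X M act)" for u
  proof -
    obtain p where "p \<in> carrier P.T" "u = P.cls p"
      using u unfolding tensor_simps P.carrier_tensor by (rule imageE) (rule that)
    then show ?thesis using cls[of p] P'.cls_closed[OF Fc[of p]] by (simp add: tensor_simps)
  qed
  show "tensor_map S X M X' M' f g (u \<oplus>\<^bsub>tensor_mod S X M act\<^esub> v) =
      tensor_map S X M X' M' f g u \<oplus>\<^bsub>tensor_mod S X' M' act'\<^esub> tensor_map S X M X' M' f g v"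
    if u: "u \<in> carrier (tensor_mod S X M act)" and v: "v \<in> carrier (tensor_mod S X M act)" for u v
  proof -
    obtain p where p: "p \<in> carrier P.T" "u = P.cls p"
      using u unfolding tensor_simps P.carrier_tensor by (rule imageE) (rule that)
    obtain q where q: "q \<in> carrier P.T" "v = P.cls q"
      using v unfolding tensor_simps P.carrier_tensor by (rule imageE) (rule that)
    have pq: "p + q \<in> carrier P.T" using p q keys_add[of p q] by auto
    show ?thesis unfolding p(2) q(2) tensor_simps P.cls_add[OF p(1) q(1), symmetric] cls[OF pq] cls[OF p(1)] cls[OF q(1)]
        frag_extend_add by (rule P'.cls_add[OF Fc[OF p(1)] Fc[OF q(1)]])
  qed
  show "tensor_map S X M X' M' f g (pt S X M x m) = pt S X' M' (f x) (g m)" if "x \<in> carrier X" "m \<in> carrier M" for x m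
    using cls[of "frag_of (x, m)"] that by (simp add: pt_def)
qed

lemma tensor_map_ext:
  assumes XM: "tensor_pair S X M" and XM': "tensor_pair S X' M'" and fg: "lin S X X' f" "lin S M M' g" and fg': "lin S X X' f'" "lin S M M' g'"
    and eq: "\<And>x m. x \<in> carrier X \<Longrightarrow> m \<in> carrier M \<Longrightarrow> pt S X' M' (f x) (g m) = pt S X' M' (f' x) (g' m)"
    and u: "u \<in> carrier (tensor_mod S X M act)"
  shows "tensor_map S X M X' M' f g u = tensor_map S X M X' M' f' g' u"
proof -
  interpret P: tensor_pair S X M by fact
  interpret P': tensor_pair S X' M' by fact
  note c = tensor_map_closed[OF XM XM' fg, where act = act and act' = "\<lambda>(_::unit) x. x"]
    tensor_map_add[OF XM XM' fg, where act = act and act' = "\<lambda>(_::unit) x. x"] tensor_map_pt[OF XM XM' fg]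
  note c' = tensor_map_closed[OF XM XM' fg', where act = act and act' = "\<lambda>(_::unit) x. x"]
    tensor_map_add[OF XM XM' fg', where act = act and act' = "\<lambda>(_::unit) x. x"] tensor_map_pt[OF XM XM' fg']
  show ?thesis
    by (rule P.tensor_ext[OF P'.abelian_group_tensor[of "\<lambda>(_::unit) x. x"], where act = act])
      (simp_all add: c c' u eq)
qed

lemma tensor_map_comp:
  assumes XM: "tensor_pair S X M" and XM': "tensor_pair S X' M'" and XM'': "tensor_pair S X'' M''"
    and fg: "lin S X X' f" "lin S M M' g" and fg': "lin S X' X'' f'" "lin S M' M'' g'"
    and u: "u \<in> carrier (tensor_mod S X M act)"
  shows "tensor_map S X' M' X'' M'' f' g' (tensor_map S X M X' M' f g u) = tensor_map S X M X'' M'' (\<lambda>x. f' (f x)) (\<lambda>m. g' (g m)) u"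
proof -
  interpret P: tensor_pair S X M by fact
  interpret P': tensor_pair S X' M' by fact
  interpret P'': tensor_pair S X'' M'' by fact
  note cf = lin_comp[OF fg(1) fg'(1)] lin_comp[OF fg(2) fg'(2)]
  note c = tensor_map_closed[OF XM XM' fg, where act = act and act' = "\<lambda>(_::unit) x. x"]
    tensor_map_add[OF XM XM' fg, where act = act and act' = "\<lambda>(_::unit) x. x"] tensor_map_pt[OF XM XM' fg]
  note c' = tensor_map_closed[OF XM' XM'' fg', where act = "\<lambda>(_::unit) x. x" and act' = "\<lambda>(_::unit) x. x"]
    tensor_map_add[OF XM' XM'' fg', where act = "\<lambda>(_::unit) x. x" and act' = "\<lambda>(_::unit) x. x"] tensor_map_pt[OF XM' XM'' fg']
  note c'' = tensor_map_closed[OF XM XM'' cf, where act = act and act' = "\<lambda>(_::unit) x. x"]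
    tensor_map_add[OF XM XM'' cf, where act = act and act' = "\<lambda>(_::unit) x. x"] tensor_map_pt[OF XM XM'' cf]
  show ?thesis
    by (rule P.tensor_ext[OF P''.abelian_group_tensor[of "\<lambda>(_::unit) x. x"], where act = act])
      (simp_all add: c c' c'' u lin_closed[OF fg(1)] lin_closed[OF fg(2)])
qed

lemma tensor_map_id:
  assumes XM: "tensor_pair S X M" and u: "u \<in> carrier (tensor_mod S X M act)"
  shows "tensor_map S X M X M (\<lambda>x. x) (\<lambda>m. m) u = u"
proof -
  interpret P: tensor_pair S X M by fact
  note c = tensor_map_closed[OF XM XM lin_id lin_id, where act = act and act' = act]
    tensor_map_add[OF XM XM lin_id lin_id, where act = act and act' = act] tensor_map_pt[OF XM XM lin_id lin_id]
  show ?thesis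
    by (rule P.tensor_ext[OF P.abelian_group_tensor[of act], where act = act and g = "\<lambda>u. u"]) (simp_all add: c u)
qed

text \<open>A tensor product carries the module structure of a commuting action on its left factor.\<close>

locale tensor_action = tensor_pair S X M
  for S :: "('s, 'z) ring_scheme" and X :: "('s, 'x) module" and M :: "('s, 'm) module" +
  fixes B :: "('b, 'y) ring_scheme" and act :: "'b \<Rightarrow> 'x \<Rightarrow> 'x"
  assumes B: "ring B" and act_lin: "b \<in> carrier B \<Longrightarrow> lin S X X (act b)"
    and act_add: "b \<in> carrier B \<Longrightarrow> c \<in> carrier B \<Longrightarrow> x \<in> carrier X \<Longrightarrow> act (b \<oplus>\<^bsub>B\<^esub> c) x = act b x \<oplus>\<^bsub>X\<^esub> act c x"
    and act_mult: "b \<in> carrier B \<Longrightarrow> c \<in> carrier B \<Longrightarrow> x \<in> carrier X \<Longrightarrow> act (b \<otimes>\<^bsub>B\<^esub> c) x = act b (act c x)"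
    and act_one: "x \<in> carrier X \<Longrightarrow> act \<one>\<^bsub>B\<^esub> x = x"
begin

lemma pair: "tensor_pair S X M" by (rule tensor_pair_axioms)

abbreviation "TM \<equiv> tensor_mod S X M act"

lemma smult_pt: "b \<in> carrier B \<Longrightarrow> x \<in> carrier X \<Longrightarrow> m \<in> carrier M \<Longrightarrow> b \<odot>\<^bsub>TM\<^esub> pt S X M x m = pt S X M (act b x) m"
  unfolding tensor_simps by (rule tensor_map_pt[OF pair pair act_lin lin_id])

lemma smult_TM_closed: "b \<in> carrier B \<Longrightarrow> u \<in> carrier TM \<Longrightarrow> b \<odot>\<^bsub>TM\<^esub> u \<in> carrier TM"
  unfolding tensor_simps(4) by (rule tensor_map_closed[OF pair pair act_lin lin_id])

lemma smult_TM_add: "b \<in> carrier B \<Longrightarrow> u \<in> carrier TM \<Longrightarrow> v \<in> carrier TM \<Longrightarrow>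
    b \<odot>\<^bsub>TM\<^esub> (u \<oplus>\<^bsub>TM\<^esub> v) = b \<odot>\<^bsub>TM\<^esub> u \<oplus>\<^bsub>TM\<^esub> b \<odot>\<^bsub>TM\<^esub> v"
  unfolding tensor_simps(4) by (rule tensor_map_add[OF pair pair act_lin lin_id])

lemma lmodule_TM: "lmodule B TM"
proof -
  interpret G: abelian_group TM by (rule abelian_group_tensor)
  interpret B: ring B by (rule B)
  show ?thesis
  proof (intro lmodule.intro lmodule_axioms.intro B G.abelian_group_axioms smult_TM_closed smult_TM_add)
    fix b c u assume b: "b \<in> carrier B" and c: "c \<in> carrier B" and u: "u \<in> carrier TM"
    note s = smult_TM_closed smult_TM_add
    show "(b \<oplus>\<^bsub>B\<^esub> c) \<odot>\<^bsub>TM\<^esub> u = b \<odot>\<^bsub>TM\<^esub> u \<oplus>\<^bsub>TM\<^esub> c \<odot>\<^bsub>TM\<^esub> u"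
    proof (rule tensor_ext[OF abelian_group_tensor[of act], where act = act and f = "\<lambda>u. (b \<oplus>\<^bsub>B\<^esub> c) \<odot>\<^bsub>TM\<^esub> u"])
      fix x m assume "x \<in> carrier X" "m \<in> carrier M"
      then show "(b \<oplus>\<^bsub>B\<^esub> c) \<odot>\<^bsub>TM\<^esub> pt S X M x m = b \<odot>\<^bsub>TM\<^esub> pt S X M x m \<oplus>\<^bsub>TM\<^esub> c \<odot>\<^bsub>TM\<^esub> pt S X M x m"
        using b c by (simp add: smult_pt act_add pt_add_left[of _ _ _ act] lin_closed[OF act_lin])
    qed (use b c u in \<open>simp_all add: s G.a_ac\<close>)
    show "(b \<otimes>\<^bsub>B\<^esub> c) \<odot>\<^bsub>TM\<^esub> u = b \<odot>\<^bsub>TM\<^esub> (c \<odot>\<^bsub>TM\<^esub> u)"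
      by (rule tensor_ext[OF abelian_group_tensor[of act], where act = act and f = "\<lambda>u. (b \<otimes>\<^bsub>B\<^esub> c) \<odot>\<^bsub>TM\<^esub> u"])
        (use b c u in \<open>simp_all add: s smult_pt act_mult lin_closed[OF act_lin]\<close>)
  next
    fix u assume u: "u \<in> carrier TM"
    show "\<one>\<^bsub>B\<^esub> \<odot>\<^bsub>TM\<^esub> u = u"
      by (rule tensor_ext[OF abelian_group_tensor[of act], where act = act and f = "\<lambda>u. \<one>\<^bsub>B\<^esub> \<odot>\<^bsub>TM\<^esub> u"])
        (use u in \<open>simp_all add: smult_TM_closed smult_TM_add smult_pt act_one\<close>)
  qed
qed

lemma lift_lin:
  fixes G :: "('b, 'g) module" and \<beta> :: "'x \<Rightarrow> 'm \<Rightarrow> 'g"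
  assumes G: "lmodule B G"
    and closed: "\<And>x m. x \<in> carrier X \<Longrightarrow> m \<in> carrier M \<Longrightarrow> \<beta> x m \<in> carrier G"
    and addl: "\<And>x y m. x \<in> carrier X \<Longrightarrow> y \<in> carrier X \<Longrightarrow> m \<in> carrier M \<Longrightarrow> \<beta> (x \<oplus>\<^bsub>X\<^esub> y) m = \<beta> x m \<oplus>\<^bsub>G\<^esub> \<beta> y m"
    and addr: "\<And>x m n. x \<in> carrier X \<Longrightarrow> m \<in> carrier M \<Longrightarrow> n \<in> carrier M \<Longrightarrow> \<beta> x (m \<oplus>\<^bsub>M\<^esub> n) = \<beta> x m \<oplus>\<^bsub>G\<^esub> \<beta> x n"
    and bal: "\<And>s x m. s \<in> carrier S \<Longrightarrow> x \<in> carrier X \<Longrightarrow> m \<in> carrier M \<Longrightarrow> \<beta> (s \<odot>\<^bsub>X\<^esub> x) m = \<beta> x (s \<odot>\<^bsub>M\<^esub> m)"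
    and act: "\<And>b x m. b \<in> carrier B \<Longrightarrow> x \<in> carrier X \<Longrightarrow> m \<in> carrier M \<Longrightarrow> \<beta> (act b x) m = b \<odot>\<^bsub>G\<^esub> \<beta> x m"
  shows "\<exists>h. lin B TM G h \<and> (\<forall>x\<in>carrier X. \<forall>m\<in>carrier M. h (pt S X M x m) = \<beta> x m)"
proof -
  interpret G: lmodule B G by fact
  obtain h where h: "\<And>u. u \<in> carrier TM \<Longrightarrow> h u \<in> carrier G"
    "\<And>u v. u \<in> carrier TM \<Longrightarrow> v \<in> carrier TM \<Longrightarrow> h (u \<oplus>\<^bsub>TM\<^esub> v) = h u \<oplus>\<^bsub>G\<^esub> h v"
    "\<And>x m. x \<in> carrier X \<Longrightarrow> m \<in> carrier M \<Longrightarrow> h (pt S X M x m) = \<beta> x m"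
    by (rule tensor_lift[where \<beta> = \<beta> and act = act, OF G.M.abelian_group_axioms])
      (erule (1) closed, erule (2) addl, erule (2) addr, erule (2) bal, rule that)
  have "lin B TM G h"
  proof (rule linI[OF h(1,2)])
    fix b u assume b: "b \<in> carrier B" and u: "u \<in> carrier TM"
    show "h (b \<odot>\<^bsub>TM\<^esub> u) = b \<odot>\<^bsub>G\<^esub> h u"
      by (rule tensor_ext[OF G.M.abelian_group_axioms, where act = act and f = "\<lambda>u. h (b \<odot>\<^bsub>TM\<^esub> u)"])
        (use b u in \<open>simp_all add: h smult_TM_closed smult_TM_add smult_pt act lin_closed[OF act_lin] G.lsmult_r_distr\<close>)
  qed
  with h(3) show ?thesis by (intro exI[of _ h]) simp
qed

lemma lin_ext:
  assumes G: "lmodule B G" and f: "lin B TM G f" and g: "lin B TM G g"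
    and eq: "\<And>x m. x \<in> carrier X \<Longrightarrow> m \<in> carrier M \<Longrightarrow> f (pt S X M x m) = g (pt S X M x m)" and u: "u \<in> carrier TM"
  shows "f u = g u"
  by (rule tensor_ext[OF lmodule_abelian_group[OF G], where act = act])
    (use u in \<open>simp_all add: eq lin_closed[OF f] lin_closed[OF g] lin_add[OF f] lin_add[OF g]\<close>)

lemma in_subm:
  assumes H: "subm B TM H" and eq: "\<And>x m. x \<in> carrier X \<Longrightarrow> m \<in> carrier M \<Longrightarrow> pt S X M x m \<in> H" and u: "u \<in> carrier TM"
  shows "u \<in> H"
proof (rule tensor_induct[OF u, of "\<lambda>u. u \<in> H"], goal_cases)
  case 1 show ?case using H by (simp add: subm_def)
next
  case (2 x m) then show ?case by (rule eq)
next
  case (3 u v) then show ?case using subm_diff[OF lmodule_TM H] by simp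
qed

end

lemma tensor_map_lin:
  assumes 1: "tensor_action S X M B act" and 2: "tensor_action S X' M' B act'" and f: "lin S X X' f" and g: "lin S M M' g"
    and fa: "\<And>b x. b \<in> carrier B \<Longrightarrow> x \<in> carrier X \<Longrightarrow> f (act b x) = act' b (f x)"
  shows "lin B (tensor_mod S X M act) (tensor_mod S X' M' act') (tensor_map S X M X' M' f g)"
proof -
  interpret P: tensor_action S X M B act by fact
  interpret P': tensor_action S X' M' B act' by fact
  note c = tensor_map_closed[OF P.pair P'.pair f g, of _ act act'] tensor_map_add[OF P.pair P'.pair f g, of _ act _ act'] tensor_map_pt[OF P.pair P'.pair f g]
  show ?thesis
  proof (rule linI[OF c(1,2)])
    fix b u assume b: "b \<in> carrier B" and u: "u \<in> carrier P.TM"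
    show "tensor_map S X M X' M' f g (b \<odot>\<^bsub>P.TM\<^esub> u) = b \<odot>\<^bsub>P'.TM\<^esub> tensor_map S X M X' M' f g u"
    proof (rule P.tensor_ext[OF P'.abelian_group_tensor[of act'], where act = act and f = "\<lambda>u. tensor_map S X M X' M' f g (b \<odot>\<^bsub>P.TM\<^esub> u)"])
      fix u assume u: "u \<in> carrier P.TM"
      note bu = P.smult_TM_closed[OF b u]
      show "tensor_map S X M X' M' f g (b \<odot>\<^bsub>P.TM\<^esub> u) \<in> carrier P'.TM" by (rule c(1)[OF bu])
      show "b \<odot>\<^bsub>P'.TM\<^esub> tensor_map S X M X' M' f g u \<in> carrier P'.TM" by (rule P'.smult_TM_closed[OF b c(1)[OF u]])
      fix v assume v: "v \<in> carrier P.TM"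
      show "tensor_map S X M X' M' f g (b \<odot>\<^bsub>P.TM\<^esub> (u \<oplus>\<^bsub>P.TM\<^esub> v)) =
          tensor_map S X M X' M' f g (b \<odot>\<^bsub>P.TM\<^esub> u) \<oplus>\<^bsub>P'.TM\<^esub> tensor_map S X M X' M' f g (b \<odot>\<^bsub>P.TM\<^esub> v)"
        unfolding P.smult_TM_add[OF b u v] by (rule c(2)[OF bu P.smult_TM_closed[OF b v]])
      show "b \<odot>\<^bsub>P'.TM\<^esub> tensor_map S X M X' M' f g (u \<oplus>\<^bsub>P.TM\<^esub> v) =
          b \<odot>\<^bsub>P'.TM\<^esub> tensor_map S X M X' M' f g u \<oplus>\<^bsub>P'.TM\<^esub> b \<odot>\<^bsub>P'.TM\<^esub> tensor_map S X M X' M' f g v"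
        unfolding c(2)[OF u v] by (rule P'.smult_TM_add[OF b c(1)[OF u] c(1)[OF v]])
    next
      fix x m assume x: "x \<in> carrier X" and m: "m \<in> carrier M"
      show "tensor_map S X M X' M' f g (b \<odot>\<^bsub>P.TM\<^esub> pt S X M x m) = b \<odot>\<^bsub>P'.TM\<^esub> tensor_map S X M X' M' f g (pt S X M x m)"
        unfolding P.smult_pt[OF b x m] c(3)[OF x m] c(3)[OF lin_closed[OF P.act_lin[OF b] x] m] fa[OF b x]
        by (rule P'.smult_pt[OF b lin_closed[OF f x] lin_closed[OF g m], symmetric])
    qed (rule u)
  qed
qed

text \<open>Right exactness in both variables at once: modulo a submodule \<open>H\<close> that contains all pure tensors with
  one factor in a kernel, the class of \<open>x \<otimes> m\<close> depends on \<open>f x\<close> and \<open>g m\<close> only.  So \<open>f \<otimes> g\<close> has a left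
  inverse modulo \<open>H\<close>, and its kernel is contained in \<open>H\<close>.\<close>

lemma tensor_kernel:
  assumes 1: "tensor_action S X M B act" and 2: "tensor_action S X' M' B act'"
    and f: "lin S X X' f" "f ` carrier X = carrier X'" and g: "lin S M M' g" "g ` carrier M = carrier M'"
    and fa: "\<And>b x. b \<in> carrier B \<Longrightarrow> x \<in> carrier X \<Longrightarrow> f (act b x) = act' b (f x)"
    and H: "subm B (tensor_mod S X M act) H"
    and kf: "\<And>x m. x \<in> carrier X \<Longrightarrow> m \<in> carrier M \<Longrightarrow> f x = \<zero>\<^bsub>X'\<^esub> \<Longrightarrow> pt S X M x m \<in> H"
    and kg: "\<And>x m. x \<in> carrier X \<Longrightarrow> m \<in> carrier M \<Longrightarrow> g m = \<zero>\<^bsub>M'\<^esub> \<Longrightarrow> pt S X M x m \<in> H"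
    and u: "u \<in> carrier (tensor_mod S X M act)" and z: "tensor_map S X M X' M' f g u = \<zero>\<^bsub>tensor_mod S X' M' act'\<^esub>"
  shows "u \<in> H"
proof -
  interpret P: tensor_action S X M B act by fact
  interpret P': tensor_action S X' M' B act' by fact
  let ?Q = "quot_mod P.TM H"
  note q = quot_mod_proj[OF P.lmodule_TM H]
  let ?q = "\<lambda>u. H +>\<^bsub>P.TM\<^esub> u"
  interpret Q: lmodule B ?Q by (rule q(4))
  interpret TM: lmodule B P.TM by (rule P.lmodule_TM)
  note ag = TM.M.abelian_group_axioms Q.M.abelian_group_axioms
  have wdf: "?q (pt S X M x m) = ?q (pt S X M y m)"
    if x: "x \<in> carrier X" "y \<in> carrier X" "m \<in> carrier M" "f x = f y" for x y m
  proof -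
    let ?d = "x \<ominus>\<^bsub>X\<^esub> y"
    have d: "?d \<in> carrier X" by (rule P.X.minus_closed[OF x(1,2)])
    have "f ?d = f x \<ominus>\<^bsub>X'\<^esub> f y"
      by (rule lin_diff[OF f(1) P.X.abelian_group_axioms P'.X.abelian_group_axioms x(1,2)])
    also have "\<dots> = \<zero>\<^bsub>X'\<^esub>" unfolding x(4) a_minus_def by (rule P'.X.r_neg[OF lin_closed[OF f(1) x(2)]])
    finally have d0: "f ?d = \<zero>\<^bsub>X'\<^esub>" .
    have "x = ?d \<oplus>\<^bsub>X\<^esub> y" using x by (simp add: a_minus_def P.X.a_assoc P.X.l_neg)
    then have "pt S X M x m = pt S X M ?d m \<oplus>\<^bsub>P.TM\<^esub> pt S X M y m" using P.pt_add_left[OF d x(2,3), of act] by simp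
    then have "?q (pt S X M x m) = ?q (pt S X M ?d m) \<oplus>\<^bsub>?Q\<^esub> ?q (pt S X M y m)"
      using lin_add[OF q(1) P.pt_closed[OF d x(3)] P.pt_closed[OF x(2,3)]] by simp
    moreover have "?q (pt S X M ?d m) = \<zero>\<^bsub>?Q\<^esub>" using q(3)[OF P.pt_closed[OF d x(3)]] kf[OF d x(3) d0] by simp
    ultimately show ?thesis using lin_closed[OF q(1) P.pt_closed[OF x(2,3)]] by simp
  qed
  have wdg: "?q (pt S X M x m) = ?q (pt S X M x n)"
    if x: "x \<in> carrier X" "m \<in> carrier M" "n \<in> carrier M" "g m = g n" for x m n
  proof -
    let ?d = "m \<ominus>\<^bsub>M\<^esub> n"
    have d: "?d \<in> carrier M" by (rule P.M.minus_closed[OF x(2,3)])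
    have "g ?d = g m \<ominus>\<^bsub>M'\<^esub> g n"
      by (rule lin_diff[OF g(1) P.M.abelian_group_axioms P'.M.abelian_group_axioms x(2,3)])
    also have "\<dots> = \<zero>\<^bsub>M'\<^esub>" unfolding x(4) a_minus_def by (rule P'.M.r_neg[OF lin_closed[OF g(1) x(3)]])
    finally have d0: "g ?d = \<zero>\<^bsub>M'\<^esub>" .
    have "m = ?d \<oplus>\<^bsub>M\<^esub> n" using x by (simp add: a_minus_def P.M.a_assoc P.M.l_neg)
    then have "pt S X M x m = pt S X M x ?d \<oplus>\<^bsub>P.TM\<^esub> pt S X M x n" using P.pt_add_right[OF x(1) d x(3), of act] by simp
    then have "?q (pt S X M x m) = ?q (pt S X M x ?d) \<oplus>\<^bsub>?Q\<^esub> ?q (pt S X M x n)"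
      using lin_add[OF q(1) P.pt_closed[OF x(1) d] P.pt_closed[OF x(1,3)]] by simp
    moreover have "?q (pt S X M x ?d) = \<zero>\<^bsub>?Q\<^esub>" using q(3)[OF P.pt_closed[OF x(1) d]] kg[OF x(1) d d0] by simp
    ultimately show ?thesis using lin_closed[OF q(1) P.pt_closed[OF x(1,3)]] by simp
  qed
  \<comment> \<open>the inverse modulo H, by means of arbitrary preimages of the two factors\<close>
  let ?s = "inv_into (carrier X) f" and ?t = "inv_into (carrier M) g"
  have s: "?s x \<in> carrier X" "f (?s x) = x" if "x \<in> carrier X'" for x
    using that unfolding f(2)[symmetric] by (simp_all add: inv_into_into f_inv_into_f)
  have t: "?t m \<in> carrier M" "g (?t m) = m" if "m \<in> carrier M'" for m
    using that unfolding g(2)[symmetric] by (simp_all add: inv_into_into f_inv_into_f)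
  let ?\<beta> = "\<lambda>x m. ?q (pt S X M (?s x) (?t m))"
  have wd: "?\<beta> (f x) (g m) = ?q (pt S X M x m)" if x: "x \<in> carrier X" "m \<in> carrier M" for x m
    using wdf[OF s(1) x(1) t(1) s(2)] wdg[OF x(1) t(1) x(2) t(2)] x lin_closed[OF f(1)] lin_closed[OF g(1)] by simp
  have \<beta>: "\<exists>h. lin B P'.TM ?Q h \<and> (\<forall>x\<in>carrier X'. \<forall>m\<in>carrier M'. h (pt S X' M' x m) = ?\<beta> x m)"
  proof (rule P'.lift_lin[OF q(4)])
    fix x m assume "x \<in> carrier X'" "m \<in> carrier M'"
    then show "?\<beta> x m \<in> carrier ?Q" using lin_closed[OF q(1) P.pt_closed, of "?s x" "?t m"] s t by simp
  next
    fix x y m assume x: "x \<in> carrier X'" "y \<in> carrier X'" "m \<in> carrier M'"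
    have "?\<beta> (x \<oplus>\<^bsub>X'\<^esub> y) m = ?q (pt S X M (?s x \<oplus>\<^bsub>X\<^esub> ?s y) (?t m))"
      using wd[of "?s x \<oplus>\<^bsub>X\<^esub> ?s y" "?t m"] lin_add[OF f(1), of "?s x" "?s y"] s t x by simp
    then show "?\<beta> (x \<oplus>\<^bsub>X'\<^esub> y) m = ?\<beta> x m \<oplus>\<^bsub>?Q\<^esub> ?\<beta> y m"
      using P.pt_add_left[of "?s x" "?s y" "?t m" act]
        lin_add[OF q(1) P.pt_closed P.pt_closed, of "?s x" "?t m" "?s y" "?t m"] s t x by simp
  next
    fix x m n assume x: "x \<in> carrier X'" "m \<in> carrier M'" "n \<in> carrier M'"
    have "?\<beta> x (m \<oplus>\<^bsub>M'\<^esub> n) = ?q (pt S X M (?s x) (?t m \<oplus>\<^bsub>M\<^esub> ?t n))"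
      using wd[of "?s x" "?t m \<oplus>\<^bsub>M\<^esub> ?t n"] lin_add[OF g(1), of "?t m" "?t n"] s t x by simp
    then show "?\<beta> x (m \<oplus>\<^bsub>M'\<^esub> n) = ?\<beta> x m \<oplus>\<^bsub>?Q\<^esub> ?\<beta> x n"
      using P.pt_add_right[of "?s x" "?t m" "?t n" act]
        lin_add[OF q(1) P.pt_closed P.pt_closed, of "?s x" "?t m" "?s x" "?t n"] s t x by simp
  next
    fix c x m assume x: "c \<in> carrier S" "x \<in> carrier X'" "m \<in> carrier M'"
    have "?\<beta> (c \<odot>\<^bsub>X'\<^esub> x) m = ?q (pt S X M (c \<odot>\<^bsub>X\<^esub> ?s x) (?t m))"
      using wd[of "c \<odot>\<^bsub>X\<^esub> ?s x" "?t m"] lin_smult[OF f(1), of c "?s x"] s t x P.smult_X by simp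
    moreover have "?\<beta> x (c \<odot>\<^bsub>M'\<^esub> m) = ?q (pt S X M (?s x) (c \<odot>\<^bsub>M\<^esub> ?t m))"
      using wd[of "?s x" "c \<odot>\<^bsub>M\<^esub> ?t m"] lin_smult[OF g(1), of c "?t m"] s t x P.smult_M by simp
    ultimately show "?\<beta> (c \<odot>\<^bsub>X'\<^esub> x) m = ?\<beta> x (c \<odot>\<^bsub>M'\<^esub> m)"
      using P.pt_balanced[of c "?s x" "?t m"] s t x by simp
  next
    fix b x m assume x: "b \<in> carrier B" "x \<in> carrier X'" "m \<in> carrier M'"
    have "?\<beta> (act' b x) m = ?q (pt S X M (act b (?s x)) (?t m))"
      using wd[of "act b (?s x)" "?t m"] fa[of b "?s x"] s t x lin_closed[OF P.act_lin] by simp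
    then show "?\<beta> (act' b x) m = b \<odot>\<^bsub>?Q\<^esub> ?\<beta> x m"
      using P.smult_pt[of b "?s x" "?t m"] lin_smult[OF q(1) _ P.pt_closed, of b "?s x" "?t m"] s t x by simp
  qed
  then obtain h where h: "lin B P'.TM ?Q h" "\<forall>x\<in>carrier X'. \<forall>m\<in>carrier M'. h (pt S X' M' x m) = ?\<beta> x m" by (elim exE conjE)
  have tl: "lin B P.TM P'.TM (tensor_map S X M X' M' f g)"
    by (rule tensor_map_lin[OF 1 2 f(1) g(1)]) (rule fa)
  have "h (tensor_map S X M X' M' f g u) = ?q u"
  proof (rule P.lin_ext[OF q(4) lin_comp[OF tl h(1)] q(1) _ u])
    fix x m assume x: "x \<in> carrier X" "m \<in> carrier M"
    show "h (tensor_map S X M X' M' f g (pt S X M x m)) = ?q (pt S X M x m)"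
      unfolding tensor_map_pt[OF P.pair P'.pair f(1) g(1) x] wd[OF x, symmetric]
      by (rule h(2)[THEN bspec, THEN bspec]) (use x lin_closed[OF f(1)] lin_closed[OF g(1)] in auto)
  qed
  then have "?q u = \<zero>\<^bsub>?Q\<^esub>"
    unfolding z using lin_zero[OF h(1) P'.abelian_group_tensor Q.M.abelian_group_axioms] by simp
  then show ?thesis using q(3)[OF u] by simp
qed

lemma lin_image_subm:
  assumes X: "lmodule A X" and Y: "lmodule A Y" and f: "lin A X Y f"
  shows "subm A Y (f ` carrier X)"
proof -
  interpret X: lmodule A X by fact
  have "f x \<oplus>\<^bsub>Y\<^esub> f y \<in> f ` carrier X" if "x \<in> carrier X" "y \<in> carrier X" for x y
    using lin_add[OF f that] that by (intro image_eqI[of _ _ "x \<oplus>\<^bsub>X\<^esub> y"]) auto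
  moreover have "a \<odot>\<^bsub>Y\<^esub> f x \<in> f ` carrier X" if "a \<in> carrier A" "x \<in> carrier X" for a x
    using lin_smult[OF f that] that by (intro image_eqI[of _ _ "a \<odot>\<^bsub>X\<^esub> x"]) auto
  moreover have "\<zero>\<^bsub>Y\<^esub> \<in> f ` carrier X"
    by (rule image_eqI[of _ _ "\<zero>\<^bsub>X\<^esub>"]) (simp_all add: lin_zero[OF f lmodule_abelian_group[OF X] lmodule_abelian_group[OF Y]])
  ultimately show ?thesis using lin_closed[OF f] by (auto simp: subm_def)
qed

lemma tensor_map_surj:
  assumes 1: "tensor_action S X M B act" and 2: "tensor_action S X' M' B act'"
    and f: "lin S X X' f" "f ` carrier X = carrier X'" and g: "lin S M M' g" "g ` carrier M = carrier M'"
    and fa: "\<And>b x. b \<in> carrier B \<Longrightarrow> x \<in> carrier X \<Longrightarrow> f (act b x) = act' b (f x)"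
  shows "tensor_map S X M X' M' f g ` carrier (tensor_mod S X M act) = carrier (tensor_mod S X' M' act')" (is "?F ` _ = _")
proof -
  interpret P: tensor_action S X M B act by fact
  interpret P': tensor_action S X' M' B act' by fact
  have tl: "lin B P.TM P'.TM (tensor_map S X M X' M' f g)"
    by (rule tensor_map_lin[OF 1 2 f(1) g(1)]) (rule fa)
  have sb: "subm B P'.TM (?F ` carrier P.TM)"
    by (rule lin_image_subm[OF P.lmodule_TM P'.lmodule_TM tl])
  show ?thesis
  proof (intro equalityI subsetI)
    fix u assume "u \<in> ?F ` carrier P.TM" then show "u \<in> carrier P'.TM" using lin_closed[OF tl] by (elim imageE) simp
  next
    fix u assume u: "u \<in> carrier P'.TM"
    show "u \<in> ?F ` carrier P.TM"
    proof (rule P'.in_subm[OF sb _ u])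
      fix x m assume "x \<in> carrier X'" "m \<in> carrier M'"
      then have "x \<in> f ` carrier X" "m \<in> g ` carrier M" using f(2) g(2) by simp_all
      then obtain y n where y: "y \<in> carrier X" "x = f y" and n: "n \<in> carrier M" "m = g n" by (elim imageE)
      show "pt S X' M' x m \<in> ?F ` carrier P.TM"
        unfolding y(2) n(2) tensor_map_pt[OF P.pair P'.pair f(1) g(1) y(1) n(1), symmetric]
        by (rule imageI[OF P.pt_closed[OF y(1) n(1)]])
    qed
  qed
qed

lemma lin_opp [simp]: "lin (opp_ring A) X Y f \<longleftrightarrow> lin A X Y f"
  by (simp add: lin_def)

context algebra_over
begin

lemma opp_algebra: "algebra_over R (opp_ring A)"
  by (intro algebra_over.intro opp_R_algebra R_algebra_axioms)

lemma ring_A: "ring A" by (rule ring_axioms)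

subsection \<open>The tensor product over the algebra\<close>

lemma tensorA_action:
  assumes Y: "lmodule (opp_ring A) Y" and M: "lmodule A M"
  shows "tensor_action A Y M R (scalar A Y)"
proof -
  interpret O: algebra_over R "opp_ring A" by (rule opp_algebra)
  interpret Y: lmodule "opp_ring A" Y by fact
  interpret M: lmodule A M by fact
  have YR: "lmodule R (restr A Y)" using O.restr_lmodule[OF Y] by simp
  interpret YR: lmodule R "restr A Y" by (rule YR)
  have Yc: "a \<odot>\<^bsub>Y\<^esub> y \<in> carrier Y" if "a \<in> carrier A" "y \<in> carrier Y" for a y
    using Y.lsmult_closed[of a y] that by simp
  show ?thesis
  proof (intro tensor_action.intro tensor_action_axioms.intro tensor_pairI Y.M.abelian_group_axioms M.M.abelian_group_axioms
      Yc M.lsmult_closed R.ring_axioms)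
    fix b assume b: "b \<in> carrier R"
    show "lin A Y Y (scalar A Y b)"
      using b YR.lsmult_r_distr[OF b] O.scalar_commute[OF Y b] Yc by (simp add: lin_def)
    fix c y assume c: "c \<in> carrier R" and y: "y \<in> carrier Y"
    show "scalar A Y (b \<oplus>\<^bsub>R\<^esub> c) y = scalar A Y b y \<oplus>\<^bsub>Y\<^esub> scalar A Y c y"
      using YR.lsmult_l_distr[OF b c, of y] y by simp
    show "scalar A Y (b \<otimes>\<^bsub>R\<^esub> c) y = scalar A Y b (scalar A Y c y)"
      using YR.lsmult_assoc[OF b c, of y] y by simp
  next
    fix y assume y: "y \<in> carrier Y"
    show "scalar A Y \<one>\<^bsub>R\<^esub> y = y" using YR.lsmult_one[of y] y by simp
  qed
qed

lemma tensorA_lmodule: "lmodule (opp_ring A) Y \<Longrightarrow> lmodule A M \<Longrightarrow> lmodule R (tensorA A Y M)"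
  unfolding tensorA_def by (rule tensor_action.lmodule_TM[OF tensorA_action])

lemma tensorA_map_lin:
  assumes X: "lmodule (opp_ring A) X" "lmodule (opp_ring A) Y" and M: "lmodule A M" "lmodule A N"
    and f: "lin A X Y f" and g: "lin A M N g"
  shows "lin R (tensorA A X M) (tensorA A Y N) (tensor_map A X M Y N f g)"
  unfolding tensorA_def
  by (rule tensor_map_lin[OF tensorA_action[OF X(1) M(1)] tensorA_action[OF X(2) M(2)] f g])
    (simp add: lin_smult[OF f])

lemma tensorA_pair: "lmodule (opp_ring A) Y \<Longrightarrow> lmodule A M \<Longrightarrow> tensor_pair A Y M"
  using tensorA_action tensor_action.pair by blast

lemma tensorA_pt_closed:
  "lmodule (opp_ring A) Y \<Longrightarrow> lmodule A M \<Longrightarrow> y \<in> carrier Y \<Longrightarrow> m \<in> carrier M \<Longrightarrow> pt A Y M y m \<in> carrier (tensorA A Y M)"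
  unfolding tensorA_def by (rule tensor_pair.pt_closed[OF tensorA_pair])

text \<open>\<open>Y \<otimes> -\<close> is additive.\<close>

lemma thru_tensorA_right:
  assumes h: "thru A M V N h" and Y: "lmodule (opp_ring A) Y" and M: "lmodule A M" and V: "lmodule A V" and N: "lmodule A N"
  shows "thru R (tensorA A Y M) (tensorA A Y V) (tensorA A Y N) (tensor_map A Y M Y N (\<lambda>y. y) h)"
  using h
proof induct
  case zero
  interpret YM: tensor_action A Y M R "scalar A Y" by (rule tensorA_action[OF Y M])
  interpret YN: tensor_action A Y N R "scalar A Y" by (rule tensorA_action[OF Y N])
  have l0: "lin R YM.TM YN.TM (\<lambda>u. \<zero>\<^bsub>YN.TM\<^esub>)" by (rule lin_const_zero[OF YN.lmodule_TM])
  have l: "lin R YM.TM YN.TM (tensor_map A Y M Y N (\<lambda>y. y) (\<lambda>x. \<zero>\<^bsub>N\<^esub>))"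
    using tensorA_map_lin[OF Y Y M N lin_id lin_const_zero[OF N]] by (simp add: tensorA_def)
  show ?case unfolding tensorA_def
  proof (rule thru.cong[OF thru.zero])
    fix u assume u: "u \<in> carrier YM.TM"
    show "tensor_map A Y M Y N (\<lambda>y. y) (\<lambda>x. \<zero>\<^bsub>N\<^esub>) u = \<zero>\<^bsub>YN.TM\<^esub>"
    proof (rule YM.lin_ext[OF YN.lmodule_TM l l0 _ u])
      fix y m assume y: "y \<in> carrier Y" and m: "m \<in> carrier M"
      show "tensor_map A Y M Y N (\<lambda>y. y) (\<lambda>x. \<zero>\<^bsub>N\<^esub>) (pt A Y M y m) = \<zero>\<^bsub>YN.TM\<^esub>"
        unfolding tensor_map_pt[OF YM.pair YN.pair lin_id lin_const_zero[OF N] y m] by (rule YN.pt_zero_right[OF y])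
    qed
  qed
next
  case (step i p h)
  interpret YM: tensor_action A Y M R "scalar A Y" by (rule tensorA_action[OF Y M])
  interpret YN: tensor_action A Y N R "scalar A Y" by (rule tensorA_action[OF Y N])
  interpret YV: tensor_action A Y V R "scalar A Y" by (rule tensorA_action[OF Y V])
  have hl: "lin A M N h" by (rule thru_lin[OF step(3) M N])
  have pl: "lin A M N (\<lambda>x. p (i x) \<oplus>\<^bsub>N\<^esub> h x)" by (rule lin_plus[OF lin_comp[OF step(1,2)] hl N])
  note ti = tensorA_map_lin[OF Y Y M V lin_id step(1), unfolded tensorA_def]
  note tp = tensorA_map_lin[OF Y Y V N lin_id step(2), unfolded tensorA_def]
  note th = tensorA_map_lin[OF Y Y M N lin_id hl, unfolded tensorA_def]
  note tpl = tensorA_map_lin[OF Y Y M N lin_id pl, unfolded tensorA_def]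
  note ts = lin_plus[OF lin_comp[OF ti tp] th YN.lmodule_TM]
  show ?case unfolding tensorA_def
  proof (rule thru.cong[OF thru.step[OF ti tp step(4)[unfolded tensorA_def]]])
    fix u assume u: "u \<in> carrier YM.TM"
    show "tensor_map A Y M Y N (\<lambda>y. y) (\<lambda>x. p (i x) \<oplus>\<^bsub>N\<^esub> h x) u =
        tensor_map A Y V Y N (\<lambda>y. y) p (tensor_map A Y M Y V (\<lambda>y. y) i u) \<oplus>\<^bsub>YN.TM\<^esub> tensor_map A Y M Y N (\<lambda>y. y) h u"
    proof (rule YM.lin_ext[OF YN.lmodule_TM tpl ts _ u])
      fix y m assume y: "y \<in> carrier Y" and m: "m \<in> carrier M"
      have c: "p (i m) \<in> carrier N" "h m \<in> carrier N" "i m \<in> carrier V"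
        using m step(1,2) hl by (simp_all add: lin_def)
      show "tensor_map A Y M Y N (\<lambda>y. y) (\<lambda>x. p (i x) \<oplus>\<^bsub>N\<^esub> h x) (pt A Y M y m) =
        tensor_map A Y V Y N (\<lambda>y. y) p (tensor_map A Y M Y V (\<lambda>y. y) i (pt A Y M y m)) \<oplus>\<^bsub>YN.TM\<^esub> tensor_map A Y M Y N (\<lambda>y. y) h (pt A Y M y m)"
        unfolding tensor_map_pt[OF YM.pair YN.pair lin_id pl y m] tensor_map_pt[OF YM.pair YV.pair lin_id step(1) y m]
          tensor_map_pt[OF YV.pair YN.pair lin_id step(2) y c(3)] tensor_map_pt[OF YM.pair YN.pair lin_id hl y m]
        by (rule YN.pt_add_right[OF y c(1,2)])
    qed
  qed
next
  case (cong h h')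
  interpret YM: tensor_action A Y M R "scalar A Y" by (rule tensorA_action[OF Y M])
  interpret YN: tensor_action A Y N R "scalar A Y" by (rule tensorA_action[OF Y N])
  have hl: "lin A M N h" by (rule thru_lin[OF cong(1) M N])
  have hl': "lin A M N h'" by (rule lin_cong[OF hl _ M]) (rule cong(3))
  show ?case
  proof (rule thru.cong[OF cong(2)])
    fix u assume u: "u \<in> carrier (tensorA A Y M)"
    show "tensor_map A Y M Y N (\<lambda>y. y) h' u = tensor_map A Y M Y N (\<lambda>y. y) h u"
      by (rule tensor_map_ext[OF YM.pair YN.pair lin_id hl' lin_id hl _ u[unfolded tensorA_def]]) (simp add: cong(3))
  qed
qed

lemma in_add_tensorA_right:
  assumes "in_add A M V" "lmodule (opp_ring A) Y" "lmodule A M" "lmodule A V"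
  shows "in_add R (tensorA A Y M) (tensorA A Y V)"
  unfolding in_add_def
proof (rule thru.cong[OF thru_tensorA_right[OF assms(1)[unfolded in_add_def] assms(2,3,4,3)]])
  fix u assume "u \<in> carrier (tensorA A Y M)"
  then show "u = tensor_map A Y M Y M (\<lambda>y. y) (\<lambda>x. x) u"
    unfolding tensorA_def by (rule tensor_map_id[OF tensorA_pair[OF assms(2,3)], symmetric])
qed

text \<open>Multiplication \<open>Y \<otimes>\<^sub>A A \<rightarrow> Y\<close> is inverse to \<open>y \<mapsto> y \<otimes> 1\<close>.\<close>

lemma tensorA_regular:
  assumes Y: "lmodule (opp_ring A) Y"
  shows "in_add R (tensorA A Y (regular A)) (restr A Y)"
proof -
  interpret O: algebra_over R "opp_ring A" by (rule opp_algebra)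
  interpret Y: lmodule "opp_ring A" Y by fact
  have YR: "lmodule R (restr A Y)" using O.restr_lmodule[OF Y] by simp
  note reg = regular_lmodule[OF ring_A]
  interpret T: tensor_action A Y "regular A" R "scalar A Y" by (rule tensorA_action[OF Y reg])
  have Yc: "a \<odot>\<^bsub>Y\<^esub> y \<in> carrier Y" if "a \<in> carrier A" "y \<in> carrier Y" for a y
    using Y.lsmult_closed[of a y] that by simp
  have "\<exists>h. lin R T.TM (restr A Y) h \<and> (\<forall>y\<in>carrier Y. \<forall>a\<in>carrier (regular A). h (pt A Y (regular A) y a) = a \<odot>\<^bsub>Y\<^esub> y)"
  proof (rule T.lift_lin[OF YR], goal_cases)
    case (1 y a) then show ?case using Yc by simp
  next
    case (2 y z a) then show ?case using Y.lsmult_r_distr[of a y z] by simp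
  next
    case (3 y a b) then show ?case using Y.lsmult_l_distr[of a b y] by simp
  next
    case (4 s y a) then show ?case using Y.lsmult_assoc[of a s y] by simp
  next
    case (5 r y a) then show ?case using O.scalar_commute[OF Y, of r a y] by simp
  qed
  then obtain h where h: "lin R T.TM (restr A Y) h" "\<forall>y\<in>carrier Y. \<forall>a\<in>carrier (regular A). h (pt A Y (regular A) y a) = a \<odot>\<^bsub>Y\<^esub> y"
    by (elim exE conjE)
  have one: "\<one>\<^bsub>A\<^esub> \<in> carrier (regular A)" by simp
  let ?s = "\<lambda>y. pt A Y (regular A) y \<one>\<^bsub>A\<^esub>"
  have s: "lin R (restr A Y) T.TM ?s"
  proof (rule linI)
    fix y assume "y \<in> carrier (restr A Y)"
    then show "?s y \<in> carrier T.TM" by (intro T.pt_closed one) simp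
    fix z assume "z \<in> carrier (restr A Y)"
    with \<open>y \<in> carrier (restr A Y)\<close> show "?s (y \<oplus>\<^bsub>restr A Y\<^esub> z) = ?s y \<oplus>\<^bsub>T.TM\<^esub> ?s z"
      using T.pt_add_left[OF _ _ one, of y z "scalar A Y"] by simp
  next
    fix r y assume "r \<in> carrier R" "y \<in> carrier (restr A Y)"
    then show "?s (r \<odot>\<^bsub>restr A Y\<^esub> y) = r \<odot>\<^bsub>T.TM\<^esub> ?s y" using T.smult_pt[OF _ _ one, of r y] by simp
  qed
  have "?s (h u) = u" if u: "u \<in> carrier T.TM" for u
  proof (rule T.lin_ext[OF T.lmodule_TM lin_comp[OF h(1) s] lin_id _ u])
    fix y a assume y: "y \<in> carrier Y" and a: "a \<in> carrier (regular A)"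
    have "h (pt A Y (regular A) y a) = a \<odot>\<^bsub>Y\<^esub> y" using h(2) y a by blast
    then show "?s (h (pt A Y (regular A) y a)) = pt A Y (regular A) y a"
      using T.pt_balanced[of a y "\<one>\<^bsub>A\<^esub>"] y a by simp
  qed
  then show ?thesis unfolding tensorA_def by (intro in_add_retract[OF h(1) s _ T.lmodule_TM])
qed

subsection \<open>Twists by projective modules over the base ring\<close>

lemma tensorR_action:
  assumes V: "lmodule A V" and U: "lmodule R U"
  shows "tensor_action R (restr A V) U A (smult V)"
proof -
  interpret V: lmodule A V by fact
  interpret U: lmodule R U by fact
  interpret VR: lmodule R "restr A V" by (rule restr_lmodule[OF V])
  show ?thesis
    by (intro tensor_action.intro tensor_action_axioms.intro tensor_pairI VR.M.abelian_group_axioms U.M.abelian_group_axioms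
      VR.lsmult_closed U.lsmult_closed ring_A)
      (auto simp: lin_def V.lsmult_l_distr V.lsmult_r_distr V.lsmult_assoc scalar_commute[OF V])
qed

lemma tensorR_lmodule: "lmodule A V \<Longrightarrow> lmodule R U \<Longrightarrow> lmodule A (tensorR R A V U)"
  unfolding tensorR_def by (rule tensor_action.lmodule_TM[OF tensorR_action])

text \<open>\<open>V \<otimes>\<^sub>R -\<close> turns a factorisation of the identity of \<open>U\<close> through \<open>R\<^sup>n\<close> into one of the identity of
  \<open>V \<otimes>\<^sub>R U\<close> through \<open>V\<^sup>n\<close>: the summand \<open>p \<circ> i\<close> with \<open>i : U \<rightarrow> R\<close> and \<open>p : R \<rightarrow> U\<close> becomes
  \<open>v \<otimes> m \<mapsto> i m v\<close> followed by \<open>v \<mapsto> v \<otimes> p 1\<close>.\<close>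

lemma tensorR_in_add:
  assumes V: "lmodule A V" and U: "lmodule R U" "in_add R U (regular R)"
  shows "in_add A (tensorR R A V U) V"
proof -
  interpret T: tensor_action R "restr A V" U A "smult V" by (rule tensorR_action[OF V U(1)])
  interpret V: lmodule A V by fact
  interpret U: lmodule R U by fact
  interpret VR: lmodule R "restr A V" by (rule restr_lmodule[OF V])
  have map_lin: "lin A T.TM T.TM (tensor_map R (restr A V) U (restr A V) U (\<lambda>v. v) h)" if "lin R U U h" for h
    by (rule tensor_map_lin[OF tensorR_action[OF V U(1)] tensorR_action[OF V U(1)] lin_id that]) simp
  have *: "thru A T.TM V T.TM (tensor_map R (restr A V) U (restr A V) U (\<lambda>v. v) h)" if "thru R U (regular R) U h" for h
    using that
  proof induct
    case zero
    note l = lin_const_zero[OF U(1), of U]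
    show ?case
    proof (rule thru.cong[OF thru.zero])
      fix u assume u: "u \<in> carrier T.TM"
      show "tensor_map R (restr A V) U (restr A V) U (\<lambda>v. v) (\<lambda>x. \<zero>\<^bsub>U\<^esub>) u = \<zero>\<^bsub>T.TM\<^esub>"
      proof (rule T.lin_ext[OF T.lmodule_TM map_lin[OF l] lin_const_zero[OF T.lmodule_TM] _ u])
        fix v m assume v: "v \<in> carrier (restr A V)" and m: "m \<in> carrier U"
        show "tensor_map R (restr A V) U (restr A V) U (\<lambda>v. v) (\<lambda>x. \<zero>\<^bsub>U\<^esub>) (pt R (restr A V) U v m) = \<zero>\<^bsub>T.TM\<^esub>"
          unfolding tensor_map_pt[OF T.pair T.pair lin_id l v m] by (rule T.pt_zero_right[OF v])
      qed
    qed
  next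
    case (step i p h)
    have hl: "lin R U U h" by (rule thru_lin[OF step(3) U(1) U(1)])
    have pl: "lin R U U (\<lambda>x. p (i x) \<oplus>\<^bsub>U\<^esub> h x)" by (rule lin_plus[OF lin_comp[OF step(1,2)] hl U(1)])
    have ic: "i m \<in> carrier R" if "m \<in> carrier U" for m using lin_closed[OF step(1) that] by simp
    have p1: "p \<one>\<^bsub>R\<^esub> \<in> carrier U" using lin_closed[OF step(2), of "\<one>\<^bsub>R\<^esub>"] by simp
    have "\<exists>f. lin A T.TM V f \<and> (\<forall>v\<in>carrier (restr A V). \<forall>m\<in>carrier U. f (pt R (restr A V) U v m) = scalar A V (i m) v)"
    proof (rule T.lift_lin[OF V], goal_cases)
      case (1 v m) then show ?case using ic by simp
    next
      case (2 v w m) then show ?case using VR.lsmult_r_distr[of "i m" v w] ic by simp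
    next
      case (3 v m n) then show ?case using VR.lsmult_l_distr[of "i m" "i n" v] ic lin_add[OF step(1), of m n] by simp
    next
      case (4 r v m)
      then show ?case using VR.lsmult_assoc[of r "i m" v] VR.lsmult_assoc[of "i m" r v] ic[of m] lin_smult[OF step(1), of r m]
        by (simp add: R.m_comm)
    next
      case (5 a v m) then show ?case using scalar_commute[OF V, of "i m" a v] ic by simp
    qed
    then obtain f where f: "lin A T.TM V f"
      "\<forall>v\<in>carrier (restr A V). \<forall>m\<in>carrier U. f (pt R (restr A V) U v m) = scalar A V (i m) v" by (elim exE conjE)
    let ?g = "\<lambda>v. pt R (restr A V) U v (p \<one>\<^bsub>R\<^esub>)"
    have g: "lin A V T.TM ?g"
    proof (rule linI)
      fix v assume v: "v \<in> carrier V"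
      then show "?g v \<in> carrier T.TM" by (intro T.pt_closed p1) simp
      fix w assume w: "w \<in> carrier V"
      show "?g (v \<oplus>\<^bsub>V\<^esub> w) = ?g v \<oplus>\<^bsub>T.TM\<^esub> ?g w"
        using T.pt_add_left[OF _ _ p1, of v w "smult V"] v w by simp
    next
      fix a v assume "a \<in> carrier A" "v \<in> carrier V"
      then show "?g (a \<odot>\<^bsub>V\<^esub> v) = a \<odot>\<^bsub>T.TM\<^esub> ?g v" using T.smult_pt[OF _ _ p1, of a v] by simp
    qed
    note ts = lin_plus[OF lin_comp[OF f(1) g] map_lin[OF hl] T.lmodule_TM]
    show ?case
    proof (rule thru.cong[OF thru.step[OF f(1) g step(4)]])
      fix u assume u: "u \<in> carrier T.TM"
      show "tensor_map R (restr A V) U (restr A V) U (\<lambda>v. v) (\<lambda>x. p (i x) \<oplus>\<^bsub>U\<^esub> h x) u =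
          ?g (f u) \<oplus>\<^bsub>T.TM\<^esub> tensor_map R (restr A V) U (restr A V) U (\<lambda>v. v) h u"
      proof (rule T.lin_ext[OF T.lmodule_TM map_lin[OF pl] ts _ u])
        fix v m assume v: "v \<in> carrier (restr A V)" and m: "m \<in> carrier U"
        have c: "p (i m) \<in> carrier U" "h m \<in> carrier U" using m step(1,2) hl by (simp_all add: lin_def)
        have "f (pt R (restr A V) U v m) = i m \<odot>\<^bsub>restr A V\<^esub> v" using f(2) v m by simp
        then have "?g (f (pt R (restr A V) U v m)) = pt R (restr A V) U v (i m \<odot>\<^bsub>U\<^esub> p \<one>\<^bsub>R\<^esub>)"
          using T.pt_balanced[OF ic[OF m] v p1] by simp
        also have "i m \<odot>\<^bsub>U\<^esub> p \<one>\<^bsub>R\<^esub> = p (i m)" using lin_regular[OF R.ring_axioms step(2) ic[OF m]] by simp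
        finally have e: "?g (f (pt R (restr A V) U v m)) = pt R (restr A V) U v (p (i m))" .
        show "tensor_map R (restr A V) U (restr A V) U (\<lambda>v. v) (\<lambda>x. p (i x) \<oplus>\<^bsub>U\<^esub> h x) (pt R (restr A V) U v m) =
          ?g (f (pt R (restr A V) U v m)) \<oplus>\<^bsub>T.TM\<^esub> tensor_map R (restr A V) U (restr A V) U (\<lambda>v. v) h (pt R (restr A V) U v m)"
          unfolding e tensor_map_pt[OF T.pair T.pair lin_id pl v m] tensor_map_pt[OF T.pair T.pair lin_id hl v m]
          by (rule T.pt_add_right[OF v c])
      qed
    qed
  next
    case (cong h h')
    have hl: "lin R U U h" by (rule thru_lin[OF cong(1) U(1) U(1)])
    have hl': "lin R U U h'" by (rule lin_cong[OF hl _ U(1)]) (rule cong(3))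
    show ?case
    proof (rule thru.cong[OF cong(2)])
      fix u assume u: "u \<in> carrier T.TM"
      show "tensor_map R (restr A V) U (restr A V) U (\<lambda>v. v) h' u = tensor_map R (restr A V) U (restr A V) U (\<lambda>v. v) h u"
        by (rule tensor_map_ext[OF T.pair T.pair lin_id hl' lin_id hl _ u]) (simp add: cong(3))
    qed
  qed
  show ?thesis unfolding in_add_def tensorR_def
  proof (rule thru.cong[OF *[OF U(2)[unfolded in_add_def]]])
    fix u assume "u \<in> carrier T.TM"
    then show "u = tensor_map R (restr A V) U (restr A V) U (\<lambda>v. v) (\<lambda>x. x) u" by (rule tensor_map_id[OF T.pair, symmetric])
  qed
qed

end

section \<open>Modules of homomorphisms\<close>

lemma lhom_eqI:
  "f \<in> lhom S X Y \<Longrightarrow> g \<in> lhom S X Y \<Longrightarrow> (\<And>x. x \<in> carrier X \<Longrightarrow> f x = g x) \<Longrightarrow> f = g"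
  unfolding lhom_iff by (blast intro: extensionalityI)

lemma hom_mod_simps:
  "carrier (hom_mod S X Y act) = lhom S X Y" "\<zero>\<^bsub>hom_mod S X Y act\<^esub> = zero_map X Y"
  "f \<oplus>\<^bsub>hom_mod S X Y act\<^esub> g = (\<lambda>x\<in>carrier X. f x \<oplus>\<^bsub>Y\<^esub> g x)" "b \<odot>\<^bsub>hom_mod S X Y act\<^esub> f = act b f"
  by (simp_all add: hom_mod_def)

lemma zero_map_lhom: "lmodule S X \<Longrightarrow> lmodule S Y \<Longrightarrow> zero_map X Y \<in> lhom S X Y"
  unfolding zero_map_def by (rule lin_restrict_lhom[OF _ lin_const_zero])

lemma plus_lhom:
  "lmodule S X \<Longrightarrow> lmodule S Y \<Longrightarrow> f \<in> lhom S X Y \<Longrightarrow> g \<in> lhom S X Y \<Longrightarrow> (\<lambda>x\<in>carrier X. f x \<oplus>\<^bsub>Y\<^esub> g x) \<in> lhom S X Y"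
  by (rule lin_restrict_lhom[OF _ lin_plus[OF lhom_lin lhom_lin]])

lemma hom_mod_lmodule:
  assumes B: "ring B" and X: "lmodule S X" and Y: "lmodule S Y"
    and cl: "\<And>b f. b \<in> carrier B \<Longrightarrow> f \<in> lhom S X Y \<Longrightarrow> act b f \<in> lhom S X Y"
    and al: "\<And>b c f x. b \<in> carrier B \<Longrightarrow> c \<in> carrier B \<Longrightarrow> f \<in> lhom S X Y \<Longrightarrow> x \<in> carrier X \<Longrightarrow> act (b \<oplus>\<^bsub>B\<^esub> c) f x = act b f x \<oplus>\<^bsub>Y\<^esub> act c f x"
    and ar: "\<And>b f g x. b \<in> carrier B \<Longrightarrow> f \<in> lhom S X Y \<Longrightarrow> g \<in> lhom S X Y \<Longrightarrow> x \<in> carrier X \<Longrightarrow>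
      act b (\<lambda>x\<in>carrier X. f x \<oplus>\<^bsub>Y\<^esub> g x) x = act b f x \<oplus>\<^bsub>Y\<^esub> act b g x"
    and am: "\<And>b c f x. b \<in> carrier B \<Longrightarrow> c \<in> carrier B \<Longrightarrow> f \<in> lhom S X Y \<Longrightarrow> x \<in> carrier X \<Longrightarrow> act (b \<otimes>\<^bsub>B\<^esub> c) f x = act b (act c f) x"
    and ao: "\<And>f x. f \<in> lhom S X Y \<Longrightarrow> x \<in> carrier X \<Longrightarrow> act \<one>\<^bsub>B\<^esub> f x = f x"
  shows "lmodule B (hom_mod S X Y act)"
proof -
  interpret B: ring B by fact
  interpret X: lmodule S X by fact
  interpret Y: lmodule S Y by fact
  note pl = plus_lhom[OF X Y] and zl = zero_map_lhom[OF X Y]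
  have c: "f x \<in> carrier Y" if "f \<in> lhom S X Y" "x \<in> carrier X" for f x
    using lin_closed[OF lhom_lin[OF that(1)] that(2)] .
  have ng: "(\<lambda>x\<in>carrier X. \<zero>\<^bsub>Y\<^esub> \<ominus>\<^bsub>Y\<^esub> f x) \<in> lhom S X Y" if "f \<in> lhom S X Y" for f
    by (rule lin_restrict_lhom[OF X lin_minus[OF lin_const_zero[OF Y] lhom_lin[OF that] Y]])
  show ?thesis
  proof (intro lmodule.intro lmodule_axioms.intro abelian_groupI B, unfold hom_mod_simps)
    fix f g h assume f: "f \<in> lhom S X Y" and g: "g \<in> lhom S X Y" and h: "h \<in> lhom S X Y"
    show "(\<lambda>x\<in>carrier X. (\<lambda>x\<in>carrier X. f x \<oplus>\<^bsub>Y\<^esub> g x) x \<oplus>\<^bsub>Y\<^esub> h x) = (\<lambda>x\<in>carrier X. f x \<oplus>\<^bsub>Y\<^esub> (\<lambda>x\<in>carrier X. g x \<oplus>\<^bsub>Y\<^esub> h x) x)"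
      by (rule lhom_eqI[OF pl[OF pl[OF f g] h] pl[OF f pl[OF g h]]]) (simp add: c f g h Y.M.a_assoc)
  next
    fix f g assume f: "f \<in> lhom S X Y" and g: "g \<in> lhom S X Y"
    show "(\<lambda>x\<in>carrier X. f x \<oplus>\<^bsub>Y\<^esub> g x) \<in> lhom S X Y" by (rule pl[OF f g])
    show "(\<lambda>x\<in>carrier X. f x \<oplus>\<^bsub>Y\<^esub> g x) = (\<lambda>x\<in>carrier X. g x \<oplus>\<^bsub>Y\<^esub> f x)"
      by (rule lhom_eqI[OF pl[OF f g] pl[OF g f]]) (simp add: c f g Y.M.a_comm)
  next
    fix f assume f: "f \<in> lhom S X Y"
    show "(\<lambda>x\<in>carrier X. zero_map X Y x \<oplus>\<^bsub>Y\<^esub> f x) = f"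
      by (rule lhom_eqI[OF pl[OF zl f] f]) (simp add: c f zero_map_def)
    show "\<exists>g\<in>lhom S X Y. (\<lambda>x\<in>carrier X. g x \<oplus>\<^bsub>Y\<^esub> f x) = zero_map X Y"
      by (rule bexI[OF _ ng[OF f]], rule lhom_eqI[OF pl[OF ng[OF f] f] zl])
        (simp add: c f zero_map_def a_minus_def Y.M.l_neg)
    show "act \<one>\<^bsub>B\<^esub> f = f" by (rule lhom_eqI[OF cl[OF B.one_closed f] f]) (simp add: ao f)
  next
    fix b f assume b: "b \<in> carrier B" and f: "f \<in> lhom S X Y"
    show "act b f \<in> lhom S X Y" by (rule cl[OF b f])
  next
    fix b c' f assume b: "b \<in> carrier B" and b': "c' \<in> carrier B" and f: "f \<in> lhom S X Y"
    show "act (b \<oplus>\<^bsub>B\<^esub> c') f = (\<lambda>x\<in>carrier X. act b f x \<oplus>\<^bsub>Y\<^esub> act c' f x)"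
      by (rule lhom_eqI[OF cl[OF B.a_closed[OF b b'] f] pl[OF cl[OF b f] cl[OF b' f]]]) (simp add: al b b' f)
    show "act (b \<otimes>\<^bsub>B\<^esub> c') f = act b (act c' f)"
      by (rule lhom_eqI[OF cl[OF B.m_closed[OF b b'] f] cl[OF b cl[OF b' f]]]) (simp add: am b b' f)
  next
    fix b f g assume b: "b \<in> carrier B" and f: "f \<in> lhom S X Y" and g: "g \<in> lhom S X Y"
    show "act b (\<lambda>x\<in>carrier X. f x \<oplus>\<^bsub>Y\<^esub> g x) = (\<lambda>x\<in>carrier X. act b f x \<oplus>\<^bsub>Y\<^esub> act b g x)"
      by (rule lhom_eqI[OF cl[OF b pl[OF f g]] pl[OF cl[OF b f] cl[OF b g]]]) (simp add: ar b f g)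
  qed (rule zl)
qed

text \<open>Precomposition with \<open>f\<close>, made extensional.\<close>

definition pre :: "('a, 'x) module \<Rightarrow> ('x \<Rightarrow> 'y) \<Rightarrow> ('y \<Rightarrow> 'w) \<Rightarrow> 'x \<Rightarrow> 'w" where
  "pre X f \<phi> = (\<lambda>x\<in>carrier X. \<phi> (f x))"

lemma pre_lhom: "lin S X X' f \<Longrightarrow> lmodule S X \<Longrightarrow> \<phi> \<in> lhom S X' Y \<Longrightarrow> pre X f \<phi> \<in> lhom S X Y"
  unfolding pre_def by (rule lin_restrict_lhom[OF _ lin_comp[OF _ lhom_lin]])

lemma pre_restr [simp]: "pre (restr A X) f = pre X f"
  by (simp add: pre_def fun_eq_iff)

lemma pre_eq_const_iff: "pre X f \<phi> = (\<lambda>x\<in>carrier X. c) \<longleftrightarrow> (\<forall>x\<in>carrier X. \<phi> (f x) = c)"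
  by (auto simp: pre_def fun_eq_iff restrict_def)

lemma lhom_left_exact:
  assumes Y: "lmodule S Y" and Z: "lmodule S Z" and W: "lmodule S W"
    and g: "lin S Y Z g" "g ` carrier Y = carrier Z" and fg: "f ` X = ker Y Z g"
  shows "inj_on (pre Y g) (lhom S Z W)"
    and "pre Y g ` lhom S Z W = {\<psi> \<in> lhom S Y W. \<forall>x\<in>X. \<psi> (f x) = \<zero>\<^bsub>W\<^esub>}"
proof -
  show "inj_on (pre Y g) (lhom S Z W)"
  proof (rule inj_onI)
    fix \<phi> \<psi> assume m: "\<phi> \<in> lhom S Z W" "\<psi> \<in> lhom S Z W" and eq: "pre Y g \<phi> = pre Y g \<psi>"
    from m show "\<phi> = \<psi>"
    proof (rule lhom_eqI)
      fix z assume "z \<in> carrier Z"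
      then have "z \<in> g ` carrier Y" using g(2) by simp
      then obtain y where "y \<in> carrier Y" "z = g y" by (elim imageE)
      then show "\<phi> z = \<psi> z" using fun_cong[OF eq, of y] by (simp add: pre_def)
    qed
  qed
  show "pre Y g ` lhom S Z W = {\<psi> \<in> lhom S Y W. \<forall>x\<in>X. \<psi> (f x) = \<zero>\<^bsub>W\<^esub>}"
  proof (intro equalityI subsetI)
    fix \<psi> assume "\<psi> \<in> pre Y g ` lhom S Z W"
    then obtain \<phi> where \<phi>: "\<phi> \<in> lhom S Z W" "\<psi> = pre Y g \<phi>" by (elim imageE)
    have "g (f x) = \<zero>\<^bsub>Z\<^esub>" "f x \<in> carrier Y" if "x \<in> X" for x using fg that by blast+
    then show "\<psi> \<in> {\<psi> \<in> lhom S Y W. \<forall>x\<in>X. \<psi> (f x) = \<zero>\<^bsub>W\<^esub>}"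
      using pre_lhom[OF g(1) Y \<phi>(1)] lin_zero[OF lhom_lin[OF \<phi>(1)] lmodule_abelian_group[OF Z] lmodule_abelian_group[OF W]]
      unfolding \<phi>(2) by (simp add: pre_def)
  next
    fix \<psi> assume "\<psi> \<in> {\<psi> \<in> lhom S Y W. \<forall>x\<in>X. \<psi> (f x) = \<zero>\<^bsub>W\<^esub>}"
    then have \<psi>: "\<psi> \<in> lhom S Y W" and z: "\<And>x. x \<in> X \<Longrightarrow> \<psi> (f x) = \<zero>\<^bsub>W\<^esub>" by simp_all
    have k: "\<psi> y = \<zero>\<^bsub>W\<^esub>" if "y \<in> carrier Y" "g y = \<zero>\<^bsub>Z\<^esub>" for y
    proof -
      have "y \<in> f ` X" using that unfolding fg by simp
      then show ?thesis using z by (elim imageE) simp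
    qed
    obtain \<phi> where \<phi>: "lin S Z W \<phi>" "\<And>y. y \<in> carrier Y \<Longrightarrow> \<phi> (g y) = \<psi> y"
      by (rule lin_factor[OF Y Z W g lhom_lin[OF \<psi>]]) (erule (1) k, rule that)
    note c = lin_restrict_lhom[OF Z \<phi>(1)]
    have "pre Y g (restrict \<phi> (carrier Z)) = \<psi>"
      by (rule lhom_eqI[OF pre_lhom[OF g(1) Y c] \<psi>]) (use \<phi>(2) lin_closed[OF g(1)] in \<open>simp add: pre_def\<close>)
    from this[symmetric] c show "\<psi> \<in> pre Y g ` lhom S Z W" by (rule image_eqI)
  qed
qed

text \<open>The dual with values in any \<open>R\<close>-module \<open>G\<close>.\<close>

definition homR :: "('r, 'z) ring_scheme \<Rightarrow> ('r, 'a) module \<Rightarrow> ('a, 'x) module \<Rightarrow> ('r, 'g) module \<Rightarrow> ('a, 'x \<Rightarrow> 'g) module" where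
  "homR R A X G = hom_mod R (restr A X) G (\<lambda>a f. \<lambda>x\<in>carrier X. f (a \<odot>\<^bsub>X\<^esub> x))"

lemma dual_homR: "dual R A X = homR R A X (regular R)"
  by (simp add: dual_def homR_def)

lemma homR_simps:
  "carrier (homR R A X G) = lhom R (restr A X) G" "\<zero>\<^bsub>homR R A X G\<^esub> = (\<lambda>x\<in>carrier X. \<zero>\<^bsub>G\<^esub>)"
  "f \<oplus>\<^bsub>homR R A X G\<^esub> g = (\<lambda>x\<in>carrier X. f x \<oplus>\<^bsub>G\<^esub> g x)" "a \<odot>\<^bsub>homR R A X G\<^esub> f = (\<lambda>x\<in>carrier X. f (a \<odot>\<^bsub>X\<^esub> x))"
  by (simp_all add: homR_def hom_mod_simps zero_map_def restrict_def)

lemma HomA_simps: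
  "carrier (HomA A X Y) = lhom A X Y" "\<zero>\<^bsub>HomA A X Y\<^esub> = zero_map X Y"
  "f \<oplus>\<^bsub>HomA A X Y\<^esub> g = (\<lambda>x\<in>carrier X. f x \<oplus>\<^bsub>Y\<^esub> g x)" "r \<odot>\<^bsub>HomA A X Y\<^esub> f = (\<lambda>x\<in>carrier X. scalar A Y r (f x))"
  by (simp_all add: HomA_def hom_mod_simps restrict_def)

context algebra_over
begin

lemma HomA_lmodule:
  assumes X: "lmodule A X" and Y: "lmodule A Y"
  shows "lmodule R (HomA A X Y)"
proof -
  interpret X: lmodule A X by fact
  interpret Y: lmodule A Y by fact
  interpret YR: lmodule R "restr A Y" by (rule restr_lmodule[OF Y])
  have c: "f x \<in> carrier Y" if "f \<in> lhom A X Y" "x \<in> carrier X" for f x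
    using lin_closed[OF lhom_lin[OF that(1)] that(2)] .
  show ?thesis unfolding HomA_def
  proof (rule hom_mod_lmodule[OF R.ring_axioms X Y], goal_cases)
    case (1 r f)
    have "lin A Y Y (scalar A Y r)"
      using 1 YR.lsmult_closed[OF 1(1)] YR.lsmult_r_distr[OF 1(1)] scalar_commute[OF Y 1(1)] by (simp add: lin_def)
    from lin_restrict_lhom[OF X lin_comp[OF lhom_lin[OF 1(2)] this]] show ?case .
  next
    case (2 r s f x) then show ?case using YR.lsmult_l_distr[of r s "f x"] c by simp
  next
    case (3 r f g x) then show ?case using YR.lsmult_r_distr[of r "f x" "g x"] c by simp
  next
    case (4 r s f x) then show ?case using YR.lsmult_assoc[of r s "f x"] c by simp
  next
    case (5 f x) then show ?case using YR.lsmult_one[of "f x"] c by simp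
  qed
qed

lemma homR_lmodule:
  assumes X: "lmodule A X" and G: "lmodule R G"
  shows "lmodule (opp_ring A) (homR R A X G)"
proof -
  interpret X: lmodule A X by fact
  interpret G: lmodule R G by fact
  note XR = restr_lmodule[OF X]
  interpret XR: lmodule R "restr A X" by (rule XR)
  have ca: "f (x \<oplus>\<^bsub>X\<^esub> y) = f x \<oplus>\<^bsub>G\<^esub> f y" if "f \<in> lhom R (restr A X) G" "x \<in> carrier X" "y \<in> carrier X" for f x y
    using lin_add[OF lhom_lin[OF that(1)], of x y] that by simp
  show ?thesis unfolding homR_def
  proof (rule hom_mod_lmodule[OF opp_ring_ring[OF ring_A] XR G], goal_cases)
    case (1 a f)
    have "lin R (restr A X) (restr A X) (\<lambda>x. a \<odot>\<^bsub>X\<^esub> x)"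
      using 1 X.lsmult_closed X.lsmult_r_distr scalar_commute[OF X] by (simp add: lin_def)
    from lin_restrict_lhom[OF XR lin_comp[OF this lhom_lin[OF 1(2)]]] show ?case by simp
  next
    case (2 a b f x) then show ?case using ca[of f "a \<odot>\<^bsub>X\<^esub> x" "b \<odot>\<^bsub>X\<^esub> x"] by (simp add: X.lsmult_l_distr)
  next
    case (3 a f g x) then show ?case by simp
  next
    case (4 a b f x) then show ?case by (simp add: X.lsmult_assoc)
  next
    case (5 f x) then show ?case by simp
  qed
qed

lemma homR_pre_lin:
  assumes f: "lin A X X' f" and X: "lmodule A X" and X': "lmodule A X'"
  shows "lin (opp_ring A) (homR R A X' G) (homR R A X G) (pre X f)"
proof -
  interpret X: lmodule A X by fact
  interpret X': lmodule A X' by fact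
  have "pre X f \<phi> \<in> lhom R (restr A X) G" if "\<phi> \<in> lhom R (restr A X') G" for \<phi>
    using pre_lhom[OF restr_lin[OF f X] restr_lmodule[OF X] that] by (simp add: pre_def)
  then show ?thesis unfolding lin_opp
    by (intro linI) (auto simp: homR_simps pre_def lin_closed[OF f] lin_smult[OF f] intro!: restrict_ext)
qed

lemma thru_homR:
  assumes h: "thru A X V Y h" and X: "lmodule A X" and V: "lmodule A V" and Y: "lmodule A Y" and G: "lmodule R G"
  shows "thru (opp_ring A) (homR R A Y G) (homR R A V G) (homR R A X G) (pre X h)"
  using h
proof induct
  case zero
  interpret G: lmodule R G by fact
  show ?case
  proof (rule thru.cong[OF thru.zero])
    fix \<phi> assume "\<phi> \<in> carrier (homR R A Y G)"
    then have "\<phi> \<zero>\<^bsub>Y\<^esub> = \<zero>\<^bsub>G\<^esub>"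
      using lin_zero[OF lhom_lin _ G.M.abelian_group_axioms, of \<phi> R "restr A Y"] lmodule_abelian_group[OF restr_lmodule[OF Y]]
      by (simp add: homR_simps)
    then show "pre X (\<lambda>x. \<zero>\<^bsub>Y\<^esub>) \<phi> = \<zero>\<^bsub>homR R A X G\<^esub>" by (simp add: pre_def homR_simps zero_map_def)
  qed
next
  case (step i p h)
  have hl: "lin A X Y h" by (rule thru_lin[OF step(3) X Y])
  show ?case
  proof (rule thru.cong[OF thru.step[OF homR_pre_lin[OF step(2) V Y] homR_pre_lin[OF step(1) X V] step(4)]])
    fix \<phi> assume \<phi>: "\<phi> \<in> carrier (homR R A Y G)"
    have "\<phi> (p (i x) \<oplus>\<^bsub>Y\<^esub> h x) = \<phi> (p (i x)) \<oplus>\<^bsub>G\<^esub> \<phi> (h x)" if "x \<in> carrier X" for x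
      using lin_add[OF lhom_lin[OF \<phi>[unfolded homR_simps]], of "p (i x)" "h x"] lin_closed[OF lin_comp[OF step(1,2)] that] lin_closed[OF hl that]
      by simp
    then show "pre X (\<lambda>x. p (i x) \<oplus>\<^bsub>Y\<^esub> h x) \<phi> = pre X i (pre V p \<phi>) \<oplus>\<^bsub>homR R A X G\<^esub> pre X h \<phi>"
      using lin_closed[OF step(1)] by (auto simp: pre_def homR_simps intro!: restrict_ext)
  qed
next
  case (cong h h')
  show ?case
    by (rule thru.cong[OF cong(2)]) (auto simp: pre_def cong(3) intro!: restrict_ext)
qed

lemma in_add_homR:
  assumes "in_add A X V" "lmodule A X" "lmodule A V" "lmodule R G"
  shows "in_add (opp_ring A) (homR R A X G) (homR R A V G)"
  unfolding in_add_def
proof (rule thru.cong[OF thru_homR[OF assms(1)[unfolded in_add_def] assms(2,3,2,4)]])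
  fix \<phi> assume "\<phi> \<in> carrier (homR R A X G)"
  then have "\<phi> \<in> extensional (carrier X)" by (simp add: homR_simps lhom_iff)
  then show "\<phi> = pre X (\<lambda>x. x) \<phi>" by (auto simp: pre_def extensional_restrict)
qed

lemma HomA_pre_lin:
  assumes f: "lin A X X' f" and X: "lmodule A X"
  shows "lin R (HomA A X' W) (HomA A X W) (pre X f)"
  using pre_lhom[OF f X]
  by (intro linI) (auto simp: HomA_simps pre_def lin_closed[OF f] intro!: restrict_ext)

lemma thru_HomA:
  assumes h: "thru A X V Y h" and X: "lmodule A X" and V: "lmodule A V" and Y: "lmodule A Y" and W: "lmodule A W"
  shows "thru R (HomA A Y W) (HomA A V W) (HomA A X W) (pre X h)"
  using h
proof induct
  case zero
  show ?case
  proof (rule thru.cong[OF thru.zero])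
    fix \<phi> assume "\<phi> \<in> carrier (HomA A Y W)"
    then have "\<phi> \<zero>\<^bsub>Y\<^esub> = \<zero>\<^bsub>W\<^esub>"
      using lin_zero[OF lhom_lin lmodule_abelian_group[OF Y] lmodule_abelian_group[OF W], of \<phi>] by (simp add: HomA_simps)
    then show "pre X (\<lambda>x. \<zero>\<^bsub>Y\<^esub>) \<phi> = \<zero>\<^bsub>HomA A X W\<^esub>" by (simp add: pre_def HomA_simps zero_map_def)
  qed
next
  case (step i p h)
  have hl: "lin A X Y h" by (rule thru_lin[OF step(3) X Y])
  show ?case
  proof (rule thru.cong[OF thru.step[OF HomA_pre_lin[OF step(2) V] HomA_pre_lin[OF step(1) X] step(4)]])
    fix \<phi> assume \<phi>: "\<phi> \<in> carrier (HomA A Y W)"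
    have "\<phi> (p (i x) \<oplus>\<^bsub>Y\<^esub> h x) = \<phi> (p (i x)) \<oplus>\<^bsub>W\<^esub> \<phi> (h x)" if "x \<in> carrier X" for x
      by (rule lin_add[OF lhom_lin[OF \<phi>[unfolded HomA_simps]] lin_closed[OF lin_comp[OF step(1,2)] that] lin_closed[OF hl that]])
    then show "pre X (\<lambda>x. p (i x) \<oplus>\<^bsub>Y\<^esub> h x) \<phi> = pre X i (pre V p \<phi>) \<oplus>\<^bsub>HomA A X W\<^esub> pre X h \<phi>"
      using lin_closed[OF step(1)] by (auto simp: pre_def HomA_simps intro!: restrict_ext)
  qed
next
  case (cong h h')
  show ?case
    by (rule thru.cong[OF cong(2)]) (auto simp: pre_def cong(3) intro!: restrict_ext)
qed

lemma in_add_HomA: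
  assumes "in_add A X V" "lmodule A X" "lmodule A V" "lmodule A W"
  shows "in_add R (HomA A X W) (HomA A V W)"
  unfolding in_add_def
proof (rule thru.cong[OF thru_HomA[OF assms(1)[unfolded in_add_def] assms(2,3,2,4)]])
  fix \<phi> assume "\<phi> \<in> carrier (HomA A X W)"
  then have "\<phi> \<in> extensional (carrier X)" by (simp add: HomA_simps lhom_iff)
  then show "\<phi> = pre X (\<lambda>x. x) \<phi>" by (auto simp: pre_def extensional_restrict)
qed

subsection \<open>Double duals\<close>

text \<open>A module that is finitely generated projective over the base ring is reflexive.  Let the identity be
  the sum of the maps \<open>p\<^sub>k \<circ> i\<^sub>k\<close> through \<open>R\<close>.  A functional \<open>F\<close> on the dual is the evaluation at
  \<open>\<Sum> F(i\<^sub>k) p\<^sub>k(1)\<close>, and evaluations are distinct because the \<open>i\<^sub>k\<close> separate points.\<close>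

lemma double_dual_in_add:
  assumes W: "lmodule A W" and pr: "in_add R (restr A W) (regular R)"
  shows "in_add A (dual R (opp_ring A) (dual R A W)) W"
proof -
  interpret W: lmodule A W by fact
  note WR = restr_lmodule[OF W] and reg = regular_lmodule[OF R.ring_axioms]
  interpret O: algebra_over R "opp_ring A" by (rule opp_algebra)
  let ?D = "dual R A W" and ?DD = "dual R (opp_ring A) (dual R A W)"
  have D: "lmodule (opp_ring A) ?D" unfolding dual_homR by (rule homR_lmodule[OF W reg])
  note DR = O.restr_lmodule[OF D]
  interpret DR: lmodule R "restr (opp_ring A) ?D" by (rule DR)
  have Dc: "carrier ?D = lhom R (restr A W) (regular R)" unfolding dual_homR homR_simps ..
  have DDc: "carrier ?DD = lhom R (restr (opp_ring A) ?D) (regular R)" unfolding dual_homR homR_simps ..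
  have rs: "r \<odot>\<^bsub>restr (opp_ring A) ?D\<^esub> \<phi> = (\<lambda>w\<in>carrier W. r \<otimes>\<^bsub>R\<^esub> \<phi> w)" if "r \<in> carrier R" "\<phi> \<in> carrier ?D" for r \<phi>
    using lin_smult[OF lhom_lin[OF that(2)[unfolded Dc]] that(1)] by (auto simp: dual_homR homR_simps intro!: restrict_ext)
  have ps: "\<phi> \<oplus>\<^bsub>?D\<^esub> \<psi> = (\<lambda>w\<in>carrier W. \<phi> w \<oplus>\<^bsub>R\<^esub> \<psi> w)" for \<phi> \<psi> unfolding dual_homR homR_simps by simp
  let ?ev = "\<lambda>w. \<lambda>\<phi>\<in>carrier ?D. \<phi> w"
  have ev: "lin A W ?DD ?ev"
  proof (rule linI)
    fix w assume w: "w \<in> carrier W"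
    have "lin R (restr (opp_ring A) ?D) (regular R) (\<lambda>\<phi>. \<phi> w)"
    proof (rule linI)
      fix \<phi> assume \<phi>: "\<phi> \<in> carrier (restr (opp_ring A) ?D)"
      then show "\<phi> w \<in> carrier (regular R)" using lin_closed[OF lhom_lin, of \<phi> R "restr A W" "regular R" w] w by (simp add: Dc)
      fix \<psi>
      show "(\<phi> \<oplus>\<^bsub>restr (opp_ring A) ?D\<^esub> \<psi>) w = \<phi> w \<oplus>\<^bsub>regular R\<^esub> \<psi> w" using w by (simp add: ps)
    next
      fix r \<phi> assume "r \<in> carrier R" "\<phi> \<in> carrier (restr (opp_ring A) ?D)"
      then show "(r \<odot>\<^bsub>restr (opp_ring A) ?D\<^esub> \<phi>) w = r \<odot>\<^bsub>regular R\<^esub> \<phi> w" using rs[of r \<phi>] w by simp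
    qed
    from lin_restrict_lhom[OF DR this] show "?ev w \<in> carrier ?DD" unfolding DDc by simp
    fix v assume v: "v \<in> carrier W"
    show "?ev (w \<oplus>\<^bsub>W\<^esub> v) = ?ev w \<oplus>\<^bsub>?DD\<^esub> ?ev v"
      unfolding dual_homR homR_simps
      by (rule restrict_ext) (use w v in \<open>simp add: lin_add[OF lhom_lin, of _ R "restr A W" "regular R" w v, simplified]\<close>)
  next
    fix a w assume a: "a \<in> carrier A" and w: "w \<in> carrier W"
    have "a \<odot>\<^bsub>?D\<^esub> \<phi> \<in> carrier ?D" if "\<phi> \<in> carrier ?D" for \<phi>
      using lmodule.lsmult_closed[OF D, of a \<phi>] a that by simp
    then show "?ev (a \<odot>\<^bsub>W\<^esub> w) = a \<odot>\<^bsub>?DD\<^esub> ?ev w"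
      using a w by (auto simp: dual_homR homR_simps intro!: restrict_ext)
  qed
  have inj: "v = w" if vw: "v \<in> carrier W" "w \<in> carrier W" "?ev v = ?ev w" for v w
  proof -
    have e: "\<phi> v = \<phi> w" if "lin R (restr A W) (regular R) \<phi>" for \<phi>
    proof -
      have "restrict \<phi> (carrier W) \<in> carrier ?D" unfolding Dc using lin_restrict_lhom[OF WR that] by simp
      from fun_cong[OF vw(3), of "restrict \<phi> (carrier W)"] this show ?thesis using vw(1,2) by simp
    qed
    have "h v = h w" if "thru R (restr A W) (regular R) (restr A W) h" for h
      using that
    proof induct
      case zero show ?case ..
    next
      case (step i p h) then show ?case using e[OF step(1)] by simp
    next
      case (cong h h') then show ?case using vw by simp
    qed
    from this[OF pr[unfolded in_add_def]] show ?thesis .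
  qed
  have surj: "\<exists>w\<in>carrier W. F = ?ev w" if F: "F \<in> carrier ?DD" for F
  proof -
    have Fl: "lin R (restr (opp_ring A) ?D) (regular R) F" and Fe: "F \<in> extensional (carrier ?D)"
      using F unfolding DDc lhom_iff by simp_all
    have "\<exists>w\<in>carrier W. \<forall>\<phi>\<in>carrier ?D. F (pre (restr A W) h \<phi>) = \<phi> w" if "thru R (restr A W) (regular R) (restr A W) h" for h
      using that
    proof induct
      case zero
      have "F (pre (restr A W) (\<lambda>x. \<zero>\<^bsub>restr A W\<^esub>) \<phi>) = \<phi> \<zero>\<^bsub>W\<^esub>" if \<phi>: "\<phi> \<in> carrier ?D" for \<phi>
      proof -
        have z: "\<phi> \<zero>\<^bsub>W\<^esub> = \<zero>\<^bsub>R\<^esub>"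
          using lin_zero[OF lhom_lin[OF \<phi>[unfolded Dc]] lmodule_abelian_group[OF WR] lmodule_abelian_group[OF reg]] by simp
        then have "pre (restr A W) (\<lambda>x. \<zero>\<^bsub>restr A W\<^esub>) \<phi> = \<zero>\<^bsub>restr (opp_ring A) ?D\<^esub>"
          by (simp add: pre_def dual_homR homR_simps zero_map_def)
        then show ?thesis using z lin_zero[OF Fl lmodule_abelian_group[OF DR] lmodule_abelian_group[OF reg]] by simp
      qed
      then show ?case by (intro bexI[of _ "\<zero>\<^bsub>W\<^esub>"] ballI) simp_all
    next
      case (step i p h)
      then obtain w where w: "w \<in> carrier W" "\<forall>\<phi>\<in>carrier ?D. F (pre (restr A W) h \<phi>) = \<phi> w" by blast
      have p1: "p \<one>\<^bsub>R\<^esub> \<in> carrier W" using lin_closed[OF step(2), of "\<one>\<^bsub>R\<^esub>"] by simp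
      let ?i = "restrict i (carrier W)"
      have iD: "?i \<in> carrier ?D" unfolding Dc using lin_restrict_lhom[OF WR step(1)] by simp
      have Fi: "F ?i \<in> carrier R" using lin_closed[OF Fl, of ?i] iD by simp
      \<comment> \<open>the summand p \<circ> i of the identity contributes F(i) p(1)\<close>
      let ?w = "scalar A W (F ?i) (p \<one>\<^bsub>R\<^esub>) \<oplus>\<^bsub>W\<^esub> w"
      have hl: "lin R (restr A W) (restr A W) h" by (rule thru_lin[OF step(3) WR WR])
      have "F (pre (restr A W) (\<lambda>x. p (i x) \<oplus>\<^bsub>restr A W\<^esub> h x) \<phi>) = \<phi> ?w" if \<phi>: "\<phi> \<in> carrier ?D" for \<phi>
      proof -
        note \<phi>l = lhom_lin[OF \<phi>[unfolded Dc]]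
        have fp: "\<phi> (p \<one>\<^bsub>R\<^esub>) \<in> carrier R" using lin_closed[OF \<phi>l, of "p \<one>\<^bsub>R\<^esub>"] p1 by simp
        have hD: "pre (restr A W) h \<phi> \<in> carrier ?D" unfolding Dc by (rule pre_lhom[OF hl WR \<phi>[unfolded Dc]])
        have iD': "\<phi> (p \<one>\<^bsub>R\<^esub>) \<odot>\<^bsub>restr (opp_ring A) ?D\<^esub> ?i \<in> carrier ?D"
          using DR.lsmult_closed[OF fp, of ?i] iD by simp
        have "pre (restr A W) (\<lambda>x. p (i x) \<oplus>\<^bsub>restr A W\<^esub> h x) \<phi> =
            \<phi> (p \<one>\<^bsub>R\<^esub>) \<odot>\<^bsub>restr (opp_ring A) ?D\<^esub> ?i \<oplus>\<^bsub>restr (opp_ring A) ?D\<^esub> pre (restr A W) h \<phi>"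
          unfolding rs[OF fp iD] restr_simps(3) ps unfolding pre_def restr_simps(1)
        proof (rule restrict_ext)
          fix x assume x: "x \<in> carrier W"
          have ix: "i x \<in> carrier R" using lin_closed[OF step(1), of x] x by simp
          have "\<phi> (p (i x)) = i x \<otimes>\<^bsub>R\<^esub> \<phi> (p \<one>\<^bsub>R\<^esub>)"
            using lin_regular[OF R.ring_axioms lin_comp[OF step(2) \<phi>l] ix] by simp
          moreover have "\<phi> (p (i x) \<oplus>\<^bsub>W\<^esub> h x) = \<phi> (p (i x)) \<oplus>\<^bsub>R\<^esub> \<phi> (h x)"
            using lin_add[OF \<phi>l, of "p (i x)" "h x"] lin_closed[OF step(2), of "i x"] ix lin_closed[OF hl, of x] x by simp
          ultimately show "\<phi> (p (i x) \<oplus>\<^bsub>W\<^esub> h x) =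
              (\<lambda>w\<in>carrier W. \<phi> (p \<one>\<^bsub>R\<^esub>) \<otimes>\<^bsub>R\<^esub> ?i w) x \<oplus>\<^bsub>R\<^esub> (\<lambda>x\<in>carrier W. \<phi> (h x)) x"
            using x ix fp by (simp add: R.m_comm)
        qed
        then have "F (pre (restr A W) (\<lambda>x. p (i x) \<oplus>\<^bsub>restr A W\<^esub> h x) \<phi>) = \<phi> (p \<one>\<^bsub>R\<^esub>) \<otimes>\<^bsub>R\<^esub> F ?i \<oplus>\<^bsub>R\<^esub> \<phi> w"
          using lin_add[OF Fl, of "\<phi> (p \<one>\<^bsub>R\<^esub>) \<odot>\<^bsub>restr (opp_ring A) ?D\<^esub> ?i" "pre (restr A W) h \<phi>"]
            lin_smult[OF Fl fp, of ?i] iD iD' hD w(2) \<phi> by simp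
        moreover have "\<phi> ?w = F ?i \<otimes>\<^bsub>R\<^esub> \<phi> (p \<one>\<^bsub>R\<^esub>) \<oplus>\<^bsub>R\<^esub> \<phi> w"
          using lin_add[OF \<phi>l, of "scalar A W (F ?i) (p \<one>\<^bsub>R\<^esub>)" w] lin_smult[OF \<phi>l Fi, of "p \<one>\<^bsub>R\<^esub>"] p1 Fi w(1) by simp
        ultimately show ?thesis using fp Fi by (simp add: R.m_comm)
      qed
      moreover have "?w \<in> carrier W" using p1 Fi w(1) by simp
      ultimately show ?case by blast
    next
      case (cong h h')
      have "F (pre (restr A W) h' \<phi>) = F (pre (restr A W) h \<phi>)" for \<phi>
        unfolding pre_def by (rule arg_cong[of _ _ F], rule restrict_ext) (simp add: cong(3))
      then show ?case using cong(2) by simp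
    qed
    from this[OF pr[unfolded in_add_def]] obtain w where w: "w \<in> carrier W" "\<forall>\<phi>\<in>carrier ?D. F (pre (restr A W) (\<lambda>x. x) \<phi>) = \<phi> w"
      by blast
    have "pre (restr A W) (\<lambda>x. x) \<phi> = \<phi>" if "\<phi> \<in> carrier ?D" for \<phi>
      using that unfolding pre_def Dc lhom_iff by (simp add: extensional_restrict)
    then have "F = ?ev w" using w(2) Fe by (intro extensionalityI[OF Fe]) auto
    then show ?thesis using w(1) by blast
  qed
  have "bij_betw ?ev (carrier W) (carrier ?DD)"
    unfolding bij_betw_def
  proof
    show "inj_on ?ev (carrier W)" by (rule inj_onI) (rule inj)
    show "?ev ` carrier W = carrier ?DD" using lin_closed[OF ev] surj by (intro equalityI subsetI) (auto simp del: restr_simps)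
  qed
  from lin_inv[OF ev this W] have inv: "lin A ?DD W (inv_into (carrier W) ?ev)" .
  have DD: "lmodule A ?DD"
    using O.homR_lmodule[OF D reg] unfolding dual_homR[of R "opp_ring A"] by simp
  show ?thesis
  proof (rule in_add_retract[OF inv ev _ DD])
    fix F assume "F \<in> carrier ?DD"
    then have "F \<in> ?ev ` carrier W" using surj by blast
    then show "?ev (inv_into (carrier W) ?ev F) = F" by (rule f_inv_into_f)
  qed
qed

end

context algebra_over
begin

section \<open>Tensor products, homomorphisms and extensions\<close>

lemma homR_opp_lmodule:
  assumes "lmodule (opp_ring A) Y" "lmodule R G" shows "lmodule A (homR R (opp_ring A) Y G)"
proof -
  interpret O: algebra_over R "opp_ring A" by (rule opp_algebra)
  show ?thesis using O.homR_lmodule[OF assms] by simp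
qed

text \<open>This map and the next are the two directions of the adjunction
  \<open>Hom\<^sub>R(Y \<otimes>\<^sub>A C, G) = Hom\<^sub>A(C, Hom\<^sub>R(Y, G))\<close>.\<close>

lemma hom_of_tensor:
  assumes Y: "lmodule (opp_ring A) Y" and C: "lmodule A C" and G: "lmodule R G" and \<phi>: "lin R (tensorA A Y C) G \<phi>"
  shows "lin A C (homR R (opp_ring A) Y G) (\<lambda>c. \<lambda>y\<in>carrier Y. \<phi> (pt A Y C y c))"
proof -
  interpret O: algebra_over R "opp_ring A" by (rule opp_algebra)
  interpret T: tensor_action A Y C R "scalar A Y" by (rule tensorA_action[OF Y C])
  interpret Y: lmodule "opp_ring A" Y by fact
  note \<phi> = \<phi>[unfolded tensorA_def]
  have YR: "lmodule R (restr (opp_ring A) Y)" by (rule O.restr_lmodule[OF Y])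
  show ?thesis
  proof (rule linI)
    fix c assume c: "c \<in> carrier C"
    have "lin R (restr (opp_ring A) Y) G (\<lambda>y. \<phi> (pt A Y C y c))"
    proof (rule linI)
      fix y assume "y \<in> carrier (restr (opp_ring A) Y)"
      then have y: "y \<in> carrier Y" by simp
      show "\<phi> (pt A Y C y c) \<in> carrier G" by (rule lin_closed[OF \<phi> T.pt_closed[OF y c]])
      fix z assume "z \<in> carrier (restr (opp_ring A) Y)"
      then have z: "z \<in> carrier Y" by simp
      show "\<phi> (pt A Y C (y \<oplus>\<^bsub>restr (opp_ring A) Y\<^esub> z) c) = \<phi> (pt A Y C y c) \<oplus>\<^bsub>G\<^esub> \<phi> (pt A Y C z c)"
        using T.pt_add_left[OF y z c, of "scalar A Y"] lin_add[OF \<phi> T.pt_closed[OF y c] T.pt_closed[OF z c]] by simp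
    next
      fix r y assume r: "r \<in> carrier R" and "y \<in> carrier (restr (opp_ring A) Y)"
      then have y: "y \<in> carrier Y" by simp
      show "\<phi> (pt A Y C (r \<odot>\<^bsub>restr (opp_ring A) Y\<^esub> y) c) = r \<odot>\<^bsub>G\<^esub> \<phi> (pt A Y C y c)"
        using T.smult_pt[OF r y c] lin_smult[OF \<phi> r T.pt_closed[OF y c]] by simp
    qed
    from lin_restrict_lhom[OF YR this]
    show "(\<lambda>y\<in>carrier Y. \<phi> (pt A Y C y c)) \<in> carrier (homR R (opp_ring A) Y G)" by (simp add: homR_simps)
    fix d assume d: "d \<in> carrier C"
    show "(\<lambda>y\<in>carrier Y. \<phi> (pt A Y C y (c \<oplus>\<^bsub>C\<^esub> d))) =
        (\<lambda>y\<in>carrier Y. \<phi> (pt A Y C y c)) \<oplus>\<^bsub>homR R (opp_ring A) Y G\<^esub> (\<lambda>y\<in>carrier Y. \<phi> (pt A Y C y d))"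
      unfolding homR_simps
    proof (rule restrict_ext)
      fix y assume y: "y \<in> carrier Y"
      show "\<phi> (pt A Y C y (c \<oplus>\<^bsub>C\<^esub> d)) = (\<lambda>y\<in>carrier Y. \<phi> (pt A Y C y c)) y \<oplus>\<^bsub>G\<^esub> (\<lambda>y\<in>carrier Y. \<phi> (pt A Y C y d)) y"
        using y T.pt_add_right[OF y c d, of "scalar A Y"] lin_add[OF \<phi> T.pt_closed[OF y c] T.pt_closed[OF y d]] by simp
    qed
  next
    fix a c assume a: "a \<in> carrier A" and c: "c \<in> carrier C"
    show "(\<lambda>y\<in>carrier Y. \<phi> (pt A Y C y (a \<odot>\<^bsub>C\<^esub> c))) = a \<odot>\<^bsub>homR R (opp_ring A) Y G\<^esub> (\<lambda>y\<in>carrier Y. \<phi> (pt A Y C y c))"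
      unfolding homR_simps
    proof (rule restrict_ext)
      fix y assume y: "y \<in> carrier Y"
      have "a \<odot>\<^bsub>Y\<^esub> y \<in> carrier Y" using Y.lsmult_closed[of a y] a y by simp
      then show "\<phi> (pt A Y C y (a \<odot>\<^bsub>C\<^esub> c)) = (\<lambda>y\<in>carrier Y. \<phi> (pt A Y C y c)) (a \<odot>\<^bsub>Y\<^esub> y)"
        using T.pt_balanced[OF a y c] by simp
    qed
  qed
qed

lemma tensor_of_hom:
  assumes Y: "lmodule (opp_ring A) Y" and C: "lmodule A C" and G: "lmodule R G" and \<psi>: "lin A C (homR R (opp_ring A) Y G) \<psi>"
  shows "\<exists>\<phi>. lin R (tensorA A Y C) G \<phi> \<and> (\<forall>y\<in>carrier Y. \<forall>c\<in>carrier C. \<phi> (pt A Y C y c) = \<psi> c y)"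
proof -
  interpret T: tensor_action A Y C R "scalar A Y" by (rule tensorA_action[OF Y C])
  have l: "lin R (restr A Y) G (\<psi> c)" if "c \<in> carrier C" for c
    using lhom_lin[of "\<psi> c" R "restr A Y" G] lin_closed[OF \<psi> that] by (simp add: homR_simps)
  show ?thesis unfolding tensorA_def
  proof (rule T.lift_lin[OF G], goal_cases)
    case (1 y c) then show ?case using lin_closed[OF l] by simp
  next
    case (2 y z c) then show ?case using lin_add[OF l, of c y z] by simp
  next
    case (3 y c d) then show ?case using lin_add[OF \<psi>, of c d] by (simp add: homR_simps)
  next
    case (4 a y c) then show ?case using lin_smult[OF \<psi>, of a c] by (simp add: homR_simps)
  next
    case (5 r y c) then show ?case using lin_smult[OF l, of c r y] by simp
  qed
qed

text \<open>By adjunction, extending a map to \<open>G\<close> along \<open>Y \<otimes> K \<rightarrow> Y \<otimes> Q\<close> means extending a map to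
  \<open>Hom\<^sub>R(Y, G)\<close> along \<open>K \<rightarrow> Q\<close>.\<close>

lemma tensor_hom_extend:
  assumes ext: "ext1_zero A N (homR R (opp_ring A) Y G)"
    and Y: "lmodule (opp_ring A) Y" and G: "lmodule R G" and K: "lmodule A K" and Q: "lmodule A Q" and N: "lmodule A N"
    and f: "lin A K Q f" "inj_on f (carrier K)" and g: "lin A Q N g" "g ` carrier Q = carrier N"
    and fg: "f ` carrier K = ker Q N g" and \<phi>: "lin R (tensorA A Y K) G \<phi>"
  shows "\<exists>\<Phi>. lin R (tensorA A Y Q) G \<Phi> \<and> (\<forall>u\<in>carrier (tensorA A Y K). \<Phi> (tensor_map A Y K Y Q (\<lambda>y. y) f u) = \<phi> u)"
proof -
  interpret TK: tensor_action A Y K R "scalar A Y" by (rule tensorA_action[OF Y K])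
  interpret TQ: tensor_action A Y Q R "scalar A Y" by (rule tensorA_action[OF Y Q])
  obtain \<psi> where \<psi>: "lin A Q (homR R (opp_ring A) Y G) \<psi>" "\<And>k. k \<in> carrier K \<Longrightarrow> \<psi> (f k) = (\<lambda>y\<in>carrier Y. \<phi> (pt A Y K y k))"
    by (rule ext1_zero_extend_injection[OF ext N homR_opp_lmodule[OF Y G] Q K g f fg hom_of_tensor[OF Y K G \<phi>]]) (rule that)
  obtain \<Phi> where \<Phi>: "lin R (tensorA A Y Q) G \<Phi>" "\<forall>y\<in>carrier Y. \<forall>c\<in>carrier Q. \<Phi> (pt A Y Q y c) = \<psi> c y"
    using tensor_of_hom[OF Y Q G \<psi>(1)] by (elim exE conjE)
  note tl = tensorA_map_lin[OF Y Y K Q lin_id f(1)]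
  have "\<Phi> (tensor_map A Y K Y Q (\<lambda>y. y) f u) = \<phi> u" if u: "u \<in> carrier (tensorA A Y K)" for u
  proof (rule TK.lin_ext[OF G lin_comp[OF tl \<Phi>(1), unfolded tensorA_def] \<phi>[unfolded tensorA_def] _ u[unfolded tensorA_def]])
    fix y k assume y: "y \<in> carrier Y" and k: "k \<in> carrier K"
    have "\<Phi> (pt A Y Q y (f k)) = \<psi> (f k) y" using \<Phi>(2) y lin_closed[OF f(1) k] by blast
    then show "\<Phi> (tensor_map A Y K Y Q (\<lambda>y. y) f (pt A Y K y k)) = \<phi> (pt A Y K y k)"
      unfolding tensor_map_pt[OF TK.pair TQ.pair lin_id f(1) y k] using \<psi>(2)[OF k] y by simp
  qed
  then show ?thesis using \<Phi>(1) by blast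
qed

lemma tensorA_exact_right_factor:
  assumes Y: "lmodule (opp_ring A) Y" and K: "lmodule A K" and Q: "lmodule A Q" and N: "lmodule A N"
    and f: "lin A K Q f" and g: "lin A Q N g" "g ` carrier Q = carrier N" and fg: "f ` carrier K = ker Q N g"
  shows "tensor_map A Y K Y Q (\<lambda>y. y) f ` carrier (tensorA A Y K) =
      ker (tensorA A Y Q) (tensorA A Y N) (tensor_map A Y Q Y N (\<lambda>y. y) g)"
    and "tensor_map A Y Q Y N (\<lambda>y. y) g ` carrier (tensorA A Y Q) = carrier (tensorA A Y N)"
proof -
  note aK = tensorA_action[OF Y K] and aQ = tensorA_action[OF Y Q] and aN = tensorA_action[OF Y N]
  interpret TK: tensor_action A Y K R "scalar A Y" by (rule aK)
  interpret TQ: tensor_action A Y Q R "scalar A Y" by (rule aQ)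
  interpret TN: tensor_action A Y N R "scalar A Y" by (rule aN)
  let ?F = "tensor_map A Y K Y Q (\<lambda>y. y) f" and ?G = "tensor_map A Y Q Y N (\<lambda>y. y) g"
  have Fl: "lin R TK.TM TQ.TM ?F" using tensorA_map_lin[OF Y Y K Q lin_id f] by (simp add: tensorA_def)
  have Gl: "lin R TQ.TM TN.TM ?G" using tensorA_map_lin[OF Y Y Q N lin_id g(1)] by (simp add: tensorA_def)
  have id: "(\<lambda>y. y) ` carrier Y = carrier Y" by simp
  show "?G ` carrier (tensorA A Y Q) = carrier (tensorA A Y N)"
    unfolding tensorA_def by (rule tensor_map_surj[OF aQ aN lin_id id g refl])
  show "?F ` carrier (tensorA A Y K) = ker (tensorA A Y Q) (tensorA A Y N) ?G"
    unfolding tensorA_def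
  proof (intro equalityI subsetI)
    fix u assume "u \<in> ?F ` carrier TK.TM"
    then obtain v where v: "v \<in> carrier TK.TM" "u = ?F v" by (rule imageE)
    have "?G (?F v) = \<zero>\<^bsub>TN.TM\<^esub>"
    proof (rule TK.lin_ext[OF TN.lmodule_TM lin_comp[OF Fl Gl] lin_const_zero[OF TN.lmodule_TM] _ v(1)])
      fix y k assume y: "y \<in> carrier Y" and k: "k \<in> carrier K"
      have fk: "f k \<in> carrier Q" "g (f k) = \<zero>\<^bsub>N\<^esub>" using fg k by blast+
      show "?G (?F (pt A Y K y k)) = \<zero>\<^bsub>TN.TM\<^esub>"
        unfolding tensor_map_pt[OF TK.pair TQ.pair lin_id f y k] tensor_map_pt[OF TQ.pair TN.pair lin_id g(1) y fk(1)] fk(2)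
        by (rule TN.pt_zero_right[OF y])
    qed
    then show "u \<in> ker TQ.TM TN.TM ?G" using v lin_closed[OF Fl v(1)] by simp
  next
    fix u assume u: "u \<in> ker TQ.TM TN.TM ?G"
    show "u \<in> ?F ` carrier TK.TM"
    proof (rule tensor_kernel[OF aQ aN lin_id id g refl lin_image_subm[OF TK.lmodule_TM TQ.lmodule_TM Fl]])
      fix y q assume y: "y \<in> carrier Y" and q: "q \<in> carrier Q"
      { assume "y = \<zero>\<^bsub>Y\<^esub>"
        then have "pt A Y Q y q = \<zero>\<^bsub>TQ.TM\<^esub>" using TQ.pt_zero_left[OF q] by simp
        then show "pt A Y Q y q \<in> ?F ` carrier TK.TM"
          using lin_image_subm[OF TK.lmodule_TM TQ.lmodule_TM Fl] by (simp add: subm_def) }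
      assume "g q = \<zero>\<^bsub>N\<^esub>"
      then have "q \<in> f ` carrier K" unfolding fg using q by simp
      then obtain k where k: "k \<in> carrier K" "q = f k" by (rule imageE) (rule that)
      show "pt A Y Q y q \<in> ?F ` carrier TK.TM"
        unfolding k(2) tensor_map_pt[OF TK.pair TQ.pair lin_id f y k(1), symmetric] by (rule imageI[OF TK.pt_closed[OF y k(1)]])
    qed (use u in auto)
  qed
qed

lemma tensorA_exact_left_factor:
  assumes X: "lmodule (opp_ring A) X" and Y: "lmodule (opp_ring A) Y" and Z: "lmodule (opp_ring A) Z" and M: "lmodule A M"
    and f: "lin A X Y f" and g: "lin A Y Z g" "g ` carrier Y = carrier Z" and fg: "f ` carrier X = ker Y Z g"
  shows "tensor_map A X M Y M f (\<lambda>m. m) ` carrier (tensorA A X M) =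
      ker (tensorA A Y M) (tensorA A Z M) (tensor_map A Y M Z M g (\<lambda>m. m))"
    and "tensor_map A Y M Z M g (\<lambda>m. m) ` carrier (tensorA A Y M) = carrier (tensorA A Z M)"
proof -
  note aX = tensorA_action[OF X M] and aY = tensorA_action[OF Y M] and aZ = tensorA_action[OF Z M]
  interpret TX: tensor_action A X M R "scalar A X" by (rule aX)
  interpret TY: tensor_action A Y M R "scalar A Y" by (rule aY)
  interpret TZ: tensor_action A Z M R "scalar A Z" by (rule aZ)
  let ?F = "tensor_map A X M Y M f (\<lambda>m. m)" and ?G = "tensor_map A Y M Z M g (\<lambda>m. m)"
  have Fl: "lin R TX.TM TY.TM ?F" using tensorA_map_lin[OF X Y M M f lin_id] by (simp add: tensorA_def)
  have Gl: "lin R TY.TM TZ.TM ?G" using tensorA_map_lin[OF Y Z M M g(1) lin_id] by (simp add: tensorA_def)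
  have id: "(\<lambda>m. m) ` carrier M = carrier M" by simp
  have gs: "g (scalar A Y r y) = scalar A Z r (g y)" if "r \<in> carrier R" "y \<in> carrier Y" for r y
    using lin_smult[OF g(1), of "r \<odot>\<^bsub>A\<^esub> \<one>\<^bsub>A\<^esub>" y] that by simp
  show "?G ` carrier (tensorA A Y M) = carrier (tensorA A Z M)"
    unfolding tensorA_def by (rule tensor_map_surj[OF aY aZ g lin_id id]) (rule gs)
  show "?F ` carrier (tensorA A X M) = ker (tensorA A Y M) (tensorA A Z M) ?G"
    unfolding tensorA_def
  proof (intro equalityI subsetI)
    fix u assume "u \<in> ?F ` carrier TX.TM"
    then obtain v where v: "v \<in> carrier TX.TM" "u = ?F v" by (rule imageE)
    have "?G (?F v) = \<zero>\<^bsub>TZ.TM\<^esub>"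
    proof (rule TX.lin_ext[OF TZ.lmodule_TM lin_comp[OF Fl Gl] lin_const_zero[OF TZ.lmodule_TM] _ v(1)])
      fix x m assume x: "x \<in> carrier X" and m: "m \<in> carrier M"
      have fx: "f x \<in> carrier Y" "g (f x) = \<zero>\<^bsub>Z\<^esub>" using fg x by blast+
      show "?G (?F (pt A X M x m)) = \<zero>\<^bsub>TZ.TM\<^esub>"
        unfolding tensor_map_pt[OF TX.pair TY.pair f lin_id x m] tensor_map_pt[OF TY.pair TZ.pair g(1) lin_id fx(1) m] fx(2)
        by (rule TZ.pt_zero_left[OF m])
    qed
    then show "u \<in> ker TY.TM TZ.TM ?G" using v lin_closed[OF Fl v(1)] by simp
  next
    fix u assume u: "u \<in> ker TY.TM TZ.TM ?G"
    show "u \<in> ?F ` carrier TX.TM"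
    proof (rule tensor_kernel[OF aY aZ g lin_id id])
      show "subm R TY.TM (?F ` carrier TX.TM)" by (rule lin_image_subm[OF TX.lmodule_TM TY.lmodule_TM Fl])
      fix y m assume y: "y \<in> carrier Y" and m: "m \<in> carrier M"
      { assume "m = \<zero>\<^bsub>M\<^esub>"
        then have "pt A Y M y m = \<zero>\<^bsub>TY.TM\<^esub>" using TY.pt_zero_right[OF y] by simp
        then show "pt A Y M y m \<in> ?F ` carrier TX.TM"
          using lin_image_subm[OF TX.lmodule_TM TY.lmodule_TM Fl] by (simp add: subm_def) }
      assume "g y = \<zero>\<^bsub>Z\<^esub>"
      then have "y \<in> f ` carrier X" unfolding fg using y by simp
      then obtain x where x: "x \<in> carrier X" "y = f x" by (rule imageE) (rule that)
      show "pt A Y M y m \<in> ?F ` carrier TX.TM"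
        unfolding x(2) tensor_map_pt[OF TX.pair TY.pair f lin_id x(1) m, symmetric] by (rule imageI[OF TX.pt_closed[OF x(1) m]])
    next
      show "u \<in> carrier TY.TM" "?G u = \<zero>\<^bsub>TZ.TM\<^esub>" using u by auto
    qed (rule gs)
  qed
qed

text \<open>Write the identity of \<open>Y \<otimes> K\<close> as a sum of composites through \<open>R\<close>, and extend the functionals in it to
  \<open>Y \<otimes> Q\<close>.\<close>

lemma tensor_split:
  assumes ext: "ext1_zero A N (homR R (opp_ring A) Y (regular R))" and YK: "in_add R (tensorA A Y K) (regular R)"
    and Y: "lmodule (opp_ring A) Y" and K: "lmodule A K" and Q: "lmodule A Q" and N: "lmodule A N"
    and f: "lin A K Q f" "inj_on f (carrier K)" and g: "lin A Q N g" "g ` carrier Q = carrier N" and fg: "f ` carrier K = ker Q N g"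
  shows "\<exists>s. lin R (tensorA A Y Q) (tensorA A Y K) s \<and> (\<forall>u\<in>carrier (tensorA A Y K). s (tensor_map A Y K Y Q (\<lambda>y. y) f u) = u)"
proof -
  note reg = regular_lmodule[OF R.ring_axioms]
  note TK = tensorA_lmodule[OF Y K] and TQ = tensorA_lmodule[OF Y Q]
  let ?F = "tensor_map A Y K Y Q (\<lambda>y. y) f"
  note Fl = tensorA_map_lin[OF Y Y K Q lin_id f(1)]
  have "\<exists>s. lin R (tensorA A Y Q) (tensorA A Y K) s \<and> (\<forall>u\<in>carrier (tensorA A Y K). s (?F u) = h u)"
    if "thru R (tensorA A Y K) (regular R) (tensorA A Y K) h" for h
    using that
  proof induct
    case zero show ?case using lin_const_zero[OF TK] by blast
  next
    case (step i p h)
    then obtain s where s: "lin R (tensorA A Y Q) (tensorA A Y K) s" "\<forall>u\<in>carrier (tensorA A Y K). s (?F u) = h u" by blast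
    obtain \<Phi> where \<Phi>: "lin R (tensorA A Y Q) (regular R) \<Phi>" "\<forall>u\<in>carrier (tensorA A Y K). \<Phi> (?F u) = i u"
      using tensor_hom_extend[OF ext Y reg K Q N f g fg step(1)] by (elim exE conjE)
    show ?case
      by (rule exI[of _ "\<lambda>u. p (\<Phi> u) \<oplus>\<^bsub>tensorA A Y K\<^esub> s u"])
        (use lin_plus[OF lin_comp[OF \<Phi>(1) step(2)] s(1) TK] \<Phi>(2) s(2) in simp)
  next
    case (cong h h') then show ?case by simp
  qed
  from this[OF YK[unfolded in_add_def]] show ?thesis .
qed

end

text \<open>The projection \<open>id - f \<circ> s\<close> kills the image of \<open>f\<close>, so it descends to a section of \<open>g\<close>.\<close>

lemma in_add_split_quotient:
  assumes C: "lmodule A C" and D: "lmodule A D" and f: "lin A B C f"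
    and g: "lin A C D g" "g ` carrier C = carrier D" and fg: "f ` carrier B = ker C D g"
    and s: "lin A C B s" "\<And>b. b \<in> carrier B \<Longrightarrow> s (f b) = b"
  shows "in_add A D C"
proof -
  interpret C: lmodule A C by fact
  interpret D: lmodule A D by fact
  let ?e = "\<lambda>x. x \<ominus>\<^bsub>C\<^esub> f (s x)"
  have e: "lin A C C ?e" by (rule lin_minus[OF lin_id lin_comp[OF s(1) f] C])
  have e0: "?e x = \<zero>\<^bsub>C\<^esub>" if "x \<in> carrier C" "g x = \<zero>\<^bsub>D\<^esub>" for x
  proof -
    have "x \<in> f ` carrier B" using that fg by simp
    then obtain b where b: "b \<in> carrier B" "x = f b" by (rule imageE) (rule that)
    then show ?thesis using s(2)[OF b(1)] that(1) by (simp add: a_minus_def C.M.r_neg)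
  qed
  obtain e' where e': "lin A D C e'" "\<And>x. x \<in> carrier C \<Longrightarrow> e' (g x) = ?e x"
    by (rule lin_factor[OF C D C g e e0]) (assumption, assumption, rule that)
  show ?thesis
  proof (rule in_add_retract[OF e'(1) g(1) _ D])
    fix d assume "d \<in> carrier D"
    then have "d \<in> g ` carrier C" using g(2) by simp
    then obtain x where x: "x \<in> carrier C" "d = g x" by (rule imageE) (rule that)
    have sx: "s x \<in> carrier B" "f (s x) \<in> carrier C" using lin_closed[OF s(1) x(1)] lin_closed[OF f] by auto
    have "f (s x) \<in> ker C D g" using fg sx(1) by blast
    then have "g (?e x) = g x"
      using lin_diff[OF g(1) C.M.abelian_group_axioms D.M.abelian_group_axioms x(1) sx(2)] lin_closed[OF g(1) x(1)] neg_zero[OF D.M.abelian_group_axioms]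
      by (simp add: a_minus_def)
    then show "g (e' d) = d" using e'(2)[OF x(1)] x(2) by simp
  qed
qed

section \<open>Filtrations\<close>

lemma ext1_zero_trivial:
  assumes M: "lmodule A M" "carrier M = {\<zero>\<^bsub>M\<^esub>}"
  shows "ext1_zero A M W"
proof -
  have "finitely_generated A M" by (intro iffD2[OF fg_iff_lspan[OF M(1)]] exI[of _ "{}"]) (use M(2) lspan.zero in auto)
  then obtain P :: "('a, nat \<Rightarrow> 'a) module" and g where P: "presents A P g M" using fg_presents[OF M(1)] by blast
  have "ker P M g = carrier P" using P M(2) lin_closed[of A P M g] by (auto simp: presents_def)
  then have "extends_all A P (ker P M g) W" by (auto simp: extends_all_def)
  then show ?thesis using P by (auto simp: ext1_zero_def)
qed

lemma subm_zero: "lmodule A X \<Longrightarrow> subm A X {\<zero>\<^bsub>X\<^esub>}"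
proof -
  assume "lmodule A X"
  then interpret lmodule A X .
  show ?thesis by (auto simp: subm_def)
qed

context algebra_over
begin

text \<open>As \<open>U\<close> is projective, the twist \<open>V l \<otimes> U\<close> lies in \<open>add (V l)\<close>.  Properties that are inherited by
  summands of sums and by extensions can therefore be checked on the \<open>V l\<close> themselves.\<close>

lemma filtered_induct:
  fixes V :: "'l \<Rightarrow> ('a, 'v) module" and X :: "('a, 'x) module"
  assumes X: "X \<in> filtered A (twists R A \<Lambda> V)" and V: "\<And>l. l \<in> \<Lambda> \<Longrightarrow> lmodule A (V l)"
    and base: "\<And>Z :: ('a, 'x) module. lmodule A Z \<Longrightarrow> carrier Z = {\<zero>\<^bsub>Z\<^esub>} \<Longrightarrow> Q Z"
    and step: "\<And>(G :: ('a, 'x) module) H f g (T :: ('a, ('v \<times> (nat \<Rightarrow> 'r) \<Rightarrow>\<^sub>0 int) set) module) l.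
      \<lbrakk>l \<in> \<Lambda>; lmodule A G; lmodule A H; lmodule A T; in_add A T (V l); lin A G H f; inj_on f (carrier G);
       lin A H T g; g ` carrier H = carrier T; f ` carrier G = ker H T g; Q G\<rbrakk> \<Longrightarrow> Q H"
  shows "Q X"
proof -
  obtain n F where F: "F 0 = {\<zero>\<^bsub>X\<^esub>}" "F n = carrier X" "\<forall>i\<le>n. submodule (F i) A X"
    and Fs: "\<forall>i<n. F i \<subseteq> F (Suc i) \<and> (\<exists>T\<in>twists R A \<Lambda> V. lmod_iso A (quot_mod (X\<lparr>carrier := F (Suc i)\<rparr>) (F i)) T)"
    and Xm: "lmodule A X"
    using X unfolding filtered_def fg_mods_def by blast
  have "i \<le> n \<Longrightarrow> Q (X\<lparr>carrier := F i\<rparr>)" for i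
  proof (induct i)
    case 0
    show ?case unfolding F(1) by (rule base[OF subm_lmodule[OF Xm subm_zero[OF Xm]]]) simp
  next
    case (Suc i)
    let ?H = "F (Suc i)" and ?G = "F i"
    let ?XH = "X\<lparr>carrier := ?H\<rparr>"
    have H: "subm A X ?H" and G: "subm A X ?G" using F(3) Suc(2) by (auto intro: submodule_subm)
    have GH: "?G \<subseteq> ?H" using Fs Suc(2) by auto
    obtain T where T: "T \<in> twists R A \<Lambda> V" and iso: "lmod_iso A (quot_mod ?XH ?G) T" using Fs Suc(2) by (meson Suc_le_lessD)
    obtain l U where l: "l \<in> \<Lambda>" and U: "U \<in> proj_mods R" and TU: "T = tensorR R A (V l) U" using T unfolding twists_def by blast
    have U': "lmodule R U" "in_add R U (regular R)" using U by (auto simp: proj_mods_iff fgp_def)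
    have Tm: "lmodule A T" unfolding TU by (rule tensorR_lmodule[OF V[OF l] U'(1)])
    have Ta: "in_add A T (V l)" unfolding TU by (rule tensorR_in_add[OF V[OF l] U'])
    have XH: "lmodule A ?XH" by (rule subm_lmodule[OF Xm H])
    have GX: "subm A ?XH ?G" using G GH by (simp add: subm_def)
    note q = quot_mod_proj[OF XH GX]
    obtain k where k: "lin A (quot_mod ?XH ?G) T k" "bij_betw k (carrier (quot_mod ?XH ?G)) (carrier T)"
      using iso unfolding lmod_iso_def by (elim bexE) (rule that, erule lhom_lin)
    let ?g = "\<lambda>x. k (?G +>\<^bsub>?XH\<^esub> x)"
    have g: "lin A ?XH T ?g" by (rule lin_comp[OF q(1) k(1)])
    have gs: "?g ` ?H = carrier T" using q(2) k(2) by (simp add: bij_betw_def image_image[symmetric])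
    note k0 = lin_zero[OF k(1) lmodule_abelian_group[OF q(4)] lmodule_abelian_group[OF Tm]]
    have "?g x = \<zero>\<^bsub>T\<^esub> \<longleftrightarrow> x \<in> ?G" if x: "x \<in> ?H" for x
    proof -
      have "?g x = \<zero>\<^bsub>T\<^esub> \<longleftrightarrow> ?G +>\<^bsub>?XH\<^esub> x = \<zero>\<^bsub>quot_mod ?XH ?G\<^esub>"
        unfolding k0[symmetric]
        by (rule inj_on_eq_iff[OF bij_betw_imp_inj_on[OF k(2)]])
          (use lin_closed[OF q(1), of x] x abelian_groupE(2)[OF lmodule_abelian_group[OF q(4)]] in auto)
      then show ?thesis using q(3)[of x] x by simp
    qed
    then have ker: "(\<lambda>x. x) ` carrier (X\<lparr>carrier := ?G\<rparr>) = ker ?XH T ?g" using GH by auto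
    have inc: "lin A (X\<lparr>carrier := ?G\<rparr>) ?XH (\<lambda>x. x)" by (rule linI) (use GH in auto)
    show ?case
      by (rule step[OF l subm_lmodule[OF Xm G] XH Tm Ta inc _ g _ ker]) (use gs Suc in simp_all)
  qed
  from this[of n] show ?thesis using F(2) by simp
qed

end

section \<open>Ext in degrees zero and one\<close>

text \<open>Here \<open>B\<close> stands for the bare set of coboundaries and \<open>z\<close> for the zero cochain.\<close>

lemma carrier_quot_mod_trivial:
  assumes "carrier (quot_mod X B) = {\<zero>\<^bsub>quot_mod X B\<^esub>}" and "f \<in> carrier X" and "z \<in> B" and "z \<oplus>\<^bsub>X\<^esub> f = f"
  shows "f \<in> B"
proof -
  have "B +>\<^bsub>X\<^esub> f \<in> carrier (quot_mod X B)" using assms(2) by (auto simp: quot_mod_def A_RCOSETS_def')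
  then have "B +>\<^bsub>X\<^esub> f = B" using assms(1) by (simp add: quot_mod_def)
  moreover have "z \<oplus>\<^bsub>X\<^esub> f \<in> B +>\<^bsub>X\<^esub> f" using assms(3) by (auto simp: a_r_coset_def')
  ultimately show ?thesis using assms(4) by simp
qed

context algebra_over
begin

text \<open>Since resolutions exist, the one picked by the choice operator is a resolution.\<close>

lemma Ext_resolution:
  fixes M :: "('a, 'm) module" and W :: "('a, 'w) module"
  assumes R: "noetherian_ring R" and fgA: "finitely_generated R A" and M: "lmodule A M" "finitely_generated A M"
  obtains P :: "nat \<Rightarrow> ('a, nat \<Rightarrow> 'a) module" and d e
  where "proj_resolution A M P d e" "\<And>i. Ext A M W i = hom_cohomology A P d W i"
proof -
  obtain P0 :: "nat \<Rightarrow> ('a, nat \<Rightarrow> 'a) module" and d0 e0 where "proj_resolution A M P0 d0 e0"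
    by (rule proj_resolution_exists[OF R R_algebra_axioms fgA M])
  then have ex: "\<exists>t. (case t of (P :: nat \<Rightarrow> ('a, nat \<Rightarrow> 'a) module, d, e) \<Rightarrow> proj_resolution A M P d e)" by auto
  obtain P :: "nat \<Rightarrow> ('a, nat \<Rightarrow> 'a) module" and d e where t: "(SOME (P, d, e). proj_resolution A M P d e) = (P, d, e)"
    by (metis prod_cases3)
  have "proj_resolution A M P d e" using someI_ex[OF ex] unfolding t by simp
  moreover have "Ext A M W i = hom_cohomology A P d W i" for i unfolding Ext_def t by simp
  ultimately show thesis by (rule that)
qed

text \<open>For a map \<open>\<phi>\<close> on the kernel of \<open>e : P\<^sub>0 \<rightarrow> M\<close>, the composite \<open>\<phi> \<circ> d\<^sub>0\<close> is a cocycle, and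
  writing it as a coboundary \<open>\<psi> \<circ> d\<^sub>0\<close> means extending \<open>\<phi>\<close> to \<open>\<psi>\<close>.\<close>

lemma Ext1_trivial_imp_ext1_zero:
  fixes M :: "('a, 'm) module" and W :: "('a, 'w) module"
  assumes R: "noetherian_ring R" and fgA: "finitely_generated R A" and M: "lmodule A M" "finitely_generated A M" and W: "lmodule A W"
    and triv: "carrier (Ext A M W 1) = {\<zero>\<^bsub>Ext A M W 1\<^esub>}"
  shows "ext1_zero A M W"
proof -
  obtain P :: "nat \<Rightarrow> ('a, nat \<Rightarrow> 'a) module" and d e where res: "proj_resolution A M P d e"
    and E: "\<And>i. Ext A M W i = hom_cohomology A P d W i"
    by (rule Ext_resolution[OF R fgA M, where W = W]) (rule that)
  have P: "fgp A (P i)" "lmodule A (P i)" and d: "d i \<in> lhom A (P (Suc i)) (P i)" for i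
    using res unfolding proj_resolution_def by (auto simp: proj_mods_iff fgp_def)
  have e: "lin A (P 0) M e" "e ` carrier (P 0) = carrier M" and d0: "d 0 ` carrier (P (Suc 0)) = ker (P 0) M e"
    and d1: "d (Suc 0) ` carrier (P (Suc (Suc 0))) = ker (P (Suc 0)) (P 0) (d 0)"
    using res unfolding proj_resolution_def a_kernel_eq by (auto simp: lhom_iff)
  have dl: "lin A (P (Suc i)) (P i) (d i)" for i by (rule lhom_lin[OF d])
  have dc: "d i x \<in> carrier (P i)" if "x \<in> carrier (P (Suc i))" for i x by (rule lin_closed[OF dl that])
  let ?Z = "{f \<in> lhom A (P (Suc 0)) W. compose (carrier (P (Suc (Suc 0)))) f (d (Suc 0)) = zero_map (P (Suc (Suc 0))) W}"
  let ?B = "(\<lambda>f. compose (carrier (P (Suc 0))) f (d 0)) ` lhom A (P 0) W"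
  have E1: "Ext A M W 1 = quot_mod ((HomA A (P (Suc 0)) W)\<lparr>carrier := ?Z\<rparr>) ?B"
    unfolding E hom_cohomology_def by (simp add: Let_def)
  have ZB: "f \<in> ?B" if f: "f \<in> ?Z" for f
  proof (rule carrier_quot_mod_trivial)
    show "carrier (quot_mod ((HomA A (P (Suc 0)) W)\<lparr>carrier := ?Z\<rparr>) ?B) = {\<zero>\<^bsub>quot_mod ((HomA A (P (Suc 0)) W)\<lparr>carrier := ?Z\<rparr>) ?B\<^esub>}"
      using triv unfolding E1 .
    show "f \<in> carrier ((HomA A (P (Suc 0)) W)\<lparr>carrier := ?Z\<rparr>)" using f by simp
    have "zero_map (P (Suc 0)) W = compose (carrier (P (Suc 0))) (zero_map (P 0) W) (d 0)"
      unfolding zero_map_def compose_def by (rule restrict_ext) (simp add: dc)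
    moreover have "compose (carrier (P (Suc 0))) (zero_map (P 0) W) (d 0) \<in> ?B"
      by (rule imageI[where f = "\<lambda>f. compose (carrier (P (Suc 0))) f (d 0)", OF zero_map_lhom[OF P(2) W]])
    ultimately show "zero_map (P (Suc 0)) W \<in> ?B" by simp
    have "\<zero>\<^bsub>HomA A (P (Suc 0)) W\<^esub> \<oplus>\<^bsub>HomA A (P (Suc 0)) W\<^esub> f = f"
      by (rule abelian_groupE(5)[OF lmodule_abelian_group[OF HomA_lmodule[OF P(2) W]]]) (use f in \<open>simp add: HomA_simps\<close>)
    then show "zero_map (P (Suc 0)) W \<oplus>\<^bsub>(HomA A (P (Suc 0)) W)\<lparr>carrier := ?Z\<rparr>\<^esub> f = f" by (simp add: HomA_simps)
  qed
  have "extends_all A (P 0) (ker (P 0) M e) W"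
    unfolding extends_all_def
  proof (intro allI impI)
    fix \<phi> assume \<phi>: "lin A ((P 0)\<lparr>carrier := ker (P 0) M e\<rparr>) W \<phi>"
    have "d 0 x \<in> ker (P 0) M e" if "x \<in> carrier (P (Suc 0))" for x using that d0 by blast
    then have "lin A (P (Suc 0)) ((P 0)\<lparr>carrier := ker (P 0) M e\<rparr>) (d 0)" by (rule lin_into_sub[OF dl])
    from lin_comp[OF this \<phi>] have l: "lin A (P (Suc 0)) W (\<lambda>x. \<phi> (d 0 x))" .
    let ?f = "restrict (\<lambda>x. \<phi> (d 0 x)) (carrier (P (Suc 0)))"
    have k: "d 0 (d (Suc 0) x) = \<zero>\<^bsub>P 0\<^esub>" if "x \<in> carrier (P (Suc (Suc 0)))" for x using that d1 by blast
    have z: "\<phi> \<zero>\<^bsub>P 0\<^esub> = \<zero>\<^bsub>W\<^esub>"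
      using lin_zero[OF \<phi> lmodule_abelian_group[OF subm_lmodule[OF P(2) kernel_subm[OF P(2) M(1) e(1)]]] lmodule_abelian_group[OF W]] by simp
    have "compose (carrier (P (Suc (Suc 0)))) ?f (d (Suc 0)) = zero_map (P (Suc (Suc 0))) W"
      unfolding zero_map_def compose_def by (rule restrict_ext) (simp add: dc k z)
    then have "?f \<in> ?Z" using lin_restrict_lhom[OF P(2) l] by simp
    from ZB[OF this] obtain \<psi> where \<psi>: "\<psi> \<in> lhom A (P 0) W" "?f = compose (carrier (P (Suc 0))) \<psi> (d 0)" by (elim imageE)
    have "\<psi> y = \<phi> y" if y: "y \<in> ker (P 0) M e" for y
    proof -
      have "y \<in> d 0 ` carrier (P (Suc 0))" using y unfolding d0 .
      then obtain x where x: "x \<in> carrier (P (Suc 0))" "y = d 0 x" by (elim imageE)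
      from fun_cong[OF \<psi>(2), of x] show ?thesis using x by (simp add: compose_def)
    qed
    then show "\<exists>\<psi>. lin A (P 0) W \<psi> \<and> (\<forall>x\<in>ker (P 0) M e. \<psi> x = \<phi> x)" using lhom_lin[OF \<psi>(1)] by blast
  qed
  then show ?thesis unfolding ext1_zero_def presents_def using P(1)[of 0] e by blast
qed

text \<open>The \<open>0\<close>-cocycles are the maps on \<open>P\<^sub>0\<close> that factor through \<open>M\<close>; the only coboundary is zero.\<close>

lemma Ext0_HomA:
  fixes M :: "('a, 'm) module" and W :: "('a, 'w) module"
  assumes R: "noetherian_ring R" and fgA: "finitely_generated R A" and M: "lmodule A M" "finitely_generated A M" and W: "lmodule A W"
  shows "in_add R (HomA A M W) (Ext A M W 0) \<and> lmodule R (Ext A M W 0)"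
proof -
  obtain P :: "nat \<Rightarrow> ('a, nat \<Rightarrow> 'a) module" and d e where res: "proj_resolution A M P d e"
    and E: "\<And>i. Ext A M W i = hom_cohomology A P d W i"
    by (rule Ext_resolution[OF R fgA M, where W = W]) (rule that)
  have P: "lmodule A (P i)" and d: "d i \<in> lhom A (P (Suc i)) (P i)" for i
    using res unfolding proj_resolution_def by (auto simp: proj_mods_iff fgp_def)
  have e: "lin A (P 0) M e" "e ` carrier (P 0) = carrier M" and d0: "d 0 ` carrier (P (Suc 0)) = ker (P 0) M e"
    using res unfolding proj_resolution_def a_kernel_eq by (auto simp: lhom_iff)
  have dl: "lin A (P (Suc i)) (P i) (d i)" for i by (rule lhom_lin[OF d])
  let ?H = "HomA A (P 0) W"
  let ?Z = "{f \<in> lhom A (P 0) W. compose (carrier (P (Suc 0))) f (d 0) = zero_map (P (Suc 0)) W}"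
  have Z: "f \<in> ?Z \<longleftrightarrow> f \<in> lhom A (P 0) W \<and> (\<forall>x\<in>carrier (P (Suc 0)). f (d 0 x) = \<zero>\<^bsub>W\<^esub>)" for f
    by (auto simp: compose_def zero_map_def restrict_def fun_eq_iff)
  have E0: "Ext A M W 0 = quot_mod (?H\<lparr>carrier := ?Z\<rparr>) {zero_map (P 0) W}"
    unfolding E hom_cohomology_def by (simp add: Let_def)
  note H = HomA_lmodule[OF P[of 0] W]
  interpret H: lmodule R ?H by (rule H)
  interpret W: lmodule A W by (rule W)
  interpret WR: lmodule R "restr A W" by (rule restr_lmodule[OF W])
  have Zs: "subm R ?H ?Z"
    unfolding subm_def
  proof (intro conjI ballI)
    show "?Z \<subseteq> carrier ?H" by (auto simp: HomA_simps)
    show "\<zero>\<^bsub>?H\<^esub> \<in> ?Z" unfolding Z using H.M.zero_closed lin_closed[OF dl] by (simp add: HomA_simps zero_map_def)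
  next
    fix f g assume f: "f \<in> ?Z" and g: "g \<in> ?Z"
    have "f \<oplus>\<^bsub>?H\<^esub> g \<in> lhom A (P 0) W" using H.M.a_closed[of f g] f g by (simp add: HomA_simps)
    then show "f \<oplus>\<^bsub>?H\<^esub> g \<in> ?Z" using f g lin_closed[OF dl] unfolding Z by (simp add: HomA_simps)
  next
    fix r f assume r: "r \<in> carrier R" and f: "f \<in> ?Z"
    have "r \<odot>\<^bsub>?H\<^esub> f \<in> lhom A (P 0) W" using H.lsmult_closed[of r f] r f by (simp add: HomA_simps)
    then show "r \<odot>\<^bsub>?H\<^esub> f \<in> ?Z" using f r lin_closed[OF dl] WR.lsmult_r_null[OF r] unfolding Z by (simp add: HomA_simps)
  qed
  note HZ = subm_lmodule[OF H Zs]
  note left_exact = lhom_left_exact[OF P M(1) W e d0]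
  have im: "pre (P 0) e ` carrier (HomA A M W) = ?Z"
    unfolding HomA_simps left_exact(2)
    by (rule Collect_cong) (auto simp: compose_def zero_map_def restrict_def fun_eq_iff)
  have pre0: "lin R (HomA A M W) (?H\<lparr>carrier := ?Z\<rparr>) (pre (P 0) e)"
    by (rule lin_into_sub[OF HomA_pre_lin[OF e(1) P]]) (use im in blast)
  have bij0: "bij_betw (pre (P 0) e) (carrier (HomA A M W)) (carrier (?H\<lparr>carrier := ?Z\<rparr>))"
    unfolding bij_betw_def using left_exact(1) im by (simp add: HomA_simps)
  have K: "subm R (?H\<lparr>carrier := ?Z\<rparr>) {zero_map (P 0) W}"
    using subm_zero[OF HZ] by (simp add: HomA_simps)
  note q = quot_mod_proj[OF HZ K]
  have bij1: "bij_betw (\<lambda>f. {zero_map (P 0) W} +>\<^bsub>?H\<lparr>carrier := ?Z\<rparr>\<^esub> f) (carrier (?H\<lparr>carrier := ?Z\<rparr>)) (carrier (quot_mod (?H\<lparr>carrier := ?Z\<rparr>) {zero_map (P 0) W}))"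
    unfolding bij_betw_def
  proof
    let ?q = "\<lambda>f. {zero_map (P 0) W} +>\<^bsub>?H\<lparr>carrier := ?Z\<rparr>\<^esub> f"
    interpret HZ: lmodule R "?H\<lparr>carrier := ?Z\<rparr>" by (rule HZ)
    interpret Q: lmodule R "quot_mod (?H\<lparr>carrier := ?Z\<rparr>) {zero_map (P 0) W}" by (rule q(4))
    show "inj_on ?q (carrier (?H\<lparr>carrier := ?Z\<rparr>))"
    proof (rule inj_onI)
      fix f g assume f: "f \<in> carrier (?H\<lparr>carrier := ?Z\<rparr>)" and g: "g \<in> carrier (?H\<lparr>carrier := ?Z\<rparr>)" and eq: "?q f = ?q g"
      have "?q (f \<ominus>\<^bsub>?H\<lparr>carrier := ?Z\<rparr>\<^esub> g) = ?q f \<ominus>\<^bsub>quot_mod (?H\<lparr>carrier := ?Z\<rparr>) {zero_map (P 0) W}\<^esub> ?q g"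
        by (rule lin_diff[OF q(1) HZ.M.abelian_group_axioms Q.M.abelian_group_axioms f g])
      also have "\<dots> = \<zero>\<^bsub>quot_mod (?H\<lparr>carrier := ?Z\<rparr>) {zero_map (P 0) W}\<^esub>"
        unfolding eq a_minus_def by (rule Q.M.r_neg[OF lin_closed[OF q(1) g]])
      finally have "f \<ominus>\<^bsub>?H\<lparr>carrier := ?Z\<rparr>\<^esub> g \<in> {zero_map (P 0) W}" using q(3)[OF HZ.M.minus_closed[OF f g]] by simp
      then show "f = g" by (intro minus_zero_imp_eq[OF HZ.M.abelian_group_axioms f g]) (simp add: HomA_simps)
    qed
  qed (rule q(2))
  have "in_add R (HomA A M W) (Ext A M W 0)" unfolding E0
    by (rule in_add_bij[OF lin_comp[OF pre0 q(1)] _ HomA_lmodule[OF M(1) W]])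
      (use bij_betw_trans[OF bij0 bij1] in \<open>simp add: comp_def\<close>)
  then show ?thesis unfolding E0 using q(4) by simp
qed

end

section \<open>Exactness and projectivity over the base ring\<close>

context algebra_over
begin

text \<open>The sequence splits over \<open>R\<close>, because its last term is projective there.\<close>

lemma homR_exact:
  assumes X: "lmodule A X" and Y: "lmodule A Y" and Z: "lmodule A Z" and G: "lmodule R G"
    and f: "lin A X Y f" "inj_on f (carrier X)" and g: "lin A Y Z g" "g ` carrier Y = carrier Z"
    and ex: "f ` carrier X = ker Y Z g" and pr: "in_add R (restr A Z) (regular R)"
  shows "inj_on (pre Y g) (carrier (homR R A Z G))"
    and "pre X f ` carrier (homR R A Y G) = carrier (homR R A X G)"
    and "pre Y g ` carrier (homR R A Z G) = ker (homR R A Y G) (homR R A X G) (pre X f)"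
proof -
  note XR = restr_lmodule[OF X] and YR = restr_lmodule[OF Y] and ZR = restr_lmodule[OF Z]
  note fR = restr_lin[OF f(1) X] and gR = restr_lin[OF g(1) Y]
  have gs: "g ` carrier (restr A Y) = carrier (restr A Z)" and ker: "f ` carrier (restr A X) = ker (restr A Y) (restr A Z) g"
    using g(2) ex by simp_all
  note left_exact = lhom_left_exact[OF YR ZR G gR gs ker]
  show "inj_on (pre Y g) (carrier (homR R A Z G))" using left_exact(1) by (simp add: homR_simps)
  show "pre Y g ` carrier (homR R A Z G) = ker (homR R A Y G) (homR R A X G) (pre X f)"
    using left_exact(2) by (simp add: homR_simps pre_eq_const_iff)
  obtain t where t: "lin R (restr A Y) (restr A X) t" "\<And>x. x \<in> carrier (restr A X) \<Longrightarrow> t (f x) = x"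
    by (rule projective_extension_splits[OF XR YR pr ZR fR _ gR gs ker]) (use f(2) in simp, rule that)
  have cX: "pre X f \<phi> \<in> carrier (homR R A X G)" if "\<phi> \<in> carrier (homR R A Y G)" for \<phi>
    using lin_closed[OF homR_pre_lin[OF f(1) X Y] that] .
  show "pre X f ` carrier (homR R A Y G) = carrier (homR R A X G)"
  proof (intro equalityI subsetI)
    fix \<phi> assume "\<phi> \<in> pre X f ` carrier (homR R A Y G)" then show "\<phi> \<in> carrier (homR R A X G)" using cX by blast
  next
    fix \<phi> assume "\<phi> \<in> carrier (homR R A X G)"
    then have \<phi>: "\<phi> \<in> lhom R (restr A X) G" by (simp add: homR_simps)
    let ?\<psi> = "pre Y t \<phi>"
    have \<psi>: "?\<psi> \<in> carrier (homR R A Y G)" using pre_lhom[OF t(1) YR \<phi>] by (simp add: homR_simps)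
    have "pre X f ?\<psi> = \<phi>"
      by (rule lhom_eqI[OF cX[OF \<psi>, unfolded homR_simps] \<phi>]) (use t(2) lin_closed[OF f(1)] in \<open>simp add: pre_def\<close>)
    from this[symmetric] \<psi> show "\<phi> \<in> pre X f ` carrier (homR R A Y G)" by (rule image_eqI)
  qed
qed

text \<open>\<open>0 \<rightarrow> Hom(N, W) \<rightarrow> Hom(Q, W) \<rightarrow> Hom(K, W) \<rightarrow> 0\<close> is exact, the last map being onto as there are no
  extensions of \<open>N\<close> by \<open>W\<close>.\<close>

lemma HomA_extension_fgp:
  assumes K: "lmodule A K" and Q: "lmodule A Q" and N: "lmodule A N" and W: "lmodule A W" and ext: "ext1_zero A N W"
    and f: "lin A K Q f" "inj_on f (carrier K)" and g: "lin A Q N g" "g ` carrier Q = carrier N" and fg: "f ` carrier K = ker Q N g"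
    and pr: "in_add R (HomA A K W) (regular R)" "in_add R (HomA A N W) (regular R)"
  shows "in_add R (HomA A Q W) (regular R)"
proof (rule in_add_regular_extension[OF pr(2) HomA_lmodule[OF N W] HomA_lmodule[OF Q W] pr(1) HomA_lmodule[OF K W]
      HomA_pre_lin[OF g(1) Q] _ HomA_pre_lin[OF f(1) K]])
  note left_exact = lhom_left_exact[OF Q N W g fg]
  show "inj_on (pre Q g) (carrier (HomA A N W))" using left_exact(1) by (simp add: HomA_simps)
  show "pre Q g ` carrier (HomA A N W) = ker (HomA A Q W) (HomA A K W) (pre K f)"
    using left_exact(2) by (simp add: HomA_simps zero_map_def pre_eq_const_iff)
  have cK: "pre K f \<phi> \<in> carrier (HomA A K W)" if "\<phi> \<in> carrier (HomA A Q W)" for \<phi>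
    using lin_closed[OF HomA_pre_lin[OF f(1) K] that] .
  show "pre K f ` carrier (HomA A Q W) = carrier (HomA A K W)"
  proof (intro equalityI subsetI)
    fix \<phi> assume "\<phi> \<in> pre K f ` carrier (HomA A Q W)" then show "\<phi> \<in> carrier (HomA A K W)" using cK by blast
  next
    fix \<phi> assume "\<phi> \<in> carrier (HomA A K W)"
    then have \<phi>: "\<phi> \<in> lhom A K W" by (simp add: HomA_simps)
    obtain \<psi> where \<psi>: "lin A Q W \<psi>" "\<And>x. x \<in> carrier K \<Longrightarrow> \<psi> (f x) = \<phi> x"
      by (rule ext1_zero_extend_injection[OF ext N W Q K g f fg lhom_lin[OF \<phi>]]) (rule that)
    have c: "restrict \<psi> (carrier Q) \<in> carrier (HomA A Q W)" using lin_restrict_lhom[OF Q \<psi>(1)] by (simp add: HomA_simps)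
    have "pre K f (restrict \<psi> (carrier Q)) = \<phi>"
      by (rule lhom_eqI[OF cK[OF c, unfolded HomA_simps] \<phi>]) (simp add: pre_def \<psi>(2) lin_closed[OF f(1)])
    from this[symmetric] c show "\<phi> \<in> pre K f ` carrier (HomA A Q W)" by (rule image_eqI)
  qed
qed

text \<open>The \<open>j\<close>-th coordinate contributes the composite
  \<open>Hom(D, W) \<rightarrow> Hom(X j, W) \<rightarrow> Hom(D, W)\<close> for the sum \<open>D\<close>.  Factorisations through \<open>R\<close> exist only after \<open>Hom(-, W)\<close> is
  applied, so the truncations are followed through \<open>Hom\<close> one coordinate at a time.\<close>

lemma thru_HomA_direct_sum:
  assumes X: "\<And>i. i \<in> I \<Longrightarrow> lmodule A (X i)" and W: "lmodule A W"
    and H: "\<And>i. i \<in> I \<Longrightarrow> in_add R (HomA A (X i) W) (regular R)" and J: "finite J" "J \<subseteq> I"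
  shows "thru R (HomA A (direct_sum I X) W) (regular R) (HomA A (direct_sum I X) W)
     (pre (direct_sum I X) (\<lambda>f. \<lambda>i\<in>I. if i \<in> J then f i else \<zero>\<^bsub>X i\<^esub>))"
  using J
proof (induct J)
  let ?D = "direct_sum I X"
  have D: "lmodule A ?D" by (rule direct_sum_lmodule[OF ring_A X])
  case empty
  show ?case
  proof (rule thru.cong[OF thru.zero])
    fix \<phi> assume "\<phi> \<in> carrier (HomA A ?D W)"
    then have "\<phi> \<zero>\<^bsub>?D\<^esub> = \<zero>\<^bsub>W\<^esub>"
      using lin_zero[OF lhom_lin lmodule_abelian_group[OF D] lmodule_abelian_group[OF W], of \<phi>] by (simp add: HomA_simps)
    then show "pre ?D (\<lambda>f. \<lambda>i\<in>I. if i \<in> {} then f i else \<zero>\<^bsub>X i\<^esub>) \<phi> = \<zero>\<^bsub>HomA A ?D W\<^esub>"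
      unfolding pre_def HomA_simps zero_map_def by (intro restrict_ext) (simp add: direct_sum_simps restrict_def)
  qed
next
  let ?D = "direct_sum I X"
  have D: "lmodule A ?D" by (rule direct_sum_lmodule[OF ring_A X])
  interpret D: lmodule A ?D by (rule D)
  case (insert j J)
  have j: "j \<in> I" using insert by simp
  let ?p = "\<lambda>f. f j" and ?i = "\<lambda>x. \<lambda>i\<in>I. if i = j then x else \<zero>\<^bsub>X i\<^esub>"
  let ?t = "\<lambda>J f. \<lambda>i\<in>I. if i \<in> J then f i else \<zero>\<^bsub>X i\<^esub>"
  have pj: "lin A ?D (X j) ?p" by (rule direct_sum_proj[OF j])
  have ij: "lin A (X j) ?D ?i" by (rule direct_sum_inj[OF ring_A X j])
  have tc: "?t J f \<in> carrier ?D" if "f \<in> carrier ?D" for f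
  proof -
    have "{i \<in> I. ?t J f i \<noteq> \<zero>\<^bsub>X i\<^esub>} \<subseteq> J" by auto
    with \<open>finite J\<close> have fin: "finite {i \<in> I. ?t J f i \<noteq> \<zero>\<^bsub>X i\<^esub>}" by (rule rev_finite_subset)
    have "?t J f i \<in> carrier (X i)" if "i \<in> I" for i
      using \<open>f \<in> carrier ?D\<close> abelian_monoid.zero_closed[OF abelian_group.axioms(1)[OF lmodule_abelian_group[OF X[OF that]]]] that
      by (auto simp: direct_sum_simps)
    with fin show ?thesis by (simp add: direct_sum_simps)
  qed
  have dec: "?t (insert j J) f = ?i (?p f) \<oplus>\<^bsub>?D\<^esub> ?t J f" if "f \<in> carrier ?D" for f
    by (rule direct_sum_truncate_insert[OF X that insert(2)])
  have HD: "lmodule R (HomA A ?D W)" by (rule HomA_lmodule[OF D W])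
  have "thru R (HomA A ?D W) (HomA A (X j) W) (HomA A ?D W) (\<lambda>\<phi>. pre ?D ?p (pre (X j) ?i \<phi>))"
    by (rule thru_single[OF HomA_pre_lin[OF ij X[OF j]] HomA_pre_lin[OF pj D] HD])
  then have 1: "thru R (HomA A ?D W) (regular R) (HomA A ?D W) (\<lambda>\<phi>. pre ?D ?p (pre (X j) ?i \<phi>))"
    by (rule thru_trans[OF _ H[OF j] HD HomA_lmodule[OF X[OF j] W] HD])
  have 2: "thru R (HomA A ?D W) (regular R) (HomA A ?D W) (pre ?D (?t J))"
    by (rule insert(3)) (use insert(4) in simp)
  show ?case
  proof (rule thru.cong[OF thru_plus[OF 1 2 HD HD]])
    fix \<phi> assume "\<phi> \<in> carrier (HomA A ?D W)"
    then have \<phi>: "lin A ?D W \<phi>" by (simp add: HomA_simps lhom_lin)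
    show "pre ?D (?t (insert j J)) \<phi> = pre ?D ?p (pre (X j) ?i \<phi>) \<oplus>\<^bsub>HomA A ?D W\<^esub> pre ?D (?t J) \<phi>"
      unfolding HomA_simps pre_def
    proof (rule restrict_ext)
      fix f assume f: "f \<in> carrier ?D"
      have "\<phi> (?t (insert j J) f) = \<phi> (?i (?p f)) \<oplus>\<^bsub>W\<^esub> \<phi> (?t J f)"
        unfolding dec[OF f] by (rule lin_add[OF \<phi> lin_closed[OF ij lin_closed[OF pj f]] tc[OF f]])
      then show "\<phi> (?t (insert j J) f) = restrict (\<lambda>x. restrict (\<lambda>x. \<phi> (?i x)) (carrier (X j)) (?p x)) (carrier ?D) f \<oplus>\<^bsub>W\<^esub>
          restrict (\<lambda>x. \<phi> (?t J x)) (carrier ?D) f"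
        using f lin_closed[OF pj f] by simp
    qed
  qed
qed

lemma HomA_direct_sum_fgp:
  assumes X: "\<And>i. i \<in> I \<Longrightarrow> lmodule A (X i)" and W: "lmodule A W"
    and H: "\<And>i. i \<in> I \<Longrightarrow> in_add R (HomA A (X i) W) (regular R)" and I: "finite I"
  shows "in_add R (HomA A (direct_sum I X) W) (regular R)"
proof -
  have t: "thru R (HomA A (direct_sum I X) W) (regular R) (HomA A (direct_sum I X) W)
     (pre (direct_sum I X) (\<lambda>f. \<lambda>i\<in>I. if i \<in> I then f i else \<zero>\<^bsub>X i\<^esub>))"
    by (rule thru_HomA_direct_sum[OF X W H I subset_refl])
  show ?thesis unfolding in_add_def
  proof (rule thru.cong[OF t])
    fix \<phi> assume "\<phi> \<in> carrier (HomA A (direct_sum I X) W)"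
    then have "\<phi> \<in> extensional (carrier (direct_sum I X))" by (simp add: HomA_simps lhom_iff)
    moreover have "(\<lambda>i\<in>I. if i \<in> I then f i else \<zero>\<^bsub>X i\<^esub>) = f" if "f \<in> carrier (direct_sum I X)" for f
      using that by (auto simp: direct_sum_simps PiE_iff extensional_def fun_eq_iff)
    ultimately show "\<phi> = pre (direct_sum I X) (\<lambda>f. \<lambda>i\<in>I. if i \<in> I then f i else \<zero>\<^bsub>X i\<^esub>) \<phi>"
      unfolding pre_def by (intro ext) (simp add: extensional_def)
  qed
qed

text \<open>Evaluation at \<open>1\<close> identifies \<open>Hom\<^sub>A(A, W)\<close> with \<open>W\<close>.\<close>

lemma in_add_HomA_generator:
  assumes W: "lmodule A W" and n: "in_add A (regular A) (G :: ('a, 'g) module)" and G: "lmodule A G"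
  shows "in_add R (restr A W) (HomA A G W)"
proof (rule in_add_trans[OF _ in_add_HomA[OF n regular_lmodule[OF ring_A] G W] restr_lmodule[OF W]])
  let ?H = "HomA A (regular A) W"
  show "lmodule R ?H" by (rule HomA_lmodule[OF regular_lmodule[OF ring_A] W])
  interpret W: lmodule A W by (rule W)
  let ?i = "\<lambda>w. \<lambda>a\<in>carrier A. a \<odot>\<^bsub>W\<^esub> w"
  have i: "?i w \<in> lhom A (regular A) W" if "w \<in> carrier W" for w
    using lin_restrict_lhom[OF regular_lmodule[OF ring_A] lin_orbit[OF W that]] by simp
  show "in_add R (restr A W) ?H"
  proof (rule in_add_retract[OF _ _ _ restr_lmodule[OF W], where i = ?i and p = "\<lambda>f. f \<one>\<^bsub>A\<^esub>"])
    show "lin R (restr A W) ?H ?i"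
    proof (rule linI)
      fix r w assume r: "r \<in> carrier R" and w: "w \<in> carrier (restr A W)"
      have "a \<odot>\<^bsub>W\<^esub> scalar A W r w = scalar A W r (a \<odot>\<^bsub>W\<^esub> w)" if "a \<in> carrier A" for a
        using scalar_commute[OF W r that] w by simp
      then show "?i (r \<odot>\<^bsub>restr A W\<^esub> w) = r \<odot>\<^bsub>?H\<^esub> ?i w" by (auto simp: HomA_simps)
    qed (use i in \<open>auto simp: HomA_simps W.lsmult_r_distr\<close>)
    show "lin R ?H (restr A W) (\<lambda>f. f \<one>\<^bsub>A\<^esub>)"
      by (rule linI) (auto simp: HomA_simps lhom_iff lin_def)
  qed simp
qed

text \<open>\<open>W = Hom\<^sub>A(A, W)\<close> is a direct summand of a sum of copies of the \<open>Hom\<^sub>A(P l, W)\<close>.\<close>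

lemma fgp_if_HomA_fgp:
  fixes P :: "'l \<Rightarrow> ('a, 'p) module"
  assumes W: "lmodule A W" and I: "finite I" and P: "\<And>l. l \<in> I \<Longrightarrow> lmodule A (P l)"
    and gen: "in_add A (regular A) (direct_sum I P)" and H: "\<And>l. l \<in> I \<Longrightarrow> in_add R (HomA A (P l) W) (regular R)"
  shows "in_add R (restr A W) (regular R)"
proof -
  have S: "lmodule A (direct_sum I P)" by (rule direct_sum_lmodule[OF ring_A P])
  show ?thesis
    by (rule in_add_trans[OF in_add_HomA_generator[OF W gen S] HomA_direct_sum_fgp[OF P W H I] restr_lmodule[OF W] HomA_lmodule[OF S W]])
qed

lemma HomA_filtered_fgp:
  fixes V :: "'l \<Rightarrow> ('a, 'v) module" and X :: "('a, 'x) module"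
  assumes X: "X \<in> filtered A (twists R A \<Lambda> V)" and V: "\<And>l. l \<in> \<Lambda> \<Longrightarrow> lmodule A (V l)" "\<And>l. l \<in> \<Lambda> \<Longrightarrow> finitely_generated A (V l)"
    and W: "lmodule A W" and ext: "\<And>l. l \<in> \<Lambda> \<Longrightarrow> ext1_zero A (V l) W"
    and H: "\<And>l. l \<in> \<Lambda> \<Longrightarrow> in_add R (HomA A (V l) W) (regular R)"
  shows "in_add R (HomA A X W) (regular R)"
proof (rule filtered_induct[OF X V(1)])
  fix Z :: "('a, 'x) module" assume Z: "lmodule A Z" "carrier Z = {\<zero>\<^bsub>Z\<^esub>}"
  let ?H = "HomA A Z W"
  have 0: "\<zero>\<^bsub>?H\<^esub> \<in> carrier ?H"
    by (rule abelian_monoid.zero_closed[OF abelian_group.axioms(1)[OF lmodule_abelian_group[OF HomA_lmodule[OF Z(1) W]]]])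
  have "\<phi> = \<zero>\<^bsub>?H\<^esub>" if "\<phi> \<in> carrier ?H" for \<phi>
  proof (rule lhom_eqI)
    show "\<phi> \<in> lhom A Z W" "\<zero>\<^bsub>?H\<^esub> \<in> lhom A Z W" using that 0 by (simp_all add: HomA_simps)
    fix x assume "x \<in> carrier Z"
    then show "\<phi> x = \<zero>\<^bsub>?H\<^esub> x"
      using lin_zero[OF lhom_lin lmodule_abelian_group[OF Z(1)] lmodule_abelian_group[OF W], of \<phi>] that Z(2)
      by (simp add: HomA_simps zero_map_def)
  qed
  then show "in_add R ?H (regular R)" using 0 by (intro in_add_trivial) blast
next
  fix G H :: "('a, 'x) module" and f g and T :: "('a, ('v \<times> (nat \<Rightarrow> 'r) \<Rightarrow>\<^sub>0 int) set) module" and l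
  assume l: "l \<in> \<Lambda>" and G: "lmodule A G" and H': "lmodule A H" and T: "lmodule A T" "in_add A T (V l)"
    and ex: "lin A G H f" "inj_on f (carrier G)" "lin A H T g" "g ` carrier H = carrier T" "f ` carrier G = ker H T g"
    and IH: "in_add R (HomA A G W) (regular R)"
  have "finitely_generated A T" by (rule fg_in_add[OF T(1) V(1)[OF l] T(2) V(2)[OF l]])
  then obtain P :: "('a, nat \<Rightarrow> 'a) module" and \<pi> where "presents A P \<pi> T" by (rule fg_presents[OF T(1)]) (rule that)
  then have eT: "ext1_zero A T W" by (rule ext1_zero_in_add_left[OF T(2) ext[OF l] T(1) V(1)[OF l] W])
  have hT: "in_add R (HomA A T W) (regular R)"
    by (rule in_add_trans[OF in_add_HomA[OF T(2,1) V(1)[OF l] W] H[OF l] HomA_lmodule[OF T(1) W] HomA_lmodule[OF V(1)[OF l] W]])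
  show "in_add R (HomA A H W) (regular R)" by (rule HomA_extension_fgp[OF G H' T(1) W eT ex IH hT])
qed

end

context algebra_over
begin

text \<open>A composite \<open>p \<circ> i\<close> through \<open>R\<close> dualises to the composite of \<open>\<phi> \<mapsto> \<phi> (p 1)\<close> and \<open>r \<mapsto> r i\<close>.\<close>

lemma thru_dual:
  assumes h: "thru R (restr A X) (regular R) (restr A Y) h" and X: "lmodule A X" and Y: "lmodule A Y"
  shows "thru R (restr A (dual R A Y)) (regular R) (restr A (dual R A X)) (pre X h)"
proof -
  have Rm: "lmodule R (regular R)" by (rule regular_lmodule) (rule R.ring_axioms)
  note XR = restr_lmodule[OF X] and YR = restr_lmodule[OF Y]
  show ?thesis using h
  proof induct
    case zero
    show ?case
    proof (rule thru.cong[OF thru.zero])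
      fix \<phi> assume "\<phi> \<in> carrier (restr A (dual R A Y))"
      then show "pre X (\<lambda>x. \<zero>\<^bsub>restr A Y\<^esub>) \<phi> = \<zero>\<^bsub>restr A (dual R A X)\<^esub>"
        using lin_zero[OF lhom_lin[where A = R] lmodule_abelian_group[OF YR] lmodule_abelian_group[OF Rm], of \<phi>]
        by (simp add: pre_def dual_homR homR_simps)
    qed
  next
    case (step i p h)
    note i = step(1) and p = step(2)
    have h: "lin R (restr A X) (restr A Y) h" by (rule thru_lin[OF step(3) XR YR])
    let ?e = "\<lambda>\<phi>. \<phi> (p \<one>\<^bsub>R\<^esub>)" and ?m = "\<lambda>r. \<lambda>x\<in>carrier X. r \<otimes>\<^bsub>R\<^esub> i x"
    have p1: "p \<one>\<^bsub>R\<^esub> \<in> carrier Y" using lin_closed[OF p, of "\<one>\<^bsub>R\<^esub>"] by simp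
    have ic: "i x \<in> carrier R" if "x \<in> carrier X" for x using lin_closed[OF i, of x] that by simp
    have e: "lin R (restr A (dual R A Y)) (regular R) ?e"
    proof (rule linI)
      fix r \<phi> assume r: "r \<in> carrier R" and "\<phi> \<in> carrier (restr A (dual R A Y))"
      then have "lin R (restr A Y) (regular R) \<phi>" by (simp add: dual_homR homR_simps lhom_lin)
      from lin_smult[OF this r, of "p \<one>\<^bsub>R\<^esub>"] p1
      show "?e (r \<odot>\<^bsub>restr A (dual R A Y)\<^esub> \<phi>) = r \<odot>\<^bsub>regular R\<^esub> ?e \<phi>" by (simp add: dual_homR homR_simps)
    qed (use p1 in \<open>auto simp: dual_homR homR_simps lhom_iff lin_def\<close>)
    have mc: "?m r \<in> lhom R (restr A X) (regular R)" if r: "r \<in> carrier R" for r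
    proof -
      have "lin R (regular R) (regular R) (\<lambda>s. r \<otimes>\<^bsub>R\<^esub> s)"
        by (rule linI) (use r in \<open>simp_all add: R.r_distr R.m_lcomm\<close>)
      from lin_restrict_lhom[OF XR lin_comp[OF i this]] show ?thesis by simp
    qed
    have m: "lin R (regular R) (restr A (dual R A X)) ?m"
    proof (rule linI)
      fix r s assume r: "r \<in> carrier R" and "s \<in> carrier (regular R)"
      then have s: "s \<in> carrier R" by simp
      have "(r \<otimes>\<^bsub>R\<^esub> s) \<otimes>\<^bsub>R\<^esub> i x = s \<otimes>\<^bsub>R\<^esub> i (scalar A X r x)" if "x \<in> carrier X" for x
        using lin_smult[OF i r, of x] that r s ic[OF that] by (simp add: R.m_ac)
      moreover have "scalar A X r x \<in> carrier X" if "x \<in> carrier X" for x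
        using X r that by (intro lmodule.lsmult_closed[OF X]) auto
      ultimately show "?m (r \<odot>\<^bsub>regular R\<^esub> s) = r \<odot>\<^bsub>restr A (dual R A X)\<^esub> ?m s"
        by (auto simp: dual_homR homR_simps)
    qed (use mc ic in \<open>auto simp: dual_homR homR_simps R.l_distr\<close>)
    show ?case
    proof (rule thru.cong[OF thru.step[OF e m step(4)]])
      fix \<phi> assume "\<phi> \<in> carrier (restr A (dual R A Y))"
      then have \<phi>: "lin R (restr A Y) (regular R) \<phi>" by (simp add: dual_homR homR_simps lhom_lin)
      have "\<phi> (p (i x) \<oplus>\<^bsub>Y\<^esub> h x) = \<phi> (p \<one>\<^bsub>R\<^esub>) \<otimes>\<^bsub>R\<^esub> i x \<oplus>\<^bsub>R\<^esub> \<phi> (h x)" if x: "x \<in> carrier X" for x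
      proof -
        have pc: "p (i x) \<in> carrier Y" using lin_closed[OF p, of "i x"] ic[OF x] by simp
        have hc: "h x \<in> carrier Y" using lin_closed[OF h, of x] x by simp
        have "p (i x) = scalar A Y (i x) (p \<one>\<^bsub>R\<^esub>)" using lin_regular[OF R.ring_axioms p ic[OF x]] by simp
        moreover have "\<phi> (scalar A Y (i x) (p \<one>\<^bsub>R\<^esub>)) = i x \<otimes>\<^bsub>R\<^esub> \<phi> (p \<one>\<^bsub>R\<^esub>)"
          using lin_smult[OF \<phi> ic[OF x], of "p \<one>\<^bsub>R\<^esub>"] p1 by simp
        moreover have "\<phi> (p \<one>\<^bsub>R\<^esub>) \<in> carrier R" using lin_closed[OF \<phi>, of "p \<one>\<^bsub>R\<^esub>"] p1 by simp
        ultimately have "\<phi> (p (i x)) = \<phi> (p \<one>\<^bsub>R\<^esub>) \<otimes>\<^bsub>R\<^esub> i x" using R.m_comm[OF ic[OF x]] by simp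
        then show ?thesis using lin_add[OF \<phi>, of "p (i x)" "h x"] pc hc by simp
      qed
      then show "pre X (\<lambda>x. p (i x) \<oplus>\<^bsub>restr A Y\<^esub> h x) \<phi> = ?m (?e \<phi>) \<oplus>\<^bsub>restr A (dual R A X)\<^esub> pre X h \<phi>"
        by (auto simp: pre_def dual_homR homR_simps)
    qed
  next
    case (cong h h')
    show ?case
    proof (rule thru.cong[OF cong(2)])
      fix \<phi> assume "\<phi> \<in> carrier (restr A (dual R A Y))"
      show "pre X h' \<phi> = pre X h \<phi>" unfolding pre_def by (rule restrict_ext) (use cong(3) in simp)
    qed
  qed
qed

lemma dual_fgp:
  assumes W: "lmodule A W" and pr: "in_add R (restr A W) (regular R)"
  shows "in_add R (restr A (dual R A W)) (regular R)"
proof -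
  have "thru R (restr A (dual R A W)) (regular R) (restr A (dual R A W)) (pre W (\<lambda>x. x))"
    by (rule thru_dual[OF pr[unfolded in_add_def] W W])
  then show ?thesis unfolding in_add_def
  proof (rule thru.cong)
    fix \<phi> assume "\<phi> \<in> carrier (restr A (dual R A W))"
    then show "\<phi> = pre W (\<lambda>x. x) \<phi>"
      by (auto simp: pre_def dual_homR homR_simps lhom_iff extensional_def fun_eq_iff)
  qed
qed

text \<open>The identity of \<open>Y \<otimes> K\<close> extends along \<open>Y \<otimes> K \<rightarrow> Y \<otimes> Q\<close>.\<close>

lemma tensor_inj_right:
  assumes ext: "ext1_zero A N (homR R (opp_ring A) Y (tensorA A Y K))"
    and Y: "lmodule (opp_ring A) Y" and K: "lmodule A K" and Q: "lmodule A Q" and N: "lmodule A N"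
    and f: "lin A K Q f" "inj_on f (carrier K)" and g: "lin A Q N g" "g ` carrier Q = carrier N"
    and fg: "f ` carrier K = ker Q N g"
  shows "inj_on (tensor_map A Y K Y Q (\<lambda>y. y) f) (carrier (tensorA A Y K))"
proof -
  obtain s where "\<And>u. u \<in> carrier (tensorA A Y K) \<Longrightarrow> s (tensor_map A Y K Y Q (\<lambda>y. y) f u) = u"
    using tensor_hom_extend[OF ext Y tensorA_lmodule[OF Y K] K Q N f g fg lin_id] by blast
  then show ?thesis by (rule inj_on_inverseI)
qed

text \<open>Put \<open>G = X \<otimes> M\<close>.  The map \<open>M \<rightarrow> Hom\<^sub>R(X, G)\<close> adjoint to the identity lifts along
  \<open>Hom\<^sub>R(Y, G) \<rightarrow> Hom\<^sub>R(X, G)\<close>, whose kernel \<open>Hom\<^sub>R(Z, G)\<close> has no extensions with \<open>M\<close>; the adjoint of the lift is a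
  left inverse of \<open>X \<otimes> M \<rightarrow> Y \<otimes> M\<close>.\<close>

lemma tensor_inj_left:
  assumes ext: "ext1_zero A M (homR R (opp_ring A) Z (tensorA A X M))" and M: "lmodule A M"
    and X: "lmodule (opp_ring A) X" and Y: "lmodule (opp_ring A) Y" and Z: "lmodule (opp_ring A) Z"
    and f: "lin A X Y f" "inj_on f (carrier X)" and g: "lin A Y Z g" "g ` carrier Y = carrier Z"
    and fg: "f ` carrier X = ker Y Z g" and pr: "in_add R (restr A Z) (regular R)"
  shows "inj_on (tensor_map A X M Y M f (\<lambda>m. m)) (carrier (tensorA A X M))"
proof -
  interpret O: algebra_over R "opp_ring A" by (rule opp_algebra)
  let ?G = "tensorA A X M" and ?H = "\<lambda>X. homR R (opp_ring A) X (tensorA A X M)"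
  note G = tensorA_lmodule[OF X M]
  have fo: "lin (opp_ring A) X Y f" and go: "lin (opp_ring A) Y Z g" and po: "in_add R (restr (opp_ring A) Z) (regular R)"
    using f(1) g(1) pr by simp_all
  note ex = O.homR_exact[OF X Y Z G fo f(2) go g(2) fg po]
  note HX = homR_opp_lmodule[OF X G] and HY = homR_opp_lmodule[OF Y G] and HZ = homR_opp_lmodule[OF Z G]
  have pf: "lin A (homR R (opp_ring A) Y ?G) (homR R (opp_ring A) X ?G) (pre X f)"
    using O.homR_pre_lin[OF fo X Y, of ?G] by simp
  have pg: "lin A (homR R (opp_ring A) Z ?G) (homR R (opp_ring A) Y ?G) (pre Y g)"
    using O.homR_pre_lin[OF go Y Z, of ?G] by simp
  obtain \<chi> where \<chi>: "lin A M (homR R (opp_ring A) Y ?G) \<chi>"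
      "\<And>m. m \<in> carrier M \<Longrightarrow> pre X f (\<chi> m) = (\<lambda>x\<in>carrier X. pt A X M x m)"
    by (rule ext1_zero_lift[OF ext M HZ HY HX pg ex(1) pf ex(2) ex(3) hom_of_tensor[OF X M G lin_id]]) (rule that)
  obtain \<Phi> where \<Phi>: "lin R (tensorA A Y M) ?G \<Phi>"
      "\<And>y m. y \<in> carrier Y \<Longrightarrow> m \<in> carrier M \<Longrightarrow> \<Phi> (pt A Y M y m) = \<chi> m y"
    using tensor_of_hom[OF Y M G \<chi>(1)] by blast
  let ?t = "tensor_map A X M Y M f (\<lambda>m. m)"
  have tl: "lin R ?G (tensorA A Y M) ?t" by (rule tensorA_map_lin[OF X Y M M f(1) lin_id])
  have "\<Phi> (?t u) = u" if u: "u \<in> carrier ?G" for u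
  proof (rule tensor_action.lin_ext[OF tensorA_action[OF X M], folded tensorA_def, OF G lin_comp[OF tl \<Phi>(1)] lin_id _ u])
    fix x m assume x: "x \<in> carrier X" and m: "m \<in> carrier M"
    have "\<Phi> (?t (pt A X M x m)) = \<chi> m (f x)"
      using tensor_map_pt[OF tensorA_pair[OF X M] tensorA_pair[OF Y M] f(1) lin_id x m] \<Phi>(2)[OF lin_closed[OF f(1) x] m] by simp
    also have "\<dots> = pt A X M x m" using fun_cong[OF \<chi>(2)[OF m], of x] x by (simp add: pre_def)
    finally show "\<Phi> (?t (pt A X M x m)) = pt A X M x m" .
  qed
  then show ?thesis by (rule inj_on_inverseI)
qed

end

section \<open>Good right modules\<close>

text \<open>The exact sequences \<open>0 \<rightarrow> C l \<rightarrow> P l \<rightarrow> \<Delta> l \<rightarrow> 0\<close> of a split quasi-hereditary algebra, with a choice made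
  for each \<open>l\<close>.\<close>

locale standard_system = algebra_over R A
  for R :: "('r, 'z) ring_scheme" (structure) and A :: "('r, 'a) module" (structure) +
  fixes \<Lambda> :: "'l::order set" and \<Delta> :: "'l \<Rightarrow> ('a, 'v) module"
    and P C :: "'l \<Rightarrow> ('a, nat \<Rightarrow> 'a) module" and f g
  assumes finite_\<Lambda>: "finite \<Lambda>"
    and \<Delta>: "l \<in> \<Lambda> \<Longrightarrow> lmodule A (\<Delta> l)" "l \<in> \<Lambda> \<Longrightarrow> finitely_generated A (\<Delta> l)"
    and P: "l \<in> \<Lambda> \<Longrightarrow> fgp A (P l)"
    and CP\<Delta>: "l \<in> \<Lambda> \<Longrightarrow> short_exact A (C l) (P l) (\<Delta> l) (f l) (g l)"
    and C: "l \<in> \<Lambda> \<Longrightarrow> C l \<in> filtered A (twists R A {m\<in>\<Lambda>. l < m} \<Delta>)"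
begin

text \<open>The last condition says that the standard modules have no extensions by the dual of \<open>Y\<close>; equivalently, by
  adjunction, that functionals extend from \<open>Y \<otimes> C l\<close> to \<open>Y \<otimes> P l\<close>.\<close>

definition good :: "('a, 'y) module \<Rightarrow> bool" where
  "good Y \<longleftrightarrow> lmodule (opp_ring A) Y \<and> in_add R (restr A Y) (regular R) \<and>
     (\<forall>l\<in>\<Lambda>. ext1_zero A (\<Delta> l) (homR R (opp_ring A) Y (regular R)))"

lemma regular_R: "lmodule R (regular R)" by (rule regular_lmodule) (rule R.ring_axioms)

lemma P_lmodule: "l \<in> \<Lambda> \<Longrightarrow> lmodule A (P l)" using P by (simp add: fgp_def)

lemma C_lmodule: "l \<in> \<Lambda> \<Longrightarrow> lmodule A (C l)" using C by (fastforce simp: filtered_def fg_mods_def)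

lemma fg: assumes l: "l \<in> \<Lambda>"
  shows "lin A (C l) (P l) (f l)" "inj_on (f l) (carrier (C l))" "lin A (P l) (\<Delta> l) (g l)"
    "g l ` carrier (P l) = carrier (\<Delta> l)" "f l ` carrier (C l) = ker (P l) (\<Delta> l) (g l)"
  using CP\<Delta>[OF l] by (simp_all add: short_exact_def a_kernel_eq lhom_lin)

lemma tensor_projective_fgp:
  assumes Y: "good Y" and Q: "fgp A Q"
  shows "in_add R (tensorA A Y Q) (regular R)"
proof -
  have y: "lmodule (opp_ring A) Y" "in_add R (restr A Y) (regular R)" and q: "lmodule A Q" "in_add A Q (regular A)"
    using Y Q by (simp_all add: good_def fgp_def)
  have A: "lmodule A (regular A)" by (rule regular_lmodule[OF ring_A])
  have YA: "in_add R (tensorA A Y (regular A)) (regular R)"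
    by (rule in_add_trans[OF tensorA_regular[OF y(1)] y(2) tensorA_lmodule[OF y(1) A]])
      (use algebra_over.restr_lmodule[OF opp_algebra y(1)] in simp)
  show ?thesis
    by (rule in_add_trans[OF in_add_tensorA_right[OF q(2) y(1) q(1) A] YA tensorA_lmodule[OF y(1) q(1)] tensorA_lmodule[OF y(1) A]])
qed

text \<open>As functionals on \<open>Y \<otimes> C l\<close> extend to \<open>Y \<otimes> P l\<close> and \<open>Y \<otimes> C l\<close> is projective, its identity extends to
  a retraction \<open>s\<close>.  Hence \<open>Y \<otimes> \<Delta> l\<close> is a summand of \<open>Y \<otimes> P l\<close>, and composing with \<open>s\<close> extends maps from
  \<open>Y \<otimes> C l\<close> to any \<open>G\<close>, not just functionals.\<close>

lemma tensor_standard: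
  assumes Y: "good Y" and l: "l \<in> \<Lambda>" and YC: "in_add R (tensorA A Y (C l)) (regular R)"
  shows tensor_standard_fgp: "in_add R (tensorA A Y (\<Delta> l)) (regular R)"
    and ext_standard_hom: "lmodule R G \<Longrightarrow> ext1_zero A (\<Delta> l) (homR R (opp_ring A) Y G)"
proof -
  have y: "lmodule (opp_ring A) Y" and e: "ext1_zero A (\<Delta> l) (homR R (opp_ring A) Y (regular R))"
    using Y l by (simp_all add: good_def)
  note fg = fg[OF l] and Cm = C_lmodule[OF l] and Pm = P_lmodule[OF l] and Dm = \<Delta>(1)[OF l]
  let ?f = "tensor_map A Y (C l) Y (P l) (\<lambda>y. y) (f l)" and ?g = "tensor_map A Y (P l) Y (\<Delta> l) (\<lambda>y. y) (g l)"
  obtain s where s: "lin R (tensorA A Y (P l)) (tensorA A Y (C l)) s"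
      "\<And>u. u \<in> carrier (tensorA A Y (C l)) \<Longrightarrow> s (?f u) = u"
    using tensor_split[OF e YC y Cm Pm Dm fg] by blast
  have tf: "lin R (tensorA A Y (C l)) (tensorA A Y (P l)) ?f" by (rule tensorA_map_lin[OF y y Cm Pm lin_id fg(1)])
  have tg: "lin R (tensorA A Y (P l)) (tensorA A Y (\<Delta> l)) ?g" by (rule tensorA_map_lin[OF y y Pm Dm lin_id fg(3)])
  note ex = tensorA_exact_right_factor[OF y Cm Pm Dm fg(1,3-5)]
  note TP = tensorA_lmodule[OF y Pm] and TD = tensorA_lmodule[OF y Dm]
  have "in_add R (tensorA A Y (\<Delta> l)) (tensorA A Y (P l))"
    by (rule in_add_split_quotient[OF TP TD tf tg ex(2,1) s])
  then show "in_add R (tensorA A Y (\<Delta> l)) (regular R)"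
    by (rule in_add_trans[OF _ tensor_projective_fgp[OF Y P[OF l]] TD TP])
  assume G: "lmodule R G"
  show "ext1_zero A (\<Delta> l) (homR R (opp_ring A) Y G)" unfolding ext1_zero_def
  proof (intro exI conjI)
    show "presents A (P l) (g l) (\<Delta> l)" using P[OF l] fg by (simp add: presents_def)
    show "extends_all A (P l) (ker (P l) (\<Delta> l) (g l)) (homR R (opp_ring A) Y G)" unfolding extends_all_def
    proof (intro allI impI)
      let ?H = "homR R (opp_ring A) Y G"
      fix \<phi> assume \<phi>: "lin A (P l\<lparr>carrier := ker (P l) (\<Delta> l) (g l)\<rparr>) ?H \<phi>"
      have f': "lin A (C l) (P l\<lparr>carrier := ker (P l) (\<Delta> l) (g l)\<rparr>) (f l)"
        by (rule lin_into_sub[OF fg(1)]) (use fg(5) in blast)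
      note \<phi>f = lin_comp[OF f' \<phi>]
      obtain \<psi> where \<psi>: "lin R (tensorA A Y (C l)) G \<psi>"
          "\<And>y c. y \<in> carrier Y \<Longrightarrow> c \<in> carrier (C l) \<Longrightarrow> \<psi> (pt A Y (C l) y c) = \<phi> (f l c) y"
        using tensor_of_hom[OF y Cm G \<phi>f] by blast
      let ?\<psi> = "\<lambda>c. \<lambda>y\<in>carrier Y. \<psi> (s (pt A Y (P l) y c))"
      show "\<exists>\<psi>. lin A (P l) ?H \<psi> \<and> (\<forall>x\<in>ker (P l) (\<Delta> l) (g l). \<psi> x = \<phi> x)"
      proof (intro exI[of _ ?\<psi>] conjI ballI)
        show "lin A (P l) ?H ?\<psi>" by (rule hom_of_tensor[OF y Pm G lin_comp[OF s(1) \<psi>(1)]])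
        fix x assume "x \<in> ker (P l) (\<Delta> l) (g l)"
        then have "x \<in> f l ` carrier (C l)" using fg(5) by simp
        then obtain c where c: "c \<in> carrier (C l)" and x: "x = f l c" by (elim imageE)
        have "s (pt A Y (P l) z (f l c)) = pt A Y (C l) z c" if z: "z \<in> carrier Y" for z
          using s(2)[OF tensorA_pt_closed[OF y Cm z c]]
            tensor_map_pt[OF tensorA_pair[OF y Cm] tensorA_pair[OF y Pm] lin_id fg(1) z c] by simp
        moreover have "\<phi> (f l c) \<in> extensional (carrier Y)"
          using lin_closed[OF \<phi>f c] by (simp add: homR_simps lhom_iff)
        ultimately show "?\<psi> x = \<phi> x" unfolding x using \<psi>(2) c by (auto simp: fun_eq_iff extensional_def)
      qed
    qed
  qed
qed

lemma presents_factor: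
  assumes "lmodule A T" "in_add A T (\<Delta> l)" "l \<in> \<Lambda>"
  obtains Q :: "('a, nat \<Rightarrow> 'a) module" and \<pi> where "presents A Q \<pi> T"
  by (rule fg_presents[OF assms(1) fg_in_add[OF assms(1) \<Delta>(1)[OF assms(3)] assms(2) \<Delta>(2)[OF assms(3)]]]) (rule that)

text \<open>For a step \<open>0 \<rightarrow> G \<rightarrow> H \<rightarrow> T \<rightarrow> 0\<close> of the filtration, the vanishing with values in
  \<open>Y \<otimes> G\<close> makes \<open>Y \<otimes> G \<rightarrow> Y \<otimes> H\<close> injective, so that \<open>Y \<otimes> H\<close> is an extension of projective modules.\<close>

lemma tensor_filtered_fgp:
  fixes X :: "('a, 'x) module" and Y :: "('a, 'y) module"
  assumes Y: "good Y" and X: "X \<in> filtered A (twists R A \<Lambda>' \<Delta>)" and sub: "\<Lambda>' \<subseteq> \<Lambda>"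
    and T: "\<And>l. l \<in> \<Lambda>' \<Longrightarrow> in_add R (tensorA A Y (\<Delta> l)) (regular R)"
    and E: "\<And>l (G :: ('r, ('y \<times> 'x \<Rightarrow>\<^sub>0 int) set) module). l \<in> \<Lambda>' \<Longrightarrow> lmodule R G \<Longrightarrow> ext1_zero A (\<Delta> l) (homR R (opp_ring A) Y G)"
  shows "in_add R (tensorA A Y X) (regular R)"
proof (rule filtered_induct[OF X])
  have y: "lmodule (opp_ring A) Y" using Y by (simp add: good_def)
  show "lmodule A (\<Delta> l)" if "l \<in> \<Lambda>'" for l using that sub \<Delta> by blast
  show "in_add R (tensorA A Y Z) (regular R)" if "lmodule A Z" "carrier Z = {\<zero>\<^bsub>Z\<^esub>}" for Z :: "('a, 'x) module"
    by (rule tensor_projective_fgp[OF Y]) (use that in \<open>simp add: fgp_def in_add_trivial\<close>)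
  fix G H :: "('a, 'x) module" and f g and T' :: "('a, ('v \<times> (nat \<Rightarrow> 'r) \<Rightarrow>\<^sub>0 int) set) module" and l
  assume l: "l \<in> \<Lambda>'" and G: "lmodule A G" and H: "lmodule A H" and T': "lmodule A T'" "in_add A T' (\<Delta> l)"
    and f: "lin A G H f" "inj_on f (carrier G)" and g: "lin A H T' g" "g ` carrier H = carrier T'"
    and ker: "f ` carrier G = ker H T' g" and IH: "in_add R (tensorA A Y G) (regular R)"
  have l': "l \<in> \<Lambda>" using l sub by blast
  note TG = tensorA_lmodule[OF y G] and TH = tensorA_lmodule[OF y H] and TT = tensorA_lmodule[OF y T'(1)]
  have tT: "in_add R (tensorA A Y T') (regular R)"
    by (rule in_add_trans[OF in_add_tensorA_right[OF T'(2) y T'(1) \<Delta>(1)[OF l']] T[OF l] TT tensorA_lmodule[OF y \<Delta>(1)[OF l']]])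
  obtain Q :: "('a, nat \<Rightarrow> 'a) module" and \<pi> where "presents A Q \<pi> T'" by (rule presents_factor[OF T' l']) (rule that)
  then have eT: "ext1_zero A T' (homR R (opp_ring A) Y (tensorA A Y G))"
    by (rule ext1_zero_in_add_left[OF T'(2) E[OF l TG] T'(1) \<Delta>(1)[OF l'] homR_opp_lmodule[OF y TG]])
  show "in_add R (tensorA A Y H) (regular R)"
    by (rule in_add_regular_extension[OF IH TG TH tT TT tensorA_map_lin[OF y y G H lin_id f(1)]
          tensor_inj_right[OF eT y G H T'(1) f g ker] tensorA_map_lin[OF y y H T'(1) lin_id g(1)]
          tensorA_exact_right_factor(2)[OF y G H T'(1) f(1) g ker] tensorA_exact_right_factor(1)[OF y G H T'(1) f(1) g ker]])
qed

lemma ext_filtered: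
  fixes X :: "('a, 'x) module" and W :: "('a, 'w) module"
  assumes W: "lmodule A W" and X: "X \<in> filtered A (twists R A \<Lambda> \<Delta>)"
    and E: "\<And>l. l \<in> \<Lambda> \<Longrightarrow> ext1_zero A (\<Delta> l) W"
  shows "ext1_zero A X W"
proof -
  have "finitely_generated A X \<and> ext1_zero A X W"
  proof (rule filtered_induct[OF X \<Delta>(1)])
    fix Z :: "('a, 'x) module" assume Z: "lmodule A Z" "carrier Z = {\<zero>\<^bsub>Z\<^esub>}"
    then have "fgp A Z" by (simp add: fgp_def in_add_trivial)
    with fgp_imp_fg[OF this] ext1_zero_trivial[OF Z] show "finitely_generated A Z \<and> ext1_zero A Z W" by simp
  next
    fix G H :: "('a, 'x) module" and f g and T' :: "('a, ('v \<times> (nat \<Rightarrow> 'r) \<Rightarrow>\<^sub>0 int) set) module" and l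
    assume l: "l \<in> \<Lambda>" and G: "lmodule A G" and H: "lmodule A H" and T': "lmodule A T'" "in_add A T' (\<Delta> l)"
      and f: "lin A G H f" "inj_on f (carrier G)" and g: "lin A H T' g" "g ` carrier H = carrier T'"
      and ker: "f ` carrier G = ker H T' g" and IH: "finitely_generated A G \<and> ext1_zero A G W"
    have fT: "finitely_generated A T'" by (rule fg_in_add[OF T'(1) \<Delta>(1)[OF l] T'(2) \<Delta>(2)[OF l]])
    have fH: "finitely_generated A H" by (rule fg_extension[OF G H T'(1) f(1) g ker conjunct1[OF IH] fT])
    obtain Q :: "('a, nat \<Rightarrow> 'a) module" and \<pi> where "presents A Q \<pi> T'" by (rule presents_factor[OF T' l]) (rule that)
    then have eT: "ext1_zero A T' W" by (rule ext1_zero_in_add_left[OF T'(2) E[OF l] T'(1) \<Delta>(1)[OF l] W])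
    obtain Q' :: "('a, nat \<Rightarrow> 'a) module" and \<pi>' where pr: "presents A Q' \<pi>' H" by (rule fg_presents[OF H fH]) (rule that)
    show "finitely_generated A H \<and> ext1_zero A H W"
      using fH ext1_zero_extension_left[OF conjunct2[OF IH] eT G H T'(1) W f g ker pr] by blast
  qed
  then show ?thesis by simp
qed

text \<open>Descending induction along the order: the filtration of \<open>C l\<close> involves the \<open>\<Delta> m\<close> with \<open>m > l\<close> only.\<close>

lemma tensor_C_fgp:
  assumes Y: "good Y" and l: "l \<in> \<Lambda>"
  shows "in_add R (tensorA A Y (C l)) (regular R)"
  using l
proof (induct "card {m\<in>\<Lambda>. l < m}" arbitrary: l rule: less_induct)
  case less
  have IH: "in_add R (tensorA A Y (C m)) (regular R)" if "m \<in> {m\<in>\<Lambda>. l < m}" for m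
  proof (rule less(1))
    have "{k\<in>\<Lambda>. m < k} \<subset> {m\<in>\<Lambda>. l < m}" using that by (auto dest: less_trans)
    then show "card {k\<in>\<Lambda>. m < k} < card {m\<in>\<Lambda>. l < m}" by (rule psubset_card_mono[rotated]) (simp add: finite_\<Lambda>)
    show "m \<in> \<Lambda>" using that by simp
  qed
  show ?case
  proof (rule tensor_filtered_fgp[OF Y C[OF less(2)]])
    show "in_add R (tensorA A Y (\<Delta> m)) (regular R)" if "m \<in> {m\<in>\<Lambda>. l < m}" for m
      by (rule tensor_standard_fgp[OF Y _ IH[OF that]]) (use that in simp)
    show "ext1_zero A (\<Delta> m) (homR R (opp_ring A) Y G)" if "m \<in> {m\<in>\<Lambda>. l < m}" "lmodule R G"
      for m and G :: "('r, ('b \<times> (nat \<Rightarrow> 'a) \<Rightarrow>\<^sub>0 int) set) module"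
      by (rule ext_standard_hom[OF Y _ IH[OF that(1)] that(2)]) (use that in simp)
  qed simp
qed

text \<open>The two properties on which both functors rest: the first puts their values into the projective modules,
  the second gives exactness.\<close>

lemma good_tensor:
  assumes Y: "good Y" and X: "X \<in> filtered A (twists R A \<Lambda> \<Delta>)"
  shows good_tensor_fgp: "in_add R (tensorA A Y X) (regular R)"
    and good_ext: "lmodule R G \<Longrightarrow> ext1_zero A X (homR R (opp_ring A) Y G)"
proof -
  have y: "lmodule (opp_ring A) Y" using Y by (simp add: good_def)
  show "in_add R (tensorA A Y X) (regular R)"
    by (rule tensor_filtered_fgp[OF Y X subset_refl])
      (auto intro: tensor_standard_fgp[OF Y] ext_standard_hom[OF Y] tensor_C_fgp[OF Y])
  assume G: "lmodule R G"
  show "ext1_zero A X (homR R (opp_ring A) Y G)"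
    by (rule ext_filtered[OF homR_opp_lmodule[OF y G] X]) (auto intro: ext_standard_hom[OF Y _ _ G] tensor_C_fgp[OF Y])
qed

end

section \<open>Exactness of tensor products with good modules\<close>

context algebra_over
begin

lemma tensorA_map_lhom:
  assumes X: "lmodule (opp_ring A) X" "lmodule (opp_ring A) Y" and M: "lmodule A M" "lmodule A N"
    and f: "lin A X Y f" and g: "lin A M N g"
  shows "tensor_map A X M Y N f g \<in> lhom R (tensorA A X M) (tensorA A Y N)"
  using tensorA_map_lin[OF X M f g] unfolding lhom_iff
  by (simp add: tensor_map_def tensorA_def tensor_simps restrict_extensional)

lemma tensorA_map_id:
  assumes X: "lmodule (opp_ring A) X" and M: "lmodule A M"
    and f: "\<And>x. x \<in> carrier X \<Longrightarrow> f x = x" and g: "\<And>m. m \<in> carrier M \<Longrightarrow> g m = m"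
  shows "tensor_map A X M X M f g = (\<lambda>u\<in>carrier (tensorA A X M). u)"
proof -
  have Xl: "lin (opp_ring A) X X f" by (rule lin_cong[OF lin_id f X])
  then have fl: "lin A X X f" by simp
  have gl: "lin A M M g" by (rule lin_cong[OF lin_id g M])
  note t = tensorA_pair[OF X M]
  have "tensor_map A X M X M f g u = u" if "u \<in> carrier (tensor_mod A X M (scalar A X))" for u
    using tensor_map_ext[OF t t fl gl lin_id lin_id _ that] tensor_map_id[OF t that] f g by simp
  then show ?thesis
    using tensorA_map_lhom[OF X X M M fl gl] by (auto simp: fun_eq_iff lhom_iff extensional_def tensorA_def)
qed

lemma tensorA_map_compose:
  assumes X: "lmodule (opp_ring A) X" "lmodule (opp_ring A) Y" "lmodule (opp_ring A) Z"
    and M: "lmodule A M" "lmodule A N" "lmodule A L"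
    and f: "lin A X Y f" "lin A Y Z f'" and g: "lin A M N g" "lin A N L g'"
    and h: "\<And>x. x \<in> carrier X \<Longrightarrow> h x = f' (f x)" and k: "\<And>m. m \<in> carrier M \<Longrightarrow> k m = g' (g m)"
  shows "tensor_map A X M Z L h k = compose (carrier (tensorA A X M)) (tensor_map A Y N Z L f' g') (tensor_map A X M Y N f g)"
proof -
  note fc = lin_comp[OF f] and gc = lin_comp[OF g]
  have "lin (opp_ring A) X Z (\<lambda>x. f' (f x))" using fc by simp
  then have "lin (opp_ring A) X Z h" by (rule lin_cong[OF _ h X(1)])
  then have hl: "lin A X Z h" by simp
  have kl: "lin A M L k" by (rule lin_cong[OF gc k M(1)])
  note t1 = tensorA_pair[OF X(1) M(1)] and t2 = tensorA_pair[OF X(2) M(2)] and t3 = tensorA_pair[OF X(3) M(3)]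
  have "tensor_map A X M Z L h k u = tensor_map A Y N Z L f' g' (tensor_map A X M Y N f g u)"
    if u: "u \<in> carrier (tensor_mod A X M (scalar A X))" for u
    unfolding tensor_map_comp[OF t1 t2 t3 f(1) g(1) f(2) g(2) u]
    by (rule tensor_map_ext[OF t1 t3 hl kl fc gc _ u]) (simp add: h k)
  then show ?thesis
    using tensorA_map_lhom[OF X(1,3) M(1,3) hl kl]
    by (auto simp: fun_eq_iff lhom_iff extensional_def tensorA_def compose_def)
qed

end

context standard_system
begin

subsection \<open>Costandard modules yield good modules\<close>

text \<open>\<open>Hom\<^sub>A(-, W)\<close> is exact on modules filtered by standard modules, hence \<open>Hom\<^sub>A(C l, W)\<close> and then
  \<open>Hom\<^sub>A(P l, W)\<close> are projective; and the \<open>P l\<close> generate \<open>A\<close>.\<close>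

lemma fgp_if_no_standard_ext:
  assumes gen: "in_add A (regular A) (direct_sum \<Lambda> P)" and W: "lmodule A W"
    and ext: "\<And>l. l \<in> \<Lambda> \<Longrightarrow> ext1_zero A (\<Delta> l) W" and H: "\<And>l. l \<in> \<Lambda> \<Longrightarrow> in_add R (HomA A (\<Delta> l) W) (regular R)"
  shows "in_add R (restr A W) (regular R)"
proof (rule fgp_if_HomA_fgp[OF W finite_\<Lambda> P_lmodule gen])
  fix l assume l: "l \<in> \<Lambda>"
  have "in_add R (HomA A (C l) W) (regular R)"
    by (rule HomA_filtered_fgp[OF C[OF l] _ _ W]) (auto intro: \<Delta> ext H)
  then show "in_add R (HomA A (P l) W) (regular R)"
    by (rule HomA_extension_fgp[OF C_lmodule[OF l] P_lmodule[OF l] \<Delta>(1)[OF l] W ext[OF l] fg[OF l] _ H[OF l]])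
qed

lemma filtered_no_standard_ext:
  fixes V :: "'l \<Rightarrow> ('a, 'w) module" and N :: "('a, 'n) module"
  assumes N: "N \<in> filtered A (twists R A \<Lambda> V)" and V: "\<And>l. l \<in> \<Lambda> \<Longrightarrow> lmodule A (V l)"
    and pr: "\<And>l. l \<in> \<Lambda> \<Longrightarrow> in_add R (restr A (V l)) (regular R)"
    and ext: "\<And>k l. k \<in> \<Lambda> \<Longrightarrow> l \<in> \<Lambda> \<Longrightarrow> ext1_zero A (\<Delta> k) (V l)"
  shows "in_add R (restr A N) (regular R) \<and> (\<forall>k\<in>\<Lambda>. ext1_zero A (\<Delta> k) N)"
proof (rule filtered_induct[OF N V])
  fix Z :: "('a, 'n) module" assume Z: "lmodule A Z" "carrier Z = {\<zero>\<^bsub>Z\<^esub>}"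
  have "ext1_zero A (\<Delta> k) Z" if "k \<in> \<Lambda>" for k
    by (rule ext1_zero_in_add_right[OF in_add_trivial[OF Z(2)] ext[OF that that] V[OF that] Z(1)])
  moreover have "in_add R (restr A Z) (regular R)" by (rule in_add_trivial) (simp add: Z(2))
  ultimately show "in_add R (restr A Z) (regular R) \<and> (\<forall>k\<in>\<Lambda>. ext1_zero A (\<Delta> k) Z)" by blast
next
  fix G H :: "('a, 'n) module" and f g and T :: "('a, ('w \<times> (nat \<Rightarrow> 'r) \<Rightarrow>\<^sub>0 int) set) module" and l
  assume l: "l \<in> \<Lambda>" and G: "lmodule A G" and H: "lmodule A H" and T: "lmodule A T" "in_add A T (V l)"
    and f: "lin A G H f" "inj_on f (carrier G)" and g: "lin A H T g" "g ` carrier H = carrier T"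
    and ker: "f ` carrier G = ker H T g"
    and IH: "in_add R (restr A G) (regular R) \<and> (\<forall>k\<in>\<Lambda>. ext1_zero A (\<Delta> k) G)"
  have "ext1_zero A (\<Delta> k) H" if k: "k \<in> \<Lambda>" for k
  proof (rule ext1_zero_extension_right[OF _ _ \<Delta>(1)[OF k] G H T(1) f g ker])
    show "ext1_zero A (\<Delta> k) G" using IH k by blast
    show "ext1_zero A (\<Delta> k) T" by (rule ext1_zero_in_add_right[OF T(2) ext[OF k l] V[OF l] T(1)])
  qed
  moreover have pT: "in_add R (restr A T) (regular R)"
    by (rule in_add_trans[OF in_add_restr[OF T(2,1) V[OF l]] pr[OF l] restr_lmodule[OF T(1)] restr_lmodule[OF V[OF l]]])
  have "in_add R (restr A H) (regular R)"
    by (rule in_add_regular_extension[OF conjunct1[OF IH] restr_lmodule[OF G] restr_lmodule[OF H] pT restr_lmodule[OF T(1)]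
          restr_lin[OF f(1) G] _ restr_lin[OF g(1) H]]) (use g(2) ker f(2) in simp_all)
  ultimately show "in_add R (restr A H) (regular R) \<and> (\<forall>k\<in>\<Lambda>. ext1_zero A (\<Delta> k) H)" by blast
qed

text \<open>The double dual of \<open>W\<close> is \<open>W\<close> again.\<close>

lemma good_dual:
  assumes W: "lmodule A W" and pr: "in_add R (restr A W) (regular R)" and ext: "\<And>k. k \<in> \<Lambda> \<Longrightarrow> ext1_zero A (\<Delta> k) W"
  shows "good (dual R A W)"
  unfolding good_def
proof (intro conjI ballI)
  interpret O: algebra_over R "opp_ring A" by (rule opp_algebra)
  show D: "lmodule (opp_ring A) (dual R A W)" unfolding dual_homR by (rule homR_lmodule[OF W regular_R])
  show "in_add R (restr A (dual R A W)) (regular R)" by (rule dual_fgp[OF W pr])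
  fix k assume k: "k \<in> \<Lambda>"
  show "ext1_zero A (\<Delta> k) (homR R (opp_ring A) (dual R A W) (regular R))"
    by (rule ext1_zero_in_add_right[OF double_dual_in_add[OF W pr, unfolded dual_homR[of R "opp_ring A"]] ext[OF k] W
          homR_opp_lmodule[OF D regular_R]])
qed

text \<open>Extensions \<open>0 \<rightarrow> G \<rightarrow> H \<rightarrow> T \<rightarrow> 0\<close> of good modules split over \<open>R\<close>, so their duals form an exact sequence of
  left modules.\<close>

lemma good_filtered:
  fixes V :: "'l \<Rightarrow> ('a, 'w) module" and X :: "('a, 'x) module"
  assumes X: "X \<in> filtered (opp_ring A) (twists R (opp_ring A) \<Lambda> V)" and V: "\<And>l. l \<in> \<Lambda> \<Longrightarrow> good (V l)"
  shows "good X"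
proof -
  interpret O: algebra_over R "opp_ring A" by (rule opp_algebra)
  have Vm: "lmodule (opp_ring A) (V l)" if "l \<in> \<Lambda>" for l using V[OF that] by (simp add: good_def)
  show ?thesis
  proof (rule O.filtered_induct[OF X Vm])
    fix Z :: "('a, 'x) module" assume Z: "lmodule (opp_ring A) Z" "carrier Z = {\<zero>\<^bsub>Z\<^esub>}"
    have "ext1_zero A (\<Delta> k) (homR R (opp_ring A) Z (regular R))" if k: "k \<in> \<Lambda>" for k
    proof -
      have "in_add A (homR R (opp_ring A) Z (regular R)) (homR R (opp_ring A) (V k) (regular R))"
        using O.in_add_homR[OF in_add_trivial[OF Z(2)] Z(1) Vm[OF k] regular_R] by simp
      then show ?thesis
        by (rule ext1_zero_in_add_right[OF _ _ homR_opp_lmodule[OF Vm[OF k] regular_R] homR_opp_lmodule[OF Z(1) regular_R]])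
          (use V[OF k] k in \<open>simp add: good_def\<close>)
    qed
    moreover have "in_add R (restr A Z) (regular R)" by (rule in_add_trivial) (simp add: Z(2))
    ultimately show "good Z" using Z(1) by (simp add: good_def)
  next
    fix G H :: "('a, 'x) module" and f g and T :: "('a, ('w \<times> (nat \<Rightarrow> 'r) \<Rightarrow>\<^sub>0 int) set) module" and l
    assume l: "l \<in> \<Lambda>" and G: "lmodule (opp_ring A) G" and H: "lmodule (opp_ring A) H"
      and T: "lmodule (opp_ring A) T" "in_add (opp_ring A) T (V l)"
      and f: "lin (opp_ring A) G H f" "inj_on f (carrier G)" and g: "lin (opp_ring A) H T g" "g ` carrier H = carrier T"
      and ker: "f ` carrier G = ker H T g" and IH: "good G"
    have VR: "in_add R (restr A (V l)) (regular R)" and GR: "in_add R (restr A G) (regular R)"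
      using V[OF l] IH by (simp_all add: good_def)
    have TR: "in_add R (restr (opp_ring A) T) (regular R)"
      by (rule in_add_trans[OF O.in_add_restr[OF T(2,1) Vm[OF l]] _ O.restr_lmodule[OF T(1)] O.restr_lmodule[OF Vm[OF l]]]) (use VR in simp)
    have "in_add R (restr (opp_ring A) H) (regular R)"
      by (rule in_add_regular_extension[OF _ O.restr_lmodule[OF G] O.restr_lmodule[OF H] TR O.restr_lmodule[OF T(1)]
            O.restr_lin[OF f(1) G] _ O.restr_lin[OF g(1) H]]) (use g(2) ker f(2) GR in simp_all)
    moreover have "ext1_zero A (\<Delta> k) (homR R (opp_ring A) H (regular R))" if k: "k \<in> \<Lambda>" for k
    proof -
      note ex = O.homR_exact[OF G H T(1) regular_R f g ker TR]
      note DT = homR_opp_lmodule[OF T(1) regular_R] and DG = homR_opp_lmodule[OF G regular_R] and DH = homR_opp_lmodule[OF H regular_R]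
      have pf: "lin A (homR R (opp_ring A) H (regular R)) (homR R (opp_ring A) G (regular R)) (pre G f)"
        using O.homR_pre_lin[OF f(1) G H, of "regular R"] by simp
      have pg: "lin A (homR R (opp_ring A) T (regular R)) (homR R (opp_ring A) H (regular R)) (pre H g)"
        using O.homR_pre_lin[OF g(1) H T(1), of "regular R"] by simp
      show ?thesis
      proof (rule ext1_zero_extension_right[OF _ _ \<Delta>(1)[OF k] DT DH DG pg ex(1) pf ex(2,3)])
        show "ext1_zero A (\<Delta> k) (homR R (opp_ring A) G (regular R))" using IH k by (simp add: good_def)
        have "in_add A (homR R (opp_ring A) T (regular R)) (homR R (opp_ring A) (V l) (regular R))"
          using O.in_add_homR[OF T(2,1) Vm[OF l] regular_R] by simp
        then show "ext1_zero A (\<Delta> k) (homR R (opp_ring A) T (regular R))"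
          by (rule ext1_zero_in_add_right[OF _ _ homR_opp_lmodule[OF Vm[OF l] regular_R] DT])
            (use V[OF l] k in \<open>simp add: good_def\<close>)
      qed
    qed
    ultimately show "good H" using H by (simp add: good_def)
  qed
qed

subsection \<open>The two functors\<close>

lemma tensor_exact_right:
  assumes Y: "good Y"
  shows "is_exact_functor A (filtered A (twists R A \<Lambda> \<Delta>) :: ('a, 'x) module set) R (proj_mods R)
    (\<lambda>X. tensorA A Y X) (\<lambda>X Z f. tensor_map A Y X Y Z (\<lambda>y. y) f)"
proof -
  have y: "lmodule (opp_ring A) Y" using Y by (simp add: good_def)
  let ?F = "filtered A (twists R A \<Lambda> \<Delta>) :: ('a, 'x) module set"
  have F: "lmodule A X" if "X \<in> ?F" for X using that by (simp add: filtered_def fg_mods_def)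
  show ?thesis unfolding is_exact_functor_def is_functor_def
  proof (intro conjI ballI allI impI)
    fix X assume X: "X \<in> ?F"
    show "tensorA A Y X \<in> proj_mods R"
      unfolding proj_mods_iff fgp_def using tensorA_lmodule[OF y F[OF X]] good_tensor_fgp[OF Y X] by blast
    show "tensor_map A Y X Y X (\<lambda>y. y) (\<lambda>x\<in>carrier X. x) = (\<lambda>u\<in>carrier (tensorA A Y X). u)"
      by (rule tensorA_map_id[OF y F[OF X]]) simp_all
  next
    fix X Z f assume "X \<in> ?F" "Z \<in> ?F" "f \<in> lhom A X Z"
    then show "tensor_map A Y X Y Z (\<lambda>y. y) f \<in> lhom R (tensorA A Y X) (tensorA A Y Z)"
      by (intro tensorA_map_lhom y F lin_id lhom_lin)
  next
    fix X X' X'' f g assume X: "X \<in> ?F" "X' \<in> ?F" "X'' \<in> ?F" and f: "f \<in> lhom A X X'" and g: "g \<in> lhom A X' X''"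
    show "tensor_map A Y X Y X'' (\<lambda>y. y) (compose (carrier X) g f) =
        compose (carrier (tensorA A Y X)) (tensor_map A Y X' Y X'' (\<lambda>y. y) g) (tensor_map A Y X Y X' (\<lambda>y. y) f)"
      by (rule tensorA_map_compose[OF y y y F[OF X(1)] F[OF X(2)] F[OF X(3)] lin_id lin_id lhom_lin[OF f] lhom_lin[OF g]])
        (simp_all add: compose_def)
  next
    fix X X' X'' f g assume X: "X \<in> ?F" "X' \<in> ?F" "X'' \<in> ?F" and s: "short_exact A X X' X'' f g"
    note Xm = F[OF X(1)] and Xm' = F[OF X(2)] and Xm'' = F[OF X(3)]
    have f: "lin A X X' f" "inj_on f (carrier X)" and g: "lin A X' X'' g" "g ` carrier X' = carrier X''"
      and fg: "f ` carrier X = ker X' X'' g"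
      using s by (simp_all add: short_exact_def a_kernel_eq lhom_lin)
    show "short_exact R (tensorA A Y X) (tensorA A Y X') (tensorA A Y X'')
        (tensor_map A Y X Y X' (\<lambda>y. y) f) (tensor_map A Y X' Y X'' (\<lambda>y. y) g)"
      unfolding short_exact_def a_kernel_eq
      using tensorA_map_lhom[OF y y Xm Xm' lin_id f(1)] tensorA_map_lhom[OF y y Xm' Xm'' lin_id g(1)]
        tensor_inj_right[OF good_ext[OF Y X(3) tensorA_lmodule[OF y Xm]] y Xm Xm' Xm'' f g fg]
        tensorA_exact_right_factor[OF y Xm Xm' Xm'' f(1) g fg]
      by blast
  qed
qed

lemma tensor_exact_left:
  fixes \<C> :: "('a, 'x) module set"
  assumes \<C>: "\<And>X. X \<in> \<C> \<Longrightarrow> good X" and M: "M \<in> filtered A (twists R A \<Lambda> \<Delta>)"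
  shows "is_exact_functor (opp_ring A) \<C> R (proj_mods R) (\<lambda>X. tensorA A X M) (\<lambda>X Z f. tensor_map A X M Z M f (\<lambda>m. m))"
proof -
  have m: "lmodule A M" using M by (simp add: filtered_def fg_mods_def)
  have F: "lmodule (opp_ring A) X" "in_add R (restr A X) (regular R)" if "X \<in> \<C>" for X using \<C>[OF that] by (simp_all add: good_def)
  have L: "lin A X Y f" if "f \<in> lhom (opp_ring A) X Y" for X Y :: "('a, 'x) module" and f using lhom_lin[OF that] by simp
  show ?thesis unfolding is_exact_functor_def is_functor_def
  proof (intro conjI ballI allI impI)
    fix X assume X: "X \<in> \<C>"
    show "tensorA A X M \<in> proj_mods R"
      unfolding proj_mods_iff fgp_def using tensorA_lmodule[OF F(1)[OF X] m] good_tensor_fgp[OF \<C>[OF X] M] by blast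
    show "tensor_map A X M X M (\<lambda>x\<in>carrier X. x) (\<lambda>m. m) = (\<lambda>u\<in>carrier (tensorA A X M). u)"
      by (rule tensorA_map_id[OF F(1)[OF X] m]) simp_all
  next
    fix X Z f assume "X \<in> \<C>" "Z \<in> \<C>" "f \<in> lhom (opp_ring A) X Z"
    then show "tensor_map A X M Z M f (\<lambda>m. m) \<in> lhom R (tensorA A X M) (tensorA A Z M)"
      by (intro tensorA_map_lhom m F lin_id L)
  next
    fix X X' X'' f g assume X: "X \<in> \<C>" "X' \<in> \<C>" "X'' \<in> \<C>" and f: "f \<in> lhom (opp_ring A) X X'" and g: "g \<in> lhom (opp_ring A) X' X''"
    show "tensor_map A X M X'' M (compose (carrier X) g f) (\<lambda>m. m) =
        compose (carrier (tensorA A X M)) (tensor_map A X' M X'' M g (\<lambda>m. m)) (tensor_map A X M X' M f (\<lambda>m. m))"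
      by (rule tensorA_map_compose[OF F(1)[OF X(1)] F(1)[OF X(2)] F(1)[OF X(3)] m m m L[OF f] L[OF g] lin_id lin_id])
        (simp_all add: compose_def)
  next
    fix X X' X'' f g assume X: "X \<in> \<C>" "X' \<in> \<C>" "X'' \<in> \<C>" and s: "short_exact (opp_ring A) X X' X'' f g"
    note Xm = F(1)[OF X(1)] and Xm' = F(1)[OF X(2)] and Xm'' = F(1)[OF X(3)]
    have f: "lin A X X' f" "inj_on f (carrier X)" and g: "lin A X' X'' g" "g ` carrier X' = carrier X''"
      and fg: "f ` carrier X = ker X' X'' g"
      using s by (simp_all add: short_exact_def a_kernel_eq L)
    show "short_exact R (tensorA A X M) (tensorA A X' M) (tensorA A X'' M)
        (tensor_map A X M X' M f (\<lambda>m. m)) (tensor_map A X' M X'' M g (\<lambda>m. m))"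
      unfolding short_exact_def a_kernel_eq
      using tensorA_map_lhom[OF Xm Xm' m m f(1) lin_id] tensorA_map_lhom[OF Xm' Xm'' m m g(1) lin_id]
        tensor_inj_left[OF good_ext[OF \<C>[OF X(3)] M tensorA_lmodule[OF Xm m]] m Xm Xm' Xm'' f g fg F(2)[OF X(3)]]
        tensorA_exact_left_factor[OF Xm Xm' Xm'' m f(1) g fg]
      by blast
  qed
qed

end

section \<open>Split quasi-hereditary algebras\<close>

text \<open>The regular module is a summand of a sum of copies of \<open>\<Oplus> P l\<close> because it is projective; it enters through
  its copy \<open>A\<^sup>1\<close>, which has elements of the type on which the two categories of projective modules are
  compared.\<close>

lemma split_quasi_hereditary_system:
  fixes A :: "('r, 'a) module" and \<Lambda> :: "'l::order set" and \<Delta> :: "'l \<Rightarrow> ('a, 'v) module"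
  assumes "split_quasi_hereditary R A \<Lambda> \<Delta>"
  obtains P C f g where "standard_system R A \<Lambda> \<Delta> P C f g" "in_add A (regular A) (direct_sum \<Lambda> P)" "finitely_generated R A"
proof -
  have R: "R_algebra R A" and fg: "finitely_generated R A" and fin: "finite \<Lambda>" and D: "\<And>l. l \<in> \<Lambda> \<Longrightarrow> \<Delta> l \<in> fg_mods A"
    using assms by (auto simp: split_quasi_hereditary_def proj_noetherian_algebra_def)
  have "\<exists>P :: 'l \<Rightarrow> ('a, nat \<Rightarrow> 'a) module. (\<forall>l\<in>\<Lambda>. P l \<in> proj_mods A \<and>
      (\<exists>(C :: ('a, nat \<Rightarrow> 'a) module) f g. short_exact A C (P l) (\<Delta> l) f g \<and> C \<in> filtered A (twists R A {m\<in>\<Lambda>. l < m} \<Delta>))) \<and>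
      (add_mods A (direct_sum \<Lambda> P) :: ('a, nat \<Rightarrow> 'a) module set) = proj_mods A"
    using assms unfolding split_quasi_hereditary_def by (elim conjE)
  then obtain P :: "'l \<Rightarrow> ('a, nat \<Rightarrow> 'a) module" where H: "\<forall>l\<in>\<Lambda>. P l \<in> proj_mods A \<and>
      (\<exists>(C :: ('a, nat \<Rightarrow> 'a) module) f g. short_exact A C (P l) (\<Delta> l) f g \<and> C \<in> filtered A (twists R A {m\<in>\<Lambda>. l < m} \<Delta>))"
      and gen: "(add_mods A (direct_sum \<Lambda> P) :: ('a, nat \<Rightarrow> 'a) module set) = proj_mods A"
    by (elim exE conjE) (rule that)
  have P: "P l \<in> proj_mods A" if "l \<in> \<Lambda>" for l using bspec[OF H that] by (rule conjunct1)
  have "\<forall>l\<in>\<Lambda>. \<exists>(C :: ('a, nat \<Rightarrow> 'a) module) f g. short_exact A C (P l) (\<Delta> l) f g \<and> C \<in> filtered A (twists R A {m\<in>\<Lambda>. l < m} \<Delta>)"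
    using bspec[OF H] by (intro ballI) (rule conjunct2)
  then obtain C f g where C: "\<forall>l\<in>\<Lambda>. short_exact A (C l :: ('a, nat \<Rightarrow> 'a) module) (P l) (\<Delta> l) (f l) (g l) \<and>
      C l \<in> filtered A (twists R A {m\<in>\<Lambda>. l < m} \<Delta>)"
    unfolding bchoice_iff by (elim exE) (rule that)
  interpret algebra_over R A by (rule algebra_over.intro[OF R])
  have Pf: "fgp A (P l)" if "l \<in> \<Lambda>" for l using P[OF that] by (simp add: proj_mods_iff)
  have 1: "standard_system R A \<Lambda> \<Delta> P C f g"
  proof (intro standard_system.intro algebra_over_axioms standard_system_axioms.intro)
    fix l assume l: "l \<in> \<Lambda>"
    show "lmodule A (\<Delta> l)" "finitely_generated A (\<Delta> l)" using D[OF l] by (simp_all add: fg_mods_def)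
    show "fgp A (P l)" by (rule Pf[OF l])
    show "short_exact A (C l) (P l) (\<Delta> l) (f l) (g l)" "C l \<in> filtered A (twists R A {m\<in>\<Lambda>. l < m} \<Delta>)"
      using bspec[OF C l] by blast+
  qed (rule fin)
  let ?F = "direct_sum {..<(1::nat)} (\<lambda>_. regular A)" and ?S = "direct_sum \<Lambda> P"
  have A: "lmodule A (regular A)" by (rule regular_lmodule[OF ring_A])
  have S: "lmodule A ?S" by (rule direct_sum_lmodule[OF ring_A]) (use Pf in \<open>simp add: fgp_def\<close>)
  have F: "?F \<in> proj_mods A" unfolding proj_mods_iff by (rule fgp_free[OF ring_A]) simp
  then have Fm: "lmodule A ?F" by (simp add: proj_mods_def fg_mods_def)
  have "?F \<in> add_mods A ?S" using F gen by simp
  then obtain n :: nat where "is_summand A ?F (direct_sum {..<n} (\<lambda>_. ?S))" by (auto simp: add_mods_def)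
  then obtain i p where ip: "lin A ?F (direct_sum {..<n} (\<lambda>_. ?S)) i" "lin A (direct_sum {..<n} (\<lambda>_. ?S)) ?F p"
      "\<And>x. x \<in> carrier ?F \<Longrightarrow> p (i x) = x" unfolding is_summand_def by (auto simp: lhom_iff)
  have a: "in_add A ?F (direct_sum {..<n} (\<lambda>_. ?S))" by (rule in_add_retract[OF ip(1,2) _ Fm]) (rule ip(3))
  have SS: "in_add A ?S ?S" by (rule in_add_refl[OF S])
  have "in_add A (direct_sum {..<n} (\<lambda>_. ?S)) ?S" by (rule direct_sum_in_add[OF ring_A S SS S]) simp
  with a have FS: "in_add A ?F ?S" by (rule in_add_trans[OF _ _ Fm direct_sum_lmodule[OF ring_A S]])
  have "in_add A (regular A) ?F"
    by (rule in_add_retract[OF direct_sum_inj[OF ring_A A] direct_sum_proj[of 0] _ A]) auto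
  then have 2: "in_add A (regular A) ?S" by (rule in_add_trans[OF _ FS A Fm])
  show thesis by (rule that[OF 1 2 fg])
qed

theorem proposition5p3:
  fixes R :: "'r ring"
    and A :: "('r, 'a) module"
    and \<Lambda> :: "'l::order set"
    and \<Delta> :: "'l \<Rightarrow> ('a, 'v) module"
    and Nabla :: "'l \<Rightarrow> ('a, 'w) module"
    and M :: "('a, 'm) module"
    and N :: "('a, 'n) module"
  assumes "cring R" and "noetherian_ring R"
    and "split_quasi_hereditary R A \<Lambda> \<Delta>"
    and "costandard R A \<Lambda> \<Delta> Nabla"
    and "M \<in> filtered A (twists R A \<Lambda> \<Delta>)"
    and "N \<in> filtered A (twists R A \<Lambda> Nabla)"
  shows "is_exact_functor (opp_ring A)
           (filtered (opp_ring A) (twists R (opp_ring A) \<Lambda> (\<lambda>l. dual R A (Nabla l)))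
             :: ('a, 'x) module set)
           R (proj_mods R)
           (\<lambda>X. tensorA A X M)
           (\<lambda>X Y f. tensor_map A X M Y M f (\<lambda>m. m)) \<and>
         is_exact_functor A
           (filtered A (twists R A \<Lambda> \<Delta>) :: ('a, 'y) module set)
           R (proj_mods R)
           (\<lambda>X. tensorA A (dual R A N) X)
           (\<lambda>X Y f. tensor_map A (dual R A N) X (dual R A N) Y (\<lambda>x. x) f)"
proof -
  obtain P C f g where "standard_system R A \<Lambda> \<Delta> P C f g" and gen: "in_add A (regular A) (direct_sum \<Lambda> P)"
      and fgA: "finitely_generated R A"
    by (rule split_quasi_hereditary_system[OF assms(3)]) (rule that)
  then interpret standard_system R A \<Lambda> \<Delta> P C f g by simp
  have V: "lmodule A (Nabla l)" if "l \<in> \<Lambda>" for l using assms(4) that by (simp add: costandard_def fg_mods_def)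
  have E: "if i = 0 \<and> l = m then lmod_iso R (Ext A (\<Delta> l) (Nabla m) i) (regular R)
        else carrier (Ext A (\<Delta> l) (Nabla m) i) = {\<zero>\<^bsub>Ext A (\<Delta> l) (Nabla m) i\<^esub>}" if "l \<in> \<Lambda>" "m \<in> \<Lambda>" for l m i
    using assms(4) that unfolding costandard_def by blast
  have ext: "ext1_zero A (\<Delta> k) (Nabla l)" if k: "k \<in> \<Lambda>" and l: "l \<in> \<Lambda>" for k l
    by (rule Ext1_trivial_imp_ext1_zero[OF assms(2) fgA \<Delta>[OF k] V[OF l]]) (use E[OF k l, of 1] in simp)
  have hom: "in_add R (HomA A (\<Delta> k) (Nabla l)) (regular R)" if k: "k \<in> \<Lambda>" and l: "l \<in> \<Lambda>" for k l
  proof -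
    have e: "in_add R (HomA A (\<Delta> k) (Nabla l)) (Ext A (\<Delta> k) (Nabla l) 0)" "lmodule R (Ext A (\<Delta> k) (Nabla l) 0)"
      using Ext0_HomA[OF assms(2) fgA \<Delta>[OF k] V[OF l]] by simp_all
    have "in_add R (Ext A (\<Delta> k) (Nabla l) 0) (regular R)"
    proof (cases "k = l")
      case True
      then have "lmod_iso R (Ext A (\<Delta> k) (Nabla l) 0) (regular R)" using E[OF k l, of 0] by simp
      then show ?thesis unfolding lmod_iso_def using in_add_bij[OF lhom_lin _ e(2)] by blast
    next
      case False
      then show ?thesis using E[OF k l, of 0] by (intro in_add_trivial) simp
    qed
    then show ?thesis by (rule in_add_trans[OF e(1) _ HomA_lmodule[OF \<Delta>(1)[OF k] V[OF l]] e(2)])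
  qed
  \<comment> \<open>the costandard modules are therefore reflexive over R, and their duals are good\<close>
  have pr: "in_add R (restr A (Nabla l)) (regular R)" if l: "l \<in> \<Lambda>" for l
    by (rule fgp_if_no_standard_ext[OF gen V[OF l] ext[OF _ l] hom[OF _ l]])
  have N: "lmodule A N" "in_add R (restr A N) (regular R)" "\<And>k. k \<in> \<Lambda> \<Longrightarrow> ext1_zero A (\<Delta> k) N"
    using filtered_no_standard_ext[OF assms(6) V pr ext] assms(6) by (auto simp: filtered_def fg_mods_def)
  show ?thesis
  proof
    show "is_exact_functor (opp_ring A) (filtered (opp_ring A) (twists R (opp_ring A) \<Lambda> (\<lambda>l. dual R A (Nabla l))) :: ('a, 'x) module set)
       R (proj_mods R) (\<lambda>X. tensorA A X M) (\<lambda>X Y f. tensor_map A X M Y M f (\<lambda>m. m))"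
      by (rule tensor_exact_left[OF good_filtered assms(5)]) (assumption, rule good_dual[OF V pr ext])
    show "is_exact_functor A (filtered A (twists R A \<Lambda> \<Delta>) :: ('a, 'y) module set) R (proj_mods R)
       (\<lambda>X. tensorA A (dual R A N) X) (\<lambda>X Y f. tensor_map A (dual R A N) X (dual R A N) Y (\<lambda>x. x) f)"
      by (rule tensor_exact_right[OF good_dual[OF N]])
  qed
qed

end
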